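(* Let $\Omega\subset\mathbb{R}^2$ be a bounded strictly convex domain with smooth boundary. There exist $C_0>0$ and $j_0=j_0(\Omega)$ sufficiently large such that for $j\ge j_0$ and any two points $x,y\in\mathrm{int}(\Omega)$ which are $C_0/j^4$ close to the diagonal of the boundary, there exist precisely four distinct broken geodesics of $j$ reflections making approximately one counterclockwise rotation, emanating from $x$ and terminating at $y$. Similarly, there exist four such orbits in the clockwise direction. If $x,y\in\partial\Omega$ and are $C_0/j^4$ close to the diagonal, there exists only one clockwise and one counterclockwise orbit connecting $x$ to $y$ in $j$ reflections and approximately one rotation. In particular, when $x=y\in\partial\Omega$, there is a unique (up to time reversal) geodesic loop based at $x$ of rotation number $1/j$.
   Context: Strictly convex means the curvature of $\partial\Omega$ is strictly positive; $\ell=|\partial\Omega|$. "$(x,y)$ is $\varepsilon$ close to the diagonal of the boundary" means $\mathrm{dist}((x,y),\Delta\partial\Omega)\le\varepsilon$, where $\Delta\partial\Omega=\{(q,q):q\in\partial\Omega\}\subset\overline\Omega\times\overline\Omega$. A broken geodesic (billiard orbit) is a polygonal path reflecting at $\partial\Omega$ with equal angles of incidence and reflection. The billiard map $\beta$ acts on $(s,\vartheta)\in\mathbb{R}/\ell\mathbb{Z}\times[0,\pi]$ ($s$ arclength, $\vartheta$ the angle of the outgoing link with the positively oriented tangent); $\widehat\beta$ is its continuous lift to $\mathbb{R}\times[0,\pi]$ normalized by $\widehat\beta(s,0)=(s,0)$, and $\pi_1$ is projection to the first factor. For an orbit from $x$ to $y$ with $j$ reflections, let $\widehat x$ be the first point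 of reflection, $\omega$ the angle of reflection at $\widehat x$, and $\widehat y$ the $(j+1)$st point of reflection, i.e. the next impact with $\partial\Omega$ after the orbit reaches $y$. The orbit makes approximately one counterclockwise rotation if $|\pi_1\widehat\beta^j(\widehat x,\omega)-\widehat y-\ell|\le\ell/100$, where $\widehat x,\widehat y$ are identified with arclength coordinates in $\mathbb{R}$ nearest to each other; approximately one clockwise rotation is defined analogously. When both endpoints lie on $\partial\Omega$, reflections are counted so that the orbit has $j$ links, i.e. $y=\pi_1\beta^j(x,\vartheta)$; a geodesic loop based at $x$ of rotation number $1/j$ is an orbit with $\pi_1\widehat\beta^j(x,\vartheta)=x+\ell$ (or its time reversal). *)

theory Defs
  imports "HOL-Analysis.Analysis"
begin

text \<open>The Euclidean plane is \<^typ>\<open>complex\<close>; multiplication by \<^const>\<open>imaginary_unit\<close> is the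
  counterclockwise quarter turn.\<close>

definition smooth_curve :: "(real \<Rightarrow> complex) \<Rightarrow> bool" where
  "smooth_curve \<gamma> \<longleftrightarrow>
     (\<exists>D :: nat \<Rightarrow> real \<Rightarrow> complex. D 0 = \<gamma> \<and>
        (\<forall>n s. (D n has_vector_derivative D (Suc n) s) (at s)))"

definition tangent :: "(real \<Rightarrow> complex) \<Rightarrow> real \<Rightarrow> complex" where
  "tangent \<gamma> s = vector_derivative \<gamma> (at s)"

text \<open>The last clause says that \<open>\<Omega>\<close> lies to the left of the curve, i.e. that the orientation is
  positive. Such a \<open>\<gamma>\<close> is unique up to the choice of the base point, and \<open>L\<close> is the length of the boundary.\<close>

definition arclength_parametrization :: "complex set \<Rightarrow> real \<Rightarrow> (real \<Rightarrow> complex) \<Rightarrow> bool" where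
  "arclength_parametrization \<Omega> L \<gamma> \<longleftrightarrow>
     L > 0 \<and> smooth_curve \<gamma> \<and> (\<forall>s. norm (tangent \<gamma> s) = 1) \<and>
     (\<forall>s. \<gamma> (s + L) = \<gamma> s) \<and> inj_on \<gamma> {0..<L} \<and> range \<gamma> = frontier \<Omega> \<and>
     (\<forall>s. \<forall>\<^sub>F r in at_right 0. \<gamma> s + r *\<^sub>R (\<i> * tangent \<gamma> s) \<in> \<Omega>)"

text \<open>Signed curvature of a unit speed curve, with respect to the left (for a positively oriented
  boundary: inward) normal.\<close>

definition curvature :: "(real \<Rightarrow> complex) \<Rightarrow> real \<Rightarrow> real" where
  "curvature \<gamma> s = (\<i> * tangent \<gamma> s) \<bullet> vector_derivative (tangent \<gamma>) (at s)"

definition smooth_strictly_convex_domain :: "complex set \<Rightarrow> bool" where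
  "smooth_strictly_convex_domain \<Omega> \<longleftrightarrow>
     open \<Omega> \<and> \<Omega> \<noteq> {} \<and> convex \<Omega> \<and>
     (\<exists>L \<gamma>. arclength_parametrization \<Omega> L \<gamma> \<and> (\<forall>s. curvature \<gamma> s > 0))"

definition close_to_boundary_diagonal :: "complex set \<Rightarrow> real \<Rightarrow> complex \<Rightarrow> complex \<Rightarrow> bool" where
  "close_to_boundary_diagonal \<Omega> \<epsilon> x y \<longleftrightarrow> infdist (x, y) {(q, q) |q. q \<in> frontier \<Omega>} \<le> \<epsilon>"

text \<open>The unoriented angle in \<open>[0, \<pi>]\<close>. A link that starts on the boundary points into \<open>\<Omega>\<close>, i.e. to
  the left of the tangent, so its unoriented angle with the tangent is also the oriented one.\<close>

definition angle_between :: "complex \<Rightarrow> complex \<Rightarrow> real" where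
  "angle_between u v = arccos (u \<bullet> v / (norm u * norm v))"

text \<open>The list \<open>p\<close> consists of all vertices, the two endpoints included.\<close>

definition broken_geodesic :: "complex set \<Rightarrow> (real \<Rightarrow> complex) \<Rightarrow> complex list \<Rightarrow> bool" where
  "broken_geodesic \<Omega> \<gamma> p \<longleftrightarrow>
     set p \<subseteq> closure \<Omega> \<and>
     (\<forall>i. Suc i < length p \<longrightarrow> p ! i \<noteq> p ! Suc i) \<and>
     (\<forall>i. Suc (Suc i) < length p \<longrightarrow>
        p ! Suc i \<in> frontier \<Omega> \<and>
        (\<forall>s. \<gamma> s = p ! Suc i \<longrightarrow>
           angle_between (p ! i - p ! Suc i) (- tangent \<gamma> s) =
           angle_between (p ! Suc (Suc i) - p ! Suc i) (tangent \<gamma> s)))"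

text \<open>The graph of the billiard map \<open>\<beta>\<close>, with elements of \<open>\<real>/L\<int>\<close> given by real representatives:
  \<open>(t, \<phi>)\<close> represents the image of \<open>(s, \<theta>)\<close>. By the reflection law the angle \<open>\<phi>\<close> of the link leaving
  \<open>\<gamma> t\<close> is the angle between the direction of the arriving link and the tangent. Glancing
  directions are fixed.\<close>

definition billiard_map_graph :: "(real \<Rightarrow> complex) \<Rightarrow> real \<times> real \<Rightarrow> real \<times> real \<Rightarrow> bool" where
  "billiard_map_graph \<gamma> = (\<lambda>(s, \<theta>) (t, \<phi>).
     if \<theta> = 0 \<or> \<theta> = pi then \<gamma> t = \<gamma> s \<and> \<phi> = \<theta>
     else \<gamma> t \<noteq> \<gamma> s \<and>
          angle_between (\<gamma> t - \<gamma> s) (tangent \<gamma> s) = \<theta> \<and>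
          angle_between (\<gamma> t - \<gamma> s) (tangent \<gamma> t) = \<phi>)"

text \<open>The continuous lift of \<open>\<beta>\<close> to \<open>\<real> \<times> [0, \<pi>]\<close> that is the identity on \<open>\<real> \<times> {e}\<close>. The lift
  normalized at \<open>e = 0\<close> measures counterclockwise rotation; the one normalized at \<open>e = \<pi>\<close>
  plays the same role for clockwise rotation. These conditions determine a lift uniquely on the strip;
  its values off the strip are irrelevant.\<close>

definition is_billiard_lift ::
    "(real \<Rightarrow> complex) \<Rightarrow> real \<Rightarrow> (real \<times> real \<Rightarrow> real \<times> real) \<Rightarrow> bool" where
  "is_billiard_lift \<gamma> e B \<longleftrightarrow>
     continuous_on (UNIV \<times> {0..pi}) B \<and>
     (\<forall>s. \<forall>\<theta>\<in>{0..pi}. billiard_map_graph \<gamma> (s, \<theta>) (B (s, \<theta>))) \<and>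
     (\<forall>s. B (s, e) = (s, e))"

definition billiard_lift :: "(real \<Rightarrow> complex) \<Rightarrow> real \<Rightarrow> real \<times> real \<Rightarrow> real \<times> real" where
  "billiard_lift \<gamma> e = (SOME B. is_billiard_lift \<gamma> e B)"

definition nearest_representatives :: "real \<Rightarrow> real \<Rightarrow> real \<Rightarrow> bool" where
  "nearest_representatives L s t \<longleftrightarrow> (\<forall>k::int. \<bar>s - t\<bar> \<le> \<bar>s - (t + of_int k * L)\<bar>)"

text \<open>Here \<open>x'\<close> and \<open>y'\<close> are boundary points and \<open>v\<close> is the direction in which the orbit
  leaves \<open>x'\<close>.\<close>

definition one_ccw_rotation ::
    "real \<Rightarrow> (real \<Rightarrow> complex) \<Rightarrow> nat \<Rightarrow> complex \<Rightarrow> complex \<Rightarrow> complex \<Rightarrow> bool" where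
  "one_ccw_rotation L \<gamma> j x' v y' \<longleftrightarrow>
     (\<exists>s t. \<gamma> s = x' \<and> \<gamma> t = y' \<and> nearest_representatives L s t \<and>
        \<bar>fst ((billiard_lift \<gamma> 0 ^^ j) (s, angle_between v (tangent \<gamma> s))) - t - L\<bar> \<le> L / 100)"

definition one_cw_rotation ::
    "real \<Rightarrow> (real \<Rightarrow> complex) \<Rightarrow> nat \<Rightarrow> complex \<Rightarrow> complex \<Rightarrow> complex \<Rightarrow> bool" where
  "one_cw_rotation L \<gamma> j x' v y' \<longleftrightarrow>
     (\<exists>s t. \<gamma> s = x' \<and> \<gamma> t = y' \<and> nearest_representatives L s t \<and>
        \<bar>fst ((billiard_lift \<gamma> pi ^^ j) (s, angle_between v (tangent \<gamma> s))) - t + L\<bar> \<le> L / 100)"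

text \<open>Orbits between interior points have \<open>j\<close> reflections, hence \<open>j + 2\<close> vertices; orbits between
  boundary points have \<open>j\<close> links, hence \<open>j + 1\<close> vertices.\<close>

definition interior_orbit ::
    "complex set \<Rightarrow> (real \<Rightarrow> complex) \<Rightarrow> nat \<Rightarrow> complex \<Rightarrow> complex \<Rightarrow> complex list \<Rightarrow> bool" where
  "interior_orbit \<Omega> \<gamma> j x y p \<longleftrightarrow>
     broken_geodesic \<Omega> \<gamma> p \<and> length p = j + 2 \<and> hd p = x \<and> last p = y"

definition boundary_orbit ::
    "complex set \<Rightarrow> (real \<Rightarrow> complex) \<Rightarrow> nat \<Rightarrow> complex \<Rightarrow> complex \<Rightarrow> complex list \<Rightarrow> bool" where
  "boundary_orbit \<Omega> \<gamma> j x y p \<longleftrightarrow>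
     broken_geodesic \<Omega> \<gamma> p \<and> length p = j + 1 \<and> hd p = x \<and> last p = y"

text \<open>The next impact after the orbit has reached its interior endpoint is the point where the
  prolongation of the last link meets the boundary.\<close>

definition next_impact :: "complex set \<Rightarrow> complex list \<Rightarrow> complex \<Rightarrow> bool" where
  "next_impact \<Omega> p y' \<longleftrightarrow>
     y' \<in> frontier \<Omega> \<and> last p \<in> open_segment (last (butlast p)) y'"

definition interior_ccw_orbits ::
    "complex set \<Rightarrow> real \<Rightarrow> (real \<Rightarrow> complex) \<Rightarrow> nat \<Rightarrow> complex \<Rightarrow> complex \<Rightarrow> complex list set" where
  "interior_ccw_orbits \<Omega> L \<gamma> j x y =
     {p. interior_orbit \<Omega> \<gamma> j x y p \<and>
         (\<exists>y'. next_impact \<Omega> p y' \<and> one_ccw_rotation L \<gamma> j (p ! 1) (p ! 2 - p ! 1) y')}"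

definition interior_cw_orbits ::
    "complex set \<Rightarrow> real \<Rightarrow> (real \<Rightarrow> complex) \<Rightarrow> nat \<Rightarrow> complex \<Rightarrow> complex \<Rightarrow> complex list set" where
  "interior_cw_orbits \<Omega> L \<gamma> j x y =
     {p. interior_orbit \<Omega> \<gamma> j x y p \<and>
         (\<exists>y'. next_impact \<Omega> p y' \<and> one_cw_rotation L \<gamma> j (p ! 1) (p ! 2 - p ! 1) y')}"

definition boundary_ccw_orbits ::
    "complex set \<Rightarrow> real \<Rightarrow> (real \<Rightarrow> complex) \<Rightarrow> nat \<Rightarrow> complex \<Rightarrow> complex \<Rightarrow> complex list set" where
  "boundary_ccw_orbits \<Omega> L \<gamma> j x y =
     {p. boundary_orbit \<Omega> \<gamma> j x y p \<and> one_ccw_rotation L \<gamma> j x (p ! 1 - p ! 0) y}"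

definition boundary_cw_orbits ::
    "complex set \<Rightarrow> real \<Rightarrow> (real \<Rightarrow> complex) \<Rightarrow> nat \<Rightarrow> complex \<Rightarrow> complex \<Rightarrow> complex list set" where
  "boundary_cw_orbits \<Omega> L \<gamma> j x y =
     {p. boundary_orbit \<Omega> \<gamma> j x y p \<and> one_cw_rotation L \<gamma> j x (p ! 1 - p ! 0) y}"

definition ccw_loop ::
    "complex set \<Rightarrow> real \<Rightarrow> (real \<Rightarrow> complex) \<Rightarrow> nat \<Rightarrow> complex \<Rightarrow> complex list \<Rightarrow> bool" where
  "ccw_loop \<Omega> L \<gamma> j x p \<longleftrightarrow>
     boundary_orbit \<Omega> \<gamma> j x x p \<and>
     (\<exists>s. \<gamma> s = x \<and>
        fst ((billiard_lift \<gamma> 0 ^^ j) (s, angle_between (p ! 1 - p ! 0) (tangent \<gamma> s))) = s + L)"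

text \<open>Geodesic loops based at \<open>x\<close> of rotation number \<open>1/j\<close>; \<^const>\<open>rev\<close> is time reversal.\<close>

definition geodesic_loops ::
    "complex set \<Rightarrow> real \<Rightarrow> (real \<Rightarrow> complex) \<Rightarrow> nat \<Rightarrow> complex \<Rightarrow> complex list set" where
  "geodesic_loops \<Omega> L \<gamma> j x = {p. ccw_loop \<Omega> L \<gamma> j x p \<or> ccw_loop \<Omega> L \<gamma> j x (rev p)}"

end

theory Submission
  imports Defs
begin

text \<open>Parametrize the boundary by its tangent angle and let \<open>g\<close> be the cube root of the radius of
  curvature. For the link from \<open>\<Gamma> a\<close> to \<open>\<Gamma> b\<close> with angles \<open>\<theta>\<close> and \<open>\<phi>\<close> at its ends, the quantities \<open>Y = g a \<cdot> \<theta>\<close> and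
  \<open>Y' = g b \<cdot> \<phi>\<close> agree up to \<open>O((b - a)\<^sup>3)\<close>, with corresponding Lipschitz bounds (Lazutkin). Reflection says
  that \<open>Y'\<close> of a link is \<open>Y\<close> of the next one, so along \<open>j\<close> links with a total rotation of order one all
  \<open>Y\<close> are comparable to \<open>1/j\<close>, and the \<open>j\<close>-th iterate of the billiard map has a strong twist: if the initial \<open>Y\<close>
  grows by \<open>\<delta>\<close> and the initial vertex moves by at most \<open>\<delta>\<close>, then the last vertex advances by at least
  a multiple of \<open>j \<delta>\<close>, while \<open>Y\<close> itself changes by at most \<open>2 \<delta>\<close>.

  An interior point \<open>x\<close> at distance \<open>O(j\<^sup>-\<^sup>4)\<close> from \<open>\<Gamma> q\<close> lies on a link of length \<open>\<approx> 1/j\<close> only if one end of the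
  link has a parameter within \<open>j\<^sup>-\<^sup>3\<close> of \<open>q\<close>. So either the first reflection or the backward prolongation of the first
  link takes place near \<open>\<Gamma> q\<close>; the same dichotomy holds at \<open>y\<close>, which gives four cases. In each case passing
  through \<open>x\<close> (or \<open>y\<close>) is a nearly vertical curve in phase space. By the twist the image of the first
  curve is nearly horizontal and crosses the second one exactly once. For boundary points the curves are
  exactly vertical and there is a single case. Complex conjugation turns counterclockwise orbits into clockwise ones.\<close>

section \<open>Chains of links with a twist\<close>

text \<open>The cube root matters because errors pile up over about \<open>j\<close> links. With
  \<open>Y\<close> of order \<open>1/j\<close>, a cubic mismatch changes \<open>Y\<close> by a
  relative amount \<open>O(j^-2)\<close> per link, hence \<open>O(1/j)\<close> in all; the bare
  angle has a quadratic mismatch and would drift by an amount comparable to itself. The twist is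
  proved for finite differences of two chains, not for derivatives of the iterated map: a Lipschitz
  form of the cubic estimate for one link suffices. Existence then comes from the intermediate value
  theorem and uniqueness from comparing two candidates. The exponent 4 arises as follows: a point on
  a chord of length about \<open>1/j\<close> has depth of the order of the product of its distances
  to the ends, so depth \<open>j^-4\<close> leaves \<open>j^-3\<close> for one of them. Along a
  focal curve the vertex then moves \<open>O(j^-2)\<close> times as much as the angle, along the
  image curve at least a multiple of \<open>j\<close> times as much, so two crossings are
  impossible. The constants must not depend on the arclength parametrization; they are all drawn
  from the tangent angle parametrization, which the domain determines.\<close>

locale twist_links =
  fixes Y Y' :: "real \<Rightarrow> real \<Rightarrow> real" and d c C y0 :: real
  assumes d_pos: "0 < d" and c_pos: "0 < c" and C_pos: "0 < C" and y0_pos: "0 < y0"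
    and Y_lower: "\<And>a b. 0 < b - a \<Longrightarrow> b - a \<le> d \<Longrightarrow> c * (b - a) \<le> Y a b"
    and Y_upper: "\<And>a b. 0 < b - a \<Longrightarrow> b - a \<le> d \<Longrightarrow> Y a b \<le> C * (b - a)"
    and Y'_lower: "\<And>a b. 0 < b - a \<Longrightarrow> b - a \<le> d \<Longrightarrow> c * (b - a) \<le> Y' a b"
    and Y'_diff: "\<And>a b. 0 < b - a \<Longrightarrow> b - a \<le> d \<Longrightarrow> \<bar>Y' a b - Y a b\<bar> \<le> C * (b - a) ^ 3"
    and Y'_diff_lipschitz: "\<And>\<eta> a b u v. \<eta> \<le> d \<Longrightarrow> 0 < b - a \<Longrightarrow> b - a \<le> \<eta> \<Longrightarrow> 0 < v - u \<Longrightarrow> v - u \<le> \<eta> \<Longrightarrow>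
       \<bar>(Y' u v - Y u v) - (Y' a b - Y a b)\<bar> \<le> C * \<eta>\<^sup>2 * \<bar>(v - u) - (b - a)\<bar> + C * \<eta> ^ 3 * \<bar>u - a\<bar>"
    and Y_increment: "\<And>\<eta> a b u v. \<eta> \<le> d \<Longrightarrow> 0 < b - a \<Longrightarrow> b - a \<le> \<eta> \<Longrightarrow> 0 < v - u \<Longrightarrow> v - u \<le> \<eta> \<Longrightarrow>
       \<exists>l m. c \<le> l \<and> l \<le> C \<and> \<bar>m\<bar> \<le> C * \<eta> \<and> Y u v - Y a b = l * ((v - u) - (b - a)) + m * (u - a)"
    and short_if_Y: "\<And>a b. 0 < b - a \<Longrightarrow> b - a < 2 * pi \<Longrightarrow> Y a b \<le> y0 \<Longrightarrow> b - a \<le> d"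
    and short_if_Y': "\<And>a b. 0 < b - a \<Longrightarrow> b - a < 2 * pi \<Longrightarrow> Y' a b \<le> y0 \<Longrightarrow> b - a \<le> d"
begin

text \<open>The bound \<open>2 * pi\<close> only says that a link ends at the first representative
  of its end point after the start; that links are short is derived from \<open>short_if_Y\<close>
  and \<open>short_if_Y'\<close>. The second clause is the reflection law.\<close>

definition links :: "(nat \<Rightarrow> real) \<Rightarrow> nat \<Rightarrow> bool" where
  "links \<psi> m \<longleftrightarrow> (\<forall>i<m. 0 < \<psi> (Suc i) - \<psi> i \<and> \<psi> (Suc i) - \<psi> i < 2 * pi) \<and>
     (\<forall>i. Suc i < m \<longrightarrow> Y' (\<psi> i) (\<psi> (Suc i)) = Y (\<psi> (Suc i)) (\<psi> (Suc (Suc i))))"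

text \<open>A discrete Gronwall argument started at an arbitrary link \<open>k\<close>: a step to a
  neighbour changes \<open>Y\<close> by at most \<open>C * (Y / c) ^ 3\<close>, which is at most the
  fraction \<open>1/m\<close> of the initial value as long as \<open>Y\<close> is below twice that
  value, so \<open>m\<close> steps never more than double it. Applied with another link as
  \<open>k\<close> it also yields lower bounds.\<close>

lemma links_comparable:
  assumes "0 < K"
  shows "\<exists>m0. \<forall>m\<ge>m0. \<forall>\<psi>. links \<psi> m \<longrightarrow> (\<forall>k<m. Y (\<psi> k) (\<psi> (Suc k)) \<le> K / real m \<longrightarrow>
           (\<forall>i<m. \<psi> (Suc i) - \<psi> i \<le> d \<and> Y (\<psi> i) (\<psi> (Suc i)) \<le> 2 * Y (\<psi> k) (\<psi> (Suc k))))"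
proof -
  \<comment> \<open>The first summand makes the cubic drift per link at most \<open>y / N\<close>;
    the second keeps \<open>2 * y\<close> below \<open>y0\<close>, so that every link met on the way
    is known to be short.\<close>
  obtain m0 :: nat where m0: "real m0 \<ge> 8 * C * K\<^sup>2 / c ^ 3 + 2 * K / y0 + 1"
    using real_arch_simple by blast
  have "\<psi> (Suc i) - \<psi> i \<le> d \<and> Y (\<psi> i) (\<psi> (Suc i)) \<le> 2 * Y (\<psi> k) (\<psi> (Suc k))"
    if m: "m \<ge> m0" and L: "links \<psi> m" and k: "k < m" and Yk: "Y (\<psi> k) (\<psi> (Suc k)) \<le> K / real m" and i: "i < m"
    for m \<psi> k i
  proof -
    define y where "y = Y (\<psi> k) (\<psi> (Suc k))"
    define N where "N = real m"
    have nonneg: "0 \<le> 8 * C * K\<^sup>2 / c ^ 3" "0 \<le> 2 * K / y0"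
      using C_pos c_pos assms y0_pos by simp_all
    have N1: "N \<ge> 8 * C * K\<^sup>2 / c ^ 3" "N \<ge> 2 * K / y0" "N \<ge> 1"
      using m m0 nonneg unfolding N_def by linarith+
    have Npos: "0 < N" using N1 by linarith
    have dpos: "0 < \<psi> (Suc i) - \<psi> i" "\<psi> (Suc i) - \<psi> i < 2 * pi" if "i < m" for i
      using L that unfolding links_def by auto
    have match: "Y' (\<psi> i) (\<psi> (Suc i)) = Y (\<psi> (Suc i)) (\<psi> (Suc (Suc i)))" if "Suc i < m" for i
      using L that unfolding links_def by auto
    have ky0: "2 * K / N \<le> y0" using N1(2) Npos y0_pos by (simp add: field_simps)
    have yk: "y \<le> K / N" using Yk by (simp add: y_def N_def)
    have small: "2 * y \<le> y0" using yk ky0 by simp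
    have Dk: "\<psi> (Suc k) - \<psi> k \<le> d"
    proof (rule short_if_Y[OF dpos[OF k]])
      show "Y (\<psi> k) (\<psi> (Suc k)) \<le> y0" using small y0_pos unfolding y_def by linarith
    qed
    have ypos: "0 < y" using Y_lower[OF dpos(1)[OF k] Dk] dpos[OF k] c_pos unfolding y_def
      by (metis less_le_trans mult_pos_pos)
    have cube: "C * (t / c) ^ 3 \<le> y / N" if "t \<le> 2 * y" "0 \<le> t" for t
    proof -
      have "C * (t / c) ^ 3 \<le> C * (2 * y / c) ^ 3"
        using that c_pos C_pos by (intro mult_left_mono power_mono divide_right_mono) auto
      also have "\<dots> = (8 * C / c ^ 3) * y * y\<^sup>2" by (simp add: power3_eq_cube power2_eq_square power_divide)
      also have "\<dots> \<le> (8 * C / c ^ 3) * y * (K / N)\<^sup>2"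
        using c_pos C_pos ypos yk by (intro mult_left_mono power_mono) auto
      also have "\<dots> = (8 * C * K\<^sup>2 / c ^ 3) * (y / N\<^sup>2)" by (simp add: power_divide)
      also have "\<dots> \<le> N * (y / N\<^sup>2)"
        using N1(1) ypos by (intro mult_right_mono) auto
      also have "\<dots> = y / N" using Npos by (simp add: power2_eq_square)
      finally show ?thesis .
    qed
    have le2: "y * (1 + real n / N) \<le> 2 * y" if "n \<le> m" for n
      using that Npos ypos unfolding N_def by (simp add: field_simps)
    have fwd: "k + n < m \<Longrightarrow> \<psi> (Suc (k + n)) - \<psi> (k + n) \<le> d \<and> Y (\<psi> (k+n)) (\<psi> (Suc (k+n))) \<le> y * (1 + real n / N)" for n
    proof (induction n)
      case 0 then show ?case using Dk by (simp add: y_def)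
    next
      case (Suc n)
      then have IH: "\<psi> (Suc (k + n)) - \<psi> (k + n) \<le> d" "Y (\<psi> (k+n)) (\<psi> (Suc (k+n))) \<le> y * (1 + real n / N)"
        and kn: "k + n < m" "Suc (k + n) < m" by auto
      let ?D = "\<psi> (Suc (k + n)) - \<psi> (k + n)" and ?Y = "Y (\<psi> (k+n)) (\<psi> (Suc (k+n)))"
      have D0: "0 < ?D" using dpos kn by auto
      have DY: "c * ?D \<le> ?Y" by (rule Y_lower[OF D0 IH(1)])
      have Y0: "0 \<le> ?Y" using DY D0 c_pos by (smt (verit) mult_pos_pos)
      have "C * ?D ^ 3 \<le> C * (?Y / c) ^ 3"
        using DY D0 c_pos C_pos by (intro mult_left_mono power_mono) (auto simp: field_simps)
      also have "\<dots> \<le> y / N" using IH(2) le2[of n] kn Y0 by (intro cube) auto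
      finally have "Y' (\<psi> (k+n)) (\<psi> (Suc (k+n))) \<le> y * (1 + real n / N) + y / N"
        using Y'_diff[OF D0 IH(1)] IH(2) by linarith
      then have B: "Y (\<psi> (Suc (k+n))) (\<psi> (Suc (Suc (k+n)))) \<le> y * (1 + real (Suc n) / N)"
        using match[OF kn(2)] by (simp add: field_simps add_divide_distrib)
      moreover have "\<psi> (Suc (Suc (k+n))) - \<psi> (Suc (k+n)) \<le> d"
        using short_if_Y[OF dpos[OF kn(2)]] B le2[of "Suc n"] kn small by auto
      ultimately show ?case by simp
    qed
    \<comment> \<open>Going backwards, the matching condition provides the value of
      \<open>Y'\<close> on the previous link; hence \<open>short_if_Y'\<close> and
      \<open>Y'_lower\<close> take the place of \<open>short_if_Y\<close> and
      \<open>Y_lower\<close>.\<close>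
    have bwd: "n \<le> k \<Longrightarrow> \<psi> (Suc (k - n)) - \<psi> (k - n) \<le> d \<and> Y (\<psi> (k-n)) (\<psi> (Suc (k-n))) \<le> y * (1 + real n / N)" for n
    proof (induction n)
      case 0 then show ?case using Dk by (simp add: y_def)
    next
      case (Suc n)
      define h where "h = k - Suc n"
      have h: "Suc h = k - n" "Suc h < m" "h < m" using Suc.prems k unfolding h_def by auto
      have IH: "Y (\<psi> (Suc h)) (\<psi> (Suc (Suc h))) \<le> y * (1 + real n / N)"
        using Suc h by simp
      let ?D = "\<psi> (Suc h) - \<psi> h" and ?Y = "Y' (\<psi> h) (\<psi> (Suc h))"
      have Yb: "?Y \<le> y * (1 + real n / N)" using IH match[OF h(2)] by simp
      have nm: "n \<le> m" using Suc.prems k by simp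
      have Dd: "?D \<le> d" using short_if_Y'[OF dpos[OF h(3)]] Yb le2[OF nm] small by auto
      have D0: "0 < ?D" by (rule dpos(1)[OF h(3)])
      have DY: "c * ?D \<le> ?Y" by (rule Y'_lower[OF D0 Dd])
      have Y0: "0 \<le> ?Y" using DY D0 c_pos by (smt (verit) mult_pos_pos)
      have "C * ?D ^ 3 \<le> C * (?Y / c) ^ 3"
        using DY D0 c_pos C_pos by (intro mult_left_mono power_mono) (auto simp: field_simps)
      also have "\<dots> \<le> y / N" using Yb le2[OF nm] Y0 by (intro cube) auto
      finally have "Y (\<psi> h) (\<psi> (Suc h)) \<le> y * (1 + real n / N) + y / N"
        using Y'_diff[OF D0 Dd] Yb by linarith
      then show ?case using Dd unfolding h_def by (simp add: field_simps add_divide_distrib)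
    qed
    show ?thesis
    proof (cases "k \<le> i")
      case True
      then have "k + (i - k) < m" "i - k \<le> m" "k + (i - k) = i" using i by auto
      then show ?thesis using fwd[of "i - k"] le2[of "i - k"] unfolding y_def by fastforce
    next
      case False
      then have "k - i \<le> k" "k - i \<le> m" "k - (k - i) = i" using k by auto
      then show ?thesis using bwd[of "k - i"] le2[of "k - i"] unfolding y_def by fastforce
    qed
  qed
  then show ?thesis by blast
qed

text \<open>Let \<open>D\<close> be the initial gap in \<open>Y\<close>. The gap stays comparable to
  \<open>D\<close> because it changes by \<open>O(D / j^2)\<close> per link, and every link converts
  it into displacement of the vertices. The displacement may reach the order \<open>j * D\<close>,
  so the change of the gap has to be estimated by \<open>Y'_diff_lipschitz\<close>; the bound
  \<open>Y'_diff\<close> is not proportional to \<open>D\<close>. The hypothesis on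
  \<open>\<xi> 0 - \<psi> 0\<close> lets the initial phase curve lean.\<close>

lemma links_twist:
  assumes "0 < K"
  shows "\<exists>c'>0. \<exists>j0. \<forall>j\<ge>j0. \<forall>m. j \<le> 2 * m \<longrightarrow> m \<le> 2 * j \<longrightarrow> (\<forall>\<psi> \<xi>. links \<psi> m \<longrightarrow> links \<xi> m \<longrightarrow>
      (\<forall>i<m. \<psi> (Suc i) - \<psi> i \<le> K / real j) \<longrightarrow> (\<forall>i<m. \<xi> (Suc i) - \<xi> i \<le> K / real j) \<longrightarrow>
      Y (\<psi> 0) (\<psi> 1) < Y (\<xi> 0) (\<xi> 1) \<longrightarrow>
      \<bar>\<xi> 0 - \<psi> 0\<bar> \<le> Y (\<xi> 0) (\<xi> 1) - Y (\<psi> 0) (\<psi> 1) \<longrightarrow>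
      c' * real j * (Y (\<xi> 0) (\<xi> 1) - Y (\<psi> 0) (\<psi> 1)) \<le> \<xi> m - \<psi> m \<and>
      \<bar>Y' (\<xi> (m - 1)) (\<xi> m) - Y' (\<psi> (m - 1)) (\<psi> m)\<bar> \<le> 2 * (Y (\<xi> 0) (\<xi> 1) - Y (\<psi> 0) (\<psi> 1)))"
proof -
  \<comment> \<open>\<open>e1\<close> bounds \<open>(1 + 2 * q) ^ i\<close> for
    \<open>i \<le> 2 * j\<close>, where \<open>q = C * K / (c * j)\<close> is the growth rate of the
    displacement; \<open>M * N * D\<close> will bound the displacement, and
    \<open>Q * D / N\<^sup>2\<close> the change of the gap at one link.\<close>
  define e1 where "e1 = exp (4 * C * K / c)"
  define M where "M = e1 * (1 + 4 / c)"
  define Q where "Q = 2 * C * K\<^sup>2 / c + (C\<^sup>2 * K ^ 3 / c + C * K ^ 3) * M"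
  have e1: "e1 \<ge> 1" using assms c_pos C_pos by (simp add: e1_def)
  have M: "M > 0" using e1 c_pos by (auto simp: M_def intro!: mult_pos_pos add_pos_pos)
  have Q: "Q > 0" unfolding Q_def using M c_pos C_pos assms
    by (intro add_pos_pos mult_pos_pos divide_pos_pos) auto
  define c' where "c' = 1 / (16 * C * e1)"
  have c': "c' > 0" using e1 C_pos by (simp add: c'_def)
  \<comment> \<open>\<open>K / d\<close> makes all links admissible, \<open>4 * Q\<close> keeps the
    accumulated change of the gap below \<open>D / 2\<close>, the two terms with
    \<open>K / c\<close> make \<open>q\<close> small, and \<open>16 * C\<close> pays for the initial
    displacement \<open>- D\<close>.\<close>
  obtain j0 :: nat where j0: "real j0 \<ge> K / d + 4 * Q + 20 * C\<^sup>2 * K / c + 2 * C * K / c + 16 * C + 1"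
    using real_arch_simple by blast
  have "c' * real j * D \<le> \<xi> m - \<psi> m \<and>
      \<bar>Y' (\<xi> (m - 1)) (\<xi> m) - Y' (\<psi> (m - 1)) (\<psi> m)\<bar> \<le> 2 * D"
    if j: "j \<ge> j0" and m: "j \<le> 2 * m" "m \<le> 2 * j" and L: "links \<psi> m" "links \<xi> m"
      and S: "\<forall>i<m. \<psi> (Suc i) - \<psi> i \<le> K / real j" "\<forall>i<m. \<xi> (Suc i) - \<xi> i \<le> K / real j"
      and D: "D = Y (\<xi> 0) (\<xi> 1) - Y (\<psi> 0) (\<psi> 1)" "0 < D"
      and near: "\<bar>\<xi> 0 - \<psi> 0\<bar> \<le> D" for j m \<psi> \<xi> D
  proof -
    define N where "N = real j"
    have nn: "0 \<le> K / d" "0 \<le> 4 * Q" "0 \<le> 20 * C\<^sup>2 * K / c" "0 \<le> 2 * C * K / c" "0 \<le> 16 * C"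
      using assms d_pos c_pos C_pos Q by simp_all
    have N: "N \<ge> K / d" "N \<ge> 4 * Q" "N \<ge> 20 * C\<^sup>2 * K / c" "N \<ge> 2 * C * K / c" "N \<ge> 16 * C" "N \<ge> 1"
      using j j0 nn unfolding N_def by linarith+
    have Npos: "0 < N" using N by linarith
    have m0: "0 < m" using m N_def Npos by (cases m) auto
    define \<eta> where "\<eta> = K / N"
    define q where "q = C * \<eta> / c"
    have eta: "0 < \<eta>" "\<eta> \<le> d" using N(1) Npos assms d_pos by (auto simp: \<eta>_def field_simps)
    have q: "0 < q" "q \<le> 1/2" "5 * q \<le> 1 / (4 * C)"
      using eta C_pos c_pos N(3,4) Npos by (auto simp: q_def \<eta>_def field_simps power2_eq_square)
    define \<delta> where "\<delta> i = \<xi> i - \<psi> i" for i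
    define \<epsilon> where "\<epsilon> i = Y (\<xi> i) (\<xi> (Suc i)) - Y (\<psi> i) (\<psi> (Suc i))" for i
    have dpos: "0 < \<psi> (Suc i) - \<psi> i" "\<psi> (Suc i) - \<psi> i \<le> \<eta>" "0 < \<xi> (Suc i) - \<xi> i" "\<xi> (Suc i) - \<xi> i \<le> \<eta>" if "i < m" for i
      using L S that unfolding links_def \<eta>_def N_def by auto
    have inc: "\<exists>l m'. c \<le> l \<and> l \<le> C \<and> \<bar>m'\<bar> \<le> C * \<eta> \<and> \<epsilon> i = l * (\<delta> (Suc i) - \<delta> i) + m' * \<delta> i" if "i < m" for i
      using Y_increment[OF eta(2) dpos[OF that]] unfolding \<epsilon>_def \<delta>_def by (simp add: algebra_simps)
    have inc_abs: "\<bar>\<delta> (Suc i) - \<delta> i\<bar> \<le> \<bar>\<epsilon> i\<bar> / c + q * \<bar>\<delta> i\<bar>" if "i < m" for i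
    proof -
      obtain l m' where lm: "c \<le> l" "l \<le> C" "\<bar>m'\<bar> \<le> C * \<eta>" "\<epsilon> i = l * (\<delta> (Suc i) - \<delta> i) + m' * \<delta> i"
        using inc[OF \<open>i < m\<close>] by blast
      have "c * \<bar>\<delta> (Suc i) - \<delta> i\<bar> \<le> l * \<bar>\<delta> (Suc i) - \<delta> i\<bar>" using lm by (intro mult_right_mono) auto
      also have "\<dots> = \<bar>\<epsilon> i - m' * \<delta> i\<bar>" using lm c_pos by (simp add: abs_mult)
      also have "\<dots> \<le> \<bar>\<epsilon> i\<bar> + \<bar>m'\<bar> * \<bar>\<delta> i\<bar>" by (metis abs_mult abs_triangle_ineq4)
      also have "\<dots> \<le> \<bar>\<epsilon> i\<bar> + C * \<eta> * \<bar>\<delta> i\<bar>" using lm by (intro add_left_mono mult_right_mono) auto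
      finally show ?thesis using c_pos by (simp add: q_def field_simps)
    qed
    have eps_step: "\<bar>(Y' (\<xi> i) (\<xi> (Suc i)) - Y' (\<psi> i) (\<psi> (Suc i))) - \<epsilon> i\<bar> \<le> C * \<eta>\<^sup>2 * \<bar>\<delta> (Suc i) - \<delta> i\<bar> + C * \<eta> ^ 3 * \<bar>\<delta> i\<bar>" if "i < m" for i
      using Y'_diff_lipschitz[OF eta(2) dpos[OF that]] unfolding \<epsilon>_def \<delta>_def by (simp add: algebra_simps)
    have match: "\<epsilon> (Suc i) = Y' (\<xi> i) (\<xi> (Suc i)) - Y' (\<psi> i) (\<psi> (Suc i))" if "Suc i < m" for i
      using L that unfolding links_def \<epsilon>_def by auto
    have pw: "(1 + 2 * q) ^ i \<le> e1" if "i \<le> 2 * j" for i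
    proof -
      have "(1 + 2 * q) ^ i \<le> exp (2 * q) ^ i" using q by (intro power_mono) (auto simp: exp_ge_add_one_self)
      also have "\<dots> = exp (real i * (2 * q))" by (simp add: exp_of_nat_mult)
      also have "\<dots> \<le> exp (2 * N * (2 * q))" using that q unfolding N_def by (auto intro!: mult_right_mono)
      also have "\<dots> = e1" using Npos by (simp add: e1_def q_def \<eta>_def field_simps)
      finally show ?thesis .
    qed
    have pw1: "(1 + q) ^ i \<le> e1" if "i \<le> 2 * j" for i
      using pw[OF that] power_mono[of "1 + q" "1 + 2 * q" i] q by linarith
    have step_bound: "\<bar>(Y' (\<xi> i) (\<xi> (Suc i)) - Y' (\<psi> i) (\<psi> (Suc i))) - \<epsilon> i\<bar> \<le> Q * D / N\<^sup>2"
      if i: "i < m" and e: "\<bar>\<epsilon> i\<bar> \<le> 2 * D" and dl: "\<bar>\<delta> i\<bar> \<le> (1 + q) ^ i * (1 + 2 * real i / c) * D" for i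
    proof -
      have "(1 + 2 * real i / c) \<le> (1 + 4 / c) * N"
      proof -
        have "real i \<le> 2 * N" using i m unfolding N_def by linarith
        then have "2 * real i / c \<le> 4 * N / c" using c_pos by (simp add: field_simps)
        then show ?thesis using N(6) by (simp add: algebra_simps)
      qed
      then have "(1 + q) ^ i * (1 + 2 * real i / c) * D \<le> e1 * ((1 + 4 / c) * N) * D"
        using pw1[of i] i m D q c_pos e1 by (intro mult_right_mono mult_mono) auto
      then have dM: "\<bar>\<delta> i\<bar> \<le> M * N * D" using dl by (simp add: M_def mult.assoc)
      have "\<bar>\<delta> (Suc i) - \<delta> i\<bar> \<le> 2 * D / c + q * (M * N * D)"
        using inc_abs[OF i] divide_right_mono[OF e, of c] mult_left_mono[OF dM, of q] q c_pos by linarith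
      then have "C * \<eta>\<^sup>2 * \<bar>\<delta> (Suc i) - \<delta> i\<bar> + C * \<eta> ^ 3 * \<bar>\<delta> i\<bar> \<le> C * \<eta>\<^sup>2 * (2 * D / c + q * (M * N * D)) + C * \<eta> ^ 3 * (M * N * D)"
        using dM C_pos eta by (intro add_mono mult_left_mono) auto
      also have "\<dots> = Q * D / N\<^sup>2"
        using Npos c_pos unfolding Q_def q_def \<eta>_def by (simp add: field_simps power2_eq_square power3_eq_cube)
      finally show ?thesis using eps_step[OF i] by linarith
    qed
    have QN: "real i * (Q * D / N\<^sup>2) \<le> D / 2" if "i \<le> 2 * j" for i
    proof -
      have "real i * (Q * D / N\<^sup>2) \<le> (2 * N) * (Q * D / N\<^sup>2)"
        using that D Q unfolding N_def by (intro mult_right_mono) auto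
      also have "\<dots> = 2 * Q * D / N" using Npos by (simp add: power2_eq_square)
      also have "\<dots> \<le> D / 2" using N(2) Npos D by (simp add: field_simps)
      finally show ?thesis .
    qed
    \<comment> \<open>The two bounds need each other: the gap \<open>\<epsilon>\<close> feeds the
      growth of \<open>\<delta>\<close>, and the size of \<open>\<delta>\<close> controls the next
      change of \<open>\<epsilon>\<close>.\<close>
    have main: "i < m \<Longrightarrow> \<bar>\<delta> i\<bar> \<le> (1 + q) ^ i * (1 + 2 * real i / c) * D \<and> \<bar>\<epsilon> i - D\<bar> \<le> real i * (Q * D / N\<^sup>2)" for i
    proof (induction i)
      case 0 then show ?case using near D by (simp add: \<delta>_def \<epsilon>_def)
    next
      case (Suc i)
      then have i: "i < m" and IH: "\<bar>\<delta> i\<bar> \<le> (1 + q) ^ i * (1 + 2 * real i / c) * D" "\<bar>\<epsilon> i - D\<bar> \<le> real i * (Q * D / N\<^sup>2)"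
        by auto
      have e2: "\<bar>\<epsilon> i\<bar> \<le> 2 * D" using IH(2) QN[of i] i m D by linarith
      have "\<bar>\<epsilon> (Suc i) - \<epsilon> i\<bar> \<le> Q * D / N\<^sup>2" using step_bound[OF i e2 IH(1)] match[OF Suc.prems] by simp
      then have "\<bar>\<epsilon> (Suc i) - D\<bar> \<le> real i * (Q * D / N\<^sup>2) + Q * D / N\<^sup>2" using IH(2) by linarith
      then have P2: "\<bar>\<epsilon> (Suc i) - D\<bar> \<le> real (Suc i) * (Q * D / N\<^sup>2)" by (simp add: algebra_simps add_divide_distrib)
      have "\<bar>\<delta> (Suc i)\<bar> \<le> (1 + q) * \<bar>\<delta> i\<bar> + 2 * D / c"
        using inc_abs[OF i] divide_right_mono[OF e2, of c] c_pos by (simp add: algebra_simps)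
      also have "\<dots> \<le> (1 + q) * ((1 + q) ^ i * (1 + 2 * real i / c) * D) + (1 + q) ^ Suc i * (2 * D / c)"
      proof (intro add_mono mult_left_mono)
        have "1 \<le> (1 + q) ^ Suc i" using q by (intro one_le_power) auto
        then show "2 * D / c \<le> (1 + q) ^ Suc i * (2 * D / c)"
          using mult_right_mono[of 1 "(1 + q) ^ Suc i" "2 * D / c"] D c_pos by auto
      qed (use IH q in auto)
      also have "\<dots> = (1 + q) ^ Suc i * (1 + 2 * real (Suc i) / c) * D"
        using c_pos by (simp add: field_simps)
      finally show ?case using P2 by blast
    qed
    have eps: "D / 2 \<le> \<epsilon> i" "\<bar>\<epsilon> i\<bar> \<le> 2 * D" if "i < m" for i
      using main[OF that] QN[of i] that m D by linarith+
    \<comment> \<open>The weight \<open>(1 + 2 * q) ^ i\<close> is an integrating factor that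
      absorbs the loss \<open>q * \<bar>\<delta> i\<bar>\<close>: for
      \<open>\<delta> i \<ge> 0\<close> because \<open>(1 + 2 * q) * (1 - q) \<ge> 1\<close>, for
      negative \<open>\<delta> i\<close> because then \<open>\<delta> i \<ge> - D\<close> and the
      loss is at most half of the gain \<open>D / (2 * C)\<close>.\<close>
    have low: "i \<le> m \<Longrightarrow> (1 + 2 * q) ^ i * \<delta> i \<ge> - D + real i * D / (4 * C)" for i
    proof (induction i)
      case 0 then show ?case using near by (simp add: \<delta>_def)
    next
      case (Suc i)
      then have i: "i < m" and IH: "(1 + 2 * q) ^ i * \<delta> i \<ge> - D + real i * D / (4 * C)" by auto
      obtain l m' where lm: "c \<le> l" "l \<le> C" "\<bar>m'\<bar> \<le> C * \<eta>" "\<epsilon> i = l * (\<delta> (Suc i) - \<delta> i) + m' * \<delta> i"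
        using inc[OF i] by blast
      have lpos: "0 < l" using lm c_pos by linarith
      have p1: "1 \<le> (1 + 2 * q) ^ i" using q by (intro one_le_power) auto
      have "\<delta> (Suc i) - \<delta> i = \<epsilon> i / l - m' * \<delta> i / l" using lm lpos by (simp add: field_simps)
      moreover have "\<epsilon> i / l \<ge> D / (2 * C)"
      proof -
        have "D / (2 * C) = (D / 2) / C" by simp
        also have "\<dots> \<le> (D / 2) / l" using lm lpos D by (intro divide_left_mono) auto
        also have "\<dots> \<le> \<epsilon> i / l" using eps[OF i] lpos by (intro divide_right_mono) auto
        finally show ?thesis .
      qed
      moreover have "m' * \<delta> i / l \<le> q * \<bar>\<delta> i\<bar>"
      proof -
        have "m' * \<delta> i / l \<le> \<bar>m'\<bar> * \<bar>\<delta> i\<bar> / l" using lpos by (simp add: abs_mult[symmetric] divide_right_mono)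
        also have "\<dots> \<le> (C * \<eta>) * \<bar>\<delta> i\<bar> / c"
          using lm c_pos by (intro frac_le mult_right_mono) auto
        finally show ?thesis by (simp add: q_def)
      qed
      ultimately have st: "\<delta> (Suc i) \<ge> \<delta> i - q * \<bar>\<delta> i\<bar> + D / (2 * C)" by linarith
      have "(1 + 2 * q) * (\<delta> i - q * \<bar>\<delta> i\<bar> + D / (2 * C)) \<ge> \<delta> i + D / (4 * C)"
      proof (cases "\<delta> i \<ge> 0")
        case True
        have "(1 + 2 * q) * (1 - q) \<ge> 1" using q by (simp add: algebra_simps mult_left_mono)
        then have "(1 + 2 * q) * (1 - q) * \<delta> i \<ge> \<delta> i" using True mult_right_mono[of 1 _ "\<delta> i"] by simp
        moreover have "(1 + 2 * q) * (D / (2 * C)) \<ge> D / (4 * C)"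
          using mult_right_mono[of 1 "1 + 2 * q" "D / (2 * C)"] q D C_pos by (simp add: field_simps)
        ultimately show ?thesis using True by (simp add: algebra_simps)
      next
        case False
        have "- D \<le> (1 + 2 * q) ^ i * \<delta> i"
          using IH D C_pos by (smt (verit) divide_nonneg_nonneg mult_nonneg_nonneg of_nat_0_le_iff)
        also have "\<dots> \<le> \<delta> i" using False p1 by (simp add: mult_le_cancel_right1)
        finally have dD: "- D \<le> \<delta> i" .
        have "(1 + 2 * q) * (\<delta> i - q * \<bar>\<delta> i\<bar> + D / (2 * C)) = \<delta> i + (3 * q + 2 * q\<^sup>2) * \<delta> i + (1 + 2 * q) * (D / (2 * C))"
          using False by (simp add: algebra_simps power2_eq_square)
        moreover have "(3 * q + 2 * q\<^sup>2) * \<delta> i \<ge> - (D / (4 * C))"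
        proof -
          have q2: "3 * q + 2 * q\<^sup>2 \<le> 5 * q" using q mult_left_mono[of q "1/2" q] by (simp add: power2_eq_square)
          have "(3 * q + 2 * q\<^sup>2) * (- \<delta> i) \<le> (5 * q) * D"
            using q2 q dD False D by (intro mult_mono) auto
          also have "\<dots> \<le> (1 / (4 * C)) * D" using q D by (intro mult_right_mono) auto
          finally show ?thesis by simp
        qed
        moreover have "(1 + 2 * q) * (D / (2 * C)) \<ge> D / (2 * C)"
          using mult_right_mono[of 1 "1 + 2 * q" "D / (2 * C)"] q D C_pos by simp
        moreover have "D / (2 * C) = D / (4 * C) + D / (4 * C)" by simp
        ultimately show ?thesis by linarith
      qed
      then have "(1 + 2 * q) * \<delta> (Suc i) \<ge> \<delta> i + D / (4 * C)"
        using mult_left_mono[OF st, of "1 + 2 * q"] q by linarith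
      then have "(1 + 2 * q) ^ i * ((1 + 2 * q) * \<delta> (Suc i)) \<ge> (1 + 2 * q) ^ i * (\<delta> i + D / (4 * C))"
        using p1 by (intro mult_left_mono) auto
      moreover have "(1 + 2 * q) ^ i * (D / (4 * C)) \<ge> D / (4 * C)"
        using mult_right_mono[OF p1, of "D / (4 * C)"] D C_pos by simp
      moreover have "(1 + 2 * q) ^ Suc i * \<delta> (Suc i) = (1 + 2 * q) ^ i * ((1 + 2 * q) * \<delta> (Suc i))" by simp
      ultimately have "(1 + 2 * q) ^ Suc i * \<delta> (Suc i) \<ge> - D + real i * D / (4 * C) + D / (4 * C)"
        using IH by (simp only: distrib_left)
      then show ?case by (simp add: add_divide_distrib algebra_simps)
    qed
    \<comment> \<open>At least \<open>N / 2\<close> links contribute \<open>N * D / (8 * C)\<close>,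
      one half of which outweighs \<open>- D\<close>.\<close>
    have A: "c' * N * D \<le> \<delta> m"
    proof -
      have "real m \<ge> N / 2" using m unfolding N_def by linarith
      then have "real m * D / (4 * C) \<ge> N / 2 * D / (4 * C)"
        using D C_pos by (intro divide_right_mono mult_right_mono) auto
      moreover have "N / 2 * D / (4 * C) = N * D / (16 * C) + N * D / (16 * C)" by simp
      moreover have "N * D / (16 * C) \<ge> D" using N(5) D C_pos by (simp add: field_simps)
      ultimately have P: "(1 + 2 * q) ^ m * \<delta> m \<ge> N * D / (16 * C)" using low[of m] by linarith
      moreover have "N * D / (16 * C) > 0" using Npos D C_pos by simp
      ultimately have "\<delta> m > 0" using q by (smt (verit) zero_less_mult_pos zero_less_power)
      then have "(1 + 2 * q) ^ m * \<delta> m \<le> e1 * \<delta> m" using pw[of m] m by (intro mult_right_mono) auto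
      then have "N * D / (16 * C) \<le> e1 * \<delta> m" using P by linarith
      then show ?thesis using e1 C_pos by (simp add: c'_def field_simps)
    qed
    have B: "\<bar>Y' (\<xi> (m - 1)) (\<xi> m) - Y' (\<psi> (m - 1)) (\<psi> m)\<bar> \<le> 2 * D"
    proof -
      have m1: "m - 1 < m" "Suc (m - 1) = m" using m0 by auto
      have "\<bar>(Y' (\<xi> (m - 1)) (\<xi> m) - Y' (\<psi> (m - 1)) (\<psi> m)) - \<epsilon> (m - 1)\<bar> \<le> Q * D / N\<^sup>2"
        using step_bound[OF m1(1) eps(2)[OF m1(1)]] main[OF m1(1)] m1 by auto
      moreover have "\<bar>\<epsilon> (m - 1) - D\<bar> \<le> D / 2" using main[OF m1(1)] QN[of "m - 1"] m m1 by linarith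
      moreover have "Q * D / N\<^sup>2 \<le> D / 2" using QN[of 1] N_def N(6) by simp
      ultimately show ?thesis by linarith
    qed
    show ?thesis using A B unfolding \<delta>_def N_def by simp
  qed
  then show ?thesis using c' by (intro exI[of _ c'] conjI exI[of _ j0]) auto
qed

end

section \<open>Chords of a curve parametrized by its tangent angle\<close>

lemma has_vector_derivative_cis_comp:
  assumes "(f has_real_derivative f') (at t)"
  shows "((\<lambda>t. cis (f t)) has_vector_derivative f' *\<^sub>R (\<i> * cis (f t))) (at t)"
proof -
  have "((\<lambda>t. \<i> * of_real (f t)) has_vector_derivative \<i> * of_real f') (at t)"
    using assms by (intro has_vector_derivative_mult_right has_vector_derivative_of_real)
      (simp add: has_real_derivative_iff_has_vector_derivative)
  from field_vector_diff_chain_at[OF this DERIV_exp]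
  have "(exp \<circ> (\<lambda>t. \<i> * of_real (f t)) has_vector_derivative \<i> * of_real f' * exp (\<i> * of_real (f t))) (at t)" .
  then show ?thesis by (simp add: o_def cis_conv_exp scaleR_conv_of_real mult_ac)
qed

lemma cis_eq_imp_eq:
  assumes "cis a = cis b" "\<bar>a - b\<bar> < 2 * pi"
  shows "a = b"
proof -
  have "cis (a - b) = 1" using assms(1) by (simp add: cis_divide[symmetric])
  then have "cos (a - b) = 1" by (simp add: complex_eq_iff)
  then obtain n :: int where n: "a - b = of_int n * 2 * pi" using cos_one_2pi_int by auto
  then have "\<bar>of_int n\<bar> * (2 * pi) < 1 * (2 * pi)" using assms(2) by (simp add: abs_mult mult.assoc)
  then have "\<bar>real_of_int n\<bar> < 1" by (metis mult_less_cancel_right_pos pi_gt_zero zero_less_mult_iff zero_less_numeral)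
  then have "n = 0" by linarith
  then show ?thesis using n by simp
qed

lemma angle_between_polar:
  assumes "0 < r" "0 \<le> \<theta>" "\<theta> \<le> pi"
  shows "angle_between (of_real r * cis (a + \<theta>)) (cis a) = \<theta>"
    and "angle_between (of_real r * cis (a - \<theta>)) (cis a) = \<theta>"
proof -
  have c: "cos (a + \<theta>) * cos a + sin (a + \<theta>) * sin a = cos \<theta>"
          "cos (a - \<theta>) * cos a + sin (a - \<theta>) * sin a = cos \<theta>"
    using cos_diff[of "a + \<theta>" a] cos_diff[of a "a - \<theta>"] by (simp_all add: mult.commute)
  have "(of_real r * cis (a + \<theta>)) \<bullet> cis a = r * cos \<theta>"
    using c(1) by (simp add: inner_complex_def distrib_left[symmetric] mult.assoc)
  moreover have "(of_real r * cis (a - \<theta>)) \<bullet> cis a = r * cos \<theta>"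
    using c(2) by (simp add: inner_complex_def distrib_left[symmetric] mult.assoc)
  ultimately show "angle_between (of_real r * cis (a + \<theta>)) (cis a) = \<theta>"
    "angle_between (of_real r * cis (a - \<theta>)) (cis a) = \<theta>"
    using assms unfolding angle_between_def by (simp_all add: norm_mult arccos_cos)
qed

text \<open>Rotation by \<open>cis (-a)\<close> turns the direction \<open>a\<close> into the
  positive real axis. In the upper half plane the unoriented angle, defined through
  \<open>arccos\<close>, equals the argument, which recovers the vector from its length and this
  angle.\<close>

lemma polar_left:
  assumes "0 < Im (cis (-a) * z)"
  shows "z = of_real (norm z) * cis (a + angle_between z (cis a))"
    and "0 < angle_between z (cis a)" "angle_between z (cis a) < pi" "0 < norm z"
proof -
  define w where "w = cis (-a) * z"
  have w: "0 < Im w" "w \<noteq> 0" using assms by (auto simp: w_def)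
  have z: "z = cis a * w" by (simp add: w_def mult.assoc[symmetric] cis_mult)
  have nz: "norm z = norm w" by (simp add: z norm_mult)
  have A: "0 < Arg w" "Arg w < pi" using w Arg_lt_pi by auto
  have wp: "w = of_real (norm w) * cis (Arg w)" using rcis_cmod_Arg[of w] by (simp add: rcis_def)
  have zz: "z = of_real (norm z) * cis (a + Arg w)"
  proof -
    have "z = cis a * (of_real (norm w) * cis (Arg w))" using z wp by simp
    also have "\<dots> = of_real (norm z) * cis (a + Arg w)" by (simp add: nz cis_mult[symmetric] mult_ac)
    finally show ?thesis .
  qed
  have "angle_between z (cis a) = Arg w"
    using angle_between_polar(1)[of "norm z" "Arg w" a] A w nz zz by simp
  then show "z = of_real (norm z) * cis (a + angle_between z (cis a))"
    "0 < angle_between z (cis a)" "angle_between z (cis a) < pi" "0 < norm z"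
    using zz A w nz by auto
qed

text \<open>Complex conjugation reduces this to \<open>polar_left\<close>.\<close>

lemma polar_right:
  assumes "Im (cis (-a) * z) < 0"
  shows "z = of_real (norm z) * cis (a - angle_between z (cis a))"
    and "0 < angle_between z (cis a)" "angle_between z (cis a) < pi" "0 < norm z"
proof -
  have "cis (- (- a)) * cnj z = cnj (cis (-a) * z)" by (simp add: cis_cnj)
  then have "0 < Im (cis (- (- a)) * cnj z)" using assms by simp
  note P = polar_left[OF this]
  have e: "angle_between (cnj z) (cis (- a)) = angle_between z (cis a)"
    by (simp add: angle_between_def inner_complex_def)
  have "cnj z = of_real (norm z) * cis (- a + angle_between z (cis a))" using P(1) e by simp
  then have "z = cnj (of_real (norm z) * cis (- a + angle_between z (cis a)))" by (metis complex_cnj_cnj)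
  then show "z = of_real (norm z) * cis (a - angle_between z (cis a))" by (simp add: cis_cnj)
  show "0 < angle_between z (cis a)" "angle_between z (cis a) < pi" "0 < norm z" using P e by auto
qed

lemma periodic_of_int:
  assumes "\<And>s::real. f (s + L) = f s" shows "f (s + of_int k * L) = f s"
proof -
  have nat: "f (s + real n * L) = f s" for s n
  proof (induction n)
    case (Suc n) then show ?case using assms[of "s + real n * L"] by (simp add: algebra_simps)
  qed simp
  show ?thesis
  proof (cases "0 \<le> k")
    case True then show ?thesis using nat[of s "nat k"] by simp
  next
    case False then show ?thesis using nat[of "s + of_int k * L" "nat (- k)"] by simp
  qed
qed

lemma period_representative:
  assumes "0 < (L::real)" obtains k :: int where "s + of_int k * L \<in> {0..<L}"
proof (rule that)
  have "of_int \<lfloor>s / L\<rfloor> * L \<le> s"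
    using mult_right_mono[OF of_int_floor_le[of "s / L"] less_imp_le[OF assms]] assms by simp
  moreover have "s < (of_int \<lfloor>s / L\<rfloor> + 1) * L"
    using mult_strict_right_mono[OF conjunct2[OF floor_correct[of "s / L"]] assms] assms by simp
  ultimately show "s + of_int (- \<lfloor>s / L\<rfloor>) * L \<in> {0..<L}" by (simp add: algebra_simps)
qed

text \<open>The boundary \<open>\<Gamma>\<close> is parametrized by its tangent angle, and \<open>g\<close> is the cube root of the radius of
  curvature, so that \<open>g \<cdot>\<close> angle is a Lazutkin coordinate.\<close>

locale gauss_curve =
  fixes \<Gamma> :: "real \<Rightarrow> complex" and g g1 g2 g3 :: "real \<Rightarrow> real" and g0 G :: real
  assumes \<Gamma>_deriv: "\<And>t. (\<Gamma> has_vector_derivative (g t ^ 3) *\<^sub>R cis t) (at t)"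
    and \<Gamma>_period: "\<And>t. \<Gamma> (t + 2 * pi) = \<Gamma> t"
    and g0_pos: "0 < g0" and g_ge: "\<And>t. g0 \<le> g t" and g_le: "\<And>t. g t \<le> G"
    and g_deriv: "\<And>t. (g has_real_derivative g1 t) (at t)"
    and g1_deriv: "\<And>t. (g1 has_real_derivative g2 t) (at t)"
    and g2_deriv: "\<And>t. (g2 has_real_derivative g3 t) (at t)"
    and g1_bound: "\<And>t. \<bar>g1 t\<bar> \<le> G" and g2_bound: "\<And>t. \<bar>g2 t\<bar> \<le> G" and g3_bound: "\<And>t. \<bar>g3 t\<bar> \<le> G"
begin

lemma g_pos: "0 < g t" using g_ge[of t] g0_pos by linarith
lemma G_pos: "0 < G" using g_le[of 0] g_pos[of 0] by linarith
lemma g_abs: "\<bar>g t\<bar> \<le> G" using g_le[of t] g_pos[of t] by simp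

text \<open>Coordinates in the frame of the tangent at \<open>\<Gamma> a\<close>: \<open>F\<close>
  is the height over the tangent line and \<open>X\<close> the abscissa along it. Their derivatives
  are the weight \<open>g ^ 3\<close> times \<open>sin\<close> and \<open>cos\<close>, which makes
  the expansion of chords manageable.\<close>

definition F :: "real \<Rightarrow> real \<Rightarrow> real" where "F a u = Im (cis (-a) * (\<Gamma> (a + u) - \<Gamma> a))"
definition X :: "real \<Rightarrow> real \<Rightarrow> real" where "X a u = Re (cis (-a) * (\<Gamma> (a + u) - \<Gamma> a))"

lemma FX_deriv:
  "(F a has_real_derivative g (a + u) ^ 3 * sin u) (at u)"
  "(X a has_real_derivative g (a + u) ^ 3 * cos u) (at u)"
proof -
  have d: "((\<lambda>u. \<Gamma> (a + u)) has_vector_derivative (g (a + u) ^ 3) *\<^sub>R cis (a + u)) (at u)"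
  proof -
    have "((\<lambda>u. a + u) has_vector_derivative 1) (at u)" by (auto intro!: derivative_eq_intros)
    from vector_diff_chain_at[OF this \<Gamma>_deriv] show ?thesis by (simp add: o_def)
  qed
  then have "((\<lambda>u. cis (-a) * (\<Gamma> (a + u) - \<Gamma> a)) has_vector_derivative cis (-a) * ((g (a + u) ^ 3) *\<^sub>R cis (a + u))) (at u)"
    by (intro has_vector_derivative_mult_right) (auto intro!: derivative_eq_intros)
  then have w: "((\<lambda>u. cis (-a) * (\<Gamma> (a + u) - \<Gamma> a)) has_vector_derivative (g (a + u) ^ 3) *\<^sub>R cis u) (at u)"
    by (simp add: cis_mult)
  show "(F a has_real_derivative g (a + u) ^ 3 * sin u) (at u)"
    using bounded_linear.has_vector_derivative[OF bounded_linear_Im w]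
    unfolding F_def[abs_def] has_real_derivative_iff_has_vector_derivative by simp
  show "(X a has_real_derivative g (a + u) ^ 3 * cos u) (at u)"
    using bounded_linear.has_vector_derivative[OF bounded_linear_Re w]
    unfolding X_def[abs_def] has_real_derivative_iff_has_vector_derivative by simp
qed

lemma \<Gamma>_period_int: "\<Gamma> (t + 2 * pi * of_int k) = \<Gamma> t"
  using periodic_of_int[of \<Gamma> "2 * pi" t k] \<Gamma>_period by (simp add: mult.commute)

lemma F_simps: "F a 0 = 0" "F a (u + 2 * pi) = F a u"
  using \<Gamma>_period[of "a + u"] by (auto simp: F_def add.assoc)

text \<open>Comparison with a circle of radius \<open>g0 ^ 3\<close>, a lower bound for the radius
  of curvature: the derivative of the difference has the sign of \<open>sin u\<close>, that is, of
  \<open>u\<close>.\<close>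

lemma F_ge_cos:
  assumes "\<bar>u\<bar> \<le> pi" shows "F a u \<ge> g0 ^ 3 * (1 - cos u)"
proof -
  define f where "f v = F a v - g0 ^ 3 * (1 - cos v)" for v
  have fd: "(f has_real_derivative (g (a + v) ^ 3 - g0 ^ 3) * sin v) (at v)" for v
    unfolding f_def[abs_def] by (auto intro!: derivative_eq_intros FX_deriv simp: algebra_simps)
  have gp: "g (a + v) ^ 3 - g0 ^ 3 \<ge> 0" for v using power_mono[OF g_ge, of 3] g0_pos by simp
  have "f u \<ge> f 0"
  proof (cases "u \<ge> 0")
    case True
    show ?thesis
      by (rule DERIV_nonneg_imp_nondecreasing[OF True])
        (use assms gp fd sin_ge_zero in \<open>force intro!: mult_nonneg_nonneg\<close>)
  next
    case False
    have "f 0 \<le> f u"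
    proof (rule DERIV_nonpos_imp_nonincreasing[of u 0 f])
      show "u \<le> 0" using False by simp
      fix x assume "u \<le> x" "x \<le> 0"
      then have "sin x \<le> 0" using sin_ge_zero[of "-x"] assms by simp
      then show "\<exists>y. (f has_real_derivative y) (at x) \<and> y \<le> 0"
        using fd gp mult_nonneg_nonpos by blast
    qed
    then show ?thesis .
  qed
  then show ?thesis by (simp add: f_def F_simps)
qed

text \<open>The comparison with the circle works up to \<open>pi\<close>; a longer arc is measured
  backwards, through \<open>u - 2 * pi\<close>.\<close>

lemma F_pos:
  assumes "0 < u" "u < 2 * pi" shows "0 < F a u"
proof -
  have *: "F a u > 0" if "\<bar>u\<bar> \<le> pi" "u \<noteq> 0" for u
  proof -
    have "cos u < 1" using cos_monotone_0_pi[of 0 "\<bar>u\<bar>"] that by simp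
    then show ?thesis using F_ge_cos[OF that(1), of a] g0_pos by (smt (verit) mult_pos_pos zero_less_power)
  qed
  show ?thesis
  proof (cases "u \<le> pi")
    case True then show ?thesis using * assms by simp
  next
    case False
    then show ?thesis using *[of "u - 2 * pi"] F_simps(2)[of a "u - 2 * pi"] assms by simp
  qed
qed

lemma chord_left: "0 < b - a \<Longrightarrow> b - a < 2 * pi \<Longrightarrow> 0 < Im (cis (-a) * (\<Gamma> b - \<Gamma> a))"
  using F_pos[of "b - a" a] by (simp add: F_def)

lemma chord_right: 
  assumes "0 < b - a" "b - a < 2 * pi" shows "Im (cis (-b) * (\<Gamma> b - \<Gamma> a)) < 0"
proof -
  have "0 < Im (cis (-b) * (\<Gamma> (a + 2 * pi) - \<Gamma> b))" using assms by (intro chord_left) auto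
  then show ?thesis unfolding \<Gamma>_period by (simp add: algebra_simps)
qed

definition th :: "real \<Rightarrow> real \<Rightarrow> real" where "th a b = angle_between (\<Gamma> b - \<Gamma> a) (cis a)"
definition ph :: "real \<Rightarrow> real \<Rightarrow> real" where "ph a b = angle_between (\<Gamma> b - \<Gamma> a) (cis b)"
definition H :: "real \<Rightarrow> real \<Rightarrow> real" where "H a b = norm (\<Gamma> b - \<Gamma> a)"

text \<open>The heart is \<open>th_add_ph\<close>: the direction of the chord is both
  \<open>a + th a b\<close> and \<open>b - ph a b\<close> modulo \<open>2 * pi\<close>, and these
  numbers are less than \<open>2 * pi\<close> apart. That the two angles add up to the parameter
  difference is the reason for parametrizing by the tangent angle.\<close>

lemma chord:
  assumes "0 < b - a" "b - a < 2 * pi"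
  shows chord_th: "\<Gamma> b - \<Gamma> a = of_real (H a b) * cis (a + th a b)"
    and chord_ph: "\<Gamma> b - \<Gamma> a = of_real (H a b) * cis (b - ph a b)"
    and th_pos: "0 < th a b" and th_less: "th a b < pi"
    and ph_pos: "0 < ph a b" and ph_less: "ph a b < pi"
    and H_pos: "0 < H a b" and th_add_ph: "th a b + ph a b = b - a"
proof -
  note L = polar_left[OF chord_left[OF assms]] and R = polar_right[OF chord_right[OF assms]]
  show 1: "\<Gamma> b - \<Gamma> a = of_real (H a b) * cis (a + th a b)" "\<Gamma> b - \<Gamma> a = of_real (H a b) * cis (b - ph a b)"
    "0 < th a b" "th a b < pi" "0 < ph a b" "ph a b < pi" "0 < H a b"
    using L R unfolding th_def ph_def H_def by auto
  have "cis (a + th a b) = cis (b - ph a b)" using 1(1,2,7) by auto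
  then have "a + th a b = b - ph a b" using 1 assms by (intro cis_eq_imp_eq) auto
  then show "th a b + ph a b = b - a" by simp
qed

text \<open>The ends move along affine paths, so partial derivatives and derivatives along segments
  come from one statement. The angle is the imaginary part of the logarithm of the chord rotated by
  \<open>cis (- A r)\<close>, which stays in the upper half plane and thus off the branch cut.
  \<open>N\<close> is the speed at which the direction of the chord turns; the formula for
  \<open>ph\<close> follows from the angle sum.\<close>

lemma th_ph_deriv:
  fixes p q a b r :: real
  defines "A \<equiv> \<lambda>r. a + r * p" and "B \<equiv> \<lambda>r. b + r * q"
  assumes "0 < B r - A r" "B r - A r < 2 * pi"
  defines "N \<equiv> (g (B r) ^ 3 * sin (ph (A r) (B r)) * q + g (A r) ^ 3 * sin (th (A r) (B r)) * p) / H (A r) (B r)"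
  shows "((\<lambda>r. th (A r) (B r)) has_real_derivative N - p) (at r)"
    and "((\<lambda>r. ph (A r) (B r)) has_real_derivative q - N) (at r)"
proof -
  define S where "S = {r. 0 < B r - A r} \<inter> {r. B r - A r < 2 * pi}"
  have S: "open S" "r \<in> S" unfolding S_def using assms(3,4)
    by (auto simp: A_def B_def intro!: open_Int open_Collect_less continuous_intros)
  define z where "z r = cis (- A r) * (\<Gamma> (B r) - \<Gamma> (A r))" for r
  have dA: "(A has_vector_derivative p) (at r)" "(B has_vector_derivative q) (at r)"
    unfolding A_def B_def by (auto intro!: derivative_eq_intros)
  have dG: "((\<lambda>r. \<Gamma> (A r)) has_vector_derivative p *\<^sub>R ((g (A r) ^ 3) *\<^sub>R cis (A r))) (at r)"
           "((\<lambda>r. \<Gamma> (B r)) has_vector_derivative q *\<^sub>R ((g (B r) ^ 3) *\<^sub>R cis (B r))) (at r)"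
    using vector_diff_chain_at[OF dA(1) \<Gamma>_deriv] vector_diff_chain_at[OF dA(2) \<Gamma>_deriv] by (simp_all add: o_def)
  have dC: "((\<lambda>r. cis (- A r)) has_vector_derivative (- p) *\<^sub>R (\<i> * cis (- A r))) (at r)"
    by (rule has_vector_derivative_cis_comp) (auto simp: A_def intro!: derivative_eq_intros)
  define z' where "z' = cis (- A r) * (q *\<^sub>R ((g (B r) ^ 3) *\<^sub>R cis (B r)) - p *\<^sub>R ((g (A r) ^ 3) *\<^sub>R cis (A r)))
     + ((- p) *\<^sub>R (\<i> * cis (- A r))) * (\<Gamma> (B r) - \<Gamma> (A r))"
  have dz: "(z has_vector_derivative z') (at r)"
    unfolding z_def z'_def by (rule has_vector_derivative_mult[OF dC has_vector_derivative_diff[OF dG(2,1)]])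
  note ch = chord[OF assms(3,4)]
  let ?t = "th (A r) (B r)" and ?f = "ph (A r) (B r)" and ?H = "H (A r) (B r)"
  have zpos: "0 < Im (z s)" if "s \<in> S" for s using that unfolding S_def z_def by (intro chord_left) auto
  have zr: "z r = of_real ?H * cis ?t" 
    unfolding z_def ch(1) by (simp add: mult.left_commute cis_mult)
  have "z r \<notin> \<real>\<^sub>\<le>\<^sub>0" using zpos[OF S(2)] by (auto simp: complex_nonpos_Reals_iff)
  from field_vector_diff_chain_at[OF dz has_field_derivative_Ln[OF this]]
  have "((\<lambda>r. Im (Ln (z r))) has_vector_derivative Im (z' * inverse (z r))) (at r)"
    using bounded_linear.has_vector_derivative[OF bounded_linear_Im] by (fastforce simp: o_def)
  moreover have "Im (z' * inverse (z r)) = N - p"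
  proof -
    have "B r - A r - ?t = ?f" using ch(8) by simp
    then have e1: "cis (- A r) * cis (B r) * cis (- ?t) = cis ?f" by (simp add: cis_mult)
    have e2: "cis (- A r) * cis (A r) * cis (- ?t) = cis (- ?t)" by (simp add: cis_mult)
    have inv: "inverse (z r) = of_real (1 / ?H) * cis (- ?t)" using ch(7) by (simp add: zr inverse_eq_divide cis_divide divide_simps)
       (simp add: cis_mult field_simps)
    have zeq: "z' = of_real (q * g (B r) ^ 3) * (cis (- A r) * cis (B r)) - of_real (p * g (A r) ^ 3) * (cis (- A r) * cis (A r)) - of_real p * \<i> * z r"
      by (simp add: z'_def z_def scaleR_conv_of_real algebra_simps)
    have ring: "(x1 * y1 - x2 * y2 - x3 * w) * (h * k) = (x1 * h) * (y1 * k) - (x2 * h) * (y2 * k) - x3 * (w * (h * k))" for x1 y1 x2 y2 x3 w h k :: complex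
      by (simp add: algebra_simps)
    have "z' * inverse (z r) = of_real (q * g (B r) ^ 3 / ?H) * (cis (- A r) * cis (B r) * cis (- ?t))
       - of_real (p * g (A r) ^ 3 / ?H) * (cis (- A r) * cis (A r) * cis (- ?t)) - of_real p * \<i> * (z r * inverse (z r))"
      unfolding inv zeq ring by simp
    also have "z r * inverse (z r) = 1" using zpos[OF S(2)] by (intro right_inverse) auto
    finally have "z' * inverse (z r) = of_real (q * g (B r) ^ 3 / ?H) * cis ?f - of_real (p * g (A r) ^ 3 / ?H) * cis (- ?t) - of_real p * \<i>"
      unfolding e1 e2 by simp
    then show ?thesis by (simp add: N_def add_divide_distrib mult_ac)
  qed
  ultimately have D: "((\<lambda>r. Im (Ln (z r))) has_real_derivative N - p) (at r)"
    by (simp add: has_real_derivative_iff_has_vector_derivative)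
  have eq: "Im (Ln (z s)) = th (A s) (B s)" if "s \<in> S" for s
  proof -
    have s: "0 < B s - A s" "B s - A s < 2 * pi" using that by (auto simp: S_def)
    note c = chord[OF s]
    have zs: "z s = of_real (H (A s) (B s)) * cis (th (A s) (B s))"
      unfolding z_def c(1) by (simp add: mult.left_commute cis_mult)
    have "z s \<noteq> 0" using zpos[OF that] by auto
    then show ?thesis using Arg_eq_Im_Ln[of "z s"] Arg_cis[of "th (A s) (B s)"] c zs
      by (simp add: Arg_times_of_real)
  qed
  show 1: "((\<lambda>r. th (A r) (B r)) has_real_derivative N - p) (at r)"
    by (rule has_field_derivative_transform_within_open[OF D S]) (use eq in auto)
  have D2: "((\<lambda>r. B r - A r - th (A r) (B r)) has_real_derivative q - N) (at r)"
  proof -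
    have "((\<lambda>r. B r - A r - th (A r) (B r)) has_real_derivative (q - p) - (N - p)) (at r)"
      by (intro DERIV_diff 1) (auto simp: A_def B_def intro!: derivative_eq_intros)
    then show ?thesis by simp
  qed
  show "((\<lambda>r. ph (A r) (B r)) has_real_derivative q - N) (at r)"
    by (rule has_field_derivative_transform_within_open[OF D2 S]) (use chord(8) in \<open>force simp: S_def\<close>)
qed

end

text \<open>Big O as \<open>\<Delta> \<rightarrow> 0\<close>, uniform in the base point.\<close>

definition bO :: "nat \<Rightarrow> (real \<Rightarrow> real \<Rightarrow> real) \<Rightarrow> bool" where
  "bO n f \<longleftrightarrow> (\<exists>C. \<forall>a \<Delta>. 0 < \<Delta> \<longrightarrow> \<Delta> \<le> 1 \<longrightarrow> \<bar>f a \<Delta>\<bar> \<le> C * \<Delta> ^ n)"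

section \<open>Rules for uniform error bounds, and Taylor remainders\<close>

lemma bOI: "(\<And>a \<Delta>. 0 < \<Delta> \<Longrightarrow> \<Delta> \<le> 1 \<Longrightarrow> \<bar>f a \<Delta>\<bar> \<le> C * \<Delta> ^ n) \<Longrightarrow> bO n f"
  unfolding bO_def by blast

lemma bOE:
  assumes "bO n f"
  obtains C where "0 < C" "\<And>a \<Delta>. 0 < \<Delta> \<Longrightarrow> \<Delta> \<le> 1 \<Longrightarrow> \<bar>f a \<Delta>\<bar> \<le> C * \<Delta> ^ n"
proof -
  obtain C where C: "\<forall>a \<Delta>. 0 < \<Delta> \<longrightarrow> \<Delta> \<le> 1 \<longrightarrow> \<bar>f a \<Delta>\<bar> \<le> C * \<Delta> ^ n" using assms unfolding bO_def by blast
  show ?thesis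
  proof (rule that[of "\<bar>C\<bar> + 1"])
    show "0 < \<bar>C\<bar> + 1" by simp
    fix a \<Delta> :: real assume "0 < \<Delta>" "\<Delta> \<le> 1"
    then have "\<bar>f a \<Delta>\<bar> \<le> C * \<Delta> ^ n" using C by blast
    also have "\<dots> \<le> (\<bar>C\<bar> + 1) * \<Delta> ^ n" using \<open>0 < \<Delta>\<close> by (intro mult_right_mono) auto
    finally show "\<bar>f a \<Delta>\<bar> \<le> (\<bar>C\<bar> + 1) * \<Delta> ^ n" .
  qed
qed

lemma bO_cong: "bO n f \<Longrightarrow> (\<And>a \<Delta>. 0 < \<Delta> \<Longrightarrow> \<Delta> \<le> 1 \<Longrightarrow> h a \<Delta> = f a \<Delta>) \<Longrightarrow> bO n h"
  unfolding bO_def by metis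

lemma bO_add: assumes "bO n f" "bO n h" shows "bO n (\<lambda>a \<Delta>. f a \<Delta> + h a \<Delta>)"
proof -
  obtain C where C: "0 < C" "\<And>a \<Delta>. 0 < \<Delta> \<Longrightarrow> \<Delta> \<le> 1 \<Longrightarrow> \<bar>f a \<Delta>\<bar> \<le> C * \<Delta> ^ n"
    by (rule bOE[OF assms(1)], rule that)
  obtain D where D: "0 < D" "\<And>a \<Delta>. 0 < \<Delta> \<Longrightarrow> \<Delta> \<le> 1 \<Longrightarrow> \<bar>h a \<Delta>\<bar> \<le> D * \<Delta> ^ n"
    by (rule bOE[OF assms(2)], rule that)
  have "\<bar>f a \<Delta> + h a \<Delta>\<bar> \<le> (C + D) * \<Delta> ^ n" if "0 < \<Delta>" "\<Delta> \<le> 1" for a \<Delta>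
    using C(2)[OF that, of a] D(2)[OF that, of a] abs_triangle_ineq[of "f a \<Delta>" "h a \<Delta>"] by (simp add: distrib_right)
  then show ?thesis by (rule bOI)
qed

lemma bO_minus: "bO n f \<Longrightarrow> bO n (\<lambda>a \<Delta>. - f a \<Delta>)"
  unfolding bO_def by simp

lemma bO_diff: "bO n f \<Longrightarrow> bO n h \<Longrightarrow> bO n (\<lambda>a \<Delta>. f a \<Delta> - h a \<Delta>)"
  using bO_add[OF _ bO_minus, of n f h] by simp

lemma bO_mult: assumes "bO n f" "bO m h" shows "bO (n + m) (\<lambda>a \<Delta>. f a \<Delta> * h a \<Delta>)"
proof -
  obtain C where C: "0 < C" "\<And>a \<Delta>. 0 < \<Delta> \<Longrightarrow> \<Delta> \<le> 1 \<Longrightarrow> \<bar>f a \<Delta>\<bar> \<le> C * \<Delta> ^ n"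
    by (rule bOE[OF assms(1)], rule that)
  obtain D where D: "0 < D" "\<And>a \<Delta>. 0 < \<Delta> \<Longrightarrow> \<Delta> \<le> 1 \<Longrightarrow> \<bar>h a \<Delta>\<bar> \<le> D * \<Delta> ^ m"
    by (rule bOE[OF assms(2)], rule that)
  show ?thesis
  proof (rule bOI[where C="C * D"])
    fix a \<Delta> :: real assume d: "0 < \<Delta>" "\<Delta> \<le> 1"
    have "\<bar>f a \<Delta>\<bar> * \<bar>h a \<Delta>\<bar> \<le> (C * \<Delta> ^ n) * (D * \<Delta> ^ m)"
      using C D d by (intro mult_mono) (auto simp: less_imp_le)
    then show "\<bar>f a \<Delta> * h a \<Delta>\<bar> \<le> C * D * \<Delta> ^ (n + m)" by (simp add: abs_mult power_add mult_ac)
  qed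
qed

lemma bO_mono: assumes "bO n f" "m \<le> n" shows "bO m f"
proof -
  obtain C where C: "0 < C" "\<And>a \<Delta>. 0 < \<Delta> \<Longrightarrow> \<Delta> \<le> 1 \<Longrightarrow> \<bar>f a \<Delta>\<bar> \<le> C * \<Delta> ^ n" by (rule bOE[OF assms(1)], rule that)
  show ?thesis
  proof (rule bOI[where C=C])
    fix a \<Delta> :: real assume d: "0 < \<Delta>" "\<Delta> \<le> 1"
    have "C * \<Delta> ^ n \<le> C * \<Delta> ^ m" using d C assms by (intro mult_left_mono power_decreasing) auto
    then show "\<bar>f a \<Delta>\<bar> \<le> C * \<Delta> ^ m" using C(2)[OF d] by (rule order_trans[rotated])
  qed
qed

lemma bO_const: "bO 0 (\<lambda>a \<Delta>. k)" by (rule bOI[where C="\<bar>k\<bar>"]) simp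
lemma bO_id: "bO 1 (\<lambda>a \<Delta>. \<Delta>)" by (rule bOI[where C=1]) simp

text \<open>Division by a factor that is bounded below by a multiple of \<open>\<Delta> ^ m\<close>.
  It will be applied to \<open>g\<^sup>2 \<Delta>\<close> and to the chord length, both with
  \<open>m = 1\<close>.\<close>

lemma bO_cancel:
  assumes "bO (n + m) (\<lambda>a \<Delta>. h a \<Delta> * f a \<Delta>)" "0 < c" "\<And>a \<Delta>. 0 < \<Delta> \<Longrightarrow> \<Delta> \<le> 1 \<Longrightarrow> c * \<Delta> ^ m \<le> h a \<Delta>"
  shows "bO n f"
proof -
  obtain C where C: "0 < C" "\<And>a \<Delta>. 0 < \<Delta> \<Longrightarrow> \<Delta> \<le> 1 \<Longrightarrow> \<bar>h a \<Delta> * f a \<Delta>\<bar> \<le> C * \<Delta> ^ (n + m)" by (rule bOE[OF assms(1)], rule that)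
  show ?thesis
  proof (rule bOI[where C="C / c"])
    fix a \<Delta> :: real assume d: "0 < \<Delta>" "\<Delta> \<le> 1"
    have "c * \<Delta> ^ m * \<bar>f a \<Delta>\<bar> \<le> h a \<Delta> * \<bar>f a \<Delta>\<bar>" using assms(3)[OF d] by (rule mult_right_mono) simp
    also have "\<dots> \<le> \<bar>h a \<Delta> * f a \<Delta>\<bar>" by (simp add: abs_mult mult_right_mono)
    also have "\<dots> \<le> C * \<Delta> ^ n * \<Delta> ^ m" using C(2)[OF d] by (simp add: power_add mult_ac)
    finally have "(c * \<bar>f a \<Delta>\<bar>) * \<Delta> ^ m \<le> (C * \<Delta> ^ n) * \<Delta> ^ m" by (simp add: mult_ac)
    then have "c * \<bar>f a \<Delta>\<bar> \<le> C * \<Delta> ^ n" using d by simp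
    then show "\<bar>f a \<Delta>\<bar> \<le> C / c * \<Delta> ^ n" using assms(2) by (simp add: field_simps)
  qed
qed

lemma bO_scale: assumes "bO n f" "bO 0 h" shows "bO n (\<lambda>a \<Delta>. h a \<Delta> * f a \<Delta>)"
  using bO_mult[OF assms(2,1)] by simp

lemma bO_comp_power:
  assumes "\<And>a \<Delta>. 0 < \<Delta> \<Longrightarrow> \<Delta> \<le> 1 \<Longrightarrow> \<bar>f a \<Delta>\<bar> \<le> K * \<bar>z a \<Delta>\<bar> ^ n" "0 \<le> K"
    and "\<And>a \<Delta>. 0 < \<Delta> \<Longrightarrow> \<Delta> \<le> 1 \<Longrightarrow> \<bar>z a \<Delta>\<bar> \<le> \<Delta>"
  shows "bO n f"
proof (rule bOI[where C=K])
  fix a \<Delta> :: real assume d: "0 < \<Delta>" "\<Delta> \<le> 1"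
  have "K * \<bar>z a \<Delta>\<bar> ^ n \<le> K * \<Delta> ^ n" using assms d by (intro mult_left_mono power_mono) auto
  then show "\<bar>f a \<Delta>\<bar> \<le> K * \<Delta> ^ n" using assms(1)[OF d] by (rule order_trans[rotated])
qed

text \<open>The mean value inequality between \<open>- \<bar>z\<bar>\<close> and
  \<open>\<bar>z\<bar>\<close> stands in for integration; it loses the factor
  \<open>1 / (n + 1)\<close>, which is harmless since only orders matter.\<close>

lemma power_bound_by_deriv:
  fixes f :: "real \<Rightarrow> real"
  assumes "f 0 = 0" "\<And>v. (f has_real_derivative f' v) (at v)"
    and "\<And>v. \<bar>v\<bar> \<le> \<bar>z\<bar> \<Longrightarrow> \<bar>f' v\<bar> \<le> K * \<bar>v\<bar> ^ n" "0 \<le> K"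
  shows "\<bar>f z\<bar> \<le> K * \<bar>z\<bar> ^ Suc n"
proof -
  have "norm (f z - f 0) \<le> (K * \<bar>z\<bar> ^ n) * norm (z - 0)"
  proof (rule field_differentiable_bound[where S="{-\<bar>z\<bar>..\<bar>z\<bar>}"])
    show "(f has_field_derivative f' v) (at v within {-\<bar>z\<bar>..\<bar>z\<bar>})" for v using assms(2) has_field_derivative_at_within by blast
    fix v assume "v \<in> {-\<bar>z\<bar>..\<bar>z\<bar>}"
    then have v: "\<bar>v\<bar> \<le> \<bar>z\<bar>" by auto
    have "K * \<bar>v\<bar> ^ n \<le> K * \<bar>z\<bar> ^ n" using v assms(4) by (intro mult_left_mono power_mono) auto
    then show "norm (f' v) \<le> K * \<bar>z\<bar> ^ n" using assms(3)[OF v] by simp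
  qed auto
  then show ?thesis using assms(1) by (simp add: mult.assoc mult.commute[of "\<bar>z\<bar>"])
qed

lemma deriv_shift:
  fixes f :: "real \<Rightarrow> real"
  assumes "\<And>t. (f has_real_derivative f1 t) (at t)"
  shows "((\<lambda>v. f (a + v)) has_real_derivative f1 (a + v)) (at v)"
proof -
  have "((\<lambda>v. a + v) has_real_derivative 1) (at v)" by (auto intro!: derivative_eq_intros)
  from DERIV_chain2[OF assms this] show ?thesis by simp
qed

lemma taylor_first:
  fixes f :: "real \<Rightarrow> real"
  assumes "\<And>t. (f has_real_derivative f1 t) (at t)" "\<And>t. \<bar>f1 t\<bar> \<le> K"
  shows "\<bar>f (a + z) - f a\<bar> \<le> K * \<bar>z\<bar> ^ 1"
proof -
  have K: "0 \<le> K" using assms(2)[of 0] by linarith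
  have d: "((\<lambda>v. f (a + v) - f a) has_real_derivative f1 (a + v)) (at v)" for v
    using DERIV_diff[OF deriv_shift[OF assms(1), of a v] DERIV_const[of "f a"]] by simp
  have "\<bar>(\<lambda>v. f (a + v) - f a) z\<bar> \<le> K * \<bar>z\<bar> ^ Suc 0"
    by (rule power_bound_by_deriv[OF _ d _ K]) (use assms(2) in simp_all)
  then show ?thesis by simp
qed

lemma taylor_second:
  fixes f :: "real \<Rightarrow> real"
  assumes "\<And>t. (f has_real_derivative f1 t) (at t)" "\<And>t. (f1 has_real_derivative f2 t) (at t)" "\<And>t. \<bar>f2 t\<bar> \<le> K"
  shows "\<bar>f (a + z) - f a - f1 a * z\<bar> \<le> K * \<bar>z\<bar> ^ 2"
proof -
  have K: "0 \<le> K" using assms(3)[of 0] by linarith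
  have d: "((\<lambda>v. f (a + v) - f a - f1 a * v) has_real_derivative f1 (a + v) - f1 a) (at v)" for v
    using DERIV_diff[OF DERIV_diff[OF deriv_shift[OF assms(1), of a v] DERIV_const[of "f a"]] DERIV_cmult_Id[of "f1 a"]] by simp
  have "\<bar>(\<lambda>v. f (a + v) - f a - f1 a * v) z\<bar> \<le> K * \<bar>z\<bar> ^ Suc 1"
    by (rule power_bound_by_deriv[OF _ d _ K]) (use taylor_first[OF assms(2,3)] in simp_all)
  then show ?thesis by (simp add: power2_eq_square)
qed

lemma cos_taylor: "\<bar>cos v - 1\<bar> \<le> 1 * \<bar>v\<bar> ^ 2" for v :: real
proof -
  have d: "((\<lambda>v. cos v - 1) has_real_derivative - sin v) (at v)" for v :: real
    using DERIV_diff[OF DERIV_cos[of v] DERIV_const[of 1]] by simp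
  have "\<bar>(\<lambda>v. cos v - 1) v\<bar> \<le> 1 * \<bar>v\<bar> ^ Suc 1"
    by (rule power_bound_by_deriv[OF _ d]) (use abs_sin_x_le_abs_x in simp_all)
  then show ?thesis by (simp add: power2_eq_square)
qed

lemma sin_taylor: "\<bar>sin z - z\<bar> \<le> 1 * \<bar>z\<bar> ^ 3" for z :: real
proof -
  have d: "((\<lambda>v. sin v - v) has_real_derivative cos v - 1) (at v)" for v :: real
    using DERIV_diff[OF DERIV_sin[of v] DERIV_ident] by simp
  have "\<bar>(\<lambda>v. sin v - v) z\<bar> \<le> 1 * \<bar>z\<bar> ^ Suc 2"
    by (rule power_bound_by_deriv[OF _ d]) (use cos_taylor in simp_all)
  then show ?thesis by (simp add: power3_eq_cube power2_eq_square)
qed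

text \<open>The weight is arbitrary because the lemma serves twice: for the height \<open>F\<close>,
  with weight \<open>g ^ 3\<close>, and for the auxiliary function \<open>Q\<close> of
  \<open>bO_n1\<close>, whose weight is the derivative of \<open>g ^ 3\<close>.\<close>

lemma taylor_sin_weight:
  fixes f r r1 r2 :: "real \<Rightarrow> real"
  assumes f0: "f 0 = 0" and fd: "\<And>v. (f has_real_derivative r (a + v) * sin v) (at v)"
    and r: "\<And>t. (r has_real_derivative r1 t) (at t)" "\<And>t. (r1 has_real_derivative r2 t) (at t)"
    and K: "\<And>t. \<bar>r t\<bar> \<le> K" "\<And>t. \<bar>r1 t\<bar> \<le> K" "\<And>t. \<bar>r2 t\<bar> \<le> K"
  shows "\<bar>f z - r a * z\<^sup>2 / 2 - r1 a * z ^ 3 / 3\<bar> \<le> (3 * K) * \<bar>z\<bar> ^ 4"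
proof -
  have K0: "0 \<le> K" using K(1)[of 0] by linarith
  have p: "((\<lambda>v. c * v\<^sup>2 / 2) has_real_derivative c * v) (at v)" "((\<lambda>v. c * v ^ 3 / 3) has_real_derivative c * v\<^sup>2) (at v)" for c v :: real
    by (auto intro!: derivative_eq_intros)
  have d: "((\<lambda>v. f v - r a * v\<^sup>2 / 2 - r1 a * v ^ 3 / 3) has_real_derivative r (a + v) * sin v - r a * v - r1 a * v\<^sup>2) (at v)" for v
    by (rule DERIV_diff[OF DERIV_diff[OF fd p(1)] p(2)])
  have b: "\<bar>r (a + v) * sin v - r a * v - r1 a * v\<^sup>2\<bar> \<le> 3 * K * \<bar>v\<bar> ^ 3" for v
  proof -
    have "r (a + v) * sin v - r a * v - r1 a * v\<^sup>2 = r (a + v) * (sin v - v) + (r (a + v) - r a - r1 a * v) * v"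
      by (simp add: algebra_simps power2_eq_square)
    also have "\<bar>\<dots>\<bar> \<le> K * (1 * \<bar>v\<bar> ^ 3) + (K * \<bar>v\<bar>\<^sup>2) * \<bar>v\<bar>"
    proof (rule order_trans[OF abs_triangle_ineq], rule add_mono)
      show "\<bar>r (a + v) * (sin v - v)\<bar> \<le> K * (1 * \<bar>v\<bar> ^ 3)"
        unfolding abs_mult using K(1) sin_taylor K0 by (intro mult_mono) auto
      show "\<bar>(r (a + v) - r a - r1 a * v) * v\<bar> \<le> (K * \<bar>v\<bar>\<^sup>2) * \<bar>v\<bar>"
        unfolding abs_mult using taylor_second[OF r K(3)] by (intro mult_right_mono) auto
    qed
    also have "\<dots> = 2 * K * \<bar>v\<bar> ^ 3" by (simp only: power3_eq_cube power2_eq_square)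
    also have "\<dots> \<le> 3 * K * \<bar>v\<bar> ^ 3" using K0 by (intro mult_right_mono) auto
    finally show ?thesis .
  qed
  have "\<bar>(\<lambda>v. f v - r a * v\<^sup>2 / 2 - r1 a * v ^ 3 / 3) z\<bar> \<le> (3 * K) * \<bar>z\<bar> ^ Suc 3"
    by (rule power_bound_by_deriv[OF _ d b]) (use f0 K0 in simp_all)
  then show ?thesis by simp
qed

lemma taylor_cos_weight:
  fixes f r r1 r2 :: "real \<Rightarrow> real"
  assumes f0: "f 0 = 0" and fd: "\<And>v. (f has_real_derivative r (a + v) * cos v) (at v)"
    and r: "\<And>t. (r has_real_derivative r1 t) (at t)" "\<And>t. (r1 has_real_derivative r2 t) (at t)"
    and K: "\<And>t. \<bar>r t\<bar> \<le> K" "\<And>t. \<bar>r2 t\<bar> \<le> K"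
  shows "\<bar>f z - r a * z - r1 a * z\<^sup>2 / 2\<bar> \<le> (2 * K) * \<bar>z\<bar> ^ 3"
proof -
  have K0: "0 \<le> K" using K(1)[of 0] by linarith
  have p: "((\<lambda>v. c * v) has_real_derivative c) (at v)" "((\<lambda>v. c * v\<^sup>2 / 2) has_real_derivative c * v) (at v)" for c v :: real
    by (auto intro!: derivative_eq_intros)
  have d: "((\<lambda>v. f v - r a * v - r1 a * v\<^sup>2 / 2) has_real_derivative r (a + v) * cos v - r a - r1 a * v) (at v)" for v
    by (rule DERIV_diff[OF DERIV_diff[OF fd p(1)] p(2)])
  have b: "\<bar>r (a + v) * cos v - r a - r1 a * v\<bar> \<le> 2 * K * \<bar>v\<bar> ^ 2" for v
  proof -
    have "r (a + v) * cos v - r a - r1 a * v = r (a + v) * (cos v - 1) + (r (a + v) - r a - r1 a * v)"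
      by (simp add: algebra_simps)
    also have "\<bar>\<dots>\<bar> \<le> K * (1 * \<bar>v\<bar> ^ 2) + K * \<bar>v\<bar>\<^sup>2"
    proof (rule order_trans[OF abs_triangle_ineq], rule add_mono)
      show "\<bar>r (a + v) * (cos v - 1)\<bar> \<le> K * (1 * \<bar>v\<bar> ^ 2)"
        unfolding abs_mult using K(1) cos_taylor K0 by (intro mult_mono) auto
    qed (rule taylor_second[OF r K(2)])
    finally show ?thesis by simp
  qed
  have "\<bar>(\<lambda>v. f v - r a * v - r1 a * v\<^sup>2 / 2) z\<bar> \<le> (2 * K) * \<bar>z\<bar> ^ Suc 2"
    by (rule power_bound_by_deriv[OF _ d b]) (use f0 K0 in simp_all)
  then show ?thesis by (simp add: power3_eq_cube power2_eq_square)
qed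

section \<open>Expansion of short chords at the parallel tangent\<close>

context gauss_curve
begin

text \<open>The suffix \<open>f\<close> marks quantities of the chord from \<open>a\<close> to \<open>a + \<Delta>\<close> as functions of \<open>a\<close> and \<open>\<Delta>\<close>;
  \<open>alf\<close> is the direction of the chord and the parameter of the parallel tangent.\<close>

definition thf where "thf a \<Delta> = th a (a + \<Delta>)"
definition phf where "phf a \<Delta> = ph a (a + \<Delta>)"
definition alf where "alf a \<Delta> = a + thf a \<Delta>"
definition Hf where "Hf a \<Delta> = H a (a + \<Delta>)"
definition Df where "Df a \<Delta> = phf a \<Delta> - thf a \<Delta>"
definition r1 where "r1 t = 3 * g t ^ 2 * g1 t"
definition r2 where "r2 t = 6 * g t * g1 t ^ 2 + 3 * g t ^ 2 * g2 t"
definition r3 where "r3 t = 6 * g1 t ^ 3 + 18 * g t * g1 t * g2 t + 3 * g t ^ 2 * g3 t"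
text \<open>27 is the sum of the coefficients in \<open>r3\<close>, the largest such sum among
  \<open>g ^ 3\<close> and its three derivatives.\<close>

definition R where "R = 27 * G ^ 3"
text \<open>When both ends of the chord move with unit speed, its direction turns with speed
  \<open>1 + n1f\<close>; when only the far end moves, it turns with speed
  \<open>mf\<close>.\<close>

definition n1f where "n1f a \<Delta> = (g (a + \<Delta>) ^ 3 * sin (phf a \<Delta>) + g a ^ 3 * sin (thf a \<Delta>) - Hf a \<Delta>) / Hf a \<Delta>"
definition mf where "mf a \<Delta> = g (a + \<Delta>) ^ 3 * sin (phf a \<Delta>) / Hf a \<Delta>"

lemma r_derivs: "((\<lambda>t. g t ^ 3) has_real_derivative r1 t) (at t)"
  "(r1 has_real_derivative r2 t) (at t)" "(r2 has_real_derivative r3 t) (at t)"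
  unfolding r1_def[abs_def] r2_def[abs_def] r3_def[abs_def]
  by (auto intro!: derivative_eq_intros g_deriv g1_deriv g2_deriv simp: algebra_simps power2_eq_square power3_eq_cube)

lemma r_bounds: "\<bar>g t ^ 3\<bar> \<le> R" "\<bar>r1 t\<bar> \<le> R" "\<bar>r2 t\<bar> \<le> R" "\<bar>r3 t\<bar> \<le> R" "0 < R"
proof -
  have m3: "\<bar>x * y * z\<bar> \<le> G ^ 3" if "\<bar>x\<bar> \<le> G" "\<bar>y\<bar> \<le> G" "\<bar>z\<bar> \<le> G" for x y z
    using mult_mono[OF mult_mono[OF that(1,2)] that(3)] G_pos by (simp add: abs_mult power3_eq_cube)
  note b = g_abs g1_bound g2_bound g3_bound
  have G3: "0 < G ^ 3" using G_pos by simp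
  show "0 < R" using G3 by (simp add: R_def)
  show "\<bar>g t ^ 3\<bar> \<le> R" using m3[OF g_abs[of t] g_abs[of t] g_abs[of t]] G3 by (simp add: R_def power3_eq_cube mult.assoc)
  have "\<bar>r1 t\<bar> = 3 * \<bar>g t * g t * g1 t\<bar>" by (simp add: r1_def power2_eq_square abs_mult mult.assoc)
  then show "\<bar>r1 t\<bar> \<le> R" using m3[OF g_abs[of t] g_abs[of t] g1_bound[of t]] G3
    unfolding R_def by linarith
  have "\<bar>r2 t\<bar> \<le> 6 * \<bar>g t * g1 t * g1 t\<bar> + 3 * \<bar>g t * g t * g2 t\<bar>"
    unfolding r2_def by (rule order_trans[OF abs_triangle_ineq]) (simp add: abs_mult power2_eq_square mult.assoc)
  then show "\<bar>r2 t\<bar> \<le> R" using m3[OF b(1)[of t] b(2)[of t] b(2)[of t]] m3[OF b(1)[of t] b(1)[of t] b(3)[of t]] G3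
    unfolding R_def by linarith
  have "\<bar>r3 t\<bar> \<le> 6 * \<bar>g1 t * g1 t * g1 t\<bar> + 18 * \<bar>g t * g1 t * g2 t\<bar> + 3 * \<bar>g t * g t * g3 t\<bar>"
    unfolding r3_def by (rule order_trans[OF abs_triangle_ineq add_mono[OF order_trans[OF abs_triangle_ineq]]])
      (auto simp add: abs_mult power2_eq_square power3_eq_cube mult.assoc)
  then show "\<bar>r3 t\<bar> \<le> R" using m3[OF b(2)[of t] b(2)[of t] b(2)[of t]] m3[OF b(1)[of t] b(2)[of t] b(3)[of t]] m3[OF b(1)[of t] b(1)[of t] b(4)[of t]]
    unfolding R_def by linarith
qed

text \<open>In the frame of the parallel tangent both ends of the chord have equal height, and their
  abscissas differ by the chord length. \<open>F_chord\<close> and \<open>X_chord\<close> are the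
  two equations from which the expansions below are drawn. \<open>Hf_lower\<close> holds because
  \<open>cos\<close> is at least 1/2 on angles up to 1.\<close>

lemma small_chord:
  assumes "0 < \<Delta>" "\<Delta> \<le> 1"
  shows "0 < thf a \<Delta>" "0 < phf a \<Delta>" "thf a \<Delta> + phf a \<Delta> = \<Delta>" "0 < Hf a \<Delta>"
    "alf a \<Delta> + phf a \<Delta> = a + \<Delta>" "alf a \<Delta> - thf a \<Delta> = a"
    and F_chord: "F (alf a \<Delta>) (phf a \<Delta>) = F (alf a \<Delta>) (- thf a \<Delta>)"
    and X_chord: "X (alf a \<Delta>) (phf a \<Delta>) - X (alf a \<Delta>) (- thf a \<Delta>) = Hf a \<Delta>"
    and Hf_lower: "(g0 ^ 3 / 2) * \<Delta> \<le> Hf a \<Delta>"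
proof -
  have p: "\<Delta> < 2 * pi" using assms pi_gt3 by linarith
  have c: "0 < (a + \<Delta>) - a" "(a + \<Delta>) - a < 2 * pi" using assms p by auto
  note ch = chord[OF c]
  show 1: "0 < thf a \<Delta>" "0 < phf a \<Delta>" "thf a \<Delta> + phf a \<Delta> = \<Delta>" "0 < Hf a \<Delta>"
    "alf a \<Delta> + phf a \<Delta> = a + \<Delta>" "alf a \<Delta> - thf a \<Delta> = a"
    using ch by (auto simp: thf_def phf_def Hf_def alf_def)
  have "\<Gamma> (alf a \<Delta> + phf a \<Delta>) - \<Gamma> (alf a \<Delta> - thf a \<Delta>) = of_real (Hf a \<Delta>) * cis (alf a \<Delta>)"
    unfolding 1(5,6) using ch(1) by (simp add: alf_def thf_def Hf_def)
  then have e: "cis (- alf a \<Delta>) * (\<Gamma> (alf a \<Delta> + phf a \<Delta>) - \<Gamma> (alf a \<Delta> - thf a \<Delta>)) = of_real (Hf a \<Delta>)"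
    by (simp add: mult.left_commute cis_mult)
  have "cis (- alf a \<Delta>) * (\<Gamma> (alf a \<Delta> + phf a \<Delta>) - \<Gamma> (alf a \<Delta>)) - cis (- alf a \<Delta>) * (\<Gamma> (alf a \<Delta> + - thf a \<Delta>) - \<Gamma> (alf a \<Delta>)) = of_real (Hf a \<Delta>)"
    unfolding e[symmetric] by (simp add: algebra_simps)
  then show "F (alf a \<Delta>) (phf a \<Delta>) = F (alf a \<Delta>) (- thf a \<Delta>)"
    and X: "X (alf a \<Delta>) (phf a \<Delta>) - X (alf a \<Delta>) (- thf a \<Delta>) = Hf a \<Delta>"
    unfolding F_def X_def by (auto simp: complex_eq_iff)
  have "(\<lambda>u. X (alf a \<Delta>) u - g0 ^ 3 / 2 * u) (- thf a \<Delta>) \<le> (\<lambda>u. X (alf a \<Delta>) u - g0 ^ 3 / 2 * u) (phf a \<Delta>)"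
 
  proof (rule DERIV_nonneg_imp_nondecreasing[of "- thf a \<Delta>" "phf a \<Delta>" "\<lambda>u. X (alf a \<Delta>) u - g0 ^ 3 / 2 * u"])
    show "- thf a \<Delta> \<le> phf a \<Delta>" using 1 by linarith
    fix u assume "- thf a \<Delta> \<le> u" "u \<le> phf a \<Delta>"
    then have "\<bar>u\<bar> \<le> 1" using 1 assms by linarith
    then have "\<bar>u\<bar> \<le> pi / 3" using pi_gt3 by linarith
    then have "cos (pi / 3) \<le> cos \<bar>u\<bar>" by (intro cos_monotone_0_pi_le) auto
    then have "1 / 2 \<le> cos u" by (simp add: cos_60)
    then have "g0 ^ 3 * (1 / 2) \<le> g (alf a \<Delta> + u) ^ 3 * cos u"
      using g0_pos power_mono[OF g_ge, of 3] g_pos by (intro mult_mono) (auto simp: less_imp_le)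
    then show "\<exists>y. ((\<lambda>u. X (alf a \<Delta>) u - g0 ^ 3 / 2 * u) has_real_derivative y) (at u) \<and> 0 \<le> y"
      by (intro exI[of _ "g (alf a \<Delta> + u) ^ 3 * cos u - g0 ^ 3 / 2"]) (auto intro!: derivative_eq_intros FX_deriv)
  qed
  then have "g0 ^ 3 / 2 * (thf a \<Delta> + phf a \<Delta>) \<le> Hf a \<Delta>" using X by (simp add: algebra_simps)
  then show "(g0 ^ 3 / 2) * \<Delta> \<le> Hf a \<Delta>" using 1 by simp
qed

lemma bO_th: "bO 1 thf" and bO_ph: "bO 1 phf"
  by (rule bOI[where C=1]; use small_chord in \<open>smt (verit) power_one_right\<close>)+

lemma bO_base: "bO 0 (\<lambda>a \<Delta>. g (h a \<Delta>))" "bO 0 (\<lambda>a \<Delta>. g1 (h a \<Delta>))" "bO 0 (\<lambda>a \<Delta>. g2 (h a \<Delta>))"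
  by (rule bOI[where C=G]; use g_abs g1_bound g2_bound in simp)+

lemma bO_inv_g: "bO 0 (\<lambda>a \<Delta>. 1 / g (h a \<Delta>))"
proof (rule bOI[where C="1 / g0"])
  fix a \<Delta> show "\<bar>1 / g (h a \<Delta>)\<bar> \<le> 1 / g0 * \<Delta> ^ 0"
    using g_ge[of "h a \<Delta>"] g_pos[of "h a \<Delta>"] g0_pos by (simp add: frac_le)
qed

lemma bO_multk: "bO n f \<Longrightarrow> bO m h \<Longrightarrow> k \<le> n + m \<Longrightarrow> bO k (\<lambda>a \<Delta>. f a \<Delta> * h a \<Delta>)"
  using bO_mono[OF bO_mult] by blast

abbreviation "ga a \<Delta> \<equiv> g (alf a \<Delta>)"
abbreviation "ga1 a \<Delta> \<equiv> g1 (alf a \<Delta>)"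
abbreviation "ga2 a \<Delta> \<equiv> g2 (alf a \<Delta>)"

lemma bO_power: "bO n f \<Longrightarrow> bO (n * k) (\<lambda>a \<Delta>. f a \<Delta> ^ k)"
proof (induction k)
  case 0 show ?case using bO_const[of 1] by simp
next
  case (Suc k) then show ?case using bO_mult[of n f "n * k"] by simp
qed

lemma abs_angles:
  assumes "0 < \<Delta>" "\<Delta> \<le> 1"
  shows "\<bar>phf a \<Delta>\<bar> \<le> \<Delta>" "\<bar>- thf a \<Delta>\<bar> \<le> \<Delta>" "\<bar>phf a \<Delta>\<bar> \<le> 1" "\<bar>- thf a \<Delta>\<bar> \<le> 1"
  using small_chord[OF assms, of a] assms by auto

text \<open>With \<open>\<Delta> = phf + thf\<close> and \<open>Df = phf - thf\<close>, the squares
  and the cubes of the two parameters \<open>phf\<close> and \<open>- thf\<close> differ by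
  \<open>\<Delta> * Df\<close> and \<open>(\<Delta> ^ 3 + 3 * \<Delta> * Df ^ 2) / 4\<close>; this
  produces the coefficients in the statement.\<close>

lemma bO_taylor_sin:
  assumes "\<And>a. f a 0 = 0" "\<And>a v. (f a has_real_derivative r (a + v) * sin v) (at v)"
    and "\<And>t. (r has_real_derivative r' t) (at t)" "\<And>t. (r' has_real_derivative r'' t) (at t)"
    and "\<And>t. \<bar>r t\<bar> \<le> K" "\<And>t. \<bar>r' t\<bar> \<le> K" "\<And>t. \<bar>r'' t\<bar> \<le> K"
  shows "bO 4 (\<lambda>a \<Delta>. (f (alf a \<Delta>) (phf a \<Delta>) - f (alf a \<Delta>) (- thf a \<Delta>))
     - (r (alf a \<Delta>) * \<Delta> * Df a \<Delta> / 2 + r' (alf a \<Delta>) * (\<Delta> ^ 3 + 3 * \<Delta> * Df a \<Delta> ^ 2) / 12))"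
proof -
  let ?e = "\<lambda>z a \<Delta>. f (alf a \<Delta>) (z a \<Delta>) - r (alf a \<Delta>) * (z a \<Delta>)\<^sup>2 / 2 - r' (alf a \<Delta>) * (z a \<Delta>) ^ 3 / 3"
  have K: "0 \<le> 3 * K" using assms(5)[of 0] by linarith
  have B: "bO 4 (?e z)" if "z = phf \<or> z = (\<lambda>a \<Delta>. - thf a \<Delta>)" for z
    by (rule bO_comp_power[where K="3 * K" and z=z])
      (use that abs_angles K taylor_sin_weight[OF assms] in auto)
  have "bO 4 (\<lambda>a \<Delta>. ?e phf a \<Delta> - ?e (\<lambda>a \<Delta>. - thf a \<Delta>) a \<Delta>)" by (intro bO_diff B) auto
  then show ?thesis
  proof (rule bO_cong)
    fix a \<Delta> :: real assume "0 < \<Delta>" "\<Delta> \<le> 1"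
    then have d: "\<Delta> = phf a \<Delta> + thf a \<Delta>" using small_chord(3)[of \<Delta> a] by simp
    have ring: "d = p + t \<Longrightarrow> (fp - ft) - (rr * d * (p - t) / 2 + rr' * (d ^ 3 + 3 * d * (p - t) ^ 2) / 12)
      = (fp - rr * p\<^sup>2 / 2 - rr' * p ^ 3 / 3) - (ft - rr * (- t)\<^sup>2 / 2 - rr' * (- t) ^ 3 / 3)" for fp ft rr rr' p t d :: real
      by (simp add: field_simps power2_eq_square power3_eq_cube)
    show "(f (alf a \<Delta>) (phf a \<Delta>) - f (alf a \<Delta>) (- thf a \<Delta>))
     - (r (alf a \<Delta>) * \<Delta> * Df a \<Delta> / 2 + r' (alf a \<Delta>) * (\<Delta> ^ 3 + 3 * \<Delta> * Df a \<Delta> ^ 2) / 12) = ?e phf a \<Delta> - ?e (\<lambda>a \<Delta>. - thf a \<Delta>) a \<Delta>"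
      unfolding Df_def by (rule ring[OF d])
  qed
qed

text \<open>Equal heights of the two ends, divided by \<open>g\<^sup>2 \<Delta>\<close>, determine
  the asymmetry \<open>Df\<close> of the angles. The argument bootstraps: the trivial order 1 of
  \<open>Df\<close> first gives order 2, after which the term with the square of \<open>Df\<close>
  drops below the precision and the leading term appears.\<close>

lemma bO_D2: "bO 2 Df" and bO_D3: "bO 3 (\<lambda>a \<Delta>. ga a \<Delta> * Df a \<Delta> + ga1 a \<Delta> * \<Delta>\<^sup>2 / 2)"
proof -
  have "bO 4 (\<lambda>a \<Delta>. (F (alf a \<Delta>) (phf a \<Delta>) - F (alf a \<Delta>) (- thf a \<Delta>))
     - ((g (alf a \<Delta>))^3 * \<Delta> * Df a \<Delta> / 2 + r1 (alf a \<Delta>) * (\<Delta> ^ 3 + 3 * \<Delta> * Df a \<Delta> ^ 2) / 12))"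
    by (rule bO_taylor_sin[OF F_simps(1) FX_deriv(1) r_derivs(1,2) r_bounds(1-3)])
  then have "bO 4 (\<lambda>a \<Delta>. (ga a \<Delta> ^ 2 * \<Delta>) * (- (ga a \<Delta> * Df a \<Delta> / 2 + ga1 a \<Delta> * (\<Delta>\<^sup>2 + 3 * Df a \<Delta> ^ 2) / 4)))"
    by (rule bO_cong)
      (simp_all add: F_chord r1_def power2_eq_square power3_eq_cube field_simps)
  then have "bO (3 + 1) (\<lambda>a \<Delta>. (ga a \<Delta> ^ 2 * \<Delta>) * (- (ga a \<Delta> * Df a \<Delta> / 2 + ga1 a \<Delta> * (\<Delta>\<^sup>2 + 3 * Df a \<Delta> ^ 2) / 4)))"
    by simp
  then have "bO 3 (\<lambda>a \<Delta>. - (ga a \<Delta> * Df a \<Delta> / 2 + ga1 a \<Delta> * (\<Delta>\<^sup>2 + 3 * Df a \<Delta> ^ 2) / 4))"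
  proof (rule bO_cancel)
    show "0 < g0\<^sup>2" using g0_pos by simp
    show "g0\<^sup>2 * \<Delta> ^ 1 \<le> ga a \<Delta> ^ 2 * \<Delta>" if "0 < \<Delta>" for a \<Delta>
      using that g0_pos g_ge[of "alf a \<Delta>"] by (auto intro!: mult_right_mono power_mono)
  qed
  from bO_minus[OF this]
  have e2: "bO 3 (\<lambda>a \<Delta>. ga a \<Delta> * Df a \<Delta> / 2 + ga1 a \<Delta> * (\<Delta>\<^sup>2 + 3 * Df a \<Delta> ^ 2) / 4)"
    unfolding minus_minus .
  have D1: "bO 1 Df" unfolding Df_def[abs_def] by (intro bO_diff bO_ph bO_th)
  have sq: "bO 2 (\<lambda>a \<Delta>. \<Delta>\<^sup>2)" using bO_power[OF bO_id, of 2] by simp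
  have D1sq: "bO 2 (\<lambda>a \<Delta>. Df a \<Delta> ^ 2)" using bO_power[OF D1, of 2] by simp
  have "bO 2 (\<lambda>a \<Delta>. (2 / ga a \<Delta>) * ((ga a \<Delta> * Df a \<Delta> / 2 + ga1 a \<Delta> * (\<Delta>\<^sup>2 + 3 * Df a \<Delta> ^ 2) / 4) - ga1 a \<Delta> * (\<Delta>\<^sup>2 * (1/4) + Df a \<Delta> ^ 2 * (3 / 4))))"
  proof (rule bO_scale)
    show "bO 0 (\<lambda>a \<Delta>. 2 / ga a \<Delta>)" using bO_scale[OF bO_inv_g bO_const[of 2], of alf] by simp
    show "bO 2 (\<lambda>a \<Delta>. (ga a \<Delta> * Df a \<Delta> / 2 + ga1 a \<Delta> * (\<Delta>\<^sup>2 + 3 * Df a \<Delta> ^ 2) / 4) - ga1 a \<Delta> * (\<Delta>\<^sup>2 * (1/4) + Df a \<Delta> ^ 2 * (3 / 4)))"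
    proof (rule bO_diff[OF bO_mono[OF e2] bO_scale[OF _ bO_base(2)]])
      have "bO 2 (\<lambda>a \<Delta>. (1/4) * \<Delta>\<^sup>2 + (3/4) * Df a \<Delta> ^ 2)"
        by (rule bO_add[OF bO_scale[OF sq bO_const] bO_scale[OF D1sq bO_const]])
      then show "bO 2 (\<lambda>a \<Delta>. \<Delta>\<^sup>2 * (1/4) + Df a \<Delta> ^ 2 * (3/4))" by (simp add: mult.commute)
    qed simp
  qed
  then show D2: "bO 2 Df" by (rule bO_cong) (use g_pos in \<open>simp add: field_simps less_imp_neq[THEN not_sym]\<close>)
  have D2sq: "bO 3 (\<lambda>a \<Delta>. Df a \<Delta> ^ 2)" using bO_mono[OF bO_power[OF D2, of 2], of 3] by simp
  have "bO 3 (\<lambda>a \<Delta>. 2 * (ga a \<Delta> * Df a \<Delta> / 2 + ga1 a \<Delta> * (\<Delta>\<^sup>2 + 3 * Df a \<Delta> ^ 2) / 4) - (3 / 2) * (ga1 a \<Delta> * Df a \<Delta> ^ 2))"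
    by (intro bO_diff bO_scale[OF e2 bO_const] bO_scale bO_const bO_base D2sq)
  then show "bO 3 (\<lambda>a \<Delta>. ga a \<Delta> * Df a \<Delta> + ga1 a \<Delta> * \<Delta>\<^sup>2 / 2)"
    by (rule bO_cong) (simp add: field_simps)
qed

text \<open>The quadratic terms of the abscissas contribute \<open>r1 * \<Delta> * Df / 2\<close>,
  which already has order 3 by \<open>bO_D2\<close>.\<close>

lemma bO_H: "bO 3 (\<lambda>a \<Delta>. Hf a \<Delta> - ga a \<Delta> ^ 3 * \<Delta>)"
proof -
  let ?e = "\<lambda>z a \<Delta>. X (alf a \<Delta>) (z a \<Delta>) - ga a \<Delta> ^ 3 * z a \<Delta> - r1 (alf a \<Delta>) * (z a \<Delta>) ^ 2 / 2"
  have X0: "X a 0 = 0" for a by (simp add: X_def)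
  have B: "bO 3 (?e z)" if "z = phf \<or> z = (\<lambda>a \<Delta>. - thf a \<Delta>)" for z
    by (rule bO_comp_power[where K="2 * R" and z=z])
      (use that abs_angles r_bounds taylor_cos_weight[OF X0 FX_deriv(2) r_derivs(1,2) r_bounds(1,3)] in \<open>auto simp: less_imp_le\<close>)
  have r1b: "bO 0 (\<lambda>a \<Delta>. r1 (alf a \<Delta>) / 2)"
  proof (rule bOI[where C=R])
    fix a \<Delta> show "\<bar>r1 (alf a \<Delta>) / 2\<bar> \<le> R * \<Delta> ^ 0" using r_bounds(2)[of "alf a \<Delta>"] by simp
  qed
  have "bO 3 (\<lambda>a \<Delta>. ?e phf a \<Delta> - ?e (\<lambda>a \<Delta>. - thf a \<Delta>) a \<Delta> + r1 (alf a \<Delta>) / 2 * (\<Delta> * Df a \<Delta>))"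
    by (intro bO_add bO_diff B bO_scale r1b bO_multk[OF bO_id bO_D2]) auto
  then show ?thesis
  proof (rule bO_cong)
    fix a \<Delta> :: real assume d: "0 < \<Delta>" "\<Delta> \<le> 1"
    then have dd: "\<Delta> = phf a \<Delta> + thf a \<Delta>" using small_chord(3)[of \<Delta> a] by simp
    have ring: "d = p + t \<Longrightarrow> (fp - ft) - rr * d = (fp - rr * p - rr' * p\<^sup>2 / 2) - (ft - rr * (- t) - rr' * (- t)\<^sup>2 / 2) + rr' / 2 * (d * (p - t))" for fp ft rr rr' p t d :: real
      by (simp add: field_simps power2_eq_square)
    show "Hf a \<Delta> - ga a \<Delta> ^ 3 * \<Delta> = ?e phf a \<Delta> - ?e (\<lambda>a \<Delta>. - thf a \<Delta>) a \<Delta> + r1 (alf a \<Delta>) / 2 * (\<Delta> * Df a \<Delta>)"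
      unfolding Df_def X_chord[OF d, symmetric] by (rule ring[OF dd])
  qed
qed

lemma bO_Hcancel: "bO (Suc n) (\<lambda>a \<Delta>. Hf a \<Delta> * f a \<Delta>) \<Longrightarrow> bO n f"
  by (rule bO_cancel[where m=1 and h=Hf and c="g0 ^ 3 / 2"]) (use g0_pos Hf_lower in auto)

text \<open>The numerator of \<open>n1f\<close> is the difference of
  \<open>g (a + z) ^ 3 * sin z - X a z\<close> between the two ends, taken in the frame of the
  parallel tangent. In the derivative of this function the cosine terms cancel and
  \<open>r1 * sin\<close> remains, so \<open>bO_taylor_sin\<close> applies once more. The second
  estimate keeps the leading coefficient for \<open>bO_translate\<close>.\<close>

lemma bO_n1: "bO 2 n1f"
  and bO_n1': "bO 3 (\<lambda>a \<Delta>. n1f a \<Delta> - \<Delta>\<^sup>2 * ((ga2 a \<Delta> * ga a \<Delta> - ga1 a \<Delta> ^ 2) / (4 * ga a \<Delta> ^ 2)))"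
proof -
  define Q where "Q a z = g (a + z) ^ 3 * sin z - X a z" for a z
  have Q0: "Q a 0 = 0" for a by (simp add: Q_def X_def)
  have gd: "((\<lambda>z. g (a + z) ^ 3) has_real_derivative r1 (a + v)) (at v)" for a v
    by (rule deriv_shift[OF r_derivs(1)])
  have Qd: "(Q a has_real_derivative r1 (a + v) * sin v) (at v)" for a v
  proof -
    have "(Q a has_real_derivative (r1 (a + v) * sin v + cos v * g (a + v) ^ 3) - g (a + v) ^ 3 * cos v) (at v)"
      unfolding Q_def[abs_def] by (intro DERIV_diff DERIV_mult DERIV_sin gd FX_deriv)
    then show ?thesis by simp
  qed
  have N: "Q (alf a \<Delta>) (phf a \<Delta>) - Q (alf a \<Delta>) (- thf a \<Delta>) = Hf a \<Delta> * n1f a \<Delta>" if "0 < \<Delta>" "\<Delta> \<le> 1" for a \<Delta>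
  proof -
    have ab: "alf a \<Delta> + phf a \<Delta> = a + \<Delta>" "alf a \<Delta> + - thf a \<Delta> = a" "Hf a \<Delta> \<noteq> 0" using small_chord[OF that, of a] by auto
    show ?thesis unfolding Q_def n1f_def ab(1,2) using ab(3) X_chord[OF that, of a] by simp
  qed
  let ?k = "\<lambda>a \<Delta>. (ga2 a \<Delta> * ga a \<Delta> - ga1 a \<Delta> ^ 2) / (4 * ga a \<Delta> ^ 2)"
  have k0: "bO 0 ?k"
  proof -
    have "bO 0 (\<lambda>a \<Delta>. ((1/4) * (1 / ga a \<Delta>) ^ 2) * (ga2 a \<Delta> * ga a \<Delta> - ga1 a \<Delta> ^ 2))"
      using bO_power[OF bO_base(2), of 2] bO_power[OF bO_inv_g, of 2] by (intro bO_scale bO_diff bO_base bO_const) auto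
    then show ?thesis by (rule bO_cong) (simp add: power_divide)
  qed
  have "bO 4 (\<lambda>a \<Delta>. (Q (alf a \<Delta>) (phf a \<Delta>) - Q (alf a \<Delta>) (- thf a \<Delta>))
     - (r1 (alf a \<Delta>) * \<Delta> * Df a \<Delta> / 2 + r2 (alf a \<Delta>) * (\<Delta> ^ 3 + 3 * \<Delta> * Df a \<Delta> ^ 2) / 12))"
    by (rule bO_taylor_sin[OF Q0 Qd r_derivs(2,3) r_bounds(2-4)])
  then have e: "bO 4 (\<lambda>a \<Delta>. Hf a \<Delta> * n1f a \<Delta> - (r1 (alf a \<Delta>) * \<Delta> * Df a \<Delta> / 2 + r2 (alf a \<Delta>) * (\<Delta> ^ 3 + 3 * \<Delta> * Df a \<Delta> ^ 2) / 12))"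
    by (rule bO_cong) (simp add: N)
  have r2b: "bO 0 (\<lambda>a \<Delta>. r2 (alf a \<Delta>))" by (rule bOI[where C=R]) (use r_bounds in simp)
  have D4: "bO 4 (\<lambda>a \<Delta>. \<Delta> * Df a \<Delta> ^ 2)" by (rule bO_multk[OF bO_id bO_power[OF bO_D2, of 2]]) simp
  have gD: "bO 4 (\<lambda>a \<Delta>. \<Delta> * (ga a \<Delta> * Df a \<Delta> + ga1 a \<Delta> * \<Delta>\<^sup>2 / 2))" by (rule bO_multk[OF bO_id bO_D3]) simp
  have "bO 4 (\<lambda>a \<Delta>. (Hf a \<Delta> * n1f a \<Delta> - (r1 (alf a \<Delta>) * \<Delta> * Df a \<Delta> / 2 + r2 (alf a \<Delta>) * (\<Delta> ^ 3 + 3 * \<Delta> * Df a \<Delta> ^ 2) / 12))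
     + (3 / 2) * (ga a \<Delta> * (ga1 a \<Delta> * (\<Delta> * (ga a \<Delta> * Df a \<Delta> + ga1 a \<Delta> * \<Delta>\<^sup>2 / 2)))) + (1 / 4) * (r2 (alf a \<Delta>) * (\<Delta> * Df a \<Delta> ^ 2)))"
    by (intro bO_add e bO_scale bO_const bO_base r2b D4 gD)
  then have Hn: "bO 4 (\<lambda>a \<Delta>. Hf a \<Delta> * n1f a \<Delta> - ga a \<Delta> ^ 3 * \<Delta> ^ 3 * ?k a \<Delta>)"
  proof (rule bO_cong)
    fix a \<Delta> :: real
    have keq: "ga a \<Delta> ^ 3 * \<Delta> ^ 3 * ?k a \<Delta> = \<Delta> ^ 3 * ga a \<Delta> * (ga2 a \<Delta> * ga a \<Delta> - ga1 a \<Delta> ^ 2) / 4"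
      using g_pos[of "alf a \<Delta>"] by (simp add: power2_eq_square power3_eq_cube)
    show "Hf a \<Delta> * n1f a \<Delta> - ga a \<Delta> ^ 3 * \<Delta> ^ 3 * ?k a \<Delta> = (Hf a \<Delta> * n1f a \<Delta> - (r1 (alf a \<Delta>) * \<Delta> * Df a \<Delta> / 2 + r2 (alf a \<Delta>) * (\<Delta> ^ 3 + 3 * \<Delta> * Df a \<Delta> ^ 2) / 12))
     + (3 / 2) * (ga a \<Delta> * (ga1 a \<Delta> * (\<Delta> * (ga a \<Delta> * Df a \<Delta> + ga1 a \<Delta> * \<Delta>\<^sup>2 / 2)))) + (1 / 4) * (r2 (alf a \<Delta>) * (\<Delta> * Df a \<Delta> ^ 2))"
      unfolding keq by (simp add: r1_def r2_def field_simps power2_eq_square power3_eq_cube)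
  qed
  have cube: "bO 3 (\<lambda>a \<Delta>. \<Delta> ^ 3)" using bO_power[OF bO_id, of 3] by simp
  have g3b: "bO 0 (\<lambda>a \<Delta>. ga a \<Delta> ^ 3)" using bO_power[OF bO_base(1), of 3] by simp
  have "bO (Suc 2) (\<lambda>a \<Delta>. Hf a \<Delta> * n1f a \<Delta>)"
  proof -
    have "bO 3 (\<lambda>a \<Delta>. (Hf a \<Delta> * n1f a \<Delta> - ga a \<Delta> ^ 3 * \<Delta> ^ 3 * ?k a \<Delta>) + ?k a \<Delta> * (ga a \<Delta> ^ 3 * \<Delta> ^ 3))"
      by (intro bO_add bO_mono[OF Hn] bO_scale cube g3b k0) simp
    then show ?thesis by simp
  qed
  then show n1: "bO 2 n1f" by (rule bO_Hcancel)
  \<comment> \<open>The leading term was found with the factor \<open>ga ^ 3 * \<Delta>\<close>;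
    exchanging that factor for the chord length costs only higher order, and then the chord length
    can be cancelled.\<close>
  have Hn5: "bO 4 (\<lambda>a \<Delta>. (Hf a \<Delta> - ga a \<Delta> ^ 3 * \<Delta>) * (\<Delta>\<^sup>2 * ?k a \<Delta>))"
    by (intro bO_multk[OF bO_H bO_mult[OF bO_power[OF bO_id, of 2] k0]]) simp
  have "bO (Suc 3) (\<lambda>a \<Delta>. (Hf a \<Delta> * n1f a \<Delta> - ga a \<Delta> ^ 3 * \<Delta> ^ 3 * ?k a \<Delta>) - (Hf a \<Delta> - ga a \<Delta> ^ 3 * \<Delta>) * (\<Delta>\<^sup>2 * ?k a \<Delta>))"
    using bO_diff[OF Hn Hn5] by simp
  then have "bO (Suc 3) (\<lambda>a \<Delta>. Hf a \<Delta> * (n1f a \<Delta> - \<Delta>\<^sup>2 * ?k a \<Delta>))"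
  proof (rule bO_cong)
    have ring: "h * (n - d\<^sup>2 * k) = (h * n - x * d ^ 3 * k) - (h - x * d) * (d\<^sup>2 * k)" for h n d k x :: real
      by (simp add: algebra_simps power2_eq_square power3_eq_cube)
    show "Hf a \<Delta> * (n1f a \<Delta> - \<Delta>\<^sup>2 * ?k a \<Delta>) = (Hf a \<Delta> * n1f a \<Delta> - ga a \<Delta> ^ 3 * \<Delta> ^ 3 * ?k a \<Delta>) - (Hf a \<Delta> - ga a \<Delta> ^ 3 * \<Delta>) * (\<Delta>\<^sup>2 * ?k a \<Delta>)" for a \<Delta>
      by (rule ring)
  qed
  then show "bO 3 (\<lambda>a \<Delta>. n1f a \<Delta> - \<Delta>\<^sup>2 * ?k a \<Delta>)" by (rule bO_Hcancel)
qed

lemma bO_taylor_b: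
  "bO 2 (\<lambda>a \<Delta>. g (a + \<Delta>) - ga a \<Delta> - ga1 a \<Delta> * phf a \<Delta>)"
  "bO 2 (\<lambda>a \<Delta>. g a - ga a \<Delta> + ga1 a \<Delta> * thf a \<Delta>)"
  "bO 2 (\<lambda>a \<Delta>. g1 (a + \<Delta>) - ga1 a \<Delta> - ga2 a \<Delta> * phf a \<Delta>)"
  "bO 2 (\<lambda>a \<Delta>. g1 a - ga1 a \<Delta> + ga2 a \<Delta> * thf a \<Delta>)"
  "bO 2 (\<lambda>a \<Delta>. g (a + \<Delta>) ^ 3 - ga a \<Delta> ^ 3 - r1 (alf a \<Delta>) * phf a \<Delta>)"
proof -
  have T: "bO 2 (\<lambda>a \<Delta>. f (alf a \<Delta> + z a \<Delta>) - f (alf a \<Delta>) - f' (alf a \<Delta>) * z a \<Delta>)"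
    if "\<And>t. (f has_real_derivative f' t) (at t)" "\<And>t. (f' has_real_derivative f'' t) (at t)" "\<And>t. \<bar>f'' t\<bar> \<le> K"
      "z = phf \<or> z = (\<lambda>a \<Delta>. - thf a \<Delta>)" for f f' f'' K z
  proof -
    have K: "0 \<le> K" using that(3)[of 0] by linarith
    show ?thesis by (rule bO_comp_power[where K=K and z=z])
      (use that(4) abs_angles K taylor_second[OF that(1-3)] in auto)
  qed
  have ab: "alf a \<Delta> + phf a \<Delta> = a + \<Delta>" "alf a \<Delta> + - thf a \<Delta> = a" if "0 < \<Delta>" "\<Delta> \<le> 1" for a \<Delta>
    using small_chord[OF that, of a] by auto
  show "bO 2 (\<lambda>a \<Delta>. g (a + \<Delta>) - ga a \<Delta> - ga1 a \<Delta> * phf a \<Delta>)"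
    by (rule bO_cong[OF T[OF g_deriv g1_deriv g2_bound, of phf]]) (use ab in auto)
  show "bO 2 (\<lambda>a \<Delta>. g a - ga a \<Delta> + ga1 a \<Delta> * thf a \<Delta>)"
    by (rule bO_cong[OF T[OF g_deriv g1_deriv g2_bound, of "\<lambda>a \<Delta>. - thf a \<Delta>"]]) (use ab in auto)
  show "bO 2 (\<lambda>a \<Delta>. g1 (a + \<Delta>) - ga1 a \<Delta> - ga2 a \<Delta> * phf a \<Delta>)"
    by (rule bO_cong[OF T[OF g1_deriv g2_deriv g3_bound, of phf]]) (use ab in auto)
  show "bO 2 (\<lambda>a \<Delta>. g1 a - ga1 a \<Delta> + ga2 a \<Delta> * thf a \<Delta>)"
    by (rule bO_cong[OF T[OF g1_deriv g2_deriv g3_bound, of "\<lambda>a \<Delta>. - thf a \<Delta>"]]) (use ab in auto)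
  show "bO 2 (\<lambda>a \<Delta>. g (a + \<Delta>) ^ 3 - ga a \<Delta> ^ 3 - r1 (alf a \<Delta>) * phf a \<Delta>)"
    by (rule bO_cong[OF T[OF r_derivs(1,2) r_bounds(3), of phf]]) (use ab in auto)
qed

text \<open>If only the far end moves, the chord turns at half of the speed to leading order. The
  first correction is kept because it has to cancel in \<open>bO_stretch\<close>.\<close>

lemma bO_m: "bO 2 (\<lambda>a \<Delta>. mf a \<Delta> - 1 / 2 - ga1 a \<Delta> * \<Delta> / (2 * ga a \<Delta>))"
proof -
  let ?k = "\<lambda>a \<Delta>. 1 / 2 + (1/2) * (ga1 a \<Delta> * ((1 / ga a \<Delta>) * \<Delta>))"
  have id0: "bO 0 (\<lambda>a \<Delta>. \<Delta>)" using bO_mono[OF bO_id] by simp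
  have k0: "bO 0 ?k" by (intro bO_add bO_const bO_scale bO_base bO_inv_g id0)
  let ?e1 = "\<lambda>a \<Delta>. g (a + \<Delta>) ^ 3 - ga a \<Delta> ^ 3 - r1 (alf a \<Delta>) * phf a \<Delta>"
  let ?e2 = "\<lambda>a \<Delta>. sin (phf a \<Delta>) - phf a \<Delta>"
  let ?e3 = "\<lambda>a \<Delta>. Hf a \<Delta> - ga a \<Delta> ^ 3 * \<Delta>"
  let ?e4 = "\<lambda>a \<Delta>. ga a \<Delta> * Df a \<Delta> + ga1 a \<Delta> * \<Delta>\<^sup>2 / 2"
  have e2: "bO 3 ?e2" by (rule bO_comp_power[where K=1 and z=phf]) (use sin_taylor abs_angles in auto)
  have ph0: "bO 3 (\<lambda>a \<Delta>. phf a \<Delta> * ?e1 a \<Delta>)" by (rule bO_multk[OF bO_ph bO_taylor_b(5)]) simp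
  have gb: "bO 0 (\<lambda>a \<Delta>. g (a + \<Delta>) ^ 3)" "bO 0 (\<lambda>a \<Delta>. ga a \<Delta> ^ 2)"
    using bO_power[OF bO_base(1), of 3] bO_power[OF bO_base(1), of 2] by auto
  have r1b: "bO 0 (\<lambda>a \<Delta>. r1 (alf a \<Delta>))" by (rule bOI[where C=R]) (use r_bounds in simp)
  have DD: "bO 3 (\<lambda>a \<Delta>. \<Delta> * Df a \<Delta>)" "bO 3 (\<lambda>a \<Delta>. Df a \<Delta> * Df a \<Delta>)"
    by (rule bO_multk[OF bO_id bO_D2] bO_multk[OF bO_D2 bO_D2]; simp)+
  have "bO 3 (\<lambda>a \<Delta>. g (a + \<Delta>) ^ 3 * ?e2 a \<Delta> + phf a \<Delta> * ?e1 a \<Delta> - ?k a \<Delta> * ?e3 a \<Delta>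
     + (1 / 2) * (ga a \<Delta> ^ 2 * ?e4 a \<Delta>) + r1 (alf a \<Delta>) * ((1 / 2) * (\<Delta> * Df a \<Delta>) + (1/4) * (Df a \<Delta> * Df a \<Delta>)))"
    by (intro bO_add bO_diff bO_scale bO_const bO_base bO_H bO_D3 e2 ph0 gb k0 r1b DD)
  then have "bO 3 (\<lambda>a \<Delta>. Hf a \<Delta> * (mf a \<Delta> - 1 / 2 - ga1 a \<Delta> * \<Delta> / (2 * ga a \<Delta>)))"
  proof (rule bO_cong)
    fix a \<Delta> :: real assume d: "0 < \<Delta>" "\<Delta> \<le> 1"
    define x where "x = ga a \<Delta>"
    define x1 where "x1 = ga1 a \<Delta>"
    define h where "h = Hf a \<Delta>"
    define D where "D = Df a \<Delta>"
    have p: "phf a \<Delta> = (\<Delta> + D) / 2" using small_chord(3)[OF d, of a] by (simp add: Df_def D_def)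
    have x0: "x \<noteq> 0" using g_pos[of "alf a \<Delta>"] by (simp add: x_def)
    have hm: "h * mf a \<Delta> = g (a + \<Delta>) ^ 3 * sin (phf a \<Delta>)" using small_chord(4)[OF d, of a] by (simp add: h_def mf_def)
    define gb where "gb = g (a + \<Delta>) ^ 3"
    define s where "s = sin (phf a \<Delta>)"
    have "h * (mf a \<Delta> - 1 / 2 - x1 * \<Delta> / (2 * x)) = gb * s - h * (1/2 + (1/2) * (x1 * ((1 / x) * \<Delta>)))"
      using hm by (simp add: algebra_simps gb_def s_def)
    also have "\<dots> = gb * (s - phf a \<Delta>) + phf a \<Delta> * (gb - x ^ 3 - (3 * x ^ 2 * x1) * phf a \<Delta>)
       - (1/2 + (1/2) * (x1 * ((1 / x) * \<Delta>))) * (h - x ^ 3 * \<Delta>)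
       + (1 / 2) * (x ^ 2 * (x * D + x1 * \<Delta>\<^sup>2 / 2)) + (3 * x ^ 2 * x1) * ((1 / 2) * (\<Delta> * D) + (1/4) * (D * D))"
      unfolding p using x0 by (simp add: field_simps power2_eq_square power3_eq_cube)
    finally show "Hf a \<Delta> * (mf a \<Delta> - 1 / 2 - ga1 a \<Delta> * \<Delta> / (2 * ga a \<Delta>)) = g (a + \<Delta>) ^ 3 * ?e2 a \<Delta> + phf a \<Delta> * ?e1 a \<Delta> - ?k a \<Delta> * ?e3 a \<Delta>
     + (1 / 2) * (ga a \<Delta> ^ 2 * ?e4 a \<Delta>) + r1 (alf a \<Delta>) * ((1 / 2) * (\<Delta> * Df a \<Delta>) + (1/4) * (Df a \<Delta> * Df a \<Delta>))"
      unfolding x_def x1_def h_def D_def gb_def s_def r1_def .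
  qed
  then have "bO (Suc 2) (\<lambda>a \<Delta>. Hf a \<Delta> * (mf a \<Delta> - 1 / 2 - ga1 a \<Delta> * \<Delta> / (2 * ga a \<Delta>)))" by simp
  then show ?thesis by (rule bO_Hcancel)
qed

text \<open>This is the derivative of \<open>Y' - Y\<close> when a link is shifted with its
  parameter length fixed. Its second order terms are
  \<open>ga1 * Df + ga2 * \<Delta>\<^sup>2 / 2\<close> minus \<open>2 * ga\<close> times the leading
  part of \<open>n1f\<close>; with the value of \<open>Df\<close> from \<open>bO_D3\<close> they
  cancel. The cancellation depends on \<open>g\<close> being the cube root of the radius of
  curvature.\<close>

lemma bO_translate: "bO 3 (\<lambda>a \<Delta>. g1 (a + \<Delta>) * phf a \<Delta> - g1 a * thf a \<Delta> - (g a + g (a + \<Delta>)) * n1f a \<Delta>)"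
proof -
  let ?e1 = "\<lambda>a \<Delta>. g1 (a + \<Delta>) - ga1 a \<Delta> - ga2 a \<Delta> * phf a \<Delta>"
  let ?e2 = "\<lambda>a \<Delta>. g1 a - ga1 a \<Delta> + ga2 a \<Delta> * thf a \<Delta>"
  let ?e3 = "\<lambda>a \<Delta>. ga a \<Delta> * Df a \<Delta> + ga1 a \<Delta> * \<Delta>\<^sup>2 / 2"
  let ?e4 = "\<lambda>a \<Delta>. n1f a \<Delta> - \<Delta>\<^sup>2 * ((ga2 a \<Delta> * ga a \<Delta> - ga1 a \<Delta> ^ 2) / (4 * ga a \<Delta> ^ 2))"
  let ?e5 = "\<lambda>a \<Delta>. (g (a + \<Delta>) - ga a \<Delta> - ga1 a \<Delta> * phf a \<Delta>) + (g a - ga a \<Delta> + ga1 a \<Delta> * thf a \<Delta>) + ga1 a \<Delta> * Df a \<Delta>"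
  have 1: "bO 3 (\<lambda>a \<Delta>. phf a \<Delta> * ?e1 a \<Delta>)" "bO 3 (\<lambda>a \<Delta>. thf a \<Delta> * ?e2 a \<Delta>)"
    by (rule bO_multk[OF bO_ph bO_taylor_b(3)] bO_multk[OF bO_th bO_taylor_b(4)]; simp)+
  have 2: "bO 1 ?e5"
    by (rule bO_add[OF bO_add[OF bO_mono[OF bO_taylor_b(1)] bO_mono[OF bO_taylor_b(2)]] bO_scale[OF bO_mono[OF bO_D2] bO_base(2)]]) simp_all
  have 3: "bO 3 (\<lambda>a \<Delta>. ?e5 a \<Delta> * n1f a \<Delta>)" by (rule bO_multk[OF 2 bO_n1]) simp
  have DD: "bO 3 (\<lambda>a \<Delta>. Df a \<Delta> * Df a \<Delta>)" by (rule bO_multk[OF bO_D2 bO_D2]) simp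
  have "bO 3 (\<lambda>a \<Delta>. phf a \<Delta> * ?e1 a \<Delta> - thf a \<Delta> * ?e2 a \<Delta> - ?e5 a \<Delta> * n1f a \<Delta> - 2 * (ga a \<Delta> * ?e4 a \<Delta>)
     + ga1 a \<Delta> * ((1 / ga a \<Delta>) * ?e3 a \<Delta>) + (1 / 2) * (ga2 a \<Delta> * (Df a \<Delta> * Df a \<Delta>)))"
    by (intro bO_add bO_diff 1 3 bO_scale bO_const bO_base bO_inv_g bO_n1' bO_D3 DD)
  then show ?thesis
  proof (rule bO_cong)
    fix a \<Delta> :: real assume d: "0 < \<Delta>" "\<Delta> \<le> 1"
    define D where "D = Df a \<Delta>"
    have p: "phf a \<Delta> = (\<Delta> + D) / 2" "thf a \<Delta> = (\<Delta> - D) / 2" using small_chord(3)[OF d, of a] by (simp_all add: Df_def D_def)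
    have x0: "x \<noteq> 0 \<Longrightarrow> b1 * ((\<Delta> + D) / 2) - c1 * ((\<Delta> - D) / 2) - (c + b) * n =
       ((\<Delta> + D) / 2) * (b1 - x1 - x2 * ((\<Delta> + D) / 2)) - ((\<Delta> - D) / 2) * (c1 - x1 + x2 * ((\<Delta> - D) / 2))
       - ((b - x - x1 * ((\<Delta> + D) / 2)) + (c - x + x1 * ((\<Delta> - D) / 2)) + x1 * D) * n
       - 2 * (x * (n - \<Delta>\<^sup>2 * ((x2 * x - x1 ^ 2) / (4 * x ^ 2)))) + x1 * ((1 / x) * (x * D + x1 * \<Delta>\<^sup>2 / 2)) + (1 / 2) * (x2 * (D * D))" for b b1 c c1 x x1 x2 n
      by (simp add: field_simps power2_eq_square)
    show "g1 (a + \<Delta>) * phf a \<Delta> - g1 a * thf a \<Delta> - (g a + g (a + \<Delta>)) * n1f a \<Delta> = phf a \<Delta> * ?e1 a \<Delta> - thf a \<Delta> * ?e2 a \<Delta> - ?e5 a \<Delta> * n1f a \<Delta> - 2 * (ga a \<Delta> * ?e4 a \<Delta>)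
     + ga1 a \<Delta> * ((1 / ga a \<Delta>) * ?e3 a \<Delta>) + (1 / 2) * (ga2 a \<Delta> * (Df a \<Delta> * Df a \<Delta>))"
      unfolding p D_def[symmetric] by (rule x0) (use g_pos[of "alf a \<Delta>"] in simp)
  qed
qed

text \<open>This is the derivative of \<open>Y' - Y\<close> when only the far end moves. To first
  order, \<open>ga1 * \<Delta> / 2\<close> comes from the angle and as much from the difference of
  the weights; their sum cancels against the correction found in \<open>bO_m\<close>.\<close>

lemma bO_stretch: "bO 2 (\<lambda>a \<Delta>. g1 (a + \<Delta>) * phf a \<Delta> + g (a + \<Delta>) - (g a + g (a + \<Delta>)) * mf a \<Delta>)"
proof -
  let ?e1 = "\<lambda>a \<Delta>. g1 (a + \<Delta>) - ga1 a \<Delta> - ga2 a \<Delta> * phf a \<Delta>"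
  let ?e2 = "\<lambda>a \<Delta>. g (a + \<Delta>) - ga a \<Delta> - ga1 a \<Delta> * phf a \<Delta>"
  let ?e3 = "\<lambda>a \<Delta>. g a - ga a \<Delta> + ga1 a \<Delta> * thf a \<Delta>"
  let ?e4 = "\<lambda>a \<Delta>. mf a \<Delta> - 1 / 2 - ga1 a \<Delta> * \<Delta> / (2 * ga a \<Delta>)"
  have 1: "bO 2 (\<lambda>a \<Delta>. phf a \<Delta> * ?e1 a \<Delta>)" by (rule bO_multk[OF bO_ph bO_taylor_b(3)]) simp
  have 2: "bO 2 (\<lambda>a \<Delta>. phf a \<Delta> * phf a \<Delta>)" "bO 2 (\<lambda>a \<Delta>. \<Delta> * Df a \<Delta>)"
    by (rule bO_multk[OF bO_ph bO_ph] bO_multk[OF bO_id bO_D2]; simp)+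
  have 3: "bO 2 (\<lambda>a \<Delta>. \<Delta> * (?e2 a \<Delta> + ?e3 a \<Delta>))"
    by (rule bO_multk[OF bO_id bO_add[OF bO_taylor_b(1,2)]]) simp
  have "bO 2 (\<lambda>a \<Delta>. phf a \<Delta> * ?e1 a \<Delta> + ga2 a \<Delta> * (phf a \<Delta> * phf a \<Delta>) + (1 / 2) * (ga1 a \<Delta> * Df a \<Delta>)
     + (1 / 2) * (?e2 a \<Delta> - ?e3 a \<Delta>) - (g a + g (a + \<Delta>)) * ?e4 a \<Delta>
     - (1 / 2) * (ga1 a \<Delta> * ((1 / ga a \<Delta>) * (\<Delta> * (?e2 a \<Delta> + ?e3 a \<Delta>) + ga1 a \<Delta> * (\<Delta> * Df a \<Delta>)))))"
    by (intro bO_add bO_diff 1 2 3 bO_scale bO_const bO_base bO_inv_g bO_D2 bO_taylor_b bO_m)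
  then show ?thesis
  proof (rule bO_cong)
    fix a \<Delta> :: real assume d: "0 < \<Delta>" "\<Delta> \<le> 1"
    define D where "D = Df a \<Delta>"
    have p: "phf a \<Delta> = (\<Delta> + D) / 2" "thf a \<Delta> = (\<Delta> - D) / 2" using small_chord(3)[OF d, of a] by (simp_all add: Df_def D_def)
    have x0: "x \<noteq> 0 \<Longrightarrow> b1 * ((\<Delta> + D) / 2) + b - (c + b) * m =
       ((\<Delta> + D) / 2) * (b1 - x1 - x2 * ((\<Delta> + D) / 2)) + x2 * (((\<Delta> + D) / 2) * ((\<Delta> + D) / 2)) + (1 / 2) * (x1 * D)
       + (1 / 2) * ((b - x - x1 * ((\<Delta> + D) / 2)) - (c - x + x1 * ((\<Delta> - D) / 2))) - (c + b) * (m - 1 / 2 - x1 * \<Delta> / (2 * x))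
       - (1 / 2) * (x1 * ((1 / x) * (\<Delta> * ((b - x - x1 * ((\<Delta> + D) / 2)) + (c - x + x1 * ((\<Delta> - D) / 2))) + x1 * (\<Delta> * D))))" for b b1 c x x1 x2 m
      by (simp add: field_simps power2_eq_square)
    show "g1 (a + \<Delta>) * phf a \<Delta> + g (a + \<Delta>) - (g a + g (a + \<Delta>)) * mf a \<Delta> = phf a \<Delta> * ?e1 a \<Delta> + ga2 a \<Delta> * (phf a \<Delta> * phf a \<Delta>) + (1 / 2) * (ga1 a \<Delta> * Df a \<Delta>)
     + (1 / 2) * (?e2 a \<Delta> - ?e3 a \<Delta>) - (g a + g (a + \<Delta>)) * ?e4 a \<Delta>
     - (1 / 2) * (ga1 a \<Delta> * ((1 / ga a \<Delta>) * (\<Delta> * (?e2 a \<Delta> + ?e3 a \<Delta>) + ga1 a \<Delta> * (\<Delta> * Df a \<Delta>))))"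
      unfolding p D_def[symmetric] by (rule x0) (use g_pos[of "alf a \<Delta>"] in simp)
  qed
qed

text \<open>To second order \<open>Y' - Y\<close> is
  \<open>ga * Df + ga1 * \<Delta>\<^sup>2 / 2\<close>, the combination that \<open>bO_D3\<close>
  shows to be of order 3.\<close>

lemma bO_E: "bO 3 (\<lambda>a \<Delta>. g (a + \<Delta>) * phf a \<Delta> - g a * thf a \<Delta>)"
proof -
  let ?e2 = "\<lambda>a \<Delta>. g (a + \<Delta>) - ga a \<Delta> - ga1 a \<Delta> * phf a \<Delta>"
  let ?e3 = "\<lambda>a \<Delta>. g a - ga a \<Delta> + ga1 a \<Delta> * thf a \<Delta>"
  have 1: "bO 3 (\<lambda>a \<Delta>. phf a \<Delta> * ?e2 a \<Delta>)" "bO 3 (\<lambda>a \<Delta>. thf a \<Delta> * ?e3 a \<Delta>)"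
    by (rule bO_multk[OF bO_ph bO_taylor_b(1)] bO_multk[OF bO_th bO_taylor_b(2)]; simp)+
  have DD: "bO 3 (\<lambda>a \<Delta>. Df a \<Delta> * Df a \<Delta>)" by (rule bO_multk[OF bO_D2 bO_D2]) simp
  have "bO 3 (\<lambda>a \<Delta>. phf a \<Delta> * ?e2 a \<Delta> - thf a \<Delta> * ?e3 a \<Delta> + (ga a \<Delta> * Df a \<Delta> + ga1 a \<Delta> * \<Delta>\<^sup>2 / 2) + (1 / 2) * (ga1 a \<Delta> * (Df a \<Delta> * Df a \<Delta>)))"
    by (intro bO_add bO_diff 1 bO_D3 bO_scale bO_const bO_base DD)
  then show ?thesis
  proof (rule bO_cong)
    fix a \<Delta> :: real assume d: "0 < \<Delta>" "\<Delta> \<le> 1"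
    define D where "D = Df a \<Delta>"
    have p: "phf a \<Delta> = (\<Delta> + D) / 2" "thf a \<Delta> = (\<Delta> - D) / 2" using small_chord(3)[OF d, of a] by (simp_all add: Df_def D_def)
    show "g (a + \<Delta>) * phf a \<Delta> - g a * thf a \<Delta> = phf a \<Delta> * ?e2 a \<Delta> - thf a \<Delta> * ?e3 a \<Delta> + (ga a \<Delta> * Df a \<Delta> + ga1 a \<Delta> * \<Delta>\<^sup>2 / 2) + (1 / 2) * (ga1 a \<Delta> * (Df a \<Delta> * Df a \<Delta>))"
      unfolding p D_def[symmetric] by (simp add: field_simps power2_eq_square)
  qed
qed

end

section \<open>The boundary curve satisfies the twist conditions\<close>

context gauss_curve
begin

text \<open>Moving the far end alone turns the chord counterclockwise, at the positive rate given by
  \<open>th_ph_deriv\<close>. Consequently a small angle forces a short link, which is what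
  \<open>short_if_Y\<close> asks for.\<close>

lemma th_strict_mono:
  assumes "a < b1" "b1 < b2" "b2 < a + 2 * pi" shows "th a b1 < th a b2"
proof -
  have "(\<lambda>r. th (a + r * 0) (0 + r * 1)) b1 < (\<lambda>r. th (a + r * 0) (0 + r * 1)) b2"
  proof (rule DERIV_pos_imp_increasing[OF assms(2)])
    fix r assume "b1 \<le> r" "r \<le> b2"
    then have r: "0 < (0 + r * 1) - (a + r * 0)" "(0 + r * 1) - (a + r * 0) < 2 * pi" using assms by auto
    note c = chord[OF r]
    have pos: "0 < g (0 + r * 1) ^ 3 * sin (ph (a + r * 0) (0 + r * 1)) / H (a + r * 0) (0 + r * 1)"
      using c g_pos by (intro divide_pos_pos mult_pos_pos sin_gt_zero) auto
    show "\<exists>y. ((\<lambda>r. th (a + r * 0) (0 + r * 1)) has_real_derivative y) (at r) \<and> 0 < y"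
      by (rule exI, rule conjI, rule th_ph_deriv(1)[OF r]) (use pos in simp)
  qed
  then show ?thesis by simp
qed

lemma ph_strict_antimono:
  assumes "a1 < a2" "a2 < b" "b < a1 + 2 * pi" shows "ph a2 b < ph a1 b"
proof -
  have "(\<lambda>r. ph (0 + r * 1) (b + r * 0)) a1 > (\<lambda>r. ph (0 + r * 1) (b + r * 0)) a2"
  proof (rule DERIV_neg_imp_decreasing[OF assms(1)])
    fix r assume "a1 \<le> r" "r \<le> a2"
    then have r: "0 < (b + r * 0) - (0 + r * 1)" "(b + r * 0) - (0 + r * 1) < 2 * pi" using assms by auto
    note c = chord[OF r]
    have pos: "0 < g (0 + r * 1) ^ 3 * sin (th (0 + r * 1) (b + r * 0)) / H (0 + r * 1) (b + r * 0)"
      using c g_pos by (intro divide_pos_pos mult_pos_pos sin_gt_zero) auto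
    show "\<exists>y. ((\<lambda>r. ph (0 + r * 1) (b + r * 0)) has_real_derivative y) (at r) \<and> y < 0"
      by (rule exI, rule conjI, rule th_ph_deriv(2)[OF r]) (use pos in simp)
  qed
  then show ?thesis by simp
qed

definition Y :: "real \<Rightarrow> real \<Rightarrow> real" where "Y a b = g a * th a b"
definition Y' :: "real \<Rightarrow> real \<Rightarrow> real" where "Y' a b = g b * ph a b"

text \<open>Links are described by start and parameter length, moving with speeds \<open>p\<close>
  and \<open>e\<close>; this separates the translation term from the stretch term, whose orders
  differ by one.\<close>

lemma Y_deriv:
  fixes p e a \<Delta> r :: real
  defines "A \<equiv> \<lambda>r. a + r * p" and "D \<equiv> \<lambda>r. \<Delta> + r * e"
  assumes D: "0 < D r" "D r \<le> 1"
  shows "((\<lambda>r. Y (A r) (A r + D r)) has_real_derivative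
     p * (g1 (A r) * thf (A r) (D r) + g (A r) * n1f (A r) (D r)) + e * (g (A r) * mf (A r) (D r))) (at r)"
   and "((\<lambda>r. Y' (A r) (A r + D r) - Y (A r) (A r + D r)) has_real_derivative
     p * (g1 (A r + D r) * phf (A r) (D r) - g1 (A r) * thf (A r) (D r) - (g (A r) + g (A r + D r)) * n1f (A r) (D r))
     + e * (g1 (A r + D r) * phf (A r) (D r) + g (A r + D r) - (g (A r) + g (A r + D r)) * mf (A r) (D r))) (at r)"
proof -
  define B where "B r = (a + \<Delta>) + r * (p + e)" for r
  have AB: "A r + D r = B r" for r by (simp add: A_def B_def D_def algebra_simps)
  have AB': "a + r * p = A r" "(a + \<Delta>) + r * (p + e) = B r" for r by (simp_all add: A_def B_def)
  have DB: "B r - A r = D r" for r by (simp add: AB[symmetric])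
  have lt: "0 < B r - A r" "B r - A r < 2 * pi" using D pi_gt3 by (auto simp: DB)
  let ?N = "(g (B r) ^ 3 * sin (ph (A r) (B r)) * (p + e) + g (A r) ^ 3 * sin (th (A r) (B r)) * p) / H (A r) (B r)"
  have d: "((\<lambda>r. th (A r) (B r)) has_real_derivative ?N - p) (at r)"
    "((\<lambda>r. ph (A r) (B r)) has_real_derivative (p + e) - ?N) (at r)"
    using th_ph_deriv[of "a + \<Delta>" r "p + e" a p] lt unfolding AB' by auto
  have H: "H (A r) (B r) > 0" by (rule H_pos[OF lt])
  have N: "?N = p * (1 + n1f (A r) (D r)) + e * mf (A r) (D r)"
    using H unfolding n1f_def mf_def Hf_def phf_def thf_def AB by (simp add: field_simps)
  have dA: "(A has_real_derivative p) (at r)" "(B has_real_derivative p + e) (at r)"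
    unfolding A_def B_def by (auto intro!: derivative_eq_intros)
  have dg: "((\<lambda>r. g (A r)) has_real_derivative g1 (A r) * p) (at r)" "((\<lambda>r. g (B r)) has_real_derivative g1 (B r) * (p + e)) (at r)"
    by (rule DERIV_chain2[OF g_deriv dA(1)], rule DERIV_chain2[OF g_deriv dA(2)])
  have Y1: "((\<lambda>r. Y (A r) (A r + D r)) has_real_derivative g1 (A r) * p * th (A r) (B r) + (?N - p) * g (A r)) (at r)"
    unfolding Y_def AB by (rule DERIV_mult[OF dg(1) d(1)])
  have Y2: "((\<lambda>r. Y' (A r) (A r + D r)) has_real_derivative g1 (B r) * (p + e) * ph (A r) (B r) + ((p + e) - ?N) * g (B r)) (at r)"
    unfolding Y'_def AB by (rule DERIV_mult[OF dg(2) d(2)])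
  show "((\<lambda>r. Y (A r) (A r + D r)) has_real_derivative
     p * (g1 (A r) * thf (A r) (D r) + g (A r) * n1f (A r) (D r)) + e * (g (A r) * mf (A r) (D r))) (at r)"
    using Y1 unfolding N unfolding thf_def AB by (simp add: algebra_simps)
  show "((\<lambda>r. Y' (A r) (A r + D r) - Y (A r) (A r + D r)) has_real_derivative
     p * (g1 (A r + D r) * phf (A r) (D r) - g1 (A r) * thf (A r) (D r) - (g (A r) + g (A r + D r)) * n1f (A r) (D r))
     + e * (g1 (A r + D r) * phf (A r) (D r) + g (A r + D r) - (g (A r) + g (A r + D r)) * mf (A r) (D r))) (at r)"
    using DERIV_diff[OF Y2 Y1] unfolding N unfolding thf_def phf_def AB by (simp add: algebra_simps)
qed

lemma twist_links_exists:
  "\<exists>d c C y0. d \<le> 1 \<and> twist_links Y Y' d c C y0"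
proof -
  obtain Ct where Ct: "0 < Ct" "\<And>a \<Delta>. 0 < \<Delta> \<Longrightarrow> \<Delta> \<le> 1 \<Longrightarrow> \<bar>g1 (a + \<Delta>) * phf a \<Delta> - g1 a * thf a \<Delta> - (g a + g (a + \<Delta>)) * n1f a \<Delta>\<bar> \<le> Ct * \<Delta> ^ 3"
    by (rule bOE[OF bO_translate], rule that)
  obtain Cs where Cs: "0 < Cs" "\<And>a \<Delta>. 0 < \<Delta> \<Longrightarrow> \<Delta> \<le> 1 \<Longrightarrow> \<bar>g1 (a + \<Delta>) * phf a \<Delta> + g (a + \<Delta>) - (g a + g (a + \<Delta>)) * mf a \<Delta>\<bar> \<le> Cs * \<Delta> ^ 2"
    by (rule bOE[OF bO_stretch], rule that)
  obtain CE where CE: "0 < CE" "\<And>a \<Delta>. 0 < \<Delta> \<Longrightarrow> \<Delta> \<le> 1 \<Longrightarrow> \<bar>g (a + \<Delta>) * phf a \<Delta> - g a * thf a \<Delta>\<bar> \<le> CE * \<Delta> ^ 3"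
    by (rule bOE[OF bO_E], rule that)
  obtain CD where CD: "0 < CD" "\<And>a \<Delta>. 0 < \<Delta> \<Longrightarrow> \<Delta> \<le> 1 \<Longrightarrow> \<bar>Df a \<Delta>\<bar> \<le> CD * \<Delta> ^ 2"
    by (rule bOE[OF bO_D2], rule that)
  have "bO 1 (\<lambda>a \<Delta>. (mf a \<Delta> - 1 / 2 - ga1 a \<Delta> * \<Delta> / (2 * ga a \<Delta>)) + (1 / 2) * (ga1 a \<Delta> * ((1 / ga a \<Delta>) * \<Delta>)))"
    by (intro bO_add bO_mono[OF bO_m] bO_scale bO_id bO_const bO_base bO_inv_g) simp
  then have bm: "bO 1 (\<lambda>a \<Delta>. mf a \<Delta> - 1 / 2)" by simp
  obtain Cm where Cm: "0 < Cm" "\<And>a \<Delta>. 0 < \<Delta> \<Longrightarrow> \<Delta> \<le> 1 \<Longrightarrow> \<bar>mf a \<Delta> - 1 / 2\<bar> \<le> Cm * \<Delta> ^ 1"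
    by (rule bOE[OF bm], rule that)
  have b1: "bO 1 (\<lambda>a \<Delta>. g1 a * thf a \<Delta> + g a * n1f a \<Delta>)"
    by (intro bO_add bO_scale bO_th bO_base bO_mono[OF bO_n1]) simp
  obtain C1 where C1: "0 < C1" "\<And>a \<Delta>. 0 < \<Delta> \<Longrightarrow> \<Delta> \<le> 1 \<Longrightarrow> \<bar>g1 a * thf a \<Delta> + g a * n1f a \<Delta>\<bar> \<le> C1 * \<Delta> ^ 1"
    by (rule bOE[OF b1], rule that)
  \<comment> \<open>The bound \<open>1 / (4 * Cm)\<close> gives \<open>mf \<ge> 1 / 4\<close>, hence
    a positive lower bound for the coefficient \<open>l\<close> in \<open>Y_increment\<close>; the
    bound \<open>1 / (2 * CD)\<close> makes both angles at least a quarter of the parameter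
    length.\<close>
  define d where "d = min 1 (min (1 / (4 * Cm)) (1 / (2 * CD)))"
  have d: "0 < d" "d \<le> 1" "Cm * d \<le> 1 / 4" "CD * d \<le> 1 / 2"
    using Cm(1) CD(1) by (auto simp: d_def min_def field_simps)
  define C where "C = G + Ct + Cs + CE + C1"
  have C: "G \<le> C" "Ct \<le> C" "Cs \<le> C" "CE \<le> C" "C1 \<le> C" "0 < C"
    using Ct(1) Cs(1) CE(1) C1(1) G_pos by (auto simp: C_def)
  have ang: "\<Delta> / 4 \<le> thf a \<Delta>" "\<Delta> / 4 \<le> phf a \<Delta>" if D: "0 < \<Delta>" "\<Delta> \<le> d" for a \<Delta>
  proof -
    have D1: "\<Delta> \<le> 1" using D d by linarith
    have "CD * \<Delta> ^ 2 \<le> (CD * d) * \<Delta>" using D CD(1) by (simp add: power2_eq_square mult_left_mono)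
    also have "\<dots> \<le> \<Delta> / 2" using mult_right_mono[OF d(4), of \<Delta>] D by simp
    finally have "\<bar>Df a \<Delta>\<bar> \<le> \<Delta> / 2" using CD(2)[OF D(1) D1, of a] by linarith
    then show "\<Delta> / 4 \<le> thf a \<Delta>" "\<Delta> / 4 \<le> phf a \<Delta>"
      using small_chord(3)[OF D(1) D1, of a] unfolding Df_def by linarith+
  qed
  have ang': "(b - a) / 4 \<le> th a b" "(b - a) / 4 \<le> ph a b" if "0 < b - a" "b - a \<le> d" for a b
    using ang[OF that, of a] by (simp_all add: thf_def phf_def)
  have le: "th a b \<le> b - a" "ph a b \<le> b - a" if "0 < b - a" "b - a \<le> d" for a b
  proof -
    have "b - a < 2 * pi" using that d pi_gt3 by linarith
    then show "th a b \<le> b - a" "ph a b \<le> b - a" using chord(3,5,8)[OF that(1)] by force+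
  qed
  \<comment> \<open>The threshold \<open>g0 * d / 8\<close> is half of \<open>g0 * d / 4\<close>,
    which \<open>Y\<close> and \<open>Y'\<close> exceed on links longer than \<open>d\<close>, by
    comparison with a link of length \<open>d\<close> sharing one end.\<close>
  have "twist_links Y Y' d (g0 / 4) C (g0 * d / 8)"
  proof (unfold_locales)
    show "0 < d" "0 < g0 / 4" "0 < C" "0 < g0 * d / 8" using d C g0_pos by auto
    fix a b :: real assume ab: "0 < b - a" "b - a \<le> d"
    have ab1: "b - a \<le> 1" using ab d by linarith
    have "g0 * ((b - a) / 4) \<le> g a * th a b" "g0 * ((b - a) / 4) \<le> g b * ph a b"
      by (rule mult_mono; use ab ang'[OF ab] g_ge g0_pos g_pos in \<open>simp add: less_imp_le\<close>)+
    then show "g0 / 4 * (b - a) \<le> Y a b" "g0 / 4 * (b - a) \<le> Y' a b" by (simp_all add: Y_def Y'_def)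
    have "g a * th a b \<le> C * (b - a)" using ab le[OF ab] ang'[OF ab] g_le[of a] C(1,6)
      by (intro mult_mono) auto
    then show "Y a b \<le> C * (b - a)" by (simp add: Y_def)
    have "\<bar>Y' a b - Y a b\<bar> \<le> CE * (b - a) ^ 3"
      using CE(2)[OF ab(1) ab1, of a] by (simp add: Y_def Y'_def thf_def phf_def)
    also have "\<dots> \<le> C * (b - a) ^ 3" using C ab by (intro mult_right_mono) auto
    finally show "\<bar>Y' a b - Y a b\<bar> \<le> C * (b - a) ^ 3" .
  next
    fix a b :: real assume ab: "0 < b - a" "b - a < 2 * pi"
    { assume Y: "Y a b \<le> g0 * d / 8"
      show "b - a \<le> d"
      proof (rule ccontr)
        assume "\<not> b - a \<le> d"
        then have "th a (a + d) < th a b" using d ab by (intro th_strict_mono) auto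
        moreover have "d / 4 \<le> th a (a + d)" using ang'[of "a + d" a] d by simp
        ultimately have "g0 * (d / 4) \<le> g a * th a b" using g_ge[of a] g0_pos d g_pos[of a] by (intro mult_mono) auto
        then show False using Y d g0_pos mult_pos_pos[OF g0_pos d(1)] unfolding Y_def by simp
      qed }
    { assume Y: "Y' a b \<le> g0 * d / 8"
      show "b - a \<le> d"
      proof (rule ccontr)
        assume "\<not> b - a \<le> d"
        then have "ph (b - d) b < ph a b" using d ab by (intro ph_strict_antimono) auto
        moreover have "d / 4 \<le> ph (b - d) b" using ang'[of b "b - d"] d by simp
        ultimately have "g0 * (d / 4) \<le> g b * ph a b" using g_ge[of b] g0_pos d g_pos[of b] by (intro mult_mono) auto
        then show False using Y d g0_pos mult_pos_pos[OF g0_pos d(1)] unfolding Y'_def by simp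
      qed }
  next
    fix \<eta> a b u v :: real
    assume eta: "\<eta> \<le> d" and ab: "0 < b - a" "b - a \<le> \<eta>" and uv: "0 < v - u" "v - u \<le> \<eta>"
    define p where "p = u - a"
    define e where "e = (v - u) - (b - a)"
    define \<Delta> where "\<Delta> = b - a"
    \<comment> \<open>Between two links the parameter length interpolates linearly, so it stays in
      the range where the estimates hold and the mean value theorem can be used along the whole
      segment.\<close>
    have seg: "0 < \<Delta> + r * e" "\<Delta> + r * e \<le> \<eta>" if r: "0 \<le> r" "r \<le> 1" for r
    proof -
      have eq: "\<Delta> + r * e = (1 - r) * \<Delta> + r * (v - u)" by (simp add: e_def \<Delta>_def algebra_simps)
      show "0 < \<Delta> + r * e"
      proof (cases "r = 0")
        case False
        then have "0 < r * (v - u)" "0 \<le> (1 - r) * \<Delta>" using r ab uv by (auto simp: \<Delta>_def)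
        then show ?thesis unfolding eq by linarith
      qed (use ab in \<open>simp add: \<Delta>_def\<close>)
      have "(1 - r) * \<Delta> + r * (v - u) \<le> (1 - r) * \<eta> + r * \<eta>"
        using r ab uv by (intro add_mono mult_left_mono) (auto simp: \<Delta>_def)
      then show "\<Delta> + r * e \<le> \<eta>" unfolding eq by (simp add: algebra_simps)
    qed
    have seg1: "\<Delta> + r * e \<le> 1" if "0 \<le> r" "r \<le> 1" for r using seg[OF that] eta d by linarith
    have ends': "u + (\<Delta> + e) = v" "a + \<Delta> = b" "a + p = u" by (auto simp: p_def e_def \<Delta>_def)
    note dv = Y_deriv[where a=a and p=p and \<Delta>=\<Delta> and e=e]
    let ?A = "\<lambda>r. a + r * p" and ?D = "\<lambda>r. \<Delta> + r * e"
    obtain z where z: "0 < z" "z < 1" and zeq: "(Y' u v - Y u v) - (Y' a b - Y a b) =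
       p * (g1 (?A z + ?D z) * phf (?A z) (?D z) - g1 (?A z) * thf (?A z) (?D z) - (g (?A z) + g (?A z + ?D z)) * n1f (?A z) (?D z))
     + e * (g1 (?A z + ?D z) * phf (?A z) (?D z) + g (?A z + ?D z) - (g (?A z) + g (?A z + ?D z)) * mf (?A z) (?D z))"
      using MVT2[of 0 1 "\<lambda>r. Y' (?A r) (?A r + ?D r) - Y (?A r) (?A r + ?D r)", OF _ dv(2)[OF seg(1) seg1]]
      by (auto simp: ends')
    have z': "0 < ?D z" "?D z \<le> \<eta>" "?D z \<le> 1" using seg[of z] seg1[of z] z by auto
    have T: "\<bar>g1 (?A z + ?D z) * phf (?A z) (?D z) - g1 (?A z) * thf (?A z) (?D z) - (g (?A z) + g (?A z + ?D z)) * n1f (?A z) (?D z)\<bar> \<le> C * \<eta> ^ 3" (is "\<bar>?T\<bar> \<le> _")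
    proof (rule order_trans[OF Ct(2)[OF z'(1,3)]])
      show "Ct * ?D z ^ 3 \<le> C * \<eta> ^ 3" using z' C(2,6) by (intro mult_mono power_mono) auto
    qed
    have S: "\<bar>g1 (?A z + ?D z) * phf (?A z) (?D z) + g (?A z + ?D z) - (g (?A z) + g (?A z + ?D z)) * mf (?A z) (?D z)\<bar> \<le> C * \<eta> ^ 2" (is "\<bar>?S\<bar> \<le> _")
    proof (rule order_trans[OF Cs(2)[OF z'(1,3)]])
      show "Cs * ?D z ^ 2 \<le> C * \<eta> ^ 2" using z' C(3,6) by (intro mult_mono power_mono) auto
    qed
    have "\<bar>p * ?T + e * ?S\<bar> \<le> \<bar>p\<bar> * (C * \<eta> ^ 3) + \<bar>e\<bar> * (C * \<eta> ^ 2)"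
      by (rule order_trans[OF abs_triangle_ineq]) (use T S in \<open>auto simp only: abs_mult intro!: add_mono mult_left_mono abs_ge_zero\<close>)
    then show "\<bar>(Y' u v - Y u v) - (Y' a b - Y a b)\<bar> \<le> C * \<eta>\<^sup>2 * \<bar>(v - u) - (b - a)\<bar> + C * \<eta> ^ 3 * \<bar>u - a\<bar>"
      unfolding zeq by (simp add: p_def[symmetric] e_def[symmetric] mult_ac add.commute)
    obtain z where z: "0 < z" "z < 1" and zeq: "Y u v - Y a b =
       p * (g1 (?A z) * thf (?A z) (?D z) + g (?A z) * n1f (?A z) (?D z)) + e * (g (?A z) * mf (?A z) (?D z))"
      using MVT2[of 0 1 "\<lambda>r. Y (?A r) (?A r + ?D r)", OF _ dv(1)[OF seg(1) seg1]]
      by (auto simp: ends')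
    have z': "0 < ?D z" "?D z \<le> \<eta>" "?D z \<le> 1" using seg[of z] seg1[of z] z by auto
    have M: "\<bar>g1 (?A z) * thf (?A z) (?D z) + g (?A z) * n1f (?A z) (?D z)\<bar> \<le> C * \<eta>"
    proof (rule order_trans[OF C1(2)[OF z'(1,3)]])
      show "C1 * ?D z ^ 1 \<le> C * \<eta>" using z' C(5,6) by (auto intro!: mult_mono)
    qed
    have "Cm * ?D z \<le> 1 / 4" using d(3) z' eta Cm(1) mult_left_mono[of "?D z" d Cm] by linarith
    then have m: "1 / 4 \<le> mf (?A z) (?D z)" "mf (?A z) (?D z) \<le> 1" using Cm(2)[OF z'(1,3), of "?A z"] by (simp_all add: abs_le_iff)
    have L1: "g0 / 4 \<le> g (?A z) * mf (?A z) (?D z)"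
      using mult_mono[OF g_ge[of "?A z"] m(1)] g0_pos m g_pos[of "?A z"] by simp
    have L2: "g (?A z) * mf (?A z) (?D z) \<le> C"
      using mult_mono[OF g_le[of "?A z"] m(2)] G_pos m C(1) by simp
    show "\<exists>l m. g0 / 4 \<le> l \<and> l \<le> C \<and> \<bar>m\<bar> \<le> C * \<eta> \<and> Y u v - Y a b = l * ((v - u) - (b - a)) + m * (u - a)"
      by (intro exI[of _ "g (?A z) * mf (?A z) (?D z)"] exI[of _ "g1 (?A z) * thf (?A z) (?D z) + g (?A z) * n1f (?A z) (?D z)"] conjI L1 L2 M)
        (simp add: zeq p_def e_def mult.commute)
  qed
  then show ?thesis using d(2) by blast
qed

end

section \<open>Billiard orbits and the lift of the billiard map\<close>

lemma angle_between_minus: "angle_between (- u) (- v) = angle_between u v"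
  by (simp add: angle_between_def)

lemma angle_between_scale: "0 < r \<Longrightarrow> angle_between (of_real r * u) v = angle_between u v"
  by (simp add: angle_between_def norm_mult scaleR_conv_of_real[symmetric])

section \<open>The billiard map in tangent angle coordinates\<close>

context gauss_curve
begin

lemma \<Gamma>_eq_iff: "\<Gamma> a = \<Gamma> b \<longleftrightarrow> (\<exists>k::int. b = a + 2 * pi * of_int k)"
proof
  assume eq: "\<Gamma> a = \<Gamma> b"
  define k where "k = \<lfloor>(b - a) / (2 * pi)\<rfloor>"
  define u where "u = (b - a) - 2 * pi * of_int k"
  have "of_int k \<le> (b - a) / (2 * pi)" "(b - a) / (2 * pi) < of_int k + 1" unfolding k_def by linarith+
  then have u: "0 \<le> u" "u < 2 * pi" by (simp_all add: u_def field_simps)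
  have "\<Gamma> (a + u) = \<Gamma> b" using \<Gamma>_period_int[of "a + u" k] by (simp add: u_def)
  then have "F a u = 0" using eq by (simp add: F_def)
  then have "u = 0" using F_pos[of u a] u by force
  then have "b = a + 2 * pi * of_int k" by (simp add: u_def)
  then show "\<exists>k::int. b = a + 2 * pi * of_int k" by blast
qed (use \<Gamma>_period_int in auto)

lemma representative_after:
  assumes "\<Gamma> b \<noteq> \<Gamma> a"
  obtains c where "\<Gamma> c = \<Gamma> b" "0 < c - a" "c - a < 2 * pi"
proof -
  define k where "k = \<lfloor>(b - a) / (2 * pi)\<rfloor>"
  define c where "c = b - 2 * pi * of_int k"
  have "of_int k \<le> (b - a) / (2 * pi)" "(b - a) / (2 * pi) < of_int k + 1" unfolding k_def by linarith+
  then have c: "a \<le> c" "c < a + 2 * pi" by (simp_all add: c_def field_simps)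
  have G: "\<Gamma> c = \<Gamma> b" using \<Gamma>_period_int[of c k] by (simp add: c_def)
  then have "c \<noteq> a" using assms by auto
  then show ?thesis using that[OF G] c by simp
qed

text \<open>The angle at the start is less than the parameter length, and the angle at the far end
  is less than \<open>pi\<close>. So \<open>th\<close> is too small at the length
  \<open>\<theta> / 2\<close> and too large at the length
  \<open>2 * pi - (pi - \<theta>) / 2\<close>; these bounds avoid limits at degenerate
  chords.\<close>

lemma th_exists:
  assumes "0 < \<theta>" "\<theta> < pi"
  shows "\<exists>u. 0 < u \<and> u < 2 * pi \<and> th a (a + u) = \<theta>"
proof -
  let ?u = "\<theta> / 2" and ?v = "2 * pi - (pi - \<theta>) / 2"
  have r: "0 < u \<and> u < 2 * pi" if "?u \<le> u" "u \<le> ?v" for u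
  proof -
    have "0 < (pi - \<theta>) / 2" using assms by simp
    then show ?thesis using that assms by linarith
  qed
  have uv: "?u \<le> ?v" using assms by (simp add: field_simps)
  have "\<exists>u\<ge>?u. u \<le> ?v \<and> th a (a + u) = \<theta>"
  proof (rule IVT)
    show "th a (a + ?u) \<le> \<theta>" "\<theta> \<le> th a (a + ?v)"
      using chord(5,6,8)[of "a + ?u" a] chord(5,6,8)[of "a + ?v" a] r[of ?u] r[of ?v] uv assms by (auto simp: field_simps)
    show "\<forall>x. ?u \<le> x \<and> x \<le> ?v \<longrightarrow> isCont (\<lambda>u. th a (a + u)) x"
    proof (intro allI impI)
      fix x assume x: "?u \<le> x \<and> x \<le> ?v"
      then have "0 < (a + x * 1) - (a + x * 0)" "(a + x * 1) - (a + x * 0) < 2 * pi" using r[of x] by auto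
      from DERIV_isCont[OF th_ph_deriv(1)[OF this]] show "isCont (\<lambda>u. th a (a + u)) x" by simp
    qed
  qed (rule uv)
  then show ?thesis using r by blast
qed

text \<open>Serves to prolong an orbit backwards by one link.\<close>

lemma ph_exists:
  assumes "0 < \<phi>" "\<phi> < pi"
  shows "\<exists>a. 0 < b - a \<and> b - a < 2 * pi \<and> ph a b = \<phi>"
proof -
  let ?u = "\<phi> / 2" and ?v = "2 * pi - (pi - \<phi>) / 2"
  have r: "0 < u \<and> u < 2 * pi" if "?u \<le> u" "u \<le> ?v" for u
  proof -
    have "0 < (pi - \<phi>) / 2" using assms by simp
    then show ?thesis using that assms by linarith
  qed
  have uv: "?u \<le> ?v" using assms by (simp add: field_simps)
  have "\<exists>u\<ge>?u. u \<le> ?v \<and> ph (b - u) b = \<phi>"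
  proof (rule IVT)
    show "ph (b - ?u) b \<le> \<phi>" "\<phi> \<le> ph (b - ?v) b"
      using chord(3,4,8)[of b "b - ?u"] chord(3,4,8)[of b "b - ?v"] r[of ?u] r[of ?v] uv assms by (auto simp: field_simps)
    show "\<forall>x. ?u \<le> x \<and> x \<le> ?v \<longrightarrow> isCont (\<lambda>u. ph (b - u) b) x"
    proof (intro allI impI)
      fix x assume x: "?u \<le> x \<and> x \<le> ?v"
      then have "0 < (b + x * 0) - (b + x * (- 1))" "(b + x * 0) - (b + x * (- 1)) < 2 * pi" using r[of x] by auto
      from DERIV_isCont[OF th_ph_deriv(2)[OF this]] show "isCont (\<lambda>u. ph (b - u) b) x" by simp
    qed
  qed (rule uv)
  then obtain u where "?u \<le> u" "u \<le> ?v" "ph (b - u) b = \<phi>" by blast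
  then show ?thesis using r[of u] by (intro exI[of _ "b - u"]) simp
qed

text \<open>The values at 0 and \<open>2 * pi\<close> belong to the glancing directions. With them
  \<open>Th a\<close> is strictly increasing on the closed interval, so its inverse
  \<open>tau\<close> is defined on the closed strip of angles.\<close>

definition Th :: "real \<Rightarrow> real \<Rightarrow> real" where
  "Th a u = (if u = 0 then 0 else if u = 2 * pi then pi else th a (a + u))"

lemma Th_mono: assumes "0 \<le> u" "u < v" "v \<le> 2 * pi" shows "Th a u < Th a v"
proof -
  have *: "0 < th a (a + w) \<and> th a (a + w) < pi" if "0 < w" "w < 2 * pi" for w
    using chord(3,4)[of "a + w" a] that by simp
  show ?thesis using assms *[of u] *[of v] th_strict_mono[of a "a + u" "a + v"] by (auto simp: Th_def)
qed

definition tau :: "real \<Rightarrow> real \<Rightarrow> real" where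
  "tau a \<theta> = (THE u. 0 \<le> u \<and> u \<le> 2 * pi \<and> Th a u = \<theta>)"

lemma tau_unique: "0 \<le> u \<Longrightarrow> u \<le> 2 * pi \<Longrightarrow> Th a u = \<theta> \<Longrightarrow> tau a \<theta> = u"
  unfolding tau_def by (rule the_equality) (use Th_mono[of _ u a] Th_mono[of u _ a] in \<open>auto, metis less_irrefl linorder_neqE_linordered_idom\<close>)

lemma tau_ends: "tau a 0 = 0" "tau a pi = 2 * pi"
  by (rule tau_unique; simp add: Th_def)+

lemma tau:
  assumes "0 < \<theta>" "\<theta> < pi"
  shows "0 < tau a \<theta>" "tau a \<theta> < 2 * pi" "th a (a + tau a \<theta>) = \<theta>" "ph a (a + tau a \<theta>) = tau a \<theta> - \<theta>"
proof -
  obtain u where u: "0 < u" "u < 2 * pi" "th a (a + u) = \<theta>" using th_exists[OF assms] by blast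
  then have "tau a \<theta> = u" by (intro tau_unique) (auto simp: Th_def)
  then show "0 < tau a \<theta>" "tau a \<theta> < 2 * pi" "th a (a + tau a \<theta>) = \<theta>" "ph a (a + tau a \<theta>) = tau a \<theta> - \<theta>"
    using u chord(8)[of "a + u" a] by auto
qed

lemma tau_th: "0 < b - a \<Longrightarrow> b - a < 2 * pi \<Longrightarrow> a + tau a (th a b) = b"
  using tau_unique[of "b - a" a "th a b"] by (auto simp: Th_def)

lemma Th_tau: assumes "0 \<le> \<theta>" "\<theta> \<le> pi" shows "0 \<le> tau a \<theta>" "tau a \<theta> \<le> 2 * pi" "Th a (tau a \<theta>) = \<theta>"
proof -
  have "(0 \<le> tau a \<theta> \<and> tau a \<theta> \<le> 2 * pi) \<and> Th a (tau a \<theta>) = \<theta>"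
  proof (cases "\<theta> = 0 \<or> \<theta> = pi")
    case True then show ?thesis using tau_ends by (auto simp: Th_def)
  next
    case False then show ?thesis using tau[of \<theta> a] assms by (auto simp: Th_def)
  qed
  then show "0 \<le> tau a \<theta>" "tau a \<theta> \<le> 2 * pi" "Th a (tau a \<theta>) = \<theta>" by auto
qed

lemma Th_continuous: "0 \<le> u \<Longrightarrow> u \<le> 2 * pi \<Longrightarrow> isCont (\<lambda>a. Th a u) a"
proof (cases "u = 0 \<or> u = 2 * pi")
  case False
  assume "0 \<le> u" "u \<le> 2 * pi"
  then have "0 < (u + a * 1) - (0 + a * 1)" "(u + a * 1) - (0 + a * 1) < 2 * pi" using False by auto
  from DERIV_isCont[OF th_ph_deriv(1)[OF this]] show ?thesis using False by (simp add: Th_def add.commute)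
qed (auto simp: Th_def)

text \<open>By strict monotonicity, \<open>l < tau a \<theta>\<close> amounts to
  \<open>Th a l < \<theta>\<close> for \<open>l\<close> between 0 and \<open>2 * pi\<close>, and
  this condition is open because \<open>Th\<close> is continuous in the base point for fixed
  \<open>l\<close>. The opposite inequality is treated alike.\<close>

lemma tau_continuous: "continuous_on (UNIV \<times> {0..pi}) (\<lambda>(a, \<theta>). tau a \<theta>)"
  unfolding continuous_on_def
proof
  fix w0 assume w0: "w0 \<in> (UNIV :: real set) \<times> {0..pi}"
  obtain a0 \<theta>0 where w: "w0 = (a0, \<theta>0)" by (cases w0)
  let ?S = "(UNIV :: real set) \<times> {0..pi}"
  have th0: "0 \<le> \<theta>0" "\<theta>0 \<le> pi" using w0 w by auto
  have lim: "((\<lambda>w. snd w - Th (fst w) l) \<longlongrightarrow> \<theta>0 - Th a0 l) (at w0 within ?S)" if "0 \<le> l" "l \<le> 2 * pi" for l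
  proof (rule tendsto_diff)
    show "(snd \<longlongrightarrow> \<theta>0) (at w0 within ?S)" using tendsto_snd[OF tendsto_ident_at[of w0 ?S]] by (simp add: w)
    have "(fst \<longlongrightarrow> a0) (at w0 within ?S)" using tendsto_fst[OF tendsto_ident_at[of w0 ?S]] by (simp add: w)
    from isCont_tendsto_compose[OF Th_continuous[OF that] this] show "((\<lambda>w. Th (fst w) l) \<longlongrightarrow> Th a0 l) (at w0 within ?S)" .
  qed
  have inS: "eventually (\<lambda>w. w \<in> ?S) (at w0 within ?S)" by (simp add: eventually_at_filter)
  have cmp: "tau a \<theta> > l" if "Th a l < \<theta>" "0 \<le> l" "l \<le> 2 * pi" "0 \<le> \<theta>" "\<theta> \<le> pi" for a \<theta> l
  proof (rule ccontr)
    assume "\<not> l < tau a \<theta>"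
    then have "tau a \<theta> < l \<or> tau a \<theta> = l" by linarith
    then show False using Th_mono[of "tau a \<theta>" l a] Th_tau[OF that(4,5), of a] that by auto
  qed
  have cmp': "tau a \<theta> < l" if "\<theta> < Th a l" "0 \<le> l" "l \<le> 2 * pi" "0 \<le> \<theta>" "\<theta> \<le> pi" for a \<theta> l
  proof (rule ccontr)
    assume "\<not> tau a \<theta> < l"
    then have "l < tau a \<theta> \<or> tau a \<theta> = l" by linarith
    then show False using Th_mono[of l "tau a \<theta>" a] Th_tau[OF that(4,5), of a] that by auto
  qed
  show "((\<lambda>(a, \<theta>). tau a \<theta>) \<longlongrightarrow> (case w0 of (a, \<theta>) \<Rightarrow> tau a \<theta>)) (at w0 within ?S)"
  proof (rule order_tendstoI)
    fix l assume "l < (case w0 of (a, \<theta>) \<Rightarrow> tau a \<theta>)"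
    then have l: "l < tau a0 \<theta>0" by (simp add: w)
    show "\<forall>\<^sub>F w in at w0 within ?S. l < (case w of (a, \<theta>) \<Rightarrow> tau a \<theta>)"
    proof (cases "l < 0")
      case True
      show ?thesis
      proof (rule eventually_mono[OF inS])
        fix w :: "real \<times> real" assume "w \<in> ?S"
        then have "0 \<le> tau (fst w) (snd w)" using Th_tau(1)[of "snd w" "fst w"] by (auto simp: mem_Times_iff)
        then show "l < (case w of (a, \<theta>) \<Rightarrow> tau a \<theta>)" using True by (simp add: split_beta)
      qed
    next
      case False
      then have l0: "0 \<le> l" "l \<le> 2 * pi" using l Th_tau(2)[OF th0, of a0] by auto
      have "Th a0 l < \<theta>0" using Th_mono[OF l0(1) l Th_tau(2)[OF th0], of a0] Th_tau(3)[OF th0, of a0] by simp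
      then have "\<forall>\<^sub>F w in at w0 within ?S. 0 < snd w - Th (fst w) l" using order_tendstoD(1)[OF lim[OF l0], of 0] by simp
      then show ?thesis using inS by eventually_elim (use cmp l0 in \<open>auto simp: split_beta\<close>)
    qed
  next
    fix l assume "(case w0 of (a, \<theta>) \<Rightarrow> tau a \<theta>) < l"
    then have l: "tau a0 \<theta>0 < l" by (simp add: w)
    show "\<forall>\<^sub>F w in at w0 within ?S. (case w of (a, \<theta>) \<Rightarrow> tau a \<theta>) < l"
    proof (cases "2 * pi < l")
      case True
      show ?thesis
      proof (rule eventually_mono[OF inS])
        fix w :: "real \<times> real" assume "w \<in> ?S"
        then have "tau (fst w) (snd w) \<le> 2 * pi" using Th_tau(2)[of "snd w" "fst w"] by (auto simp: mem_Times_iff)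
        then show "(case w of (a, \<theta>) \<Rightarrow> tau a \<theta>) < l" using True by (simp add: split_beta)
      qed
    next
      case False
      then have l0: "0 \<le> l" "l \<le> 2 * pi" using l Th_tau(1)[OF th0, of a0] by auto
      have "\<theta>0 < Th a0 l" using Th_mono[OF Th_tau(1)[OF th0] l l0(2), of a0] Th_tau(3)[OF th0, of a0] by simp
      then have "\<forall>\<^sub>F w in at w0 within ?S. snd w - Th (fst w) l < 0" using order_tendstoD(2)[OF lim[OF l0], of 0] by simp
      then show ?thesis using inS by eventually_elim (use cmp' l0 in \<open>auto simp: split_beta\<close>)
    qed
  qed
qed

text \<open>The billiard map lifted to the line, on pairs of tangent angle and outgoing angle:
  \<open>tau\<close> is the parameter length of the link and, by the angle sum,
  \<open>tau - \<theta>\<close> the angle at its far end.\<close>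

definition bm :: "real \<times> real \<Rightarrow> real \<times> real" where
  "bm w = (fst w + tau (fst w) (snd w), tau (fst w) (snd w) - snd w)"

lemma bm_inner:
  assumes "0 < \<theta>" "\<theta> < pi"
  shows "0 < fst (bm (a, \<theta>)) - a" "fst (bm (a, \<theta>)) - a < 2 * pi" "th a (fst (bm (a, \<theta>))) = \<theta>"
    "ph a (fst (bm (a, \<theta>))) = snd (bm (a, \<theta>))" "0 < snd (bm (a, \<theta>))" "snd (bm (a, \<theta>)) < pi"
  using tau[OF assms, of a] chord(5,6)[of "a + tau a \<theta>" a] by (auto simp: bm_def)

lemma bm_chord:
  assumes "0 < b - a" "b - a < 2 * pi" shows "bm (a, th a b) = (b, ph a b)"
  using tau_th[OF assms] chord(8)[OF assms] by (auto simp: bm_def)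

lemma bm_strip: "\<theta> \<in> {0..pi} \<Longrightarrow> snd (bm (a, \<theta>)) \<in> {0..pi}"
  using bm_inner[of \<theta> a] tau_ends[of a] by (cases "\<theta> = 0 \<or> \<theta> = pi") (auto simp: bm_def)

lemma bm_continuous: "continuous_on (UNIV \<times> {0..pi}) bm"
proof -
  have "continuous_on (UNIV \<times> {0..pi}) (\<lambda>w. tau (fst w) (snd w))"
    using tau_continuous by (simp add: split_beta)
  then show ?thesis unfolding bm_def[abs_def] by (intro continuous_intros)
qed

lemma bm_iter_inner:
  assumes "0 < \<theta>" "\<theta> < pi" shows "0 < snd ((bm ^^ n) (a, \<theta>)) \<and> snd ((bm ^^ n) (a, \<theta>)) < pi"
proof (induction n)
  case (Suc n) then show ?case using bm_inner(5,6)[of "snd ((bm ^^ n) (a, \<theta>))" "fst ((bm ^^ n) (a, \<theta>))"] by simp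
qed (use assms in auto)

lemma bm_iter_strip: "w \<in> UNIV \<times> {0..pi} \<Longrightarrow> (bm ^^ n) w \<in> UNIV \<times> {0..pi}"
proof (induction n)
  case (Suc n) then show ?case using bm_strip[of "snd ((bm ^^ n) w)" "fst ((bm ^^ n) w)"] by (auto simp: mem_Times_iff)
qed auto

lemma bm_iter_continuous: "continuous_on (UNIV \<times> {0..pi}) (bm ^^ n)"
proof (induction n)
  case (Suc n)
  have "continuous_on (UNIV \<times> {0..pi}) (bm \<circ> (bm ^^ n))"
    by (rule continuous_on_compose[OF Suc continuous_on_subset[OF bm_continuous]]) (use bm_iter_strip in blast)
  then show ?case by simp
qed (auto simp: continuous_on_id id_def)

text \<open>The vertices of the orbit that leaves \<open>\<Gamma> u\<close> at the angle \<open>\<theta>\<close>.\<close>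

definition vx :: "real \<Rightarrow> real \<Rightarrow> nat \<Rightarrow> real" where "vx u \<theta> i = fst ((bm ^^ i) (u, \<theta>))"
definition ax :: "real \<Rightarrow> real \<Rightarrow> nat \<Rightarrow> real" where "ax u \<theta> i = snd ((bm ^^ i) (u, \<theta>))"

lemma vx_0 [simp]: "vx u \<theta> 0 = u" "ax u \<theta> 0 = \<theta>" by (simp_all add: vx_def ax_def)

lemma vx_add: "vx u \<theta> (i + k) = vx (vx u \<theta> k) (ax u \<theta> k) i" "ax u \<theta> (i + k) = ax (vx u \<theta> k) (ax u \<theta> k) i"
  by (simp_all add: vx_def ax_def funpow_add)

lemma vx_Suc: "vx u \<theta> (Suc i) = fst (bm (vx u \<theta> i, ax u \<theta> i))" "ax u \<theta> (Suc i) = snd (bm (vx u \<theta> i, ax u \<theta> i))"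
  by (simp_all add: vx_def ax_def)

lemma orbit_link:
  assumes "0 < \<theta>" "\<theta> < pi"
  shows "0 < ax u \<theta> i" "ax u \<theta> i < pi" "0 < vx u \<theta> (Suc i) - vx u \<theta> i" "vx u \<theta> (Suc i) - vx u \<theta> i < 2 * pi"
    "th (vx u \<theta> i) (vx u \<theta> (Suc i)) = ax u \<theta> i" "ph (vx u \<theta> i) (vx u \<theta> (Suc i)) = ax u \<theta> (Suc i)"
proof -
  show 1: "0 < ax u \<theta> i" "ax u \<theta> i < pi" using bm_iter_inner[OF assms, of i u] by (auto simp: ax_def)
  show "0 < vx u \<theta> (Suc i) - vx u \<theta> i" "vx u \<theta> (Suc i) - vx u \<theta> i < 2 * pi"
    "th (vx u \<theta> i) (vx u \<theta> (Suc i)) = ax u \<theta> i" "ph (vx u \<theta> i) (vx u \<theta> (Suc i)) = ax u \<theta> (Suc i)"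
    unfolding vx_Suc using bm_inner[OF 1, of "vx u \<theta> i"] by auto
qed

end

lemma open_segment_param:
  fixes a b :: complex
  shows "x \<in> open_segment a b \<longleftrightarrow> a \<noteq> b \<and> (\<exists>t. 0 < t \<and> t < 1 \<and> x = a + of_real t * (b - a))"
  unfolding in_segment(2) by (auto simp: scaleR_conv_of_real algebra_simps)

lemma last_butlast_nth:
  assumes "length (butlast p) = Suc j" shows "last (butlast p) = p ! j"
proof -
  have ne: "butlast p \<noteq> []" using assms by (metis list.size(3) nat.simps(3))
  have "last (butlast p) = butlast p ! j" using last_conv_nth[OF ne] unfolding assms by simp
  also have "\<dots> = p ! j" by (rule nth_butlast) (simp only: assms lessI)
  finally show ?thesis .
qed

text \<open>The domain with one positively oriented arclength parametrization of its boundary: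
  \<open>A\<close> is the tangent angle as a function of arclength and \<open>C\<close> its inverse.
  The data of \<open>gauss_curve\<close> stay fixed while \<open>\<gamma>\<close> varies, which
  makes all constants independent of the base point. \<open>inner\<close> says that the domain lies
  strictly to the left of every tangent line.\<close>

locale billiard_table = gauss_curve +
  fixes \<Omega> :: "complex set" and \<gamma> :: "real \<Rightarrow> complex" and A C :: "real \<Rightarrow> real" and L :: real
  assumes L_pos: "0 < L" and \<gamma>_eq: "\<And>s. \<gamma> s = \<Gamma> (A s)" and tangent_eq: "\<And>s. tangent \<gamma> s = cis (A s)"
    and A_shift: "\<And>s. A (s + L) = A s + 2 * pi" and A_C: "\<And>\<psi>. A (C \<psi>) = \<psi>" and C_A: "\<And>s. C (A s) = s"
    and C_deriv: "\<And>\<psi>. (C has_real_derivative g \<psi> ^ 3) (at \<psi>)" and A_cont: "continuous_on UNIV A"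
    and frontier_eq: "frontier \<Omega> = range \<Gamma>" and open_\<Omega>: "open \<Omega>"
    and inner: "\<And>x \<psi>. x \<in> \<Omega> \<Longrightarrow> 0 < Im (cis (-\<psi>) * (x - \<Gamma> \<psi>))"
begin

lemma \<gamma>_C: "\<gamma> (C \<psi>) = \<Gamma> \<psi>" by (simp add: \<gamma>_eq A_C)

lemma C_shift: "C (\<psi> + 2 * pi * of_int k) = C \<psi> + of_int k * L"
proof -
  have 1: "C (\<psi> + 2 * pi) = C \<psi> + L" for \<psi> using C_A[of "C \<psi> + L"] by (simp add: A_shift A_C)
  have nat: "C (\<psi> + 2 * pi * real n) = C \<psi> + real n * L" for \<psi> n
  proof (induction n)
    case (Suc n)
    then show ?case using 1[of "\<psi> + 2 * pi * real n"] by (simp add: algebra_simps)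
  qed simp
  show ?thesis
  proof (cases "k \<ge> 0")
    case True then show ?thesis using nat[of \<psi> "nat k"] by simp
  next
    case False then show ?thesis using nat[of "\<psi> + 2 * pi * of_int k" "nat (-k)"] by (simp add: algebra_simps)
  qed
qed

lemma C_increment:
  assumes "a \<le> b" shows "g0 ^ 3 * (b - a) \<le> C b - C a" "C b - C a \<le> G ^ 3 * (b - a)"
proof -
  have "(\<lambda>x. C x - g0 ^ 3 * x) a \<le> (\<lambda>x. C x - g0 ^ 3 * x) b"
  proof (rule DERIV_nonneg_imp_nondecreasing[OF assms, of "\<lambda>x. C x - g0 ^ 3 * x"])
    fix x show "\<exists>y. ((\<lambda>x. C x - g0 ^ 3 * x) has_real_derivative y) (at x) \<and> 0 \<le> y"
      by (rule exI[of _ "g x ^ 3 - g0 ^ 3"]) (use power_mono[OF g_ge[of x], of 3] g0_pos DERIV_diff[OF C_deriv[of x] DERIV_cmult_Id[of "g0^3"]] in auto)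
  qed
  then show "g0 ^ 3 * (b - a) \<le> C b - C a" by (simp add: algebra_simps)
  have "(\<lambda>x. G ^ 3 * x - C x) a \<le> (\<lambda>x. G ^ 3 * x - C x) b"
  proof (rule DERIV_nonneg_imp_nondecreasing[OF assms, of "\<lambda>x. G ^ 3 * x - C x"])
    fix x show "\<exists>y. ((\<lambda>x. G ^ 3 * x - C x) has_real_derivative y) (at x) \<and> 0 \<le> y"
      by (rule exI[of _ "G ^ 3 - g x ^ 3"]) (use power_mono[OF g_le[of x], of 3] less_imp_le[OF g_pos[of x]] DERIV_diff[OF DERIV_cmult_Id[of "G^3"] C_deriv[of x]] in auto)
  qed
  then show "C b - C a \<le> G ^ 3 * (b - a)" by (simp add: algebra_simps)
qed

text \<open>\<open>bm\<close> conjugated to arclength: the explicit lift with which the one chosen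
  in \<open>billiard_lift\<close> will be identified.\<close>

definition B0 :: "real \<times> real \<Rightarrow> real \<times> real" where
  "B0 w = (C (fst (bm (A (fst w), snd w))), snd (bm (A (fst w), snd w)))"

lemma bm_bounce:
  assumes "0 < \<theta>" "\<theta> < pi"
  shows "\<Gamma> (fst (bm (a, \<theta>))) \<noteq> \<Gamma> a"
    "angle_between (\<Gamma> (fst (bm (a, \<theta>))) - \<Gamma> a) (cis a) = \<theta>"
    "angle_between (\<Gamma> (fst (bm (a, \<theta>))) - \<Gamma> a) (cis (fst (bm (a, \<theta>)))) = snd (bm (a, \<theta>))"
  using bm_inner[OF assms, of a] H_pos[OF bm_inner(1,2)[OF assms, of a]] by (auto simp: th_def ph_def H_def)

lemma bm_ends: "bm (a, 0) = (a, 0)" "bm (a, pi) = (a + 2 * pi, pi)"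
  by (simp_all add: bm_def tau_ends)

lemma is_lift_B0: "is_billiard_lift \<gamma> 0 B0"
  unfolding is_billiard_lift_def
proof (intro conjI allI ballI)
  have "continuous_on (UNIV \<times> {0..pi}) (\<lambda>w. A (fst w))"
    by (rule continuous_on_compose2[OF A_cont continuous_on_fst[OF continuous_on_id]]) auto
  then have c1: "continuous_on (UNIV \<times> {0..pi}) (\<lambda>w. (A (fst w), snd w))"
    by (intro continuous_on_Pair continuous_on_snd continuous_on_id)
  have c2: "continuous_on (UNIV \<times> {0..pi}) (\<lambda>w. bm (A (fst w), snd w))"
    by (rule continuous_on_compose2[OF bm_continuous c1]) auto
  have cC: "continuous_on UNIV C" by (rule DERIV_continuous_on[where D="\<lambda>\<psi>. g \<psi> ^ 3"]) (use C_deriv in simp)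
  have "continuous_on (UNIV \<times> {0..pi}) (\<lambda>w. C (fst (bm (A (fst w), snd w))))"
    by (rule continuous_on_compose2[OF cC continuous_on_fst[OF c2]]) auto
  then show "continuous_on (UNIV \<times> {0..pi}) B0"
    unfolding B0_def[abs_def] by (intro continuous_on_Pair continuous_on_snd[OF c2])
next
  fix s \<theta> :: real assume \<theta>: "\<theta> \<in> {0..pi}"
  show "billiard_map_graph \<gamma> (s, \<theta>) (B0 (s, \<theta>))"
  proof (cases "\<theta> = 0 \<or> \<theta> = pi")
    case True
    then show ?thesis using \<Gamma>_period[of "A s"]
      by (auto simp: billiard_map_graph_def B0_def bm_ends \<gamma>_C \<gamma>_eq[of s] C_A)
  next
    case False
    then have t: "0 < \<theta>" "\<theta> < pi" using \<theta> by auto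
    show ?thesis using False bm_bounce[OF t, of "A s"]
      by (auto simp: billiard_map_graph_def B0_def \<gamma>_C \<gamma>_eq[of s] tangent_eq A_C)
  qed
next
  fix s show "B0 (s, 0) = (s, 0)" by (simp add: B0_def bm_ends C_A)
qed

lemma cis_shift: "cis (a + 2 * pi * of_int k) = cis a"
proof -
  have "cis (2 * pi * of_int k) = 1" by (rule cis_multiple_2pi) simp
  then show ?thesis by (simp add: cis_mult[symmetric])
qed

text \<open>Broken geodesics are given by vertices and unoriented angles. Taking the representative
  of the next vertex after \<open>a\<close> turns each of their links into a step of
  \<open>bm\<close>.\<close>

lemma hit:
  assumes "z \<in> frontier \<Omega>" "z \<noteq> \<Gamma> a" "angle_between (z - \<Gamma> a) (cis a) = \<theta>"
  shows "0 < \<theta>" "\<theta> < pi" "z = \<Gamma> (fst (bm (a, \<theta>)))"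
    "angle_between (z - \<Gamma> a) (cis (fst (bm (a, \<theta>)))) = snd (bm (a, \<theta>))"
proof -
  obtain b where "z = \<Gamma> b" using assms(1) frontier_eq by auto
  then obtain c where c: "\<Gamma> c = z" "0 < c - a" "c - a < 2 * pi" using representative_after[of b a] assms(2) by auto
  have th: "th a c = \<theta>" using assms(3) c by (simp add: th_def)
  show "0 < \<theta>" "\<theta> < pi" using chord(3,4)[OF c(2,3)] th by auto
  have "bm (a, \<theta>) = (c, ph a c)" using bm_chord[OF c(2,3)] th by simp
  then show "z = \<Gamma> (fst (bm (a, \<theta>)))" "angle_between (z - \<Gamma> a) (cis (fst (bm (a, \<theta>)))) = snd (bm (a, \<theta>))"
    using c(1) by (auto simp: ph_def)
qed

text \<open>For fixed \<open>s\<close> the tangent angles of the two lifts differ by a multiple of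
  \<open>2 * pi\<close> that depends continuously on \<open>\<theta>\<close>; it is therefore
  constant, and it vanishes at the glancing angle 0. This pins down the lift that
  \<open>billiard_lift\<close> picks by \<open>SOME\<close>.\<close>

lemma lift_unique:
  assumes "is_billiard_lift \<gamma> 0 B" "\<theta> \<in> {0..pi}"
  shows "B (s, \<theta>) = B0 (s, \<theta>)"
proof -
  have cB: "continuous_on (UNIV \<times> {0..pi}) B"
    and gB: "\<And>\<theta>. \<theta> \<in> {0..pi} \<Longrightarrow> billiard_map_graph \<gamma> (s, \<theta>) (B (s, \<theta>))" and B0s: "B (s, 0) = (s, 0)"
    using assms(1) unfolding is_billiard_lift_def by auto
  have step: "(\<exists>k::int. A (fst (B (s, \<theta>))) = fst (bm (A s, \<theta>)) + 2 * pi * of_int k) \<and> snd (B (s, \<theta>)) = snd (bm (A s, \<theta>))"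
    if \<theta>: "\<theta> \<in> {0..pi}" for \<theta>
  proof -
    obtain t \<phi> where B: "B (s, \<theta>) = (t, \<phi>)" by (cases "B (s, \<theta>)")
    have gr: "billiard_map_graph \<gamma> (s, \<theta>) (t, \<phi>)" using gB[OF \<theta>] B by simp
    show ?thesis
    proof (cases "\<theta> = 0 \<or> \<theta> = pi")
      case True
      then have "\<gamma> t = \<gamma> s" "\<phi> = \<theta>" using gr by (auto simp: billiard_map_graph_def)
      then have "\<Gamma> (fst (bm (A s, \<theta>))) = \<Gamma> (A t)" using True \<Gamma>_period[of "A s"] by (auto simp: \<gamma>_eq bm_ends)
      then show ?thesis using \<Gamma>_eq_iff True \<open>\<phi> = \<theta>\<close> by (auto simp: B bm_ends)
    next
      case False
      then have g: "\<gamma> t \<noteq> \<gamma> s" "angle_between (\<gamma> t - \<gamma> s) (tangent \<gamma> s) = \<theta>" "angle_between (\<gamma> t - \<gamma> s) (tangent \<gamma> t) = \<phi>"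
        using gr by (auto simp: billiard_map_graph_def)
      have z: "\<gamma> t \<in> frontier \<Omega>" by (simp add: frontier_eq \<gamma>_eq)
      note h = hit[OF z, of "A s" \<theta>]
      have e: "\<gamma> t = \<Gamma> (fst (bm (A s, \<theta>)))" using h(3) g by (simp add: \<gamma>_eq tangent_eq)
      then obtain k :: int where k: "A t = fst (bm (A s, \<theta>)) + 2 * pi * of_int k" using \<Gamma>_eq_iff by (metis \<gamma>_eq)
      have "cis (A t) = cis (fst (bm (A s, \<theta>)))" unfolding k by (rule cis_shift)
      then have "\<phi> = snd (bm (A s, \<theta>))" using h(4) g by (simp add: \<gamma>_eq[of s] tangent_eq)
      then show ?thesis using k B by auto
    qed
  qed
  define f where "f \<theta> = (A (fst (B (s, \<theta>))) - fst (bm (A s, \<theta>))) / (2 * pi)" for \<theta>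
  have int: "f \<theta> \<in> \<int>" if "\<theta> \<in> {0..pi}" for \<theta> using step[OF that] by (auto simp: f_def)
  have cf: "continuous_on {0..pi} f"
  proof -
    have 1: "continuous_on {0..pi} (\<lambda>\<theta>. B (s, \<theta>))"
      by (rule continuous_on_compose2[OF cB]) (auto intro!: continuous_intros)
    have 2: "continuous_on {0..pi} (\<lambda>\<theta>. bm (A s, \<theta>))"
      by (rule continuous_on_compose2[OF bm_continuous]) (auto intro!: continuous_intros)
    have "continuous_on {0..pi} (\<lambda>\<theta>. A (fst (B (s, \<theta>))))"
      by (rule continuous_on_compose2[OF A_cont continuous_on_fst[OF 1]]) auto
    then show ?thesis unfolding f_def[abs_def] using 2 by (intro continuous_intros) auto
  qed
  have "f constant_on {0..pi}"
  proof (rule continuous_discrete_range_constant[OF _ cf])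
    fix x assume x: "x \<in> {0..pi}"
    show "\<exists>e>0. \<forall>y. y \<in> {0..pi} \<and> f y \<noteq> f x \<longrightarrow> e \<le> norm (f y - f x)"
    proof (intro exI[of _ 1] conjI allI impI)
      fix y assume y: "y \<in> {0..pi} \<and> f y \<noteq> f x"
      then have "f y - f x \<in> \<int>" "f y - f x \<noteq> 0" using int x by auto
      then show "1 \<le> norm (f y - f x)" using Ints_nonzero_abs_ge1[of "f y - f x"] by auto
    qed simp
  qed simp
  then have "f \<theta> = f 0" using assms(2) unfolding constant_on_def by force
  also have "f 0 = 0" by (simp add: f_def B0s bm_ends)
  finally have "A (fst (B (s, \<theta>))) = fst (bm (A s, \<theta>))" by (simp add: f_def)
  then have "fst (B (s, \<theta>)) = C (fst (bm (A s, \<theta>)))" by (metis C_A)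
  then show ?thesis using step[OF assms(2)] by (simp add: B0_def prod_eq_iff)
qed

lemma is_lift_billiard_lift: "is_billiard_lift \<gamma> 0 (billiard_lift \<gamma> 0)"
  unfolding billiard_lift_def by (rule someI[where P="is_billiard_lift \<gamma> 0", OF is_lift_B0])

lemma lift_iter:
  assumes "0 < \<theta>" "\<theta> < pi"
  shows "(billiard_lift \<gamma> 0 ^^ n) (s, \<theta>) = (C (vx (A s) \<theta> n), ax (A s) \<theta> n)"
proof (induction n)
  case (Suc n)
  have "ax (A s) \<theta> n \<in> {0..pi}" using orbit_link(1,2)[OF assms, of "A s" n] by auto
  then show ?case using Suc lift_unique[OF is_lift_billiard_lift, of "ax (A s) \<theta> n" "C (vx (A s) \<theta> n)"]
    by (simp add: B0_def A_C vx_Suc)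
qed (simp add: C_A)

lemma orbit_chord:
  assumes "0 < \<theta>" "\<theta> < pi"
  shows "\<Gamma> (vx u \<theta> (Suc i)) - \<Gamma> (vx u \<theta> i) = of_real (H (vx u \<theta> i) (vx u \<theta> (Suc i))) * cis (vx u \<theta> i + ax u \<theta> i)"
    "0 < H (vx u \<theta> i) (vx u \<theta> (Suc i))" "vx u \<theta> i + ax u \<theta> i = vx u \<theta> (Suc i) - ax u \<theta> (Suc i)"
  using orbit_link[OF assms, of u i] chord(1,7,8)[of "vx u \<theta> (Suc i)" "vx u \<theta> i"] by auto

text \<open>The first and the last vertex may lie off the boundary, so only the directions of the
  links are prescribed. The reflection law holds because the direction \<open>vx - ax\<close> of
  arrival and the direction \<open>vx + ax\<close> of departure are mirror images in the
  tangent.\<close>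

lemma geodesicI:
  assumes \<theta>: "0 < \<theta>" "\<theta> < pi"
    and link: "\<And>i. Suc i < length p \<Longrightarrow> \<exists>r>0. p ! Suc i - p ! i = of_real r * cis (vx u \<theta> i + ax u \<theta> i)"
    and vertex: "\<And>i. Suc (Suc i) < length p \<Longrightarrow> p ! Suc i = \<Gamma> (vx u \<theta> (Suc i))"
    and cl: "set p \<subseteq> closure \<Omega>"
  shows "broken_geodesic \<Omega> \<gamma> p"
  unfolding broken_geodesic_def
proof (intro conjI allI impI cl)
  fix i assume "Suc i < length p"
  then show "p ! i \<noteq> p ! Suc i" using link[of i] by auto
next
  fix i assume i: "Suc (Suc i) < length p"
  show "p ! Suc i \<in> frontier \<Omega>" using vertex[OF i] by (simp add: frontier_eq)
  fix s assume s: "\<gamma> s = p ! Suc i"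
  let ?b = "vx u \<theta> (Suc i)" and ?\<phi> = "ax u \<theta> (Suc i)"
  have "\<Gamma> ?b = \<Gamma> (A s)" using s vertex[OF i] by (simp add: \<gamma>_eq)
  then obtain k :: int where "A s = ?b + 2 * pi * of_int k" using \<Gamma>_eq_iff by blast
  then have T: "tangent \<gamma> s = cis ?b" by (simp only: tangent_eq cis_shift)
  note a = orbit_link(1,2)[OF \<theta>, of u "Suc i"]
  obtain r where r: "0 < r" "p ! Suc i - p ! i = of_real r * cis (?b - ?\<phi>)"
    using link[of i] i orbit_chord(3)[OF \<theta>, of u i] by auto
  obtain r' where r': "0 < r'" "p ! Suc (Suc i) - p ! Suc i = of_real r' * cis (?b + ?\<phi>)"
    using link[OF i] by auto
  have "angle_between (p ! i - p ! Suc i) (- tangent \<gamma> s) = angle_between (- (p ! Suc i - p ! i)) (- cis ?b)"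
    by (simp add: T)
  also have "\<dots> = ?\<phi>" unfolding angle_between_minus r(2) using angle_between_polar(2)[OF r(1)] a by simp
  also have "\<dots> = angle_between (p ! Suc (Suc i) - p ! Suc i) (tangent \<gamma> s)"
    unfolding T r'(2) using angle_between_polar(1)[OF r'(1)] a by simp
  finally show "angle_between (p ! i - p ! Suc i) (- tangent \<gamma> s) = angle_between (p ! Suc (Suc i) - p ! Suc i) (tangent \<gamma> s)" .
qed

text \<open>One vertex and one angle determine all later ones, each step being an instance of
  \<open>hit\<close>. The offset \<open>k\<close> lets the chain begin at the first reflection, as
  the first vertex of an interior orbit is not on the boundary.\<close>

lemma geodesic_chain:
  assumes p: "broken_geodesic \<Omega> \<gamma> p" and start: "p ! k = \<Gamma> a" "angle_between (p ! Suc k - p ! k) (cis a) = \<theta>"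
    and \<theta>: "0 < \<theta>" "\<theta> < pi" and len: "Suc (k + n) < length p"
  shows "p ! (k + n) = \<Gamma> (vx a \<theta> n) \<and> angle_between (p ! Suc (k + n) - p ! (k + n)) (cis (vx a \<theta> n)) = ax a \<theta> n"
  using len
proof (induction n)
  case 0 then show ?case using start by simp
next
  case (Suc n)
  let ?v = "vx a \<theta> n" and ?t = "ax a \<theta> n"
  have IH: "p ! (k + n) = \<Gamma> ?v" "angle_between (p ! Suc (k + n) - p ! (k + n)) (cis ?v) = ?t"
    using Suc by auto
  have ne: "p ! Suc (k + n) \<noteq> \<Gamma> ?v" using p Suc.prems IH(1) unfolding broken_geodesic_def by (metis Suc_lessD add_Suc_right)
  have fr: "p ! Suc (k + n) \<in> frontier \<Omega>" using p Suc.prems unfolding broken_geodesic_def by simp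
  have h: "p ! Suc (k + n) = \<Gamma> (vx a \<theta> (Suc n))" "angle_between (p ! Suc (k + n) - p ! (k + n)) (cis (vx a \<theta> (Suc n))) = ax a \<theta> (Suc n)"
    using hit[OF fr ne, of ?t] IH by (simp_all add: vx_Suc)
  have "\<gamma> (C (vx a \<theta> (Suc n))) = p ! Suc (k + n)" by (simp add: \<gamma>_C h(1))
  then have "angle_between (p ! (k + n) - p ! Suc (k + n)) (- tangent \<gamma> (C (vx a \<theta> (Suc n)))) =
     angle_between (p ! Suc (Suc (k + n)) - p ! Suc (k + n)) (tangent \<gamma> (C (vx a \<theta> (Suc n))))"
    using p Suc.prems unfolding broken_geodesic_def by simp
  moreover have "angle_between (p ! (k + n) - p ! Suc (k + n)) (- cis (vx a \<theta> (Suc n))) = ax a \<theta> (Suc n)"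
    using h(2) angle_between_minus[of "p ! Suc (k + n) - p ! (k + n)" "cis (vx a \<theta> (Suc n))"] by simp
  ultimately show ?case using h(1) by (simp add: tangent_eq A_C)
qed

section \<open>Orbit sets expressed by iterates of the billiard map\<close>

lemma nearest_iff: "nearest_representatives L s t \<longleftrightarrow> \<bar>s - t\<bar> \<le> L / 2"
proof
  assume n: "nearest_representatives L s t"
  have "\<bar>s - t\<bar> \<le> \<bar>s - (t + of_int 1 * L)\<bar>" "\<bar>s - t\<bar> \<le> \<bar>s - (t + of_int (- 1) * L)\<bar>"
    using n unfolding nearest_representatives_def by blast+
  then show "\<bar>s - t\<bar> \<le> L / 2" using L_pos by (auto simp: abs_if split: if_splits)
next
  assume n: "\<bar>s - t\<bar> \<le> L / 2"
  show "nearest_representatives L s t" unfolding nearest_representatives_def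
  proof
    fix k :: int
    show "\<bar>s - t\<bar> \<le> \<bar>s - (t + of_int k * L)\<bar>"
    proof (cases "k = 0")
      case False
      then have "1 \<le> \<bar>real_of_int k\<bar>" by linarith
      then have "L \<le> \<bar>of_int k * L\<bar>" using L_pos mult_right_mono[of 1 "\<bar>real_of_int k\<bar>" L] by (simp add: abs_mult)
      then show ?thesis using n by linarith
    qed simp
  qed
qed

text \<open>\<open>C \<psi>\<close> and \<open>t\<close> represent the same boundary point, so they
  differ by a multiple of \<open>L\<close>; the tolerance singles out the multiple 1.\<close>

lemma rotation_number_one:
  assumes "\<Gamma> \<psi> = \<gamma> t" "\<bar>C \<psi> - t - L\<bar> \<le> L / 100" shows "C \<psi> = t + L"
proof -
  obtain k :: int where "\<psi> = A t + 2 * pi * of_int k" using assms(1) \<Gamma>_eq_iff by (metis \<gamma>_eq)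
  then have k: "C \<psi> = t + of_int k * L" by (simp add: C_shift C_A)
  have "\<bar>(of_int k - 1) * L\<bar> \<le> L / 100" using assms(2) k by (simp add: algebra_simps)
  then have "\<bar>of_int (k - 1)\<bar> * L \<le> (1 / 100) * L" using L_pos by (simp add: abs_mult)
  then have "\<bar>real_of_int (k - 1)\<bar> \<le> 1 / 100" using L_pos by (metis mult_le_cancel_right_pos)
  then have "k = 1" by linarith
  then show ?thesis using k by simp
qed

text \<open>Since the tolerance \<open>L / 100\<close> collapses to equality, the representative of
  \<open>y\<close> is \<open>C (vx u \<theta> j) - L\<close>. What remains of the rotation condition
  is that this number is nearest to \<open>C u\<close>, that is, within
  \<open>L / 2\<close>.\<close>

lemma boundary_ccw_iff:
  assumes "1 \<le> j" "x \<in> frontier \<Omega>" "y \<in> frontier \<Omega>"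
  shows "p \<in> boundary_ccw_orbits \<Omega> L \<gamma> j x y \<longleftrightarrow> (\<exists>u \<theta>. 0 < \<theta> \<and> \<theta> < pi \<and> x = \<Gamma> u \<and> y = \<Gamma> (vx u \<theta> j) \<and>
     \<bar>C (vx u \<theta> j) - L - C u\<bar> \<le> L / 2 \<and> p = map (\<lambda>i. \<Gamma> (vx u \<theta> i)) [0..<Suc j])"
proof
  assume "p \<in> boundary_ccw_orbits \<Omega> L \<gamma> j x y"
  then have p: "broken_geodesic \<Omega> \<gamma> p" "length p = j + 1" "hd p = x" "last p = y"
    and rot: "one_ccw_rotation L \<gamma> j x (p ! 1 - p ! 0) y"
    unfolding boundary_ccw_orbits_def boundary_orbit_def by auto
  have "p \<noteq> []" using p(2) by auto
  then have ends: "p ! 0 = x" "p ! j = y" using p hd_conv_nth[of p] last_conv_nth[of p] by auto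
  obtain s t where st: "\<gamma> s = x" "\<gamma> t = y" "\<bar>s - t\<bar> \<le> L / 2"
    "\<bar>fst ((billiard_lift \<gamma> 0 ^^ j) (s, angle_between (p ! 1 - p ! 0) (tangent \<gamma> s))) - t - L\<bar> \<le> L / 100"
    using rot unfolding one_ccw_rotation_def nearest_iff by auto
  define u where "u = A s"
  define \<theta> where "\<theta> = angle_between (p ! 1 - p ! 0) (cis u)"
  have u: "x = \<Gamma> u" using st by (simp add: u_def \<gamma>_eq)
  have ne: "p ! Suc i \<noteq> p ! i" if "i < j" for i using p that unfolding broken_geodesic_def by (metis Suc_eq_plus1 Suc_mono)
  have fr: "p ! i \<in> frontier \<Omega>" if "i \<le> j" for i
  proof (cases "i = 0 \<or> i = j")
    case True then show ?thesis using ends assms by auto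
  next
    case False
    then have "0 < i" "i < j" using that by auto
    then obtain i' where "i = Suc i'" by (cases i) auto
    moreover have "Suc i < length p" using p(2) \<open>i < j\<close> by simp
    ultimately show ?thesis using p(1) unfolding broken_geodesic_def by blast
  qed
  have \<theta>: "0 < \<theta>" "\<theta> < pi" using hit(1,2)[OF fr[of 1], of u \<theta>] ne[of 0] ends u assms(1) by (auto simp: \<theta>_def)
  have st': "p ! 0 = \<Gamma> u" "angle_between (p ! Suc 0 - p ! 0) (cis u) = \<theta>" using ends u by (auto simp: \<theta>_def)
  have ch: "p ! n = \<Gamma> (vx u \<theta> n) \<and> angle_between (p ! Suc n - p ! n) (cis (vx u \<theta> n)) = ax u \<theta> n" if "n < j" for n
  proof -
    have "Suc (0 + n) < length p" using that p(2) by simp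
    from geodesic_chain[OF p(1) st' \<theta> this] show ?thesis unfolding add_0 .
  qed
  have lastv: "p ! j = \<Gamma> (vx u \<theta> j)"
  proof -
    obtain n where n: "j = Suc n" using assms(1) by (cases j) auto
    then have "n < j" by simp
    then have c: "p ! n = \<Gamma> (vx u \<theta> n)" "angle_between (p ! Suc n - p ! n) (cis (vx u \<theta> n)) = ax u \<theta> n" using ch[of n] by blast+
    have "p ! j \<noteq> \<Gamma> (vx u \<theta> n)" using ne[of n] n c(1) by simp
    from hit(3)[OF fr[OF order_refl] this c(2)[unfolded c(1), folded n]] show ?thesis unfolding n by (simp only: vx_Suc)
  qed
  have pm: "p = map (\<lambda>i. \<Gamma> (vx u \<theta> i)) [0..<Suc j]"
  proof (rule nth_equalityI)
    fix i assume "i < length p"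
    then have "i < j \<or> i = j" using p(2) by auto
    then show "p ! i = map (\<lambda>i. \<Gamma> (vx u \<theta> i)) [0..<Suc j] ! i" using ch[of i] lastv by (auto simp del: upt_Suc)
  qed (use p in simp)
  have "\<bar>C (vx u \<theta> j) - t - L\<bar> \<le> L / 100" using st(4) lift_iter[OF \<theta>, of j s] by (simp add: tangent_eq \<theta>_def u_def)
  then have "C (vx u \<theta> j) = t + L" using lastv ends st(2) by (intro rotation_number_one) auto
  moreover have "C u = s" by (simp add: u_def C_A)
  ultimately have "\<bar>C (vx u \<theta> j) - L - C u\<bar> \<le> L / 2" using st(3) by (simp add: abs_minus_commute)
  then show "\<exists>u \<theta>. 0 < \<theta> \<and> \<theta> < pi \<and> x = \<Gamma> u \<and> y = \<Gamma> (vx u \<theta> j) \<and>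
     \<bar>C (vx u \<theta> j) - L - C u\<bar> \<le> L / 2 \<and> p = map (\<lambda>i. \<Gamma> (vx u \<theta> i)) [0..<Suc j]"
    using \<theta> u lastv ends pm by blast
next
  assume "\<exists>u \<theta>. 0 < \<theta> \<and> \<theta> < pi \<and> x = \<Gamma> u \<and> y = \<Gamma> (vx u \<theta> j) \<and>
     \<bar>C (vx u \<theta> j) - L - C u\<bar> \<le> L / 2 \<and> p = map (\<lambda>i. \<Gamma> (vx u \<theta> i)) [0..<Suc j]"
  then obtain u \<theta> where \<theta>: "0 < \<theta>" "\<theta> < pi" and xy: "x = \<Gamma> u" "y = \<Gamma> (vx u \<theta> j)"
    and near: "\<bar>C (vx u \<theta> j) - L - C u\<bar> \<le> L / 2" and pm: "p = map (\<lambda>i. \<Gamma> (vx u \<theta> i)) [0..<Suc j]" by blast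
  have len: "length p = j + 1" by (simp add: pm)
  have nth: "p ! i = \<Gamma> (vx u \<theta> i)" if "i \<le> j" for i using that unfolding pm by (simp del: upt_Suc)
  have "broken_geodesic \<Omega> \<gamma> p"
  proof (rule geodesicI[OF \<theta>])
    fix i assume "Suc i < length p"
    then show "\<exists>r>0. p ! Suc i - p ! i = of_real r * cis (vx u \<theta> i + ax u \<theta> i)"
      using orbit_chord(1,2)[OF \<theta>, of u i] len by (auto simp: nth)
  next
    show "set p \<subseteq> closure \<Omega>" unfolding pm using frontier_eq by (auto simp: frontier_def)
  qed (use nth len in auto)
  moreover have "hd p = x" "last p = y" using xy len by (auto simp: pm hd_map last_map simp del: upt_Suc)
  moreover have "one_ccw_rotation L \<gamma> j x (p ! 1 - p ! 0) y"
    unfolding one_ccw_rotation_def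
  proof (rule exI[of _ "C u"], rule exI[of _ "C (vx u \<theta> j) - L"], intro conjI)
    show "\<gamma> (C u) = x" by (simp add: \<gamma>_C xy)
    show "\<gamma> (C (vx u \<theta> j) - L) = y"
      using C_shift[of "vx u \<theta> j" "-1"] \<gamma>_C[of "vx u \<theta> j + 2 * pi * of_int (- 1)"] \<Gamma>_period_int[of "vx u \<theta> j" "-1"] by (simp add: xy)
    show "nearest_representatives L (C u) (C (vx u \<theta> j) - L)" using near unfolding nearest_iff by (simp add: abs_minus_commute)
    have "angle_between (p ! 1 - p ! 0) (tangent \<gamma> (C u)) = \<theta>"
      using bm_bounce(2)[OF \<theta>, of u] vx_Suc(1)[of u \<theta> 0] nth[of 1] nth[of 0] assms(1) by (simp add: tangent_eq A_C)
    then show "\<bar>fst ((billiard_lift \<gamma> 0 ^^ j) (C u, angle_between (p ! 1 - p ! 0) (tangent \<gamma> (C u)))) - (C (vx u \<theta> j) - L) - L\<bar> \<le> L / 100"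
      using lift_iter[OF \<theta>, of j "C u"] L_pos by (simp add: A_C)
  qed
  ultimately show "p \<in> boundary_ccw_orbits \<Omega> L \<gamma> j x y"
    using len unfolding boundary_ccw_orbits_def boundary_orbit_def by simp
qed

text \<open>For a loop the displacement is a multiple of \<open>L\<close>, and being within
  \<open>L / 2\<close> of \<open>L\<close> forces equality. Loops are thus covered by the count of
  boundary orbits.\<close>

lemma ccw_loop_iff:
  assumes "1 \<le> j" "x \<in> frontier \<Omega>"
  shows "ccw_loop \<Omega> L \<gamma> j x p \<longleftrightarrow> p \<in> boundary_ccw_orbits \<Omega> L \<gamma> j x x"
proof
  assume "ccw_loop \<Omega> L \<gamma> j x p"
  then show "p \<in> boundary_ccw_orbits \<Omega> L \<gamma> j x x"
    unfolding ccw_loop_def boundary_ccw_orbits_def one_ccw_rotation_def nearest_iff using L_pos by fastforce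
next
  assume p: "p \<in> boundary_ccw_orbits \<Omega> L \<gamma> j x x"
  then obtain u \<theta> where \<theta>: "0 < \<theta>" "\<theta> < pi" and xy: "x = \<Gamma> u" "x = \<Gamma> (vx u \<theta> j)"
    and near: "\<bar>C (vx u \<theta> j) - L - C u\<bar> \<le> L / 2" and pm: "p = map (\<lambda>i. \<Gamma> (vx u \<theta> i)) [0..<Suc j]"
    using boundary_ccw_iff[OF assms(1,2,2)] by blast
  have nth: "p ! i = \<Gamma> (vx u \<theta> i)" if "i \<le> j" for i using that unfolding pm by (simp del: upt_Suc)
  obtain k :: int where k: "vx u \<theta> j = u + 2 * pi * of_int k" using \<Gamma>_eq_iff xy by metis
  then have Ck: "C (vx u \<theta> j) = C u + of_int k * L" by (simp add: C_shift)
  have "\<bar>(of_int k - 1) * L\<bar> \<le> L / 2" using near Ck by (simp add: algebra_simps)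
  then have "\<bar>of_int (k - 1)\<bar> * L \<le> (1 / 2) * L" using L_pos by (simp add: abs_mult)
  then have "\<bar>real_of_int (k - 1)\<bar> \<le> 1 / 2" using L_pos by (metis mult_le_cancel_right_pos)
  then have "k = 1" by linarith
  have ang: "angle_between (p ! 1 - p ! 0) (tangent \<gamma> (C u)) = \<theta>"
    using bm_bounce(2)[OF \<theta>, of u] vx_Suc(1)[of u \<theta> 0] nth[of 1] nth[of 0] assms(1) by (simp add: tangent_eq A_C)
  have "fst ((billiard_lift \<gamma> 0 ^^ j) (C u, angle_between (p ! 1 - p ! 0) (tangent \<gamma> (C u)))) = C u + L"
    unfolding ang using lift_iter[OF \<theta>, of j "C u"] Ck \<open>k = 1\<close> by (simp add: A_C)
  then show "ccw_loop \<Omega> L \<gamma> j x p"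
    using p xy \<gamma>_C[of u] unfolding ccw_loop_def boundary_ccw_orbits_def by auto
qed

text \<open>The orbit is prolonged at both ends to the boundary: index 0 is the backward impact of
  the first link and \<open>Suc j\<close> the next impact. The reflections have the indices 1 to
  \<open>j\<close>, and \<open>x\<close> and \<open>y\<close> lie on the first and the last of
  \<open>j + 1\<close> full links.\<close>

lemma interior_ccw_iff:
  assumes "2 \<le> j" "x \<in> \<Omega>" "y \<in> \<Omega>"
  shows "p \<in> interior_ccw_orbits \<Omega> L \<gamma> j x y \<longleftrightarrow> (\<exists>u \<theta>. 0 < \<theta> \<and> \<theta> < pi \<and>
     x \<in> open_segment (\<Gamma> u) (\<Gamma> (vx u \<theta> 1)) \<and> y \<in> open_segment (\<Gamma> (vx u \<theta> j)) (\<Gamma> (vx u \<theta> (Suc j))) \<and>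
     \<bar>C (vx u \<theta> (Suc j)) - L - C (vx u \<theta> 1)\<bar> \<le> L / 2 \<and> p = x # map (\<lambda>i. \<Gamma> (vx u \<theta> (Suc i))) [0..<j] @ [y])"
proof
  assume "p \<in> interior_ccw_orbits \<Omega> L \<gamma> j x y"
  then obtain y' where p: "broken_geodesic \<Omega> \<gamma> p" "length p = j + 2" "hd p = x" "last p = y"
    and y': "y' \<in> frontier \<Omega>" "last p \<in> open_segment (last (butlast p)) y'"
    and rot: "one_ccw_rotation L \<gamma> j (p ! 1) (p ! 2 - p ! 1) y'"
    unfolding interior_ccw_orbits_def interior_orbit_def next_impact_def by auto
  have "p \<noteq> []" using p(2) by auto
  then have ends: "p ! 0 = x" "p ! Suc j = y" using p hd_conv_nth[of p] last_conv_nth[of p] by auto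
  have lb: "length (butlast p) = Suc j" using p(2) by simp
  have "last (butlast p) = p ! j" by (rule last_butlast_nth[OF lb])
  then have yseg: "y \<in> open_segment (p ! j) y'" using y' p(4) by simp
  obtain s t where st: "\<gamma> s = p ! 1" "\<gamma> t = y'" "\<bar>s - t\<bar> \<le> L / 2"
    "\<bar>fst ((billiard_lift \<gamma> 0 ^^ j) (s, angle_between (p ! 2 - p ! 1) (tangent \<gamma> s))) - t - L\<bar> \<le> L / 100"
    using rot unfolding one_ccw_rotation_def nearest_iff by auto
  define a where "a = A s"
  define \<theta> where "\<theta> = angle_between (p ! 2 - p ! 1) (cis a)"
  have a: "p ! 1 = \<Gamma> a" using st by (simp add: a_def \<gamma>_eq)
  have ne: "p ! Suc i \<noteq> p ! i" if "i \<le> j" for i using p that unfolding broken_geodesic_def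
    by (metis Suc_eq_plus1 add_2_eq_Suc' le_imp_less_Suc not_less_eq)
  have fr: "p ! Suc i \<in> frontier \<Omega>" if "i < j" for i using p that unfolding broken_geodesic_def by simp
  have \<theta>: "0 < \<theta>" "\<theta> < pi" using hit(1,2)[OF fr[of 1], of a \<theta>] ne[of 1] a assms(1) by (auto simp: \<theta>_def numeral_2_eq_2)
  have st': "p ! 1 = \<Gamma> a" "angle_between (p ! Suc 1 - p ! 1) (cis a) = \<theta>" using a by (auto simp: \<theta>_def numeral_2_eq_2)
  have ch: "p ! Suc n = \<Gamma> (vx a \<theta> n) \<and> angle_between (p ! Suc (Suc n) - p ! Suc n) (cis (vx a \<theta> n)) = ax a \<theta> n" if "n < j" for n
  proof -
    have "Suc (1 + n) < length p" using that p(2) by simp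
    from geodesic_chain[OF p(1) st' \<theta> this] show ?thesis unfolding plus_1_eq_Suc .
  qed
  obtain n where n: "j = Suc n" using assms(1) by (cases j) auto
  obtain l where l: "0 < l" "l < 1" "y = p ! j + of_real l * (y' - p ! j)" "p ! j \<noteq> y'"
    using yseg unfolding open_segment_param by blast
  have "n < j" using n by simp
  then have c: "p ! j = \<Gamma> (vx a \<theta> n)" "angle_between (y - p ! j) (cis (vx a \<theta> n)) = ax a \<theta> n"
    using ch[of n] ends(2) unfolding n by metis+
  have yl: "y - p ! j = of_real l * (y' - p ! j)" using l(3) by simp
  have "angle_between (y' - \<Gamma> (vx a \<theta> n)) (cis (vx a \<theta> n)) = ax a \<theta> n"
    using c(2)[unfolded yl, unfolded angle_between_scale[OF l(1)]] unfolding c(1) .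
  from hit(3)[OF y'(1) _ this] have y'v: "y' = \<Gamma> (vx a \<theta> j)" using l(4) c(1) unfolding n vx_Suc by metis
  \<comment> \<open>The backward prolongation: a link that reaches the first reflection point at the
    angle at which the orbit leaves it.\<close>
  obtain u where u: "0 < a - u" "a - u < 2 * pi" "ph u a = \<theta>" using ph_exists[OF \<theta>] by blast
  define \<theta>' where "\<theta>' = th u a"
  have \<theta>': "0 < \<theta>'" "\<theta>' < pi" using chord(3,4)[OF u(1,2)] by (auto simp: \<theta>'_def)
  have v1: "vx u \<theta>' 1 = a" "ax u \<theta>' 1 = \<theta>" using bm_chord[OF u(1,2)] u(3) vx_Suc[of u \<theta>' 0] by (simp_all add: \<theta>'_def)
  have vs: "vx u \<theta>' (Suc i) = vx a \<theta> i" for i using vx_add(1)[of u \<theta>' i 1] v1 by simp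
  have pm: "p = x # map (\<lambda>i. \<Gamma> (vx u \<theta>' (Suc i))) [0..<j] @ [y]"
  proof (rule nth_equalityI)
    fix i assume "i < length p"
    then have "i = 0 \<or> (\<exists>m<j. i = Suc m) \<or> i = Suc j" using p(2) by (cases i) auto
    then show "p ! i = (x # map (\<lambda>i. \<Gamma> (vx u \<theta>' (Suc i))) [0..<j] @ [y]) ! i" using ch ends vs by (auto simp: nth_append)
  qed (use p in simp)
  have yseg': "y \<in> open_segment (\<Gamma> (vx u \<theta>' j)) (\<Gamma> (vx u \<theta>' (Suc j)))"
    using yseg y'v ch[of n] n vs by simp
  have xseg: "x \<in> open_segment (\<Gamma> u) (\<Gamma> (vx u \<theta>' 1))"
  proof -
    have e: "\<gamma> s = p ! Suc 0" using st by simp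
    have "Suc (Suc 0) < length p" using p(2) assms(1) by simp
    then have "angle_between (p ! 0 - p ! Suc 0) (- tangent \<gamma> s) = angle_between (p ! Suc (Suc 0) - p ! Suc 0) (tangent \<gamma> s)"
      using p(1) e unfolding broken_geodesic_def by blast
    then have "angle_between (x - \<Gamma> a) (- cis a) = \<theta>" using ends a by (simp add: tangent_eq \<theta>_def a_def numeral_2_eq_2)
    then have ang: "angle_between (\<Gamma> a - x) (cis a) = \<theta>" using angle_between_minus[of "\<Gamma> a - x" "cis a"] by simp
    have "Im (cis (-a) * (\<Gamma> a - x)) < 0" using inner[OF assms(2), of a] by (simp add: algebra_simps)
    note pr = polar_right[OF this, unfolded ang]
    define r where "r = norm (\<Gamma> a - x)"
    define h where "h = H u a"
    have r: "\<Gamma> a - x = of_real r * cis (a - \<theta>)" "0 < r" using pr by (auto simp: r_def)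
    have h: "\<Gamma> a - \<Gamma> u = of_real h * cis (a - \<theta>)" "0 < h" using chord(2,7)[OF u(1,2)] u(3) by (auto simp: h_def)
    have ad: "a - \<theta> = u + \<theta>'" using chord(8)[OF u(1,2)] u(3) by (simp add: \<theta>'_def)
    have xu: "x - \<Gamma> u = of_real (h - r) * cis (u + \<theta>')"
    proof -
      have "x - \<Gamma> u = (\<Gamma> a - \<Gamma> u) - (\<Gamma> a - x)" by simp
      then show ?thesis unfolding r h ad by (simp add: algebra_simps)
    qed
    \<comment> \<open>So far \<open>x\<close> is known to lie on the line of the prolonged link,
      before \<open>\<Gamma> a\<close>. Lying strictly to the left of the tangent at
      \<open>\<Gamma> u\<close>, it must come after \<open>\<Gamma> u\<close>.\<close>
    have "0 < Im (cis (-u) * (x - \<Gamma> u))" by (rule inner[OF assms(2)])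
    also have "cis (-u) * (x - \<Gamma> u) = of_real (h - r) * cis \<theta>'" unfolding xu by (simp add: mult.left_commute cis_mult)
    finally have "0 < (h - r) * sin \<theta>'" by simp
    then have rh: "r < h" using sin_gt_zero[OF \<theta>'] by (simp add: zero_less_mult_iff)
    have "of_real ((h - r) / h) * (\<Gamma> a - \<Gamma> u) = x - \<Gamma> u" unfolding h(1) ad xu using h(2) by simp
    then have "x = \<Gamma> u + of_real ((h - r) / h) * (\<Gamma> a - \<Gamma> u)" by simp
    moreover have "0 < (h - r) / h" "(h - r) / h < 1" using rh r(2) h(2) by auto
    moreover have "\<Gamma> u \<noteq> \<Gamma> a" using h by auto
    ultimately show ?thesis unfolding open_segment_param v1 by blast
  qed
  have "\<bar>C (vx a \<theta> j) - t - L\<bar> \<le> L / 100" using st(4) lift_iter[OF \<theta>, of j s] by (simp add: tangent_eq \<theta>_def a_def)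
  then have "C (vx a \<theta> j) = t + L" using y'v st(2) by (intro rotation_number_one) auto
  moreover have "C a = s" by (simp add: a_def C_A)
  ultimately have "\<bar>C (vx u \<theta>' (Suc j)) - L - C (vx u \<theta>' 1)\<bar> \<le> L / 2" using st(3) vs v1 by (simp add: abs_minus_commute)
  then show "\<exists>u \<theta>. 0 < \<theta> \<and> \<theta> < pi \<and>
     x \<in> open_segment (\<Gamma> u) (\<Gamma> (vx u \<theta> 1)) \<and> y \<in> open_segment (\<Gamma> (vx u \<theta> j)) (\<Gamma> (vx u \<theta> (Suc j))) \<and>
     \<bar>C (vx u \<theta> (Suc j)) - L - C (vx u \<theta> 1)\<bar> \<le> L / 2 \<and> p = x # map (\<lambda>i. \<Gamma> (vx u \<theta> (Suc i))) [0..<j] @ [y]"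
    using \<theta>' xseg yseg' pm by blast
next
  assume "\<exists>u \<theta>. 0 < \<theta> \<and> \<theta> < pi \<and>
     x \<in> open_segment (\<Gamma> u) (\<Gamma> (vx u \<theta> 1)) \<and> y \<in> open_segment (\<Gamma> (vx u \<theta> j)) (\<Gamma> (vx u \<theta> (Suc j))) \<and>
     \<bar>C (vx u \<theta> (Suc j)) - L - C (vx u \<theta> 1)\<bar> \<le> L / 2 \<and> p = x # map (\<lambda>i. \<Gamma> (vx u \<theta> (Suc i))) [0..<j] @ [y]"
  then obtain u \<theta> where \<theta>: "0 < \<theta>" "\<theta> < pi" and xs: "x \<in> open_segment (\<Gamma> u) (\<Gamma> (vx u \<theta> 1))"
    and ys: "y \<in> open_segment (\<Gamma> (vx u \<theta> j)) (\<Gamma> (vx u \<theta> (Suc j)))"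
    and near: "\<bar>C (vx u \<theta> (Suc j)) - L - C (vx u \<theta> 1)\<bar> \<le> L / 2"
    and pm: "p = x # map (\<lambda>i. \<Gamma> (vx u \<theta> (Suc i))) [0..<j] @ [y]" by blast
  have len: "length p = j + 2" by (simp add: pm)
  have nth: "p ! Suc i = \<Gamma> (vx u \<theta> (Suc i))" if "i < j" for i using that unfolding pm by (simp add: nth_append)
  have p0: "p ! 0 = x" "p ! Suc j = y" unfolding pm by (simp_all add: nth_append)
  obtain j' where j': "j = Suc j'" "1 \<le> j'" using assms(1) by (cases j) auto
  have "broken_geodesic \<Omega> \<gamma> p"
  proof (rule geodesicI[OF \<theta>])
    fix i assume "Suc i < length p"
    then consider "i = 0" | "i = j" | i' where "i = Suc i'" "i < j" using len by (cases i) force+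
    then show "\<exists>r>0. p ! Suc i - p ! i = of_real r * cis (vx u \<theta> i + ax u \<theta> i)"
    proof cases
      case 1
      obtain t where t: "0 < t" "t < 1" "x = \<Gamma> u + of_real t * (\<Gamma> (vx u \<theta> 1) - \<Gamma> u)" using xs unfolding open_segment_param by blast
      have "\<Gamma> (vx u \<theta> 1) - x = of_real (1 - t) * (\<Gamma> (vx u \<theta> (Suc 0)) - \<Gamma> (vx u \<theta> 0))" using t(3) by (simp add: algebra_simps)
      also have "\<dots> = of_real ((1 - t) * H (vx u \<theta> 0) (vx u \<theta> (Suc 0))) * cis (vx u \<theta> 0 + ax u \<theta> 0)"
        unfolding orbit_chord(1)[OF \<theta>] by simp
      finally show ?thesis using 1 nth[of 0] p0 j' t orbit_chord(2)[OF \<theta>, of u 0]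
        by (intro exI[of _ "(1 - t) * H (vx u \<theta> 0) (vx u \<theta> (Suc 0))"]) auto
    next
      case 2
      obtain t where t: "0 < t" "t < 1" "y = \<Gamma> (vx u \<theta> j) + of_real t * (\<Gamma> (vx u \<theta> (Suc j)) - \<Gamma> (vx u \<theta> j))"
        using ys unfolding open_segment_param by blast
      have "y - \<Gamma> (vx u \<theta> j) = of_real (t * H (vx u \<theta> j) (vx u \<theta> (Suc j))) * cis (vx u \<theta> j + ax u \<theta> j)"
        using t(3) unfolding orbit_chord(1)[OF \<theta>] by simp
      then show ?thesis using 2 nth[of j'] p0 j' t orbit_chord(2)[OF \<theta>, of u j]
        by (intro exI[of _ "t * H (vx u \<theta> j) (vx u \<theta> (Suc j))"]) auto
    next
      case 3
      then show ?thesis using nth[of i'] nth[of i] orbit_chord(1,2)[OF \<theta>, of u i] by auto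
    qed
  next
    fix i assume "Suc (Suc i) < length p"
    then show "p ! Suc i = \<Gamma> (vx u \<theta> (Suc i))" using nth len by simp
  next
    have "range \<Gamma> \<subseteq> closure \<Omega>" using frontier_eq by (auto simp: frontier_def)
    then show "set p \<subseteq> closure \<Omega>" unfolding pm using assms closure_subset by auto
  qed
  moreover have "hd p = x" "last p = y" by (auto simp: pm)
  moreover have "next_impact \<Omega> p (\<Gamma> (vx u \<theta> (Suc j)))"
  proof -
    have lb: "length (butlast p) = Suc j" using len by simp
    have "last (butlast p) = p ! j" by (rule last_butlast_nth[OF lb])
    then show ?thesis unfolding next_impact_def using ys nth[of j'] j' \<open>last p = y\<close> by (simp add: frontier_eq)
  qed
  moreover have "one_ccw_rotation L \<gamma> j (p ! 1) (p ! 2 - p ! 1) (\<Gamma> (vx u \<theta> (Suc j)))"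
    unfolding one_ccw_rotation_def
  proof (rule exI[of _ "C (vx u \<theta> 1)"], rule exI[of _ "C (vx u \<theta> (Suc j)) - L"], intro conjI)
    show "\<gamma> (C (vx u \<theta> 1)) = p ! 1" using nth[of 0] j' by (simp add: \<gamma>_C)
    show "\<gamma> (C (vx u \<theta> (Suc j)) - L) = \<Gamma> (vx u \<theta> (Suc j))"
      using C_shift[of "vx u \<theta> (Suc j)" "-1"] \<gamma>_C[of "vx u \<theta> (Suc j) + 2 * pi * of_int (- 1)"] \<Gamma>_period_int[of "vx u \<theta> (Suc j)" "-1"] by simp
    show "nearest_representatives L (C (vx u \<theta> 1)) (C (vx u \<theta> (Suc j)) - L)" using near unfolding nearest_iff by (simp add: abs_minus_commute)
    let ?\<theta> = "ax u \<theta> 1"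
    have \<theta>1: "0 < ?\<theta>" "?\<theta> < pi" using orbit_link(1,2)[OF \<theta>] by auto
    have ang: "angle_between (p ! 2 - p ! 1) (tangent \<gamma> (C (vx u \<theta> 1))) = ?\<theta>"
      using bm_bounce(2)[OF \<theta>1, of "vx u \<theta> 1"] vx_Suc(1)[of u \<theta> 1] nth[of 0] nth[of 1] j' by (simp add: tangent_eq A_C numeral_2_eq_2)
    have "vx (vx u \<theta> 1) ?\<theta> j = vx u \<theta> (Suc j)" using vx_add(1)[of u \<theta> j 1] by simp
    then show "\<bar>fst ((billiard_lift \<gamma> 0 ^^ j) (C (vx u \<theta> 1), angle_between (p ! 2 - p ! 1) (tangent \<gamma> (C (vx u \<theta> 1))))) - (C (vx u \<theta> (Suc j)) - L) - L\<bar> \<le> L / 100"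
      unfolding ang using lift_iter[OF \<theta>1, of j "C (vx u \<theta> 1)"] L_pos by (simp add: A_C)
  qed
  ultimately show "p \<in> interior_ccw_orbits \<Omega> L \<gamma> j x y"
    using len unfolding interior_ccw_orbits_def interior_orbit_def by auto
qed

end

section \<open>Links of an orbit of about one turn have size of order 1/m\<close>

context twist_links
begin

lemma half_le: "x \<le> 2 * y \<Longrightarrow> x / 2 \<le> (y::real)" by simp

lemma links_total:
  assumes "a \<le> b" "\<And>i. a \<le> i \<Longrightarrow> i < b \<Longrightarrow> \<psi> (Suc i) - \<psi> i \<le> (M::real)"
  shows "\<psi> b - \<psi> a \<le> real (b - a) * M"
  using assms
proof (induction b rule: dec_induct)
  case (step n)
  have "\<psi> n - \<psi> a \<le> real (n - a) * M" using step by auto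
  moreover have "\<psi> (Suc n) - \<psi> n \<le> M" using step by auto
  ultimately show ?case using step(1) by (simp add: Suc_diff_le algebra_simps)
qed simp

lemma links_total_ge:
  assumes "a \<le> b" "\<And>i. a \<le> i \<Longrightarrow> i < b \<Longrightarrow> (M::real) \<le> \<psi> (Suc i) - \<psi> i"
  shows "real (b - a) * M \<le> \<psi> b - \<psi> a"
proof -
  have "- \<psi> b - - \<psi> a \<le> real (b - a) * (- M)"   proof (rule links_total[OF assms(1)])
    fix i assume "a \<le> i" "i < b"
    then show "- \<psi> (Suc i) - - \<psi> i \<le> - M" using assms(2)[of i] by simp
  qed
  then show ?thesis by simp
qed

text \<open>Averaging: at least half of the links share a total length between
  \<open>\<delta>\<close> and \<open>4 * pi\<close>, so one of them has length at most
  \<open>8 * pi / m\<close> and one at least \<open>\<delta> / m\<close>;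
  \<open>links_comparable\<close> spreads both bounds over the chain. The window from
  \<open>a\<close> to \<open>b\<close> is free because a rotation condition may concern only part of
  the chain.\<close>

lemma orbit_scale:
  assumes "0 < \<delta>"
  shows "\<exists>k1>0. \<exists>k2. \<exists>m0. \<forall>m\<ge>m0. \<forall>a b. a < b \<longrightarrow> b \<le> m \<longrightarrow> m \<le> 2 * (b - a) \<longrightarrow> (\<forall>\<psi>. links \<psi> m \<longrightarrow>
     \<delta> \<le> \<psi> b - \<psi> a \<longrightarrow> \<psi> b - \<psi> a \<le> 4 * pi \<longrightarrow>
     (\<forall>i<m. \<psi> (Suc i) - \<psi> i \<le> d \<and> k1 / real m \<le> Y (\<psi> i) (\<psi> (Suc i)) \<and> Y (\<psi> i) (\<psi> (Suc i)) \<le> k2 / real m))"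
proof -
  \<comment> \<open>Twice the bound \<open>C * (8 * pi / m)\<close> for \<open>Y\<close> at a short
    link, the factor 2 being the loss in \<open>links_comparable\<close>.\<close>
  define K where "K = 16 * pi * C"
  have K: "0 < K" using C_pos by (simp add: K_def)
  obtain m1 where m1: "\<forall>m\<ge>m1. \<forall>\<psi>. links \<psi> m \<longrightarrow> (\<forall>k<m. Y (\<psi> k) (\<psi> (Suc k)) \<le> K / real m \<longrightarrow>
           (\<forall>i<m. \<psi> (Suc i) - \<psi> i \<le> d \<and> Y (\<psi> i) (\<psi> (Suc i)) \<le> 2 * Y (\<psi> k) (\<psi> (Suc k))))"
    using links_comparable[OF K] by blast
  obtain m2 :: nat where m2: "real m2 \<ge> 8 * pi / d + 1" using real_arch_simple by blast
  define k1 where "k1 = c * \<delta> / 2"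
  have k1: "0 < k1" using c_pos assms by (simp add: k1_def)
  have "\<psi> (Suc i) - \<psi> i \<le> d \<and> k1 / real m \<le> Y (\<psi> i) (\<psi> (Suc i)) \<and> Y (\<psi> i) (\<psi> (Suc i)) \<le> K / real m"
    if m: "m \<ge> max m1 m2" and ab: "a < b" "b \<le> m" "m \<le> 2 * (b - a)" and L: "links \<psi> m"
      and T: "\<delta> \<le> \<psi> b - \<psi> a" "\<psi> b - \<psi> a \<le> 4 * pi" and i: "i < m" for m a b \<psi> i
  proof -
    have "0 \<le> 8 * pi / d" using d_pos by simp
    then have mr: "real m \<ge> 8 * pi / d" "0 < real m" using m m2 by (auto simp: field_simps)
    have dp: "0 < \<psi> (Suc i) - \<psi> i" if "i < m" for i using L that unfolding links_def by auto
    have n: "0 < real (b - a)" "real m \<le> 2 * real (b - a)" "real (b - a) \<le> real m" using ab by auto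
    have "\<exists>k\<ge>a. k < b \<and> \<psi> (Suc k) - \<psi> k \<le> 8 * pi / real m"
    proof (rule ccontr)
      assume "\<not> ?thesis"
      then have c: "8 * pi / real m < \<psi> (Suc k) - \<psi> k" if "a \<le> k" "k < b" for k using that by force
      have "real (b - a) * (8 * pi / real m) \<le> \<psi> b - \<psi> a" by (rule links_total_ge) (use ab c in \<open>auto intro!: less_imp_le\<close>)
      moreover have "4 * pi \<le> real (b - a) * (8 * pi / real m)"
      proof -
        have "4 * pi * real m \<le> 4 * pi * (2 * real (b - a))" using n(2) by (intro mult_left_mono) auto
        then have "4 * pi * real m \<le> (real (b - a) * (8 * pi))" by (simp only: mult_ac)
        then have "4 * pi \<le> (real (b - a) * (8 * pi)) / real m" using mr(2) by (subst le_divide_eq) auto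
        then show ?thesis by simp
      qed
      ultimately have eq: "\<psi> b - \<psi> a = real (b - a) * (8 * pi / real m)" using T by linarith
      have "\<psi> (b - 1) - \<psi> a \<ge> real (b - 1 - a) * (8 * pi / real m)" by (rule links_total_ge) (use ab c in \<open>auto intro!: less_imp_le\<close>)
      moreover have "\<psi> b - \<psi> (b - 1) > 8 * pi / real m" using c[of "b - 1"] ab by auto
      moreover have n1: "real (b - a) = real (b - 1 - a) + 1" using ab by auto
      have "real (b - a) * (8 * pi / real m) = real (b - 1 - a) * (8 * pi / real m) + 8 * pi / real m"
        unfolding n1 by (simp only: distrib_right mult_1)
      ultimately show False using eq by linarith
    qed
    then obtain k where k: "a \<le> k" "k < b" "\<psi> (Suc k) - \<psi> k \<le> 8 * pi / real m" by blast
    have km: "k < m" using k ab by auto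
    have "8 * pi / real m \<le> d" using mr d_pos by (simp add: field_simps)
    then have "Y (\<psi> k) (\<psi> (Suc k)) \<le> C * (\<psi> (Suc k) - \<psi> k)" using k dp[OF km] by (intro Y_upper) auto
    also have "\<dots> \<le> C * (8 * pi / real m)" using k C_pos by (intro mult_left_mono) auto
    finally have "Y (\<psi> k) (\<psi> (Suc k)) \<le> C * (8 * pi / real m)" .
    moreover have "K / real m = 2 * (C * (8 * pi / real m))" by (simp add: K_def)
    ultimately have Yk: "2 * Y (\<psi> k) (\<psi> (Suc k)) \<le> K / real m" by linarith
    have Yk0: "0 \<le> Y (\<psi> k) (\<psi> (Suc k))"
      using Y_lower[OF dp[OF km]] k(3) \<open>8 * pi / real m \<le> d\<close> c_pos dp[OF km] by (smt (verit) mult_pos_pos)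
    have all: "\<psi> (Suc i) - \<psi> i \<le> d \<and> Y (\<psi> i) (\<psi> (Suc i)) \<le> K / real m" if "i < m" for i
    proof -
      have "Y (\<psi> k) (\<psi> (Suc k)) \<le> K / real m" using Yk Yk0 by linarith
      then have "\<psi> (Suc i) - \<psi> i \<le> d \<and> Y (\<psi> i) (\<psi> (Suc i)) \<le> 2 * Y (\<psi> k) (\<psi> (Suc k))"
        using m1 m L km that by (meson max.bounded_iff)
      then show ?thesis using Yk by linarith
    qed
    have "\<exists>k\<ge>a. k < b \<and> \<delta> / real m \<le> \<psi> (Suc k) - \<psi> k"
    proof (rule ccontr)
      assume "\<not> ?thesis"
      then have c: "\<psi> (Suc k) - \<psi> k < \<delta> / real m" if "a \<le> k" "k < b" for k using that by force
      have "\<psi> (b - 1) - \<psi> a \<le> real (b - 1 - a) * (\<delta> / real m)" by (rule links_total) (use ab c in \<open>auto intro!: less_imp_le\<close>)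
      moreover have "\<psi> b - \<psi> (b - 1) < \<delta> / real m" using c[of "b - 1"] ab by auto
      moreover have n1: "real (b - a) = real (b - 1 - a) + 1" using ab by auto
      have "real (b - a) * (\<delta> / real m) = real (b - 1 - a) * (\<delta> / real m) + \<delta> / real m"
        unfolding n1 by (simp only: distrib_right mult_1)
      ultimately have "\<psi> b - \<psi> a < real (b - a) * (\<delta> / real m)" by linarith
      also have "\<dots> \<le> real m * (\<delta> / real m)" using n(3) mr(2) assms by (intro mult_right_mono) auto
      also have "\<dots> = \<delta>" using mr(2) by simp
      finally show False using T by linarith
    qed
    then obtain h where h: "a \<le> h" "h < b" "\<delta> / real m \<le> \<psi> (Suc h) - \<psi> h" by blast
    have hm: "h < m" using h ab by auto
    have "c * (\<delta> / real m) \<le> c * (\<psi> (Suc h) - \<psi> h)" using h c_pos by (intro mult_left_mono) auto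
    also have "\<dots> \<le> Y (\<psi> h) (\<psi> (Suc h))" using all[OF hm] dp[OF hm] by (intro Y_lower) auto
    also have "\<dots> \<le> 2 * Y (\<psi> i) (\<psi> (Suc i))" using m1 m L hm i all[OF i] by (meson max.bounded_iff)
    finally have "c * (\<delta> / real m) \<le> 2 * Y (\<psi> i) (\<psi> (Suc i))" .
    then have "c * (\<delta> / real m) / 2 \<le> Y (\<psi> i) (\<psi> (Suc i))" by (rule half_le)
    moreover have "k1 / real m = c * (\<delta> / real m) / 2" by (simp add: k1_def)
    ultimately have "k1 / real m \<le> Y (\<psi> i) (\<psi> (Suc i))" by (simp only:)
    then show ?thesis using all[OF i] by blast
  qed
  then show ?thesis using k1 by blast
qed

end

section \<open>Rays through a point near the boundary\<close>

context gauss_curve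
begin

lemma \<Gamma>_lipschitz: "norm (\<Gamma> a - \<Gamma> b) \<le> G ^ 3 * \<bar>a - b\<bar>"
proof -
  have "norm (\<Gamma> a - \<Gamma> b) \<le> G ^ 3 * norm (a - b)"
  proof (rule differentiable_bound[where S=UNIV])
    fix x show "(\<Gamma> has_derivative (\<lambda>h. h *\<^sub>R ((g x ^ 3) *\<^sub>R cis x))) (at x within UNIV)"
      using \<Gamma>_deriv[of x] by (simp add: has_vector_derivative_def)
    show "onorm (\<lambda>h. h *\<^sub>R ((g x ^ 3) *\<^sub>R cis x)) \<le> G ^ 3"
    proof (rule onorm_le)
      fix h :: real
      have "g x ^ 3 \<le> G ^ 3" using power_mono[OF g_le] g_pos less_imp_le by blast
      then show "norm (h *\<^sub>R ((g x ^ 3) *\<^sub>R cis x)) \<le> G ^ 3 * norm h"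
        using g_pos[of x] by (simp add: abs_mult mult_left_mono mult.commute[of _ "\<bar>h\<bar>"])
    qed
  qed auto
  then show ?thesis by simp
qed

lemma sin_ge_half: assumes "0 \<le> z" "z \<le> 1 / 2" shows "z / 2 \<le> sin (z::real)"
proof -
  have "z ^ 3 \<le> z * (1 / 2)\<^sup>2" using mult_left_mono[OF power_mono[OF assms(2,1), of 2] assms(1)] by (simp add: power3_eq_cube power2_eq_square)
  then show ?thesis using sin_taylor[of z] assms by (simp add: abs_le_iff power2_eq_square)
qed

lemma F_quadratic: assumes "\<bar>u\<bar> \<le> 1" shows "(g0 ^ 3 / 8) * u\<^sup>2 \<le> F q u"
proof -
  have "\<bar>u / 2\<bar> / 2 \<le> sin \<bar>u / 2\<bar>" using assms by (intro sin_ge_half) auto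
  then have "(\<bar>u / 2\<bar> / 2)\<^sup>2 \<le> (sin \<bar>u / 2\<bar>)\<^sup>2" by (intro power_mono) auto
  then have "u\<^sup>2 / 16 \<le> (sin (u / 2))\<^sup>2" by (simp add: power_divide abs_if split: if_splits)
  then have "u\<^sup>2 / 8 \<le> 1 - cos u" using cos_double_sin[of "u / 2"] by simp
  then have "g0 ^ 3 * (u\<^sup>2 / 8) \<le> g0 ^ 3 * (1 - cos u)" using g0_pos by (intro mult_left_mono) auto
  also have "\<dots> \<le> F q u" using assms pi_gt3 by (intro F_ge_cos) auto
  finally show ?thesis by simp
qed

text \<open>After reduction to \<open>\<bar>u\<bar> \<le> pi\<close> by full turns, the height
  \<open>F\<close> excludes \<open>\<bar>u\<bar> > 1\<close>, and the lower bound for short chords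
  then gives the linear estimate.\<close>

lemma near_parameter:
  assumes "norm (\<Gamma> a - \<Gamma> q) < g0 ^ 3 / 8"
  obtains k :: int where "\<bar>a - (q + 2 * pi * of_int k)\<bar> \<le> 1" "\<bar>a - (q + 2 * pi * of_int k)\<bar> \<le> 2 / g0 ^ 3 * norm (\<Gamma> a - \<Gamma> q)"
proof -
  define k where "k = round ((a - q) / (2 * pi))"
  define q' where "q' = q + 2 * pi * of_int k"
  define u where "u = a - q'"
  have q': "\<Gamma> q' = \<Gamma> q" by (simp add: q'_def \<Gamma>_period_int)
  have "\<bar>of_int k - (a - q) / (2 * pi)\<bar> \<le> 1 / 2" unfolding k_def by (rule of_int_round_abs_le)
  then have "\<bar>2 * pi * (of_int k - (a - q) / (2 * pi))\<bar> \<le> 2 * pi * (1 / 2)"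
    unfolding abs_mult using pi_gt_zero by (intro mult_mono) auto
  moreover have "2 * pi * (of_int k - (a - q) / (2 * pi)) = - u" by (simp add: u_def q'_def field_simps)
  ultimately have upi: "\<bar>u\<bar> \<le> pi" by simp
  have g3: "0 < g0 ^ 3" using g0_pos by simp
  have Fle: "F q' u \<le> norm (\<Gamma> a - \<Gamma> q)"
  proof -
    have "F q' u \<le> norm (cis (- q') * (\<Gamma> (q' + u) - \<Gamma> q'))" unfolding F_def using abs_Im_le_cmod by (meson abs_le_D1)
    then show ?thesis by (simp add: norm_mult u_def q')
  qed
  have u1: "\<bar>u\<bar> \<le> 1"
  proof (rule ccontr)
    assume "\<not> \<bar>u\<bar> \<le> 1"
    then have "cos \<bar>u\<bar> \<le> cos 1" using upi by (intro cos_monotone_0_pi_le) auto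
    moreover have "1 / 8 \<le> 1 - cos (1::real)" using cos_double_sin[of "1/2::real"] sin_ge_half[of "1/2"] power_mono[of "1/4" "sin (1/2::real)" 2] by (simp add: power2_eq_square)
    ultimately have "1 / 8 \<le> 1 - cos u" by simp
    then have "g0 ^ 3 * (1 / 8) \<le> g0 ^ 3 * (1 - cos u)" using g3 by (intro mult_left_mono) auto
    also have "\<dots> \<le> F q' u" by (rule F_ge_cos[OF upi])
    finally show False using Fle assms by simp
  qed
  have "g0 ^ 3 / 2 * \<bar>u\<bar> \<le> norm (\<Gamma> a - \<Gamma> q)"
  proof (cases u "0::real" rule: linorder_cases)
    case less
    then have "g0 ^ 3 / 2 * (- u) \<le> Hf a (- u)" using u1 by (intro Hf_lower) auto
    then show ?thesis using less by (simp add: Hf_def H_def u_def q' norm_minus_commute)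
  next
    case greater
    then have "g0 ^ 3 / 2 * u \<le> Hf q' u" using u1 by (intro Hf_lower) auto
    then show ?thesis using greater by (simp add: Hf_def H_def u_def q')
  qed simp
  then have "\<bar>u\<bar> \<le> 2 / g0 ^ 3 * norm (\<Gamma> a - \<Gamma> q)" using g3 by (simp add: field_simps)
  then show ?thesis using that[of k] u1 by (simp add: u_def q'_def)
qed

text \<open>\<open>foc s x u \<theta> = 0\<close> says that \<open>x\<close> lies on the line that leaves (\<open>s = 1\<close>) or reaches (\<open>s = - 1\<close>)
  \<open>\<Gamma> u\<close> at the angle \<open>\<theta>\<close>.\<close>

definition foc :: "real \<Rightarrow> complex \<Rightarrow> real \<Rightarrow> real \<Rightarrow> real" where
  "foc s x u \<theta> = Im (cis (- (u + s * \<theta>)) * (x - \<Gamma> u))"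

lemma foc_deriv:
  fixes u \<theta> p e r s :: real
  defines "U \<equiv> \<lambda>r. u + r * p" and "T \<equiv> \<lambda>r. \<theta> + r * e"
  assumes s: "s = 1 \<or> s = -1"
  shows "((\<lambda>r. foc s x (U r) (T r)) has_real_derivative
    p * g (U r) ^ 3 * (s * sin (T r)) - (p + s * e) * Re (cis (- (U r + s * T r)) * (x - \<Gamma> (U r)))) (at r)"
proof -
  let ?a = "\<lambda>r. - (U r + s * T r)"
  have da: "(?a has_real_derivative - (p + s * e)) (at r)"
    unfolding U_def T_def by (auto intro!: derivative_eq_intros simp: algebra_simps)
  have dU: "(U has_vector_derivative p) (at r)" unfolding U_def by (auto intro!: derivative_eq_intros)
  have d1: "((\<lambda>r. x - \<Gamma> (U r)) has_vector_derivative 0 - p *\<^sub>R ((g (U r) ^ 3) *\<^sub>R cis (U r))) (at r)"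
    using vector_diff_chain_at[OF dU \<Gamma>_deriv] by (intro has_vector_derivative_diff has_vector_derivative_const) (simp add: o_def)
  note D = bounded_linear.has_vector_derivative[OF bounded_linear_Im has_vector_derivative_mult[OF has_vector_derivative_cis_comp[OF da] d1]]
  have c: "cis (?a r) * cis (U r) = cis (- (s * T r))" by (simp add: cis_mult)
  have "cis (?a r) * (0 - p *\<^sub>R ((g (U r) ^ 3) *\<^sub>R cis (U r))) = of_real (- (p * g (U r) ^ 3)) * (cis (?a r) * cis (U r))"
    by (simp add: scaleR_conv_of_real algebra_simps)
  then have "Im (cis (?a r) * (0 - p *\<^sub>R ((g (U r) ^ 3) *\<^sub>R cis (U r)))) = p * g (U r) ^ 3 * (s * sin (T r))"
    unfolding c using s by auto
  moreover have "Im ((- (p + s * e)) *\<^sub>R (\<i> * cis (?a r)) * (x - \<Gamma> (U r))) = - ((p + s * e) * Re (cis (?a r) * (x - \<Gamma> (U r))))"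
    by (simp add: scaleR_conv_of_real algebra_simps)
  ultimately have E: "Im (cis (?a r) * (0 - p *\<^sub>R ((g (U r) ^ 3) *\<^sub>R cis (U r))) + (- (p + s * e)) *\<^sub>R (\<i> * cis (?a r)) * (x - \<Gamma> (U r)))
     = p * g (U r) ^ 3 * (s * sin (T r)) - (p + s * e) * Re (cis (- (U r + s * T r)) * (x - \<Gamma> (U r)))"
    by (simp only: plus_complex.sel)
  show ?thesis using D unfolding foc_def has_real_derivative_iff_has_vector_derivative E .
qed

lemma foc_bound: "\<bar>foc s x u \<theta> - foc s z u \<theta>\<bar> \<le> norm (x - z)"
proof -
  have "foc s x u \<theta> - foc s z u \<theta> = Im (cis (- (u + s * \<theta>)) * (x - z))" by (simp add: foc_def algebra_simps)
  also have "\<bar>\<dots>\<bar> \<le> norm (cis (- (u + s * \<theta>)) * (x - z))" by (rule abs_Im_le_cmod)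
  finally show ?thesis by (simp add: norm_mult)
qed

lemma foc_cont: "continuous_on S a \<Longrightarrow> continuous_on S b \<Longrightarrow> continuous_on S (\<lambda>z. foc s x (a z) (b z))"
proof -
  assume ab: "continuous_on S a" "continuous_on S b"
  have "continuous_on UNIV \<Gamma>"
    by (rule continuous_at_imp_continuous_on) (use \<Gamma>_deriv has_vector_derivative_continuous in blast)
  from continuous_on_compose2[OF this ab(1)] have c: "continuous_on S (\<lambda>z. \<Gamma> (a z))" by simp
  show ?thesis unfolding foc_def by (intro continuous_intros c ab)
qed

text \<open>The vertices from which the point \<open>x\<close>, at depth \<open>O(j\<^sup>-\<^sup>4)\<close>, is seen at an angle of order \<open>1/j\<close>
  form a nearly vertical curve in the phase space.\<close>

lemma foc_vertical:
  assumes "0 < k1" "0 < k2"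
  shows "\<exists>M. 0 < M \<and> (\<exists>j0. \<forall>j\<ge>j0. \<forall>s x q u v \<theta> \<phi>. (s = 1 \<or> s = -1) \<longrightarrow> norm (x - \<Gamma> q) \<le> 1 / real j ^ 4 \<longrightarrow>
    \<bar>u - q\<bar> \<le> 1 / real j ^ 3 \<longrightarrow> \<bar>v - q\<bar> \<le> 1 / real j ^ 3 \<longrightarrow>
    k1 / real j \<le> \<theta> \<longrightarrow> \<theta> \<le> k2 / real j \<longrightarrow> k1 / real j \<le> \<phi> \<longrightarrow> \<phi> \<le> k2 / real j \<longrightarrow>
    foc s x u \<theta> = 0 \<longrightarrow> foc s x v \<phi> = 0 \<longrightarrow>
    \<bar>v - u\<bar> \<le> M / real j ^ 2 * \<bar>\<phi> - \<theta>\<bar> \<and> (\<theta> \<le> \<phi> \<longrightarrow> g0 / 2 * (\<phi> - \<theta>) \<le> g v * \<phi> - g u * \<theta>))"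
proof -
  define Q where "Q = 1 + G ^ 3"
  have Q: "0 < Q" using G_pos by (simp add: Q_def add_pos_pos)
  define m where "m = g0 ^ 3 * k1"
  have m: "0 < m" using g0_pos assms by (simp add: m_def)
  define M where "M = 4 * Q / m"
  have M: "0 < M" using Q m by (simp add: M_def)
  obtain j0 :: nat where j0: "real j0 \<ge> 2 * k2 + 4 * Q / m + 2 * k2 * G * M / g0 + 1" using real_arch_simple by blast
  have "\<bar>v - u\<bar> \<le> M / real j ^ 2 * \<bar>\<phi> - \<theta>\<bar> \<and> (\<theta> \<le> \<phi> \<longrightarrow> g0 / 2 * (\<phi> - \<theta>) \<le> g v * \<phi> - g u * \<theta>)"
    if j: "j \<ge> j0" and s: "s = 1 \<or> s = -1" and x: "norm (x - \<Gamma> q) \<le> 1 / real j ^ 4" and uv: "\<bar>u - q\<bar> \<le> 1 / real j ^ 3" "\<bar>v - q\<bar> \<le> 1 / real j ^ 3"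
      and ang: "k1 / real j \<le> \<theta>" "\<theta> \<le> k2 / real j" "k1 / real j \<le> \<phi>" "\<phi> \<le> k2 / real j" and f: "foc s x u \<theta> = 0" "foc s x v \<phi> = 0"
    for j s x q u v \<theta> \<phi>
  proof -
    define N where "N = real j"
    have nn: "0 \<le> 2 * k2" "0 \<le> 4 * Q / m" "0 \<le> 2 * k2 * G * M / g0" using assms Q m M G_pos g0_pos by auto
    have N: "2 * k2 \<le> N" "4 * Q / m \<le> N" "2 * k2 * G * M / g0 \<le> N" "1 \<le> N" using j j0 nn unfolding N_def by linarith+
    then have N0: "0 < N" by linarith
    define p where "p = v - u"
    define e where "e = \<phi> - \<theta>"
    let ?U = "\<lambda>r. u + r * p" and ?T = "\<lambda>r. \<theta> + r * e"
    let ?R = "\<lambda>r. Re (cis (- (?U r + s * ?T r)) * (x - \<Gamma> (?U r)))"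
    \<comment> \<open>Mean value theorem between the two phase points. Moving the vertex by
      \<open>p\<close> counts with the weight \<open>g ^ 3 * sin\<close>, of order
      \<open>1 / N\<close>; turning the line counts with the distance of \<open>x\<close> from the
      vertex, of order \<open>N^-3\<close>. Their ratio is the slope \<open>N^-2\<close>.\<close>
    obtain z where z: "0 < z" "z < 1" and z0: "p * g (?U z) ^ 3 * (s * sin (?T z)) - (p + s * e) * ?R z = 0"
    proof -
      have "\<exists>z>0. z < 1 \<and> foc s x (?U 1) (?T 1) - foc s x (?U 0) (?T 0) = (1 - 0) * (p * g (?U z) ^ 3 * (s * sin (?T z)) - (p + s * e) * ?R z)"
        by (rule MVT2) (use foc_deriv[OF s] in auto)
      then show ?thesis using that f by (auto simp: p_def e_def)
    qed
    have conv: "?T z = (1 - z) * \<theta> + z * \<phi>" "?U z - q = (1 - z) * (u - q) + z * (v - q)" by (auto simp: e_def p_def algebra_simps)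
    have T1: "k1 / N \<le> ?T z" "?T z \<le> k2 / N"
      unfolding conv using convex_bound_le[of \<theta> "k2/N" \<phi> "1 - z" z] convex_bound_le[of "-\<theta>" "-(k1/N)" "-\<phi>" "1 - z" z] ang z by (auto simp: N_def algebra_simps)
    have U1: "\<bar>?U z - q\<bar> \<le> 1 / N ^ 3"
    proof -
      have "\<bar>?U z - q\<bar> \<le> (1 - z) * \<bar>u - q\<bar> + z * \<bar>v - q\<bar>" unfolding conv(2) using z abs_triangle_ineq[of "(1 - z) * (u - q)" "z * (v - q)"] by (simp add: abs_mult)
      also have "\<dots> \<le> 1 / N ^ 3" by (rule convex_bound_le) (use uv z in \<open>auto simp: N_def\<close>)
      finally show ?thesis .
    qed
    have R: "\<bar>?R z\<bar> \<le> Q / N ^ 3"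
    proof -
      have "\<bar>?R z\<bar> \<le> norm (cis (- (?U z + s * ?T z)) * (x - \<Gamma> (?U z)))" by (rule abs_Re_le_cmod)
      also have "\<dots> = norm ((x - \<Gamma> q) + (\<Gamma> q - \<Gamma> (?U z)))" by (simp add: norm_mult)
      also have "\<dots> \<le> 1 / N ^ 4 + G ^ 3 * (1 / N ^ 3)"
      proof (rule norm_triangle_le[OF add_mono])
        show "norm (x - \<Gamma> q) \<le> 1 / N ^ 4" using x by (simp add: N_def)
        have "norm (\<Gamma> q - \<Gamma> (?U z)) \<le> G ^ 3 * \<bar>q - ?U z\<bar>" by (rule \<Gamma>_lipschitz)
        also have "\<dots> \<le> G ^ 3 * (1 / N ^ 3)" using U1 G_pos by (intro mult_left_mono) (auto simp: abs_minus_commute)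
        finally show "norm (\<Gamma> q - \<Gamma> (?U z)) \<le> G ^ 3 * (1 / N ^ 3)" .
      qed
      also have "\<dots> \<le> 1 / N ^ 3 + G ^ 3 * (1 / N ^ 3)"
        using N power_increasing[of 3 4 N] N0 by (intro add_right_mono divide_left_mono) auto
      also have "\<dots> = Q / N ^ 3" by (simp add: Q_def add_divide_distrib)
      finally show ?thesis .
    qed
    have "k2 / N \<le> 1 / 2" "0 < k1 / N" using N(1) N0 assms by (auto simp: field_simps)
    then have T2: "?T z \<le> 1 / 2" and Tpos: "0 < ?T z" using T1 by linarith+
    have sn: "k1 / (2 * N) \<le> sin (?T z)" using sin_ge_half[of "?T z"] T1 T2 Tpos by simp
    moreover have "0 < k1 / (2 * N)" using assms N0 by simp
    ultimately have sp: "0 < sin (?T z)" by linarith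
    have "\<bar>p\<bar> * (m / (2 * N)) \<le> \<bar>p\<bar> * (g (?U z) ^ 3 * sin (?T z))"
    proof (rule mult_left_mono)
      have "g0 ^ 3 * (k1 / (2 * N)) \<le> g (?U z) ^ 3 * sin (?T z)"
        using sn power_mono[OF g_ge[of "?U z"], of 3] g0_pos assms N0 less_imp_le[OF g_pos[of "?U z"]] by (intro mult_mono) auto
      then show "m / (2 * N) \<le> g (?U z) ^ 3 * sin (?T z)" by (simp add: m_def)
    qed simp
    also have "\<dots> = \<bar>p * g (?U z) ^ 3 * (s * sin (?T z))\<bar>"
      using s sp g_pos[of "?U z"] by (auto simp: abs_mult)
    also have "\<dots> = \<bar>p + s * e\<bar> * \<bar>?R z\<bar>" using z0 by (simp add: abs_mult[symmetric])
    also have "\<dots> \<le> (\<bar>p\<bar> + \<bar>e\<bar>) * (Q / N ^ 3)"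
      using R Q N0 s by (intro mult_mono) auto
    finally have A: "\<bar>p\<bar> * (m / (2 * N)) \<le> (\<bar>p\<bar> + \<bar>e\<bar>) * (Q / N ^ 3)" .
    have "Q / N ^ 3 \<le> m / (4 * N)"
    proof -
      have "4 * Q \<le> m * N" using N(2) m by (simp add: field_simps)
      also have "\<dots> \<le> m * N ^ 2" using m N(4) N0 by (simp add: power2_eq_square)
      finally have "4 * Q * N \<le> m * N ^ 2 * N" using N0 by (intro mult_right_mono) auto
      then show ?thesis using N0 by (simp add: field_simps power2_eq_square power3_eq_cube)
    qed
    then have "\<bar>p\<bar> * (Q / N ^ 3) \<le> \<bar>p\<bar> * (m / (4 * N))" by (intro mult_left_mono) auto
    moreover have "\<bar>p\<bar> * (m / (2 * N)) = \<bar>p\<bar> * (m / (4 * N)) + \<bar>p\<bar> * (m / (4 * N))" by simp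
    moreover have "(\<bar>p\<bar> + \<bar>e\<bar>) * (Q / N ^ 3) = \<bar>p\<bar> * (Q / N ^ 3) + \<bar>e\<bar> * (Q / N ^ 3)" by (rule distrib_right)
    ultimately have "\<bar>p\<bar> * (m / (4 * N)) \<le> \<bar>e\<bar> * (Q / N ^ 3)" using A by linarith
    then have B: "\<bar>p\<bar> \<le> M / N ^ 2 * \<bar>e\<bar>" using m N0 by (simp add: M_def field_simps power2_eq_square power3_eq_cube)
    \<comment> \<open>The change of \<open>g\<close> between the two vertices costs only
      \<open>O(e / N ^ 3)\<close>, so \<open>g * \<theta>\<close> still grows with the angle at a
      rate of at least \<open>g0 / 2\<close>.\<close>
    have "g0 / 2 * e \<le> g v * \<phi> - g u * \<theta>" if "0 \<le> e"
    proof -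
      have "\<bar>g v - g u\<bar> \<le> G * \<bar>p\<bar>" using taylor_first[OF g_deriv g1_bound, of u p] by (simp add: p_def)
      moreover have "0 < k1 / real j" using assms N0 by (simp add: N_def)
      then have "\<bar>\<theta>\<bar> \<le> k2 / real j" using ang by linarith
      ultimately have "\<bar>\<theta> * (g v - g u)\<bar> \<le> (k2 / N) * (G * \<bar>p\<bar>)" unfolding abs_mult using ang assms N0
        by (intro mult_mono) (auto simp: N_def)
      also have "\<dots> \<le> (k2 / N) * (G * (M / N ^ 2 * \<bar>e\<bar>))" using B assms N0 G_pos by (intro mult_left_mono) auto
      also have "\<dots> = (k2 * G * M / N ^ 3) * \<bar>e\<bar>" by (simp add: power3_eq_cube power2_eq_square)
      also have "\<dots> \<le> g0 / 2 * \<bar>e\<bar>"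
      proof (rule mult_right_mono)
        have "2 * k2 * G * M \<le> g0 * N" using N(3) g0_pos by (simp add: field_simps)
        also have "\<dots> \<le> g0 * N ^ 3" using N(4) power_increasing[of 1 3 N] g0_pos by simp
        finally show "k2 * G * M / N ^ 3 \<le> g0 / 2" using N0 by (simp add: field_simps)
      qed simp
      finally have th: "\<bar>\<theta> * (g v - g u)\<bar> \<le> g0 / 2 * e" using that by simp
      have "g0 * e \<le> g v * e" using g_ge that by (intro mult_right_mono) auto
      moreover have "g v * \<phi> - g u * \<theta> = g v * e + \<theta> * (g v - g u)" by (simp add: e_def algebra_simps)
      ultimately show ?thesis using th by (simp add: abs_le_iff)
    qed
    then show ?thesis using B by (simp add: p_def e_def N_def)
  qed
  then show ?thesis using M by blast
qed

end

locale twist_curve = gauss_curve +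
  fixes d c K y0 :: real
  assumes d_le_1: "d \<le> 1" and twist: "twist_links Y Y' d c K y0"

sublocale twist_curve \<subseteq> tw: twist_links Y Y' d c K y0 by (rule twist)

context gauss_curve
begin

lemma Y_orbit:
  assumes "0 < \<theta>" "\<theta> < pi"
  shows "Y (vx u \<theta> i) (vx u \<theta> (Suc i)) = g (vx u \<theta> i) * ax u \<theta> i"
    "Y' (vx u \<theta> i) (vx u \<theta> (Suc i)) = g (vx u \<theta> (Suc i)) * ax u \<theta> (Suc i)"
  using orbit_link[OF assms, of u i] by (auto simp: Y_def Y'_def)

lemma sin_between: assumes "z / 2 \<le> t" "t \<le> 2 * z" "0 < z" "z \<le> 1 / 4" shows "z / 4 \<le> sin (t::real)"
  using sin_ge_half[of t] assms by linarith

text \<open>Seen from a vertex at parameter distance \<open>w = 1 / j ^ 3\<close> on either side of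
  \<open>q\<close>, the point \<open>\<Gamma> q\<close> appears almost along the tangent. A line at
  an angle \<open>\<theta>\<close> much larger than \<open>w\<close> therefore passes it on a
  definite side, at a distance of order \<open>w * \<theta>\<close>, that is \<open>j^-4\<close>,
  which dominates the offset of \<open>x\<close> once \<open>c0\<close> is small.\<close>

lemma foc_sign:
  assumes "0 < k1" "0 < k2"
  shows "\<exists>c0>0. \<exists>j0. \<forall>j\<ge>j0. \<forall>s x q \<theta>. (s = 1 \<or> s = -1) \<longrightarrow> norm (x - \<Gamma> q) \<le> c0 / real j ^ 4 \<longrightarrow>
     k1 / real j \<le> \<theta> \<longrightarrow> \<theta> \<le> k2 / real j \<longrightarrow>
     s * foc s x (q - 1 / real j ^ 3) \<theta> < 0 \<and> 0 < s * foc s x (q + 1 / real j ^ 3) \<theta>"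
proof -
  \<comment> \<open>Half of \<open>(g0 ^ 3 / 2) * (k1 / 4)\<close>, the coefficient of
    \<open>1 / N ^ 4\<close> in the lower bound for the distance of \<open>\<Gamma> q\<close> from
    the line.\<close>
  define c0 where "c0 = g0 ^ 3 * k1 / 16"
  have c0: "0 < c0" using g0_pos assms by (simp add: c0_def)
  obtain j0 :: nat where j0: "real j0 \<ge> 4 * k2 + 2 / k1 + 1" using real_arch_simple by blast
  have "s * foc s x (q - 1 / real j ^ 3) \<theta> < 0 \<and> 0 < s * foc s x (q + 1 / real j ^ 3) \<theta>"
    if j: "j \<ge> j0" and s: "s = 1 \<or> s = -1" and x: "norm (x - \<Gamma> q) \<le> c0 / real j ^ 4" and th: "k1 / real j \<le> \<theta>" "\<theta> \<le> k2 / real j" for j s x q \<theta>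
  proof -
    define N where "N = real j"
    have nn: "0 \<le> 4 * k2" "0 \<le> 2 / k1" using assms by auto
    have N: "4 * k2 \<le> N" "2 / k1 \<le> N" "1 \<le> N" using j j0 nn unfolding N_def by linarith+
    have N0: "0 < N" using N by linarith
    define w where "w = 1 / N ^ 3"
    have w: "0 < w" "w \<le> 1" using N by (auto simp: w_def)
    have t: "0 < \<theta>" "\<theta> \<le> 1 / 4" "w \<le> \<theta> / 2"
    proof -
      have "0 < k1 / N" using assms N0 by simp
      then show "0 < \<theta>" using th(1) unfolding N_def by linarith
      have "k2 / N \<le> 1 / 4" using N(1) N0 by (simp add: field_simps)
      then show "\<theta> \<le> 1 / 4" using th(2) unfolding N_def by linarith
      have "2 \<le> k1 * N" using N(2) assms by (simp add: field_simps)
      also have "\<dots> \<le> k1 * N ^ 2" using N(3) assms power_increasing[of 1 2 N] by simp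
      finally have "w \<le> k1 / N / 2" using N0 by (simp add: w_def field_simps power2_eq_square power3_eq_cube)
      also have "\<dots> \<le> \<theta> / 2" using th(1) by (intro divide_right_mono) (auto simp: N_def)
      finally show "w \<le> \<theta> / 2" .
    qed
    have key: "c0 / N ^ 4 < H' * (\<theta> / 4)" if "g0 ^ 3 / 2 * w \<le> H'" for H'
    proof -
      have "0 < g0 ^ 3 / 2 * w" using g0_pos w by simp
      then have H0: "0 \<le> H'" using that by linarith
      have "c0 / N ^ 4 < g0 ^ 3 * k1 / (8 * N ^ 4)" using g0_pos assms N0 by (simp add: c0_def field_simps)
      also have "\<dots> = (g0 ^ 3 / 2 * w) * (k1 / N / 4)" using N0 by (simp add: w_def field_simps eval_nat_numeral)
      also have "\<dots> \<le> H' * (\<theta> / 4)" using that th w g0_pos assms N0 H0 by (intro mult_mono) (auto simp: N_def)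
      finally show ?thesis .
    qed
    have ww: "w < 2 * pi" using w pi_gt3 by linarith
    have xN: "norm (x - \<Gamma> q) \<le> c0 / N ^ 4" using x by (simp add: N_def)
    have A: "s * foc s x (q - w) \<theta> < 0"
    proof -
      let ?a = "q - w"
      have lk: "0 < q - ?a" "q - ?a < 2 * pi" using w ww by auto
      note ch = chord[OF lk]
      have Hl: "g0 ^ 3 / 2 * w \<le> H ?a q" using Hf_lower[OF w, of ?a] by (simp add: Hf_def)
      have tt: "0 < th ?a q" "th ?a q \<le> w" using ch(3,5,8) by auto
      have "cis (- (?a + s * \<theta>)) * (\<Gamma> q - \<Gamma> ?a) = of_real (H ?a q) * (cis (- (?a + s * \<theta>)) * cis (?a + th ?a q))"
        unfolding ch(1) by (simp add: mult_ac)
      also have "cis (- (?a + s * \<theta>)) * cis (?a + th ?a q) = cis (th ?a q - s * \<theta>)" by (simp add: cis_mult)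
      finally have f: "foc s (\<Gamma> q) ?a \<theta> = H ?a q * sin (th ?a q - s * \<theta>)" by (simp add: foc_def)
      have sg: "s * sin (th ?a q - s * \<theta>) = - sin (\<theta> - s * th ?a q)"
        using s by (auto simp: sin_minus[of "\<theta> - th ?a q", symmetric] add.commute simp del: sin_minus)
      have "\<theta> / 4 \<le> sin (\<theta> - s * th ?a q)" by (rule sin_between) (use s t tt in auto)
      then have "H ?a q * (\<theta> / 4) \<le> H ?a q * sin (\<theta> - s * th ?a q)" using ch(7) by (intro mult_left_mono) auto
      moreover have "s * foc s (\<Gamma> q) ?a \<theta> = - (H ?a q * sin (\<theta> - s * th ?a q))"
        unfolding f mult.left_commute[of s] sg by simp
      ultimately have "s * foc s (\<Gamma> q) ?a \<theta> \<le> - (H ?a q * (\<theta> / 4))" by linarith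
      moreover have "\<bar>s * foc s x ?a \<theta> - s * foc s (\<Gamma> q) ?a \<theta>\<bar> \<le> c0 / N ^ 4"
        using order_trans[OF foc_bound[of s x ?a \<theta> "\<Gamma> q"] xN] s by auto
      ultimately show ?thesis using key[OF Hl] by linarith
    qed
    have B: "0 < s * foc s x (q + w) \<theta>"
    proof -
      let ?b = "q + w"
      have lk: "0 < ?b - q" "?b - q < 2 * pi" using w ww by auto
      note ch = chord[OF lk]
      have Hl: "g0 ^ 3 / 2 * w \<le> H q ?b" using Hf_lower[OF w, of q] by (simp add: Hf_def)
      have tt: "0 < ph q ?b" "ph q ?b \<le> w" using ch(3,5,8) by auto
      have "\<Gamma> q - \<Gamma> ?b = - (of_real (H q ?b) * cis (?b - ph q ?b))" using ch(2) by (simp add: algebra_simps)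
      then have "cis (- (?b + s * \<theta>)) * (\<Gamma> q - \<Gamma> ?b) = - (of_real (H q ?b) * (cis (- (?b + s * \<theta>)) * cis (?b - ph q ?b)))"
        by (simp add: mult_ac)
      also have "cis (- (?b + s * \<theta>)) * cis (?b - ph q ?b) = cis (- (ph q ?b + s * \<theta>))" by (simp add: cis_mult algebra_simps)
      finally have f: "foc s (\<Gamma> q) ?b \<theta> = H q ?b * sin (ph q ?b + s * \<theta>)" by (simp add: foc_def sin_minus[of "ph q ?b + s * \<theta>", simplified])
      have sg: "s * sin (ph q ?b + s * \<theta>) = sin (\<theta> + s * ph q ?b)"
        using s sin_minus[of "ph q ?b - \<theta>"] by (auto simp: add.commute)
      have "\<theta> / 4 \<le> sin (\<theta> + s * ph q ?b)" by (rule sin_between) (use s t tt in auto)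
      then have "H q ?b * (\<theta> / 4) \<le> H q ?b * sin (\<theta> + s * ph q ?b)" using ch(7) by (intro mult_left_mono) auto
      moreover have "s * foc s (\<Gamma> q) ?b \<theta> = H q ?b * sin (\<theta> + s * ph q ?b)"
        unfolding f mult.left_commute[of s] sg by simp
      ultimately have "H q ?b * (\<theta> / 4) \<le> s * foc s (\<Gamma> q) ?b \<theta>" by linarith
      moreover have "\<bar>s * foc s x ?b \<theta> - s * foc s (\<Gamma> q) ?b \<theta>\<bar> \<le> c0 / N ^ 4"
        using order_trans[OF foc_bound[of s x ?b \<theta> "\<Gamma> q"] xN] s by auto
      ultimately show ?thesis using key[OF Hl] by linarith
    qed
    show ?thesis using A B by (simp add: w_def N_def)
  qed
  then show ?thesis using c0 by blast
qed

definition inside :: "complex \<Rightarrow> bool" where "inside x \<longleftrightarrow> (\<forall>\<psi>. 0 < Im (cis (- \<psi>) * (x - \<Gamma> \<psi>)))"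

text \<open>A zero of \<open>foc\<close> places \<open>x\<close> on the full line. Since
  \<open>x\<close> is strictly to the left of the tangent at \<open>\<Gamma> u\<close>, it lies on
  the half line that enters the domain, for either value of \<open>s\<close>.\<close>

lemma foc_zero_ray:
  assumes "inside x" "foc s x u \<theta> = 0" "0 < \<theta>" "\<theta> < pi" "s = 1 \<or> s = -1"
  shows "x - \<Gamma> u = of_real (s * norm (x - \<Gamma> u)) * cis (u + s * \<theta>)" "0 < norm (x - \<Gamma> u)"
proof -
  define z where "z = cis (- (u + s * \<theta>)) * (x - \<Gamma> u)"
  have "Im z = 0" using assms(2) by (simp add: z_def foc_def)
  then have zr: "z = of_real (Re z)" by (simp add: complex_eq_iff)
  have "x - \<Gamma> u = cis (u + s * \<theta>) * z" unfolding z_def by (simp add: mult.assoc[symmetric] cis_mult)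
  then have e: "x - \<Gamma> u = of_real (Re z) * cis (u + s * \<theta>)" using zr by (metis mult.commute)
  have "0 < Im (cis (- u) * (x - \<Gamma> u))" using assms(1) unfolding inside_def by blast
  also have "cis (- u) * (x - \<Gamma> u) = of_real (Re z) * cis (s * \<theta>)" unfolding e by (simp add: mult.left_commute cis_mult)
  finally have "0 < Re z * (s * sin \<theta>)" using assms(5) by auto
  then have "0 < (s * Re z) * sin \<theta>" by (simp add: mult_ac)
  then have "0 < s * Re z" using zero_less_mult_pos2 sin_gt_zero[OF assms(3,4)] by blast
  moreover have "norm (x - \<Gamma> u) = \<bar>Re z\<bar>" unfolding e by (simp add: norm_mult)
  ultimately have "Re z = s * norm (x - \<Gamma> u)" "0 < norm (x - \<Gamma> u)" using assms(5) by auto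
  then show "x - \<Gamma> u = of_real (s * norm (x - \<Gamma> u)) * cis (u + s * \<theta>)" "0 < norm (x - \<Gamma> u)" using e by auto
qed

lemma foc_segment:
  assumes "x \<in> open_segment (\<Gamma> a) (\<Gamma> b)" "0 < b - a" "b - a < 2 * pi"
  shows "foc 1 x a (th a b) = 0" "foc (-1) x b (ph a b) = 0"
proof -
  note ch = chord[OF assms(2,3)]
  obtain t where t: "x = \<Gamma> a + of_real t * (\<Gamma> b - \<Gamma> a)" using assms(1) unfolding open_segment_param by blast
  have "x - \<Gamma> a = of_real (t * H a b) * cis (a + th a b)" using t ch(1) by simp
  then show "foc 1 x a (th a b) = 0" unfolding foc_def by (simp only:) (subst mult.left_commute, subst cis_mult, simp)
  have "x - \<Gamma> b = of_real (t - 1) * (\<Gamma> b - \<Gamma> a)" using t by (simp add: algebra_simps)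
  then have "x - \<Gamma> b = of_real ((t - 1) * H a b) * cis (b - ph a b)" using ch(2) by simp
  then show "foc (-1) x b (ph a b) = 0" unfolding foc_def by (simp only:) (subst mult.left_commute, subst cis_mult, simp)
qed

text \<open>A converse of \<open>foc_segment\<close>: the ray from one end enters the domain, and a
  distance below the chord length keeps \<open>x\<close> before the other end.\<close>

lemma segment_foc:
  assumes x: "inside x" and ab: "0 < b - a" "b - a < 2 * pi"
    and f: "foc 1 x a (th a b) = 0 \<and> norm (x - \<Gamma> a) < H a b \<or> foc (-1) x b (ph a b) = 0 \<and> norm (x - \<Gamma> b) < H a b"
  shows "x \<in> open_segment (\<Gamma> a) (\<Gamma> b)"
proof -
  note ch = chord[OF ab]
  have ne: "\<Gamma> a \<noteq> \<Gamma> b" using ch(7) by (auto simp: H_def)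
  show ?thesis
  proof (cases "foc 1 x a (th a b) = 0 \<and> norm (x - \<Gamma> a) < H a b")
    case True
    define r where "r = norm (x - \<Gamma> a)"
    have r: "x - \<Gamma> a = of_real r * cis (a + th a b)" "0 < r" using foc_zero_ray[OF x, of 1 a "th a b"] True ch(3,4) by (auto simp: r_def)
    have "of_real (r / H a b) * (\<Gamma> b - \<Gamma> a) = x - \<Gamma> a" unfolding ch(1) r(1) using ch(7) by simp
    then have "x = \<Gamma> a + of_real (r / H a b) * (\<Gamma> b - \<Gamma> a)" by simp
    moreover have "0 < r / H a b" "r / H a b < 1" using r(2) ch(7) True by (auto simp: r_def)
    ultimately show ?thesis using ne unfolding open_segment_param by blast
  next
    case False
    then have F: "foc (-1) x b (ph a b) = 0" "norm (x - \<Gamma> b) < H a b" using f by auto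
    define r where "r = norm (x - \<Gamma> b)"
    have r: "x - \<Gamma> b = of_real (- r) * cis (b - ph a b)" "0 < r" using foc_zero_ray[OF x, of "-1" b "ph a b"] F ch(5,6) by (auto simp: r_def)
    have "of_real (- r / H a b) * (\<Gamma> b - \<Gamma> a) = x - \<Gamma> b" unfolding ch(2) r(1) using ch(7) by simp
    moreover have "of_real (1 - r / H a b) * (\<Gamma> b - \<Gamma> a) = (\<Gamma> b - \<Gamma> a) + of_real (- r / H a b) * (\<Gamma> b - \<Gamma> a)"
      by (simp add: algebra_simps)
    ultimately have "x = \<Gamma> a + of_real (1 - r / H a b) * (\<Gamma> b - \<Gamma> a)" by simp
    moreover have "0 < 1 - r / H a b" "1 - r / H a b < 1" using r(2) ch(7) F(2) by (auto simp: r_def)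
    ultimately show ?thesis using ne unfolding open_segment_param by blast
  qed
qed

lemma near_dist:
  assumes "norm (x - \<Gamma> q) \<le> 1 / real j ^ 4" "\<bar>a - (q + 2 * pi * of_int k)\<bar> \<le> 1 / real j ^ 3" "1 \<le> j"
  shows "norm (x - \<Gamma> a) \<le> (1 + G ^ 3) / real j ^ 3"
proof -
  have q: "\<Gamma> q = \<Gamma> (q + 2 * pi * of_int k)" by (simp add: \<Gamma>_period_int)
  have "norm (x - \<Gamma> a) = norm ((x - \<Gamma> q) + (\<Gamma> (q + 2 * pi * of_int k) - \<Gamma> a))" using q by simp
  also have "\<dots> \<le> 1 / real j ^ 4 + G ^ 3 * (1 / real j ^ 3)"
  proof (rule norm_triangle_le[OF add_mono[OF assms(1)]])
    have "norm (\<Gamma> (q + 2 * pi * of_int k) - \<Gamma> a) \<le> G ^ 3 * \<bar>(q + 2 * pi * of_int k) - a\<bar>" by (rule \<Gamma>_lipschitz)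
    also have "\<dots> \<le> G ^ 3 * (1 / real j ^ 3)" using assms(2) G_pos by (intro mult_left_mono) (auto simp: abs_minus_commute)
    finally show "norm (\<Gamma> (q + 2 * pi * of_int k) - \<Gamma> a) \<le> G ^ 3 * (1 / real j ^ 3)" .
  qed
  also have "1 / real j ^ 4 \<le> 1 / real j ^ 3" using power_increasing[of 3 4 "real j"] assms(3) by (intro divide_left_mono) auto
  finally show ?thesis by (simp add: add_divide_distrib)
qed

text \<open>With
  \<open>x = (1 - t) \<Gamma> a + t \<Gamma> b\<close>, quadratic support bounds the depth from below by a multiple of
  \<open>(1 - t) A\<^sup>2 + t B\<^sup>2 \<ge> t (1 - t) (A + B)\<^sup>2\<close>, where \<open>A\<close> and \<open>B\<close> are the distances of the ends from \<open>\<Gamma> q\<close>.\<close>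

lemma link_ends:
  assumes "0 < k1" "0 < k2"
  shows "\<exists>c0>0. \<exists>j0. \<forall>j\<ge>j0. \<forall>a b x q. k1 / real j \<le> b - a \<longrightarrow> b - a \<le> k2 / real j \<longrightarrow> b - a \<le> 1 \<longrightarrow>
     x \<in> open_segment (\<Gamma> a) (\<Gamma> b) \<longrightarrow> norm (x - \<Gamma> q) \<le> c0 / real j ^ 4 \<longrightarrow>
     (\<exists>k::int. \<bar>a - (q + 2 * pi * of_int k)\<bar> \<le> 1 / real j ^ 3) \<or> (\<exists>k::int. \<bar>b - (q + 2 * pi * of_int k)\<bar> \<le> 1 / real j ^ 3)"
proof -
  \<comment> \<open>Quadratic support in terms of distances: the height over the tangent at
    \<open>\<Gamma> q\<close> is at least \<open>g0 ^ 3 / 8 * u\<^sup>2\<close>, while the distance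
    from \<open>\<Gamma> q\<close> is at most \<open>G ^ 3 * \<bar>u\<bar>\<close>.\<close>
  define \<kappa> where "\<kappa> = g0 ^ 3 / (8 * G ^ 6)"
  have \<kappa>: "0 < \<kappa>" using g0_pos G_pos by (simp add: \<kappa>_def)
  define h where "h = g0 ^ 3 / 2 * k1"
  have h: "0 < h" using g0_pos assms by (simp add: h_def)
  \<comment> \<open>Chosen so that the nearer end, whose distance from \<open>\<Gamma> q\<close> is
    at most \<open>c0 * (2 / (\<kappa> * h) + 1) / N ^ 3\<close>, comes within parameter distance
    \<open>1 / N ^ 3\<close> by \<open>near_parameter\<close>.\<close>
  define c0 where "c0 = min 1 (g0 ^ 3 / 2 / (2 / (\<kappa> * h) + 1))"
  have g3: "0 < g0 ^ 3" using g0_pos by simp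
  have pos: "0 < 2 / (\<kappa> * h) + 1" using \<kappa> h by (simp add: add_pos_pos)
  have c0: "0 < c0" "c0 \<le> 1" using g3 pos by (auto simp: c0_def)
  have "c0 \<le> g0 ^ 3 / 2 / (2 / (\<kappa> * h) + 1)" unfolding c0_def by (rule min.cobounded2)
  then have c0': "c0 * (2 / (\<kappa> * h) + 1) \<le> g0 ^ 3 / 2" by (simp only: pos_le_divide_eq[OF pos])
  obtain j0 :: nat where j0: "real j0 \<ge> 8 * (G ^ 3 * k2 + 1) / g0 ^ 3 + 1" using real_arch_simple by blast
  have "(\<exists>k::int. \<bar>a - (q + 2 * pi * of_int k)\<bar> \<le> 1 / real j ^ 3) \<or> (\<exists>k::int. \<bar>b - (q + 2 * pi * of_int k)\<bar> \<le> 1 / real j ^ 3)"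
    if j: "j \<ge> j0" and ab: "k1 / real j \<le> b - a" "b - a \<le> k2 / real j" "b - a \<le> 1" and x: "x \<in> open_segment (\<Gamma> a) (\<Gamma> b)" and q: "norm (x - \<Gamma> q) \<le> c0 / real j ^ 4"
    for j a b x q
  proof -
    define N where "N = real j"
    have nn: "0 \<le> 8 * (G ^ 3 * k2 + 1) / g0 ^ 3" using G_pos g0_pos assms by simp
    have N: "8 * (G ^ 3 * k2 + 1) / g0 ^ 3 < N" "1 \<le> N" using j j0 nn unfolding N_def by linarith+
    have N0: "0 < N" using N by linarith
    define \<epsilon> where "\<epsilon> = norm (x - \<Gamma> q)"
    have \<epsilon>: "\<epsilon> \<le> c0 / N ^ 4" "0 \<le> \<epsilon>" using q by (auto simp: \<epsilon>_def N_def)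
    have N34: "c0 / N ^ 4 \<le> c0 / N ^ 3" "c0 / N ^ 4 \<le> 1 / N"
    proof -
      show "c0 / N ^ 4 \<le> c0 / N ^ 3" using power_increasing[of 3 4 N] N c0 by (intro divide_left_mono) auto
      have "c0 / N ^ 4 \<le> 1 / N ^ 4" using c0 N0 by (intro divide_right_mono) auto
      also have "\<dots> \<le> 1 / N" using power_increasing[of 1 4 N] N by (intro divide_left_mono) auto
      finally show "c0 / N ^ 4 \<le> 1 / N" .
    qed
    obtain t where t: "0 < t" "t < 1" "x = \<Gamma> a + of_real t * (\<Gamma> b - \<Gamma> a)" using x unfolding open_segment_param by blast
    define D where "D = norm (\<Gamma> b - \<Gamma> a)"
    have ba: "0 < b - a" using ab(1) assms N0 by (smt (verit) N_def divide_pos_pos)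
    have D1: "h / N \<le> D" using Hf_lower[OF ba ab(3), of a] ab(1) g3 mult_left_mono[OF ab(1), of "g0 ^ 3 / 2"] by (simp add: D_def Hf_def H_def h_def N_def)
    then have D0: "0 < D" using h N0 by (smt (verit) divide_pos_pos)
    have D2: "D \<le> G ^ 3 * k2 / N"
    proof -
      have "D \<le> G ^ 3 * \<bar>b - a\<bar>" unfolding D_def by (rule \<Gamma>_lipschitz)
      also have "\<dots> \<le> G ^ 3 * (k2 / N)" using ab(2) ba G_pos by (intro mult_left_mono) (auto simp: N_def)
      finally show ?thesis by simp
    qed
    have xa: "norm (x - \<Gamma> a) = t * D" using t by (simp add: D_def norm_mult)
    have "x - \<Gamma> b = of_real (t - 1) * (\<Gamma> b - \<Gamma> a)" using t(3) by (simp add: algebra_simps)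
    then have xb: "norm (x - \<Gamma> b) = (1 - t) * D" using t by (simp only: norm_mult norm_of_real) (simp add: D_def)
    define P where "P = norm (\<Gamma> a - \<Gamma> q)"
    define Q where "Q = norm (\<Gamma> b - \<Gamma> q)"
    have PQ: "P \<le> t * D + \<epsilon>" "Q \<le> (1 - t) * D + \<epsilon>"
      using norm_triangle_ineq[of "\<Gamma> a - x" "x - \<Gamma> q"] norm_triangle_ineq[of "\<Gamma> b - x" "x - \<Gamma> q"] xa xb
      by (simp_all add: P_def Q_def \<epsilon>_def norm_minus_commute)
    have tD: "t * D \<le> D" "(1 - t) * D \<le> D" using t D0 by (auto simp: mult_left_le_one_le)
    have small: "D + \<epsilon> < g0 ^ 3 / 8"
    proof -
      have "D + \<epsilon> \<le> (G ^ 3 * k2 + 1) / N" using D2 \<epsilon>(1) N34(2) by (simp add: add_divide_distrib)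
      also have "\<dots> < g0 ^ 3 / 8" using N(1) N0 g3 by (simp add: field_simps)
      finally show ?thesis .
    qed
    have P8: "norm (\<Gamma> a - \<Gamma> q) < g0 ^ 3 / 8" "norm (\<Gamma> b - \<Gamma> q) < g0 ^ 3 / 8"
      using PQ tD small unfolding P_def Q_def by linarith+
    obtain ka :: int where ka: "\<bar>a - (q + 2 * pi * of_int ka)\<bar> \<le> 1" "\<bar>a - (q + 2 * pi * of_int ka)\<bar> \<le> 2 / g0 ^ 3 * norm (\<Gamma> a - \<Gamma> q)"
      by (rule near_parameter[OF P8(1)], rule that)
    obtain kb :: int where kb: "\<bar>b - (q + 2 * pi * of_int kb)\<bar> \<le> 1" "\<bar>b - (q + 2 * pi * of_int kb)\<bar> \<le> 2 / g0 ^ 3 * norm (\<Gamma> b - \<Gamma> q)"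
      by (rule near_parameter[OF P8(2)], rule that)
    have quad: "\<kappa> * norm (\<Gamma> e - \<Gamma> q) ^ 2 \<le> Im (cis (- q) * (\<Gamma> e - \<Gamma> q))"
      if k: "\<bar>e - (q + 2 * pi * of_int k)\<bar> \<le> 1" for e and k :: int
    proof -
      define u where "u = e - (q + 2 * pi * of_int k)"
      have e: "\<Gamma> e = \<Gamma> (q + u)" using \<Gamma>_period_int[of "q + u" k] by (simp add: u_def algebra_simps)
      have "norm (\<Gamma> e - \<Gamma> q) \<le> G ^ 3 * \<bar>u\<bar>" unfolding e using \<Gamma>_lipschitz[of "q + u" q] by simp
      then have "norm (\<Gamma> e - \<Gamma> q) ^ 2 \<le> (G ^ 3 * \<bar>u\<bar>) ^ 2" by (intro power_mono) auto
      then have "\<kappa> * norm (\<Gamma> e - \<Gamma> q) ^ 2 \<le> \<kappa> * (G ^ 6 * u\<^sup>2)" using \<kappa> by (intro mult_left_mono) (auto simp: power_mult_distrib)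
      also have "\<dots> = (g0 ^ 3 / 8) * u\<^sup>2" using G_pos by (simp add: \<kappa>_def)
      also have "\<dots> \<le> F q u" by (rule F_quadratic) (use k in \<open>simp add: u_def\<close>)
      finally show ?thesis by (simp add: F_def e)
    qed
    have "\<kappa> * ((1 - t) * P\<^sup>2 + t * Q\<^sup>2) \<le> \<epsilon>"
    proof -
      have "\<kappa> * ((1 - t) * P\<^sup>2 + t * Q\<^sup>2) = (1 - t) * (\<kappa> * P\<^sup>2) + t * (\<kappa> * Q\<^sup>2)" by (simp add: algebra_simps)
      also have "\<dots> \<le> (1 - t) * Im (cis (- q) * (\<Gamma> a - \<Gamma> q)) + t * Im (cis (- q) * (\<Gamma> b - \<Gamma> q))"
        using quad[OF ka(1)] quad[OF kb(1)] t unfolding P_def Q_def by (intro add_mono mult_left_mono) auto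
      also have "\<dots> = Im (cis (- q) * (x - \<Gamma> q))" unfolding t(3) by (simp add: algebra_simps)
      also have "\<dots> \<le> norm (cis (- q) * (x - \<Gamma> q))" using abs_Im_le_cmod abs_le_D1 by blast
      finally show ?thesis by (simp add: norm_mult \<epsilon>_def)
    qed
    moreover have "t * (1 - t) * D\<^sup>2 \<le> (1 - t) * P\<^sup>2 + t * Q\<^sup>2"
    proof -
      have "D \<le> P + Q" using norm_triangle_ineq[of "\<Gamma> b - \<Gamma> q" "\<Gamma> q - \<Gamma> a"] by (simp add: D_def P_def Q_def norm_minus_commute)
      then have "D\<^sup>2 \<le> (P + Q)\<^sup>2" using D0 by (intro power_mono) auto
      then have "t * (1 - t) * D\<^sup>2 \<le> t * (1 - t) * (P + Q)\<^sup>2" using t by (intro mult_left_mono) auto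
      moreover have "(1 - t) * P\<^sup>2 + t * Q\<^sup>2 - t * (1 - t) * (P + Q)\<^sup>2 = ((1 - t) * P - t * Q)\<^sup>2"
        by (simp add: algebra_simps power2_eq_square)
      ultimately show ?thesis by (smt (verit) zero_le_power2)
    qed
    ultimately have prod: "\<kappa> * (t * (1 - t) * D\<^sup>2) \<le> \<epsilon>" using \<kappa> by (smt (verit) mult_left_mono)
    \<comment> \<open>\<open>l\<close> will be the smaller one of \<open>t\<close> and
      \<open>1 - t\<close>. The other factor is at least 1/2 and \<open>D\<close> is at least
      \<open>h / N\<close>, so the product bound limits \<open>l * D\<close>.\<close>
    have short: "l * D \<le> 2 * c0 / (\<kappa> * h) / N ^ 3" if l: "0 < l" "l \<le> 1 / 2" and p: "\<kappa> * (l * (1 - l) * D\<^sup>2) \<le> \<epsilon>" for l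
    proof -
      have "\<kappa> * (l * D) * h / (2 * N) = (\<kappa> * l * D) * ((1 / 2) * (h / N))" by simp
      also have "\<dots> \<le> (\<kappa> * l * D) * ((1 - l) * D)"
        using l D1 D0 \<kappa> h N0 by (intro mult_left_mono mult_mono) auto
      also have "\<dots> = \<kappa> * (l * (1 - l) * D\<^sup>2)" by (simp add: power2_eq_square)
      also have "\<dots> \<le> c0 / N ^ 4" using p \<epsilon> by linarith
      finally show ?thesis using \<kappa> h N0 by (simp add: field_simps eval_nat_numeral)
    qed
    have fin: "2 / g0 ^ 3 * R \<le> 1 / N ^ 3" if "R \<le> 2 * c0 / (\<kappa> * h) / N ^ 3 + \<epsilon>" for R
    proof -
      have "R \<le> (c0 * (2 / (\<kappa> * h) + 1)) / N ^ 3"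
        using that \<epsilon>(1) N34(1) by (simp add: algebra_simps add_divide_distrib)
      also have "\<dots> \<le> (g0 ^ 3 / 2) / N ^ 3" using c0' N0 by (intro divide_right_mono) auto
      finally show ?thesis using g3 by (simp add: field_simps)
    qed
    show ?thesis
    proof (cases "t \<le> 1 / 2")
      case True
      have "t * D \<le> 2 * c0 / (\<kappa> * h) / N ^ 3" by (rule short) (use t True prod in auto)
      then have "2 / g0 ^ 3 * P \<le> 1 / N ^ 3" using PQ by (intro fin) linarith
      then show ?thesis using ka(2) unfolding P_def N_def by (meson order_trans)
    next
      case False
      have "(1 - t) * D \<le> 2 * c0 / (\<kappa> * h) / N ^ 3" by (rule short) (use t False prod in \<open>auto simp: mult.commute\<close>)
      then have "2 / g0 ^ 3 * Q \<le> 1 / N ^ 3" using PQ by (intro fin) linarith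
      then show ?thesis using kb(2) unfolding Q_def N_def by (meson order_trans)
    qed
  qed
  then show ?thesis using c0 by blast
qed

end

section \<open>Sweep, twist and uniqueness for billiard orbits\<close>

context twist_curve
begin

lemma orbit_links:
  assumes "0 < \<theta>" "\<theta> < pi" shows "tw.links (\<lambda>i. vx u \<theta> (k + i)) m"
  using orbit_link[OF assms, of u] Y_orbit[OF assms, of u] unfolding tw.links_def by simp

text \<open>At one end of a window of initial angles of order \<open>1/j\<close> the orbit turns by
  at most half a turn, at the other by at least three half turns. A turn near \<open>2 * pi\<close>
  is thus reached inside, with a margin that lets the starting vertex and the target move.\<close>

lemma orbit_sweep:
  "\<exists>\<kappa>1 \<kappa>2. 0 < \<kappa>1 \<and> \<kappa>1 \<le> \<kappa>2 \<and> (\<exists>j0. \<forall>j\<ge>j0. \<forall>m. j \<le> 2 * m \<longrightarrow> m \<le> 2 * j \<longrightarrow> (\<forall>u \<theta>. \<kappa>1 / real j \<le> \<theta> \<longrightarrow> \<theta> \<le> \<kappa>2 / real j \<longrightarrow>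
     0 < \<theta> \<and> \<theta> < pi \<and> (\<forall>i<m. vx u \<theta> (Suc i) - vx u \<theta> i \<le> d \<and> g (vx u \<theta> i) * ax u \<theta> i \<le> 2 * (g u * \<theta>) \<and> g u * \<theta> \<le> 2 * (g (vx u \<theta> i) * ax u \<theta> i)) \<and>
     (\<theta> = \<kappa>1 / real j \<longrightarrow> vx u \<theta> m - u \<le> pi) \<and> (\<theta> = \<kappa>2 / real j \<longrightarrow> 3 * pi \<le> vx u \<theta> m - u)))"
proof -
  \<comment> \<open>With \<open>Y\<close> at most doubled along the orbit, up to
    \<open>2 * N\<close> links cover at most \<open>4 * G * \<kappa>1 / c = pi\<close>; with
    \<open>Y\<close> at most halved, at least \<open>N / 2\<close> links cover at least
    \<open>g0 * \<kappa>2 / (4 * K) \<ge> 3 * pi\<close>.\<close>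
  define \<kappa>1 where "\<kappa>1 = pi * c / (4 * G)"
  define \<kappa>2 where "\<kappa>2 = 12 * pi * K / g0 + \<kappa>1"
  have \<kappa>: "0 < \<kappa>1" "\<kappa>1 \<le> \<kappa>2" "0 < \<kappa>2" "3 * pi \<le> g0 * \<kappa>2 / (4 * K)"
  proof -
    show k1: "0 < \<kappa>1" using tw.c_pos G_pos by (simp add: \<kappa>1_def)
    have p: "0 < 12 * pi * K / g0" using tw.C_pos g0_pos by simp
    show "\<kappa>1 \<le> \<kappa>2" "0 < \<kappa>2" using k1 p unfolding \<kappa>2_def by linarith+
    have "g0 * \<kappa>2 / (4 * K) = 3 * pi + g0 * \<kappa>1 / (4 * K)"
      using tw.C_pos g0_pos by (simp add: \<kappa>2_def field_simps)
    moreover have "0 < g0 * \<kappa>1 / (4 * K)" using k1 tw.C_pos g0_pos by simp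
    ultimately show "3 * pi \<le> g0 * \<kappa>2 / (4 * K)" by linarith
  qed
  define Q where "Q = 2 * G * \<kappa>2"
  have Q: "0 < Q" using G_pos \<kappa> by (simp add: Q_def)
  obtain m1 where m1: "\<forall>m\<ge>m1. \<forall>\<psi>. tw.links \<psi> m \<longrightarrow> (\<forall>k<m. Y (\<psi> k) (\<psi> (Suc k)) \<le> Q / real m \<longrightarrow>
           (\<forall>i<m. \<psi> (Suc i) - \<psi> i \<le> d \<and> Y (\<psi> i) (\<psi> (Suc i)) \<le> 2 * Y (\<psi> k) (\<psi> (Suc k))))"
    using tw.links_comparable[OF Q] by blast
  \<comment> \<open>The reverse comparison starts at an arbitrary link, where \<open>Y\<close> is
    known only up to \<open>2 * Q / m\<close>; hence the second threshold.\<close>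
  define Q2 where "Q2 = 2 * Q"
  have Q2: "0 < Q2" using Q by (simp add: Q2_def)
  obtain m2 where m2: "\<forall>m\<ge>m2. \<forall>\<psi>. tw.links \<psi> m \<longrightarrow> (\<forall>k<m. Y (\<psi> k) (\<psi> (Suc k)) \<le> Q2 / real m \<longrightarrow>
           (\<forall>i<m. \<psi> (Suc i) - \<psi> i \<le> d \<and> Y (\<psi> i) (\<psi> (Suc i)) \<le> 2 * Y (\<psi> k) (\<psi> (Suc k))))"
    using tw.links_comparable[OF Q2] by blast
  obtain j1 :: nat where j1: "real j1 \<ge> \<kappa>2 + 1" using real_arch_simple by blast
  have "0 < \<theta> \<and> \<theta> < pi \<and> (\<forall>i<m. vx u \<theta> (Suc i) - vx u \<theta> i \<le> d \<and> g (vx u \<theta> i) * ax u \<theta> i \<le> 2 * (g u * \<theta>) \<and> g u * \<theta> \<le> 2 * (g (vx u \<theta> i) * ax u \<theta> i)) \<and>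
     (\<theta> = \<kappa>1 / real j \<longrightarrow> vx u \<theta> m - u \<le> pi) \<and> (\<theta> = \<kappa>2 / real j \<longrightarrow> 3 * pi \<le> vx u \<theta> m - u)"
    if j: "j \<ge> 2 * m1 + 2 * m2 + j1" and m: "j \<le> 2 * m" "m \<le> 2 * j" and th: "\<kappa>1 / real j \<le> \<theta>" "\<theta> \<le> \<kappa>2 / real j" for j m u \<theta>
  proof -
    define N where "N = real j"
    have N: "\<kappa>2 + 1 \<le> N" using j j1 unfolding N_def by linarith
    have N0: "0 < N" using N \<kappa> by linarith
    have m0: "0 < m" using m N0 by (auto simp: N_def intro!: gr0I)
    have mr: "real m \<le> 2 * N" "N \<le> 2 * real m" using m by (auto simp: N_def)
    have "0 < \<kappa>1 / N" using \<kappa> N0 by simp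
    moreover have "\<kappa>2 / N < 1" using N N0 by simp
    ultimately have t: "0 < \<theta>" "\<theta> < pi" using th pi_gt3 unfolding N_def by linarith+
    have L: "tw.links (vx u \<theta>) m" using orbit_links[OF t, of u 0 m] by simp
    have Y: "Y (vx u \<theta> i) (vx u \<theta> (Suc i)) = g (vx u \<theta> i) * ax u \<theta> i" for i by (rule Y_orbit[OF t])
    have Yz: "Y u (vx u \<theta> (Suc 0)) = g u * \<theta>" using Y[of 0] by simp
    have "g u * \<theta> \<le> G * (\<kappa>2 / N)" using g_le th(2) t g_pos[of u] G_pos by (intro mult_mono) (auto simp: N_def)
    also have "\<dots> \<le> Q / real m" using mr m0 N0 \<kappa> G_pos by (simp add: Q_def field_simps mult_left_mono)
    finally have Y0: "Y (vx u \<theta> 0) (vx u \<theta> (Suc 0)) \<le> Q / real m" by (simp add: Yz)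
    have mm: "m \<ge> m1" "m \<ge> m2" using j m by linarith+
    have A: "vx u \<theta> (Suc i) - vx u \<theta> i \<le> d \<and> g (vx u \<theta> i) * ax u \<theta> i \<le> 2 * (g u * \<theta>)" if "i < m" for i
      using m1[rule_format, OF mm(1) L m0 Y0 that] by (simp add: Y Yz)
    have B: "g u * \<theta> \<le> 2 * (g (vx u \<theta> i) * ax u \<theta> i)" if "i < m" for i
    proof -
      have "Y (vx u \<theta> i) (vx u \<theta> (Suc i)) \<le> 2 * Y (vx u \<theta> 0) (vx u \<theta> (Suc 0))" using A[OF that] by (simp add: Y Yz)
      also have "\<dots> \<le> 2 * (Q / real m)" using Y0 by (rule mult_left_mono) simp
      finally have "Y (vx u \<theta> i) (vx u \<theta> (Suc i)) \<le> Q2 / real m" by (simp add: Q2_def)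
      from m2[rule_format, OF mm(2) L that this m0] show ?thesis by (simp add: Y Yz)
    qed
    have lk: "0 < vx u \<theta> (Suc i) - vx u \<theta> i" for i using orbit_link[OF t] by auto
    have up: "vx u \<theta> m - u \<le> pi" if "\<theta> = \<kappa>1 / real j"
    proof -
      have "vx u \<theta> m - vx u \<theta> 0 \<le> real (m - 0) * (2 * G * \<kappa>1 / (c * N))"
      proof (rule tw.links_total)
        fix i assume i: "0 \<le> i" "i < m"
        have "c * (vx u \<theta> (Suc i) - vx u \<theta> i) \<le> 2 * (g u * \<theta>)"
          using tw.Y_lower[OF lk[of i]] A[OF i(2)] by (simp add: Y)
        also have "\<dots> \<le> 2 * (G * (\<kappa>1 / N))" using mult_right_mono[OF g_le[of u] less_imp_le[OF t(1)]] that by (simp add: N_def)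
        finally have "vx u \<theta> (Suc i) - vx u \<theta> i \<le> 2 * (G * (\<kappa>1 / N)) / c" by (simp only: pos_le_divide_eq[OF tw.c_pos] mult.commute[of _ c])
        then show "vx u \<theta> (Suc i) - vx u \<theta> i \<le> 2 * G * \<kappa>1 / (c * N)" using tw.c_pos N0 by (simp add: field_simps)
      qed simp
      also have "\<dots> \<le> (2 * N) * (2 * G * \<kappa>1 / (c * N))"
        using mr G_pos \<kappa> tw.c_pos N0 by (intro mult_right_mono) auto
      also have "\<dots> = pi" using N0 tw.c_pos G_pos by (simp add: \<kappa>1_def)
      finally show ?thesis by simp
    qed
    have lo: "3 * pi \<le> vx u \<theta> m - u" if "\<theta> = \<kappa>2 / real j"
    proof -
      have "real (m - 0) * (g0 * \<kappa>2 / (2 * K * N)) \<le> vx u \<theta> m - vx u \<theta> 0"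
      proof (rule tw.links_total_ge)
        fix i assume i: "0 \<le> i" "i < m"
        have "g0 * (\<kappa>2 / N) \<le> g u * \<theta>" using mult_right_mono[OF g_ge[of u] less_imp_le[OF t(1)]] that by (simp add: N_def)
        also have "\<dots> \<le> 2 * (K * (vx u \<theta> (Suc i) - vx u \<theta> i))"
          using B[OF i(2)] tw.Y_upper[OF lk[of i]] A[OF i(2)] by (simp add: Y)
        finally have "g0 * \<kappa>2 / N \<le> (vx u \<theta> (Suc i) - vx u \<theta> i) * (2 * K)" by (simp add: mult_ac)
        then have "(g0 * \<kappa>2 / N) / (2 * K) \<le> vx u \<theta> (Suc i) - vx u \<theta> i" using tw.C_pos by (simp only: pos_divide_le_eq)
        then show "g0 * \<kappa>2 / (2 * K * N) \<le> vx u \<theta> (Suc i) - vx u \<theta> i" by (simp add: mult_ac)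
      qed simp
      moreover have "(N / 2) * (g0 * \<kappa>2 / (2 * K * N)) \<le> real m * (g0 * \<kappa>2 / (2 * K * N))"
        using mr g0_pos \<kappa> tw.C_pos N0 by (intro mult_right_mono) auto
      moreover have "(N / 2) * (g0 * \<kappa>2 / (2 * K * N)) = g0 * \<kappa>2 / (4 * K)" using N0 by simp
      ultimately show ?thesis using \<kappa>(4) by simp
    qed
    show ?thesis using t A B up lo by blast
  qed
  then show ?thesis using \<kappa>(1,2) by blast
qed

text \<open>\<open>links_twist\<close> in phase space terms: \<open>g * \<theta>\<close> is the
  coordinate \<open>Y\<close> of the outgoing link, and at the end \<open>g * ax\<close> is
  \<open>Y'\<close> of the last link, so the conclusion can be compared with a focal condition at
  the final vertex.\<close>

lemma twist_orbits:
  assumes "0 < k2"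
  shows "\<exists>c'>0. \<exists>j0. \<forall>j\<ge>j0. \<forall>m. j \<le> 2 * m \<longrightarrow> m \<le> 2 * j \<longrightarrow> (\<forall>u \<theta> v \<phi>.
     0 < \<theta> \<longrightarrow> \<theta> < pi \<longrightarrow> 0 < \<phi> \<longrightarrow> \<phi> < pi \<longrightarrow>
     (\<forall>i<m. vx u \<theta> (Suc i) - vx u \<theta> i \<le> k2 / real j) \<longrightarrow> (\<forall>i<m. vx v \<phi> (Suc i) - vx v \<phi> i \<le> k2 / real j) \<longrightarrow>
     g u * \<theta> < g v * \<phi> \<longrightarrow> \<bar>v - u\<bar> \<le> g v * \<phi> - g u * \<theta> \<longrightarrow>
     c' * real j * (g v * \<phi> - g u * \<theta>) \<le> vx v \<phi> m - vx u \<theta> m \<and>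
     \<bar>g (vx v \<phi> m) * ax v \<phi> m - g (vx u \<theta> m) * ax u \<theta> m\<bar> \<le> 2 * (g v * \<phi> - g u * \<theta>))"
proof -
  obtain c' j0 where c': "0 < c'" and T: "\<forall>j\<ge>j0. \<forall>m. j \<le> 2 * m \<longrightarrow> m \<le> 2 * j \<longrightarrow> (\<forall>\<psi> \<xi>. tw.links \<psi> m \<longrightarrow> tw.links \<xi> m \<longrightarrow>
      (\<forall>i<m. \<psi> (Suc i) - \<psi> i \<le> k2 / real j) \<longrightarrow> (\<forall>i<m. \<xi> (Suc i) - \<xi> i \<le> k2 / real j) \<longrightarrow>
      Y (\<psi> 0) (\<psi> 1) < Y (\<xi> 0) (\<xi> 1) \<longrightarrow>
      \<bar>\<xi> 0 - \<psi> 0\<bar> \<le> Y (\<xi> 0) (\<xi> 1) - Y (\<psi> 0) (\<psi> 1) \<longrightarrow>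
      c' * real j * (Y (\<xi> 0) (\<xi> 1) - Y (\<psi> 0) (\<psi> 1)) \<le> \<xi> m - \<psi> m \<and>
      \<bar>Y' (\<xi> (m - 1)) (\<xi> m) - Y' (\<psi> (m - 1)) (\<psi> m)\<bar> \<le> 2 * (Y (\<xi> 0) (\<xi> 1) - Y (\<psi> 0) (\<psi> 1)))"
    using tw.links_twist[OF assms] by blast
  have "c' * real j * (g v * \<phi> - g u * \<theta>) \<le> vx v \<phi> m - vx u \<theta> m \<and>
     \<bar>g (vx v \<phi> m) * ax v \<phi> m - g (vx u \<theta> m) * ax u \<theta> m\<bar> \<le> 2 * (g v * \<phi> - g u * \<theta>)"
    if j: "j \<ge> Suc j0" and m: "j \<le> 2 * m" "m \<le> 2 * j" and t: "0 < \<theta>" "\<theta> < pi" and f: "0 < \<phi>" "\<phi> < pi"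
     and S: "\<forall>i<m. vx u \<theta> (Suc i) - vx u \<theta> i \<le> k2 / real j" "\<forall>i<m. vx v \<phi> (Suc i) - vx v \<phi> i \<le> k2 / real j"
     and D: "g u * \<theta> < g v * \<phi>" "\<bar>v - u\<bar> \<le> g v * \<phi> - g u * \<theta>" for j m u \<theta> v \<phi>
  proof -
    have m0: "Suc (m - 1) = m" using m j by linarith
    have L: "tw.links (vx u \<theta>) m" "tw.links (vx v \<phi>) m" using orbit_links[OF t, of u 0 m] orbit_links[OF f, of v 0 m] by simp_all
    have Y0: "Y (vx u \<theta> 0) (vx u \<theta> 1) = g u * \<theta>" "Y (vx v \<phi> 0) (vx v \<phi> 1) = g v * \<phi>"
      using Y_orbit(1)[OF t, of u 0] Y_orbit(1)[OF f, of v 0] by simp_all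
    have Ym: "Y' (vx u \<theta> (m - 1)) (vx u \<theta> m) = g (vx u \<theta> m) * ax u \<theta> m" "Y' (vx v \<phi> (m - 1)) (vx v \<phi> m) = g (vx v \<phi> m) * ax v \<phi> m"
      using Y_orbit(2)[OF t, of u "m - 1"] Y_orbit(2)[OF f, of v "m - 1"] unfolding m0 by simp_all
    have jj: "j0 \<le> j" using j by simp
    have D': "\<bar>vx v \<phi> 0 - vx u \<theta> 0\<bar> \<le> g v * \<phi> - g u * \<theta>" using D by simp
    show ?thesis
      using T[rule_format, OF jj m L, unfolded Y0 Ym, OF S(1)[rule_format] S(2)[rule_format] D(1) D'] by simp
  qed
  then show ?thesis using c' by blast
qed

text \<open>The phase curves of the focal conditions are nearly vertical, while the twist makes the image of
  a nearly vertical curve nearly horizontal.\<close>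

lemma orbit_unique:
  assumes "0 < k1" "0 < k2"
  shows "\<exists>j0. \<forall>j\<ge>j0. \<forall>m. j \<le> 2 * m \<longrightarrow> m \<le> 2 * j \<longrightarrow> (\<forall>s t x y q u \<theta> v \<phi>. (s = 1 \<or> s = -1) \<longrightarrow> (t = 1 \<or> t = -1) \<longrightarrow>
    norm (x - \<Gamma> q) \<le> 1 / real j ^ 4 \<longrightarrow> norm (y - \<Gamma> q) \<le> 1 / real j ^ 4 \<longrightarrow>
    0 < \<theta> \<longrightarrow> \<theta> < pi \<longrightarrow> 0 < \<phi> \<longrightarrow> \<phi> < pi \<longrightarrow>
    (\<forall>i<m. vx u \<theta> (Suc i) - vx u \<theta> i \<le> k2 / real j) \<longrightarrow> (\<forall>i<m. vx v \<phi> (Suc i) - vx v \<phi> i \<le> k2 / real j) \<longrightarrow>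
    (\<forall>i\<le>m. k1 / real j \<le> ax u \<theta> i \<and> ax u \<theta> i \<le> k2 / real j) \<longrightarrow> (\<forall>i\<le>m. k1 / real j \<le> ax v \<phi> i \<and> ax v \<phi> i \<le> k2 / real j) \<longrightarrow>
    \<bar>u - q\<bar> \<le> 1 / real j ^ 3 \<longrightarrow> \<bar>v - q\<bar> \<le> 1 / real j ^ 3 \<longrightarrow>
    \<bar>vx u \<theta> m - (q + 2 * pi)\<bar> \<le> 1 / real j ^ 3 \<longrightarrow> \<bar>vx v \<phi> m - (q + 2 * pi)\<bar> \<le> 1 / real j ^ 3 \<longrightarrow>
    foc s x u \<theta> = 0 \<longrightarrow> foc s x v \<phi> = 0 \<longrightarrow>
    foc t y (vx u \<theta> m) (ax u \<theta> m) = 0 \<longrightarrow> foc t y (vx v \<phi> m) (ax v \<phi> m) = 0 \<longrightarrow> u = v \<and> \<theta> = \<phi>)"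
proof -
  obtain M j1 where M: "0 < M" and V: "\<And>j s x q u v \<theta> \<phi>. j \<ge> j1 \<Longrightarrow> (s = 1 \<or> s = -1) \<Longrightarrow> norm (x - \<Gamma> q) \<le> 1 / real j ^ 4 \<Longrightarrow>
    \<bar>u - q\<bar> \<le> 1 / real j ^ 3 \<Longrightarrow> \<bar>v - q\<bar> \<le> 1 / real j ^ 3 \<Longrightarrow>
    k1 / real j \<le> \<theta> \<Longrightarrow> \<theta> \<le> k2 / real j \<Longrightarrow> k1 / real j \<le> \<phi> \<Longrightarrow> \<phi> \<le> k2 / real j \<Longrightarrow>
    foc s x u \<theta> = 0 \<Longrightarrow> foc s x v \<phi> = 0 \<Longrightarrow>
    \<bar>v - u\<bar> \<le> M / real j ^ 2 * \<bar>\<phi> - \<theta>\<bar> \<and> (\<theta> \<le> \<phi> \<longrightarrow> g0 / 2 * (\<phi> - \<theta>) \<le> g v * \<phi> - g u * \<theta>)"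
    using foc_vertical[OF assms] by metis
  obtain c' j2 where c': "0 < c'" and T0: "\<forall>j\<ge>j2. \<forall>m. j \<le> 2 * m \<longrightarrow> m \<le> 2 * j \<longrightarrow> (\<forall>u \<theta> v \<phi>.
     0 < \<theta> \<longrightarrow> \<theta> < pi \<longrightarrow> 0 < \<phi> \<longrightarrow> \<phi> < pi \<longrightarrow>
     (\<forall>i<m. vx u \<theta> (Suc i) - vx u \<theta> i \<le> k2 / real j) \<longrightarrow> (\<forall>i<m. vx v \<phi> (Suc i) - vx v \<phi> i \<le> k2 / real j) \<longrightarrow>
     g u * \<theta> < g v * \<phi> \<longrightarrow> \<bar>v - u\<bar> \<le> g v * \<phi> - g u * \<theta> \<longrightarrow>
     c' * real j * (g v * \<phi> - g u * \<theta>) \<le> vx v \<phi> m - vx u \<theta> m \<and>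
     \<bar>g (vx v \<phi> m) * ax v \<phi> m - g (vx u \<theta> m) * ax u \<theta> m\<bar> \<le> 2 * (g v * \<phi> - g u * \<theta>))"
    by (insert twist_orbits[OF assms(2)], elim exE conjE, rule that)
  obtain j3 :: nat where j3: "real j3 \<ge> 2 * M / g0 + 4 * M / (g0 * c') + 1" using real_arch_simple by blast
  have key: "\<theta> = \<phi>" if j: "j \<ge> j1 + j2 + j3" and m: "j \<le> 2 * m" "m \<le> 2 * j" and st: "s = 1 \<or> s = -1" "t = 1 \<or> t = -1"
     and xy: "norm (x - \<Gamma> q) \<le> 1 / real j ^ 4" "norm (y - \<Gamma> q) \<le> 1 / real j ^ 4"
     and th: "0 < \<theta>" "\<theta> < pi" "0 < \<phi>" "\<phi> < pi"
     and S: "\<forall>i<m. vx u \<theta> (Suc i) - vx u \<theta> i \<le> k2 / real j" "\<forall>i<m. vx v \<phi> (Suc i) - vx v \<phi> i \<le> k2 / real j"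
     and A: "\<forall>i\<le>m. k1 / real j \<le> ax u \<theta> i \<and> ax u \<theta> i \<le> k2 / real j" "\<forall>i\<le>m. k1 / real j \<le> ax v \<phi> i \<and> ax v \<phi> i \<le> k2 / real j"
     and near: "\<bar>u - q\<bar> \<le> 1 / real j ^ 3" "\<bar>v - q\<bar> \<le> 1 / real j ^ 3"
       "\<bar>vx u \<theta> m - (q + 2 * pi)\<bar> \<le> 1 / real j ^ 3" "\<bar>vx v \<phi> m - (q + 2 * pi)\<bar> \<le> 1 / real j ^ 3"
     and F: "foc s x u \<theta> = 0" "foc s x v \<phi> = 0" "foc t y (vx u \<theta> m) (ax u \<theta> m) = 0" "foc t y (vx v \<phi> m) (ax v \<phi> m) = 0"
     and le: "\<theta> \<le> \<phi>"
    for j m s t x y q u \<theta> v \<phi>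
  proof (rule ccontr)
    assume "\<theta> \<noteq> \<phi>"
    then have lt: "\<theta> < \<phi>" using le by simp
    define N where "N = real j"
    have nn: "0 \<le> 2 * M / g0" "0 \<le> 4 * M / (g0 * c')" using M g0_pos c' by auto
    have N: "2 * M / g0 \<le> N" "4 * M / (g0 * c') < N" "1 \<le> N" using j j3 nn unfolding N_def by linarith+
    have N0: "0 < N" using N by linarith
    have jj: "j1 \<le> j" "j2 \<le> j" using j by auto
    have A0: "k1 / real j \<le> \<theta>" "\<theta> \<le> k2 / real j" "k1 / real j \<le> \<phi>" "\<phi> \<le> k2 / real j" using A[rule_format, of 0] by auto
    define D where "D = g v * \<phi> - g u * \<theta>"
    have v1: "\<bar>v - u\<bar> \<le> M / N ^ 2 * (\<phi> - \<theta>)" "g0 / 2 * (\<phi> - \<theta>) \<le> D"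
      using V[OF jj(1) st(1) xy(1) near(1,2) A0 F(1,2)] lt by (auto simp: N_def D_def)
    have D0: "0 < D" using v1(2) lt g0_pos by (smt (verit) half_gt_zero mult_pos_pos)
    have ph: "\<phi> - \<theta> \<le> 2 / g0 * D" using v1(2) g0_pos by (simp add: field_simps)
    have "\<bar>v - u\<bar> \<le> M / N ^ 2 * (2 / g0 * D)" using v1(1) mult_left_mono[OF ph, of "M / N ^ 2"] M N0 by simp
    also have "\<dots> = (2 * M / g0) / N ^ 2 * D" by (simp add: field_simps)
    also have "\<dots> \<le> 1 * D"
    proof (rule mult_right_mono)
      have "2 * M / g0 \<le> N ^ 2" using N(1) power_increasing[of 1 2 N] N(3) by simp
      then show "2 * M / g0 / N ^ 2 \<le> 1" using N0 by (subst divide_le_eq_1_pos) auto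
    qed (use D0 in simp)
    finally have vu: "\<bar>v - u\<bar> \<le> D" by simp
    have tw: "c' * N * D \<le> vx v \<phi> m - vx u \<theta> m" "\<bar>g (vx v \<phi> m) * ax v \<phi> m - g (vx u \<theta> m) * ax u \<theta> m\<bar> \<le> 2 * D"
      using T0[rule_format, OF jj(2) m th S(1)[rule_format] S(2)[rule_format]] D0 vu unfolding D_def N_def by auto
    define \<delta> where "\<delta> = \<bar>ax v \<phi> m - ax u \<theta> m\<bar>"
    have yq: "norm (y - \<Gamma> (q + 2 * pi)) \<le> 1 / real j ^ 4" using xy(2) \<Gamma>_period by simp
    have Am: "k1 / real j \<le> ax u \<theta> m" "ax u \<theta> m \<le> k2 / real j" "k1 / real j \<le> ax v \<phi> m" "ax v \<phi> m \<le> k2 / real j"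
      using A[rule_format, of m] by auto
    have v2: "\<bar>vx v \<phi> m - vx u \<theta> m\<bar> \<le> M / N ^ 2 * \<delta>" "g0 / 2 * \<delta> \<le> 2 * D"
    proof -
      show "\<bar>vx v \<phi> m - vx u \<theta> m\<bar> \<le> M / N ^ 2 * \<delta>"
        using V[OF jj(1) st(2) yq near(3,4) Am F(3,4)] by (simp add: N_def \<delta>_def)
      show "g0 / 2 * \<delta> \<le> 2 * D"
      \<comment> \<open>The final angles may come in either order, so the estimate for the focal
        curve of \<open>y\<close> is applied with the two orbits possibly exchanged.\<close>
      proof (cases "ax u \<theta> m \<le> ax v \<phi> m")
        case True
        then show ?thesis using V[OF jj(1) st(2) yq near(3,4) Am F(3,4)] tw(2) by (simp add: \<delta>_def abs_le_iff)
      next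
        case False
        then show ?thesis using V[OF jj(1) st(2) yq near(4,3) Am(3,4,1,2) F(4,3)] tw(2) by (simp add: \<delta>_def abs_le_iff)
      qed
    qed
    \<comment> \<open>The contradiction: the twist separates the final vertices by at least
      \<open>c' * N * D\<close>, whereas on the steep focal curve of \<open>y\<close> they differ by
      at most \<open>M / N ^ 2 * (4 / g0 * D)\<close>.\<close>
    have "\<delta> \<le> 4 / g0 * D" using v2(2) g0_pos by (simp add: field_simps)
    then have "c' * N * D \<le> M / N ^ 2 * (4 / g0 * D)"
      using tw(1) v2(1) mult_left_mono[of \<delta> "4 / g0 * D" "M / N ^ 2"] M N0 by simp
    also have "\<dots> = (4 * M / g0 / N ^ 2) * D" by (simp add: field_simps)
    finally have "c' * N \<le> 4 * M / g0 / N ^ 2" using D0 by (simp only: mult_le_cancel_right_pos)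
    also have "\<dots> \<le> 4 * M / g0 / 1"
      using M g0_pos N(3) one_le_power[OF N(3), of 2] by (intro divide_left_mono) auto
    finally have "c' * N \<le> 4 * M / g0" by simp
    moreover have "4 * M / g0 < c' * N" using N(2) c' g0_pos by (simp add: field_simps)
    ultimately show False by simp
  qed
  show ?thesis
  proof (rule exI[of _ "j1 + j2 + j3"], intro allI impI)
    fix j m s t x y q u \<theta> v \<phi>
    assume j: "j1 + j2 + j3 \<le> j" and m: "j \<le> 2 * m" "m \<le> 2 * j" and st: "s = 1 \<or> s = (-1::real)" "t = 1 \<or> t = (-1::real)"
     and xy: "norm (x - \<Gamma> q) \<le> 1 / real j ^ 4" "norm (y - \<Gamma> q) \<le> 1 / real j ^ 4"
     and th: "0 < \<theta>" "\<theta> < pi" "0 < \<phi>" "\<phi> < pi"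
     and S: "\<forall>i<m. vx u \<theta> (Suc i) - vx u \<theta> i \<le> k2 / real j" "\<forall>i<m. vx v \<phi> (Suc i) - vx v \<phi> i \<le> k2 / real j"
     and A: "\<forall>i\<le>m. k1 / real j \<le> ax u \<theta> i \<and> ax u \<theta> i \<le> k2 / real j" "\<forall>i\<le>m. k1 / real j \<le> ax v \<phi> i \<and> ax v \<phi> i \<le> k2 / real j"
     and near: "\<bar>u - q\<bar> \<le> 1 / real j ^ 3" "\<bar>v - q\<bar> \<le> 1 / real j ^ 3"
       "\<bar>vx u \<theta> m - (q + 2 * pi)\<bar> \<le> 1 / real j ^ 3" "\<bar>vx v \<phi> m - (q + 2 * pi)\<bar> \<le> 1 / real j ^ 3"
     and F: "foc s x u \<theta> = 0" "foc s x v \<phi> = 0" "foc t y (vx u \<theta> m) (ax u \<theta> m) = 0" "foc t y (vx v \<phi> m) (ax v \<phi> m) = 0"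
    have eq: "\<theta> = \<phi>"
    proof (cases "\<theta> \<le> \<phi>")
      case True
      show ?thesis by (rule key[OF j m st xy th S A near F True])
    next
      case False
      then have le: "\<phi> \<le> \<theta>" by simp
      show ?thesis by (rule key[OF j m st xy th(3,4,1,2) S(2,1) A(2,1) near(2,1,4,3) F(2,1,4,3) le, symmetric])
    qed
    have jj: "j1 \<le> j" using j by auto
    have A0: "k1 / real j \<le> \<theta>" "\<theta> \<le> k2 / real j" "k1 / real j \<le> \<phi>" "\<phi> \<le> k2 / real j" using A[rule_format, of 0] by auto
    have "\<bar>v - u\<bar> \<le> 0" using V[OF jj st(1) xy(1) near(1,2) A0 F(1,2)] eq by simp
    then show "u = v \<and> \<theta> = \<phi>" using eq by simp
  qed
qed

end

context gauss_curve
begin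

lemma tau_shift: "tau (a + 2 * pi * of_int k) \<theta> = tau a \<theta>"
proof -
  have c: "cis (a + 2 * pi * of_int k) = cis a"
  proof -
    have "cis (2 * pi * of_int k) = 1" by (rule cis_multiple_2pi) simp
    then show ?thesis by (simp add: cis_mult[symmetric])
  qed
  have "\<Gamma> ((a + 2 * pi * of_int k) + u) = \<Gamma> (a + u)" for u
    using \<Gamma>_period_int[of "a + u" k] by (simp add: algebra_simps)
  then have "Th (a + 2 * pi * of_int k) = Th a" unfolding Th_def th_def c \<Gamma>_period_int by auto
  then show ?thesis unfolding tau_def by simp
qed

lemma vx_shift: "vx (u + 2 * pi * of_int k) \<theta> i = vx u \<theta> i + 2 * pi * of_int k \<and> ax (u + 2 * pi * of_int k) \<theta> i = ax u \<theta> i"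
proof (induction i)
  case (Suc i) then show ?case unfolding vx_Suc by (simp add: bm_def tau_shift)
qed simp

end

lemma (in billiard_table) inside_\<Omega>: "x \<in> \<Omega> \<Longrightarrow> inside x"
  unfolding inside_def using inner by blast

section \<open>Existence of connecting orbits, and a priori range of all orbits\<close>

context twist_curve
begin

text \<open>The intermediate value theorem is used on two levels. For each angle in the sweep window
  the focal condition at \<open>x\<close> has a solution \<open>U \<theta>\<close> near
  \<open>q\<close>. Along the curve of these solutions the twist makes the final vertex increase,
  through the interval of radius \<open>1 / j ^ 3\<close> around \<open>q + 2 * pi\<close>; at its
  two ends \<open>foc_sign\<close> gives opposite signs for the focal condition at
  \<open>y\<close>.\<close>

lemma orbit_exists:
  "\<exists>k1>0. \<exists>k2>0. \<exists>c0>0. \<exists>j0. \<forall>j\<ge>j0. \<forall>m. j \<le> m + 1 \<longrightarrow> m \<le> j + 1 \<longrightarrow> (\<forall>s t x y q. (s = 1 \<or> s = -1) \<longrightarrow> (t = 1 \<or> t = -1) \<longrightarrow>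
    norm (x - \<Gamma> q) \<le> c0 / real j ^ 4 \<longrightarrow> norm (y - \<Gamma> q) \<le> c0 / real j ^ 4 \<longrightarrow>
    (\<exists>u \<theta>. 0 < \<theta> \<and> \<theta> < pi \<and> (\<forall>i<m. vx u \<theta> (Suc i) - vx u \<theta> i \<le> k2 / real j) \<and> (\<forall>i\<le>m. k1 / real j \<le> ax u \<theta> i \<and> ax u \<theta> i \<le> k2 / real j) \<and>
      \<bar>u - q\<bar> \<le> 1 / real j ^ 3 \<and> \<bar>vx u \<theta> m - (q + 2 * pi)\<bar> \<le> 1 / real j ^ 3 \<and> foc s x u \<theta> = 0 \<and> foc t y (vx u \<theta> m) (ax u \<theta> m) = 0))"
proof -
  obtain \<kappa>1 \<kappa>2 j1 where \<kappa>: "0 < \<kappa>1" "\<kappa>1 \<le> \<kappa>2" and sweep: "\<forall>j\<ge>j1. \<forall>m. j \<le> 2 * m \<longrightarrow> m \<le> 2 * j \<longrightarrow> (\<forall>u \<theta>. \<kappa>1 / real j \<le> \<theta> \<longrightarrow> \<theta> \<le> \<kappa>2 / real j \<longrightarrow>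
     0 < \<theta> \<and> \<theta> < pi \<and> (\<forall>i<m. vx u \<theta> (Suc i) - vx u \<theta> i \<le> d \<and> g (vx u \<theta> i) * ax u \<theta> i \<le> 2 * (g u * \<theta>) \<and> g u * \<theta> \<le> 2 * (g (vx u \<theta> i) * ax u \<theta> i)) \<and>
     (\<theta> = \<kappa>1 / real j \<longrightarrow> vx u \<theta> m - u \<le> pi) \<and> (\<theta> = \<kappa>2 / real j \<longrightarrow> 3 * pi \<le> vx u \<theta> m - u))"
    by (insert orbit_sweep, elim exE conjE, rule that)
  have \<kappa>2: "0 < \<kappa>2" using \<kappa> by linarith
  define k1 where "k1 = g0 * \<kappa>1 / (2 * G)"
  define k2 where "k2 = 2 * G * \<kappa>2 / g0 + 2 * G * \<kappa>2 / c"
  have p2: "0 < 2 * G * \<kappa>2 / g0" "0 < 2 * G * \<kappa>2 / c" using G_pos g0_pos tw.c_pos \<kappa>2 by auto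
  have k1: "0 < k1" using g0_pos G_pos \<kappa> by (simp add: k1_def)
  have k2: "0 < k2" "2 * G * \<kappa>2 / g0 \<le> k2" "2 * G * \<kappa>2 / c \<le> k2" unfolding k2_def using p2 by linarith+
  obtain c1 j2 where c1: "0 < c1" and sign: "\<forall>j\<ge>j2. \<forall>s x q \<theta>. (s = 1 \<or> s = -1) \<longrightarrow> norm (x - \<Gamma> q) \<le> c1 / real j ^ 4 \<longrightarrow>
     k1 / real j \<le> \<theta> \<longrightarrow> \<theta> \<le> k2 / real j \<longrightarrow>
     s * foc s x (q - 1 / real j ^ 3) \<theta> < 0 \<and> 0 < s * foc s x (q + 1 / real j ^ 3) \<theta>"
    by (insert foc_sign[OF k1 k2(1)], elim exE conjE, rule that)
  obtain M j3 where M: "0 < M" and V: "\<forall>j\<ge>j3. \<forall>s x q u v \<theta> \<phi>. (s = 1 \<or> s = -1) \<longrightarrow> norm (x - \<Gamma> q) \<le> 1 / real j ^ 4 \<longrightarrow>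
    \<bar>u - q\<bar> \<le> 1 / real j ^ 3 \<longrightarrow> \<bar>v - q\<bar> \<le> 1 / real j ^ 3 \<longrightarrow>
    k1 / real j \<le> \<theta> \<longrightarrow> \<theta> \<le> k2 / real j \<longrightarrow> k1 / real j \<le> \<phi> \<longrightarrow> \<phi> \<le> k2 / real j \<longrightarrow>
    foc s x u \<theta> = 0 \<longrightarrow> foc s x v \<phi> = 0 \<longrightarrow>
    \<bar>v - u\<bar> \<le> M / real j ^ 2 * \<bar>\<phi> - \<theta>\<bar> \<and> (\<theta> \<le> \<phi> \<longrightarrow> g0 / 2 * (\<phi> - \<theta>) \<le> g v * \<phi> - g u * \<theta>)"
    by (insert foc_vertical[OF k1 k2(1)], elim exE conjE, rule that)
  obtain c' j4 where c': "0 < c'" and T: "\<forall>j\<ge>j4. \<forall>m. j \<le> 2 * m \<longrightarrow> m \<le> 2 * j \<longrightarrow> (\<forall>u \<theta> v \<phi>.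
     0 < \<theta> \<longrightarrow> \<theta> < pi \<longrightarrow> 0 < \<phi> \<longrightarrow> \<phi> < pi \<longrightarrow>
     (\<forall>i<m. vx u \<theta> (Suc i) - vx u \<theta> i \<le> k2 / real j) \<longrightarrow> (\<forall>i<m. vx v \<phi> (Suc i) - vx v \<phi> i \<le> k2 / real j) \<longrightarrow>
     g u * \<theta> < g v * \<phi> \<longrightarrow> \<bar>v - u\<bar> \<le> g v * \<phi> - g u * \<theta> \<longrightarrow>
     c' * real j * (g v * \<phi> - g u * \<theta>) \<le> vx v \<phi> m - vx u \<theta> m \<and>
     \<bar>g (vx v \<phi> m) * ax v \<phi> m - g (vx u \<theta> m) * ax u \<theta> m\<bar> \<le> 2 * (g v * \<phi> - g u * \<theta>))"
    by (insert twist_orbits[OF k2(1)], elim exE conjE, rule that)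
  obtain j5 :: nat where j5: "real j5 \<ge> 2 * M / g0 + 3" using real_arch_simple by blast
  define c0 where "c0 = min c1 1"
  have c0: "0 < c0" "c0 \<le> c1" "c0 \<le> 1" using c1 by (auto simp: c0_def)
  have main: "\<exists>u \<theta>. 0 < \<theta> \<and> \<theta> < pi \<and> (\<forall>i<m. vx u \<theta> (Suc i) - vx u \<theta> i \<le> k2 / real j) \<and> (\<forall>i\<le>m. k1 / real j \<le> ax u \<theta> i \<and> ax u \<theta> i \<le> k2 / real j) \<and>
      \<bar>u - q\<bar> \<le> 1 / real j ^ 3 \<and> \<bar>vx u \<theta> m - (q + 2 * pi)\<bar> \<le> 1 / real j ^ 3 \<and> foc s x u \<theta> = 0 \<and> foc t y (vx u \<theta> m) (ax u \<theta> m) = 0"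
    if j: "j \<ge> j1 + j2 + j3 + j4 + j5" and m: "j \<le> m + 1" "m \<le> j + 1" and st: "s = 1 \<or> s = -1" "t = 1 \<or> t = -1"
      and xy: "norm (x - \<Gamma> q) \<le> c0 / real j ^ 4" "norm (y - \<Gamma> q) \<le> c0 / real j ^ 4" for j m s t x y q
  proof -
    have jj: "j1 \<le> j" "j2 \<le> j" "j3 \<le> j" "j4 \<le> j" "j5 \<le> j" using j by auto
    define N where "N = real j"
    have "0 \<le> 2 * M / g0" using M g0_pos by simp
    then have N: "2 * M / g0 \<le> N" "3 \<le> N" using jj(5) j5 unfolding N_def by linarith+
    have N0: "0 < N" using N by linarith
    have j3': "3 \<le> j" using N(2) by (simp add: N_def)
    define w where "w = 1 / N ^ 3"
    have w: "0 < w" "w \<le> 1" using N0 N(2) by (auto simp: w_def)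
    have wj: "1 / real j ^ 3 = w" by (simp add: w_def N_def)
    have x1: "norm (x - \<Gamma> q) \<le> 1 / real j ^ 4" "norm (x - \<Gamma> q) \<le> c1 / real j ^ 4" "norm (y - \<Gamma> q) \<le> c1 / real j ^ 4"
      using xy divide_right_mono[OF c0(3), of "real j ^ 4"] divide_right_mono[OF c0(2), of "real j ^ 4"] by simp_all
    have y2: "norm (y - \<Gamma> (q + 2 * pi)) \<le> c1 / real j ^ 4" using x1(3) \<Gamma>_period by simp
    define lo where "lo = \<kappa>1 / N"
    define hi where "hi = \<kappa>2 / N"
    have lohi: "lo \<le> hi" using \<kappa> N0 by (simp add: lo_def hi_def divide_right_mono)
    have m1: "j \<le> 2 * Suc m" "Suc m \<le> 2 * j" "j \<le> 2 * m" "m \<le> 2 * j" using m j3' by auto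
    have "g0 * lo \<le> g u * \<theta> \<and> g u * \<theta> \<le> G * hi" if "lo \<le> \<theta>" "\<theta> \<le> hi" "0 < \<theta>" for u \<theta>
    proof
      have "0 \<le> lo" using \<kappa>(1) N0 by (simp add: lo_def)
      then show "g0 * lo \<le> g u * \<theta>" using g_ge[of u] less_imp_le[OF g_pos[of u]] that by (intro mult_mono) auto
      show "g u * \<theta> \<le> G * hi" using g_le[of u] G_pos that by (intro mult_mono) auto
    qed
    note gu' = this
    have bas: "0 < \<theta> \<and> \<theta> < pi \<and> (\<forall>i<m. vx u \<theta> (Suc i) - vx u \<theta> i \<le> k2 / N) \<and> (\<forall>i\<le>m. k1 / N \<le> ax u \<theta> i \<and> ax u \<theta> i \<le> k2 / N)"
      if \<theta>: "lo \<le> \<theta>" "\<theta> \<le> hi" for u \<theta>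
    proof -
      have S: "0 < \<theta>" "\<theta> < pi" and B: "\<And>i. i < Suc m \<Longrightarrow> vx u \<theta> (Suc i) - vx u \<theta> i \<le> d \<and> g (vx u \<theta> i) * ax u \<theta> i \<le> 2 * (g u * \<theta>) \<and> g u * \<theta> \<le> 2 * (g (vx u \<theta> i) * ax u \<theta> i)"
        using sweep[rule_format, OF jj(1) m1(1,2), of \<theta> u] \<theta> unfolding lo_def hi_def N_def by auto
      have gu: "g0 * lo \<le> g u * \<theta>" "g u * \<theta> \<le> G * hi" using gu'[OF \<theta> S(1)] by auto
      have ax: "k1 / N \<le> ax u \<theta> i \<and> ax u \<theta> i \<le> k2 / N" if "i \<le> m" for i
      proof
        have a0: "0 < ax u \<theta> i" by (rule orbit_link(1)[OF S])
        have Bi: "g (vx u \<theta> i) * ax u \<theta> i \<le> 2 * (g u * \<theta>)" "g u * \<theta> \<le> 2 * (g (vx u \<theta> i) * ax u \<theta> i)" using B[of i] that by auto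
        have "g0 * lo \<le> 2 * (G * ax u \<theta> i)" using gu(1) Bi(2) mult_right_mono[OF g_le[of "vx u \<theta> i"] less_imp_le[OF a0]] by linarith
        then have "g0 * lo / (2 * G) \<le> ax u \<theta> i" using G_pos by (simp add: pos_divide_le_eq mult_ac)
        then show "k1 / N \<le> ax u \<theta> i" by (simp add: k1_def lo_def mult_ac)
        have "ax u \<theta> i * g0 \<le> 2 * (G * hi)" using gu(2) Bi(1) mult_right_mono[OF g_ge[of "vx u \<theta> i"] less_imp_le[OF a0]] by (simp add: mult.commute)
        then have "ax u \<theta> i \<le> 2 * (G * hi) / g0" using g0_pos by (simp add: pos_le_divide_eq)
        also have "\<dots> = (2 * G * \<kappa>2 / g0) / N" using g0_pos N0 by (simp add: hi_def field_simps)
        also have "\<dots> \<le> k2 / N" using k2(2) N0 by (intro divide_right_mono) auto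
        finally show "ax u \<theta> i \<le> k2 / N" .
      qed
      have "vx u \<theta> (Suc i) - vx u \<theta> i \<le> k2 / N" if "i < m" for i
      proof -
        have "c * (vx u \<theta> (Suc i) - vx u \<theta> i) \<le> Y (vx u \<theta> i) (vx u \<theta> (Suc i))" using B[of i] that orbit_link(3)[OF S] by (intro tw.Y_lower) auto
        also have "\<dots> = g (vx u \<theta> i) * ax u \<theta> i" by (rule Y_orbit(1)[OF S])
        also have "\<dots> \<le> 2 * (G * hi)" using B[of i] that gu(2) by auto
        finally have "(vx u \<theta> (Suc i) - vx u \<theta> i) * c \<le> 2 * (G * hi)" by (simp only: mult.commute)
        then have "vx u \<theta> (Suc i) - vx u \<theta> i \<le> 2 * (G * hi) / c" by (simp only: pos_le_divide_eq[OF tw.c_pos])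
        also have "\<dots> = (2 * G * \<kappa>2 / c) / N" using tw.c_pos N0 by (simp add: hi_def field_simps)
        also have "\<dots> \<le> k2 / N" using k2(3) N0 by (intro divide_right_mono) auto
        finally show ?thesis .
      qed
      then show ?thesis using S ax by blast
    qed
    have win: "k1 / real j \<le> \<theta>" "\<theta> \<le> k2 / real j" if "lo \<le> \<theta>" "\<theta> \<le> hi" for \<theta>
      using bas[OF that, of q] by (auto simp: N_def dest: spec[of _ "0::nat"])
    have "\<exists>u. \<bar>u - q\<bar> \<le> w \<and> foc s x u \<theta> = 0" if \<theta>: "lo \<le> \<theta>" "\<theta> \<le> hi" for \<theta>
    proof -
      have sg: "s * foc s x (q - w) \<theta> < 0" "0 < s * foc s x (q + w) \<theta>"
        using sign[rule_format, OF jj(2) st(1) x1(2) win[OF \<theta>]] unfolding wj by auto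
      have ct: "continuous_on {q - w..q + w} (\<lambda>u. s * foc s x u \<theta>)"
        by (intro continuous_intros foc_cont)
      have "\<exists>u\<ge>q - w. u \<le> q + w \<and> s * foc s x u \<theta> = 0"
        by (rule IVT'[of "\<lambda>u. s * foc s x u \<theta>", OF _ _ _ ct]) (use sg w in auto)
      then obtain u where "q - w \<le> u" "u \<le> q + w" "s * foc s x u \<theta> = 0" by blast
      then show ?thesis using st(1) by (intro exI[of _ u]) auto
    qed
    \<comment> \<open>\<open>U\<close> is an arbitrary choice of zeros. The estimate of
      \<open>foc_vertical\<close> holds for any two of them and makes \<open>U\<close> Lipschitz,
      hence continuous.\<close>
    then obtain U where U: "\<And>\<theta>. lo \<le> \<theta> \<Longrightarrow> \<theta> \<le> hi \<Longrightarrow> \<bar>U \<theta> - q\<bar> \<le> w \<and> foc s x (U \<theta>) \<theta> = 0"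
      by metis
    have VU: "\<bar>U \<phi> - U \<theta>\<bar> \<le> M / N ^ 2 * \<bar>\<phi> - \<theta>\<bar> \<and> (\<theta> \<le> \<phi> \<longrightarrow> g0 / 2 * (\<phi> - \<theta>) \<le> g (U \<phi>) * \<phi> - g (U \<theta>) * \<theta>)"
      if a: "lo \<le> \<theta>" "\<theta> \<le> hi" and b: "lo \<le> \<phi>" "\<phi> \<le> hi" for \<theta> \<phi>
      using V[rule_format, OF jj(3) st(1) x1(1) _ _ win[OF a] win[OF b], of "U \<theta>" "U \<phi>"] U[OF a] U[OF b] unfolding wj N_def by blast
    have Ucont: "continuous_on {lo..hi} U"
    proof (rule lipschitz_on_continuous_on[where L="M / N ^ 2"], rule lipschitz_onI)
      show "0 \<le> M / N\<^sup>2" using M by simp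
      fix \<theta> \<phi> assume "\<theta> \<in> {lo..hi}" "\<phi> \<in> {lo..hi}"
      then show "dist (U \<theta>) (U \<phi>) \<le> M / N\<^sup>2 * dist \<theta> \<phi>" using VU[of \<phi> \<theta>] by (simp add: dist_real_def)
    qed
    define Z where "Z \<theta> = (bm ^^ m) (U \<theta>, \<theta>)" for \<theta>
    have Zcont: "continuous_on {lo..hi} Z" unfolding Z_def
    proof (rule continuous_on_compose2[OF bm_iter_continuous])
      show "continuous_on {lo..hi} (\<lambda>\<theta>. (U \<theta>, \<theta>))" by (intro continuous_intros Ucont)
      show "(\<lambda>\<theta>. (U \<theta>, \<theta>)) ` {lo..hi} \<subseteq> UNIV \<times> {0..pi}" using bas by (auto simp: less_imp_le)
    qed
    define v where "v \<theta> = vx (U \<theta>) \<theta> m" for \<theta>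
    define a where "a \<theta> = ax (U \<theta>) \<theta> m" for \<theta>
    have vcont: "continuous_on {lo..hi} v" "continuous_on {lo..hi} a"
      using continuous_on_fst[OF Zcont] continuous_on_snd[OF Zcont] by (simp_all add: v_def[abs_def] a_def[abs_def] Z_def vx_def ax_def)
    have mono: "v \<theta> < v \<phi>" if b: "lo \<le> \<theta>" "\<theta> < \<phi>" "\<phi> \<le> hi" for \<theta> \<phi>
    proof -
      have h: "lo \<le> \<theta>" "\<theta> \<le> hi" "lo \<le> \<phi>" "\<phi> \<le> hi" using b by auto
      define D where "D = g (U \<phi>) * \<phi> - g (U \<theta>) * \<theta>"
      have D1: "g0 / 2 * (\<phi> - \<theta>) \<le> D" using VU[OF h] b by (simp add: D_def)
      moreover have "0 < g0 / 2 * (\<phi> - \<theta>)" using g0_pos b by simp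
      ultimately have D0: "0 < D" by linarith
      have "\<bar>U \<phi> - U \<theta>\<bar> \<le> M / N ^ 2 * (\<phi> - \<theta>)" using VU[OF h] b by simp
      also have "\<dots> \<le> g0 / 2 * (\<phi> - \<theta>)"
      proof (rule mult_right_mono)
        have "2 * M \<le> g0 * N" using N(1) g0_pos by (simp add: field_simps)
        also have "\<dots> \<le> g0 * N ^ 2" using g0_pos N(2) power_increasing[of 1 2 N] by simp
        finally show "M / N ^ 2 \<le> g0 / 2" using N0 by (simp add: field_simps)
      qed (use b in simp)
      finally have near: "\<bar>U \<phi> - U \<theta>\<bar> \<le> D" using D1 by linarith
      have "c' * real j * D \<le> v \<phi> - v \<theta>"
        using T[rule_format, OF jj(4) m1(3,4), of \<theta> \<phi> "U \<theta>" "U \<phi>"] bas[OF h(1,2), of "U \<theta>"] bas[OF h(3,4), of "U \<phi>"] D0 near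
        unfolding D_def v_def N_def by auto
      moreover have "0 < c' * real j * D" using c' N0 D0 by (simp add: N_def)
      ultimately show ?thesis by linarith
    qed
    have vlo: "v lo \<le> q + 2 * pi - w"
    proof -
      have "vx (U lo) lo m - U lo \<le> pi" using sweep[rule_format, OF jj(1) m1(3,4), of lo "U lo"] lohi unfolding lo_def hi_def N_def by auto
      then show ?thesis using U[of lo] lohi w pi_gt3 unfolding v_def by auto
    qed
    have vhi: "q + 2 * pi + w \<le> v hi"
    proof -
      have "3 * pi \<le> vx (U hi) hi m - U hi" using sweep[rule_format, OF jj(1) m1(3,4), of hi "U hi"] lohi unfolding lo_def hi_def N_def by auto
      then show ?thesis using U[of hi] lohi w pi_gt3 unfolding v_def by auto
    qed
    obtain \<theta>1 where t1: "lo \<le> \<theta>1" "\<theta>1 \<le> hi" "v \<theta>1 = q + 2 * pi - w"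
      using IVT'[of v lo "q + 2 * pi - w" hi, OF vlo _ lohi vcont(1)] vhi w by force
    obtain \<theta>2 where t2: "lo \<le> \<theta>2" "\<theta>2 \<le> hi" "v \<theta>2 = q + 2 * pi + w"
      using IVT'[of v lo "q + 2 * pi + w" hi, OF _ vhi lohi vcont(1)] vlo w by force
    have t12: "\<theta>1 < \<theta>2"
    proof (rule ccontr)
      assume "\<not> \<theta>1 < \<theta>2"
      then have "\<theta>2 < \<theta>1 \<or> \<theta>1 = \<theta>2" by linarith
      then show False using mono[of \<theta>2 \<theta>1] t1 t2 w by auto
    qed
    have aw: "k1 / real j \<le> a \<theta>" "a \<theta> \<le> k2 / real j" if "lo \<le> \<theta>" "\<theta> \<le> hi" for \<theta> using bas[OF that, of "U \<theta>"] by (auto simp: a_def N_def)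
    have s1: "t * foc t y (v \<theta>1) (a \<theta>1) \<le> 0"
      using sign[rule_format, OF jj(2) st(2) y2 aw[OF t1(1,2)]] unfolding wj t1(3) by simp
    have s2: "0 \<le> t * foc t y (v \<theta>2) (a \<theta>2)"
      using sign[rule_format, OF jj(2) st(2) y2 aw[OF t2(1,2)]] unfolding wj t2(3) by simp
    have ct: "continuous_on {\<theta>1..\<theta>2} (\<lambda>\<theta>. t * foc t y (v \<theta>) (a \<theta>))"
      using t1 t2 by (intro continuous_intros foc_cont continuous_on_subset[OF vcont(1)] continuous_on_subset[OF vcont(2)]) auto
    obtain \<theta> where th: "\<theta>1 \<le> \<theta>" "\<theta> \<le> \<theta>2" "t * foc t y (v \<theta>) (a \<theta>) = 0"
      using IVT'[of "\<lambda>\<theta>. t * foc t y (v \<theta>) (a \<theta>)", OF s1 s2 less_imp_le[OF t12] ct] by blast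
    have h: "lo \<le> \<theta>" "\<theta> \<le> hi" using th t1 t2 by linarith+
    \<comment> \<open>Because \<open>v\<close> increases, a zero between \<open>\<theta>1\<close>
      and \<open>\<theta>2\<close> has its final vertex within \<open>w\<close> of
      \<open>q + 2 * pi\<close>.\<close>
    have vw: "v \<theta>1 \<le> v \<theta>" "v \<theta> \<le> v \<theta>2"
      using mono[of \<theta>1 \<theta>] mono[of \<theta> \<theta>2] th t1 t2 by (cases "\<theta>1 = \<theta>"; cases "\<theta> = \<theta>2"; force)+
    have "foc t y (v \<theta>) (a \<theta>) = 0" using th(3) st(2) by auto
    then show ?thesis using bas[OF h, of "U \<theta>"] U[OF h] vw t1(3) t2(3) unfolding wj
      by (intro exI[of _ "U \<theta>"] exI[of _ \<theta>]) (auto simp: v_def a_def N_def abs_le_iff)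
  qed
  show ?thesis
    by (rule exI[of _ k1], intro conjI k1, rule exI[of _ k2], intro conjI k2(1), rule exI[of _ c0], intro conjI c0(1),
        rule exI[of _ "j1 + j2 + j3 + j4 + j5"], intro allI impI, rule main; assumption)
qed

text \<open>About one turn between the vertices \<open>a\<close> and \<open>b\<close> forces all
  links and angles, also those just outside this window, to be of order \<open>1/j\<close>. The
  choices of \<open>a\<close> and \<open>b\<close> cover the four types of interior orbits as well
  as boundary orbits; the bounds feed \<open>link_ends\<close>, \<open>orbit_unique\<close> and
  \<open>twist_orbits\<close>.\<close>

lemma orbit_range:
  assumes "0 < \<delta>"
  shows "\<exists>k1>0. \<exists>k2>0. \<exists>j0. \<forall>j\<ge>j0. \<forall>a b u \<theta>. 0 < \<theta> \<longrightarrow> \<theta> < pi \<longrightarrow> a \<le> 1 \<longrightarrow> j \<le> b \<longrightarrow> b \<le> Suc j \<longrightarrow>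
    \<delta> \<le> vx u \<theta> b - vx u \<theta> a \<longrightarrow> vx u \<theta> b - vx u \<theta> a \<le> 4 * pi \<longrightarrow>
    (\<forall>i\<le>j. k1 / real j \<le> vx u \<theta> (Suc i) - vx u \<theta> i \<and> vx u \<theta> (Suc i) - vx u \<theta> i \<le> k2 / real j \<and> vx u \<theta> (Suc i) - vx u \<theta> i \<le> 1) \<and>
    (\<forall>i\<le>Suc j. k1 / real j \<le> ax u \<theta> i \<and> ax u \<theta> i \<le> k2 / real j)"
proof -
  obtain \<kappa>1 \<kappa>2 m0 where \<kappa>: "0 < \<kappa>1" and S: "\<forall>m\<ge>m0. \<forall>a b. a < b \<longrightarrow> b \<le> m \<longrightarrow> m \<le> 2 * (b - a) \<longrightarrow> (\<forall>\<psi>. tw.links \<psi> m \<longrightarrow>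
     \<delta> \<le> \<psi> b - \<psi> a \<longrightarrow> \<psi> b - \<psi> a \<le> 4 * pi \<longrightarrow>
     (\<forall>i<m. \<psi> (Suc i) - \<psi> i \<le> d \<and> \<kappa>1 / real m \<le> Y (\<psi> i) (\<psi> (Suc i)) \<and> Y (\<psi> i) (\<psi> (Suc i)) \<le> \<kappa>2 / real m))"
    by (insert tw.orbit_scale[OF assms], elim exE conjE, rule that)
  define k1' where "k1' = \<kappa>1 / (2 * K)"
  define k1 where "k1 = k1' * min 1 (c / G)"
  define k2 where "k2 = \<bar>\<kappa>2\<bar> / c + 1"
  have k1': "0 < k1'" using \<kappa> tw.C_pos by (simp add: k1'_def)
  have cG: "0 < c / G" using tw.c_pos G_pos by simp
  have mn: "0 < min 1 (c / G)" "min 1 (c / G) \<le> 1" "min 1 (c / G) \<le> c / G" using cG by auto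
  have k1: "0 < k1" "k1 \<le> k1'" "k1 \<le> k1' * (c / G)"
    using mult_pos_pos[OF k1' mn(1)] mult_left_mono[OF mn(2) less_imp_le[OF k1']] mult_left_mono[OF mn(3) less_imp_le[OF k1']] by (simp_all add: k1_def)
  have k2: "0 < k2" using tw.c_pos by (simp add: k2_def add_nonneg_pos)
  have "(\<forall>i\<le>j. k1 / real j \<le> vx u \<theta> (Suc i) - vx u \<theta> i \<and> vx u \<theta> (Suc i) - vx u \<theta> i \<le> k2 / real j \<and> vx u \<theta> (Suc i) - vx u \<theta> i \<le> 1) \<and>
    (\<forall>i\<le>Suc j. k1 / real j \<le> ax u \<theta> i \<and> ax u \<theta> i \<le> k2 / real j)"
    if j: "j \<ge> m0 + 3" and t: "0 < \<theta>" "\<theta> < pi" and ab: "a \<le> 1" "j \<le> b" "b \<le> Suc j"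
      and T: "\<delta> \<le> vx u \<theta> b - vx u \<theta> a" "vx u \<theta> b - vx u \<theta> a \<le> 4 * pi" for j a b u \<theta>
  proof -
    define N where "N = real j"
    have N: "3 \<le> N" "real (Suc j) = N + 1" using j by (auto simp: N_def)
    have N0: "0 < N" using N by linarith
    have mm: "m0 \<le> Suc j" "a < b" "Suc j \<le> 2 * (b - a)" using j ab by linarith+
    have L: "tw.links (vx u \<theta>) (Suc j)" using orbit_links[OF t, of u 0 "Suc j"] by simp
    have B: "vx u \<theta> (Suc i) - vx u \<theta> i \<le> d" "\<kappa>1 / (N + 1) \<le> Y (vx u \<theta> i) (vx u \<theta> (Suc i))" "Y (vx u \<theta> i) (vx u \<theta> (Suc i)) \<le> \<kappa>2 / (N + 1)" if "i \<le> j" for i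
      using S[rule_format, OF mm(1,2) ab(3) mm(3) L T, of i] that unfolding N(2) by auto
    note l = orbit_link[OF t, of u]
    have D1: "k1' / N \<le> vx u \<theta> (Suc i) - vx u \<theta> i" if "i \<le> j" for i
    proof -
      have "\<kappa>1 / (2 * N) \<le> \<kappa>1 / (N + 1)" using \<kappa> N by (intro divide_left_mono) auto
      also have "\<dots> \<le> K * (vx u \<theta> (Suc i) - vx u \<theta> i)" using B[OF that] tw.Y_upper[OF l(3) B(1)[OF that]] by linarith
      finally have "\<kappa>1 / (2 * N) \<le> (vx u \<theta> (Suc i) - vx u \<theta> i) * K" by (simp only: mult.commute)
      then have "(\<kappa>1 / (2 * N)) / K \<le> vx u \<theta> (Suc i) - vx u \<theta> i" by (simp only: pos_divide_le_eq[OF tw.C_pos])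
      then show ?thesis by (simp add: k1'_def mult_ac)
    qed
    have D2: "vx u \<theta> (Suc i) - vx u \<theta> i \<le> k2 / N" if "i \<le> j" for i
    proof -
      have "c * (vx u \<theta> (Suc i) - vx u \<theta> i) \<le> \<kappa>2 / (N + 1)" using B[OF that] tw.Y_lower[OF l(3) B(1)[OF that]] by linarith
      also have "\<dots> \<le> \<bar>\<kappa>2\<bar> / (N + 1)" using N0 by (intro divide_right_mono) auto
      also have "\<dots> \<le> \<bar>\<kappa>2\<bar> / N" using N0 by (intro divide_left_mono) auto
      finally have "(vx u \<theta> (Suc i) - vx u \<theta> i) * c \<le> \<bar>\<kappa>2\<bar> / N" by (simp only: mult.commute)
      then have "vx u \<theta> (Suc i) - vx u \<theta> i \<le> (\<bar>\<kappa>2\<bar> / N) / c" by (simp only: pos_le_divide_eq[OF tw.c_pos])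
      also have "\<dots> = (\<bar>\<kappa>2\<bar> / c) / N" by simp
      also have "\<dots> \<le> k2 / N" using N0 by (intro divide_right_mono) (auto simp: k2_def)
      finally show ?thesis .
    qed
    have A1: "k1' * (c / G) / N \<le> ax u \<theta> i" if "c * (k1' / N) \<le> g e * ax u \<theta> i" for i e
    proof -
      have "g e * ax u \<theta> i \<le> G * ax u \<theta> i" using g_le[of e] l(1)[of i] by (intro mult_right_mono) auto
      then have "c * (k1' / N) \<le> G * ax u \<theta> i" using that by linarith
      also have "G * ax u \<theta> i = ax u \<theta> i * G" by (rule mult.commute)
      finally have "c * (k1' / N) / G \<le> ax u \<theta> i" by (simp only: pos_divide_le_eq[OF G_pos])
      then show ?thesis by (simp add: mult_ac)
    qed
    have kN: "k1 / N \<le> k1' / N" "k1 / N \<le> k1' * (c / G) / N" using divide_right_mono[OF k1(2), of N] divide_right_mono[OF k1(3), of N] N0 by simp_all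
    have ax: "k1 / N \<le> ax u \<theta> i \<and> ax u \<theta> i \<le> k2 / N" if "i \<le> Suc j" for i
    proof (cases "i \<le> j")
      case True
      have "c * (k1' / N) \<le> c * (vx u \<theta> (Suc i) - vx u \<theta> i)" using D1[OF True] tw.c_pos by (intro mult_left_mono) auto
      also have "\<dots> \<le> g (vx u \<theta> i) * ax u \<theta> i" using tw.Y_lower[OF l(3) B(1)[OF True]] Y_orbit(1)[OF t, of u i] by simp
      finally have "k1' * (c / G) / N \<le> ax u \<theta> i" by (rule A1)
      moreover have "ax u \<theta> i \<le> vx u \<theta> (Suc i) - vx u \<theta> i" using chord(5,8)[OF l(3,4)[of i]] l(5)[of i] by linarith
      ultimately show ?thesis using kN D2[OF True] by linarith
    next
      case False
      \<comment> \<open>The last angle belongs to the link after the chain; it is read off from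
        \<open>Y'\<close> of the last link inside it.\<close>
      then have i: "i = Suc j" using that by simp
      have "c * (k1' / N) \<le> c * (vx u \<theta> (Suc j) - vx u \<theta> j)" using D1[of j] tw.c_pos by (intro mult_left_mono) auto
      also have "\<dots> \<le> g (vx u \<theta> (Suc j)) * ax u \<theta> (Suc j)" using tw.Y'_lower[OF l(3) B(1)[of j]] Y_orbit(2)[OF t, of u j] by simp
      finally have "k1' * (c / G) / N \<le> ax u \<theta> i" unfolding i by (rule A1)
      moreover have "ax u \<theta> (Suc j) \<le> vx u \<theta> (Suc j) - vx u \<theta> j" using chord(3,8)[OF l(3,4)[of j]] l(6)[of j] by linarith
      ultimately show ?thesis using kN D2[of j] i by simp
    qed
    have "k1 / N \<le> vx u \<theta> (Suc i) - vx u \<theta> i \<and> vx u \<theta> (Suc i) - vx u \<theta> i \<le> k2 / N \<and> vx u \<theta> (Suc i) - vx u \<theta> i \<le> 1" if "i \<le> j" for i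
      using D1[OF that] D2[OF that] B(1)[OF that] kN d_le_1 by linarith
    then show ?thesis using ax unfolding N_def by blast
  qed
  then show ?thesis using k1(1) k2 by blast
qed

end

section \<open>Counting orbits\<close>

lemma card_four:
  assumes "\<And>b1 b2. \<exists>!p. p \<in> S \<and> f1 p = (b1::bool) \<and> f2 p = (b2::bool)"
  shows "card S = 4"
proof -
  have "bij_betw (\<lambda>p. (f1 p, f2 p)) S (UNIV :: (bool \<times> bool) set)"
    unfolding bij_betw_def
  proof
    show "inj_on (\<lambda>p. (f1 p, f2 p)) S" using assms by (auto simp: inj_on_def)
    show "(\<lambda>p. (f1 p, f2 p)) ` S = UNIV"
    proof (intro equalityI subset_UNIV subsetI)
      fix b :: "bool \<times> bool"
      obtain p where "p \<in> S" "f1 p = fst b" "f2 p = snd b" using assms[of "fst b" "snd b"] by blast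
      then show "b \<in> (\<lambda>p. (f1 p, f2 p)) ` S" by (intro image_eqI[of _ _ p]) auto
    qed
  qed
  then have "card S = card (UNIV :: (bool \<times> bool) set)" by (rule bij_betw_same_card)
  also have "\<dots> = 4" by (simp add: UNIV_Times_UNIV[symmetric] card_cartesian_product del: UNIV_Times_UNIV)
  finally show ?thesis .
qed

section \<open>Rotation measured in arclength and in the tangent angle\<close>

context billiard_table
begin

lemma C_lipschitz: "\<bar>C a - C b\<bar> \<le> G ^ 3 * \<bar>a - b\<bar>"
proof (cases "a \<le> b")
  case True
  have "0 \<le> g0 ^ 3 * (b - a)" using True g0_pos by simp
  then show ?thesis using C_increment[OF True] True by (simp add: abs_if)
next
  case False
  then have ba: "b \<le> a" by simp
  have "0 \<le> g0 ^ 3 * (a - b)" using ba g0_pos by simp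
  then show ?thesis using C_increment[OF ba] ba by (simp add: abs_if)
qed

lemma L_ge: "2 * pi * g0 ^ 3 \<le> L"
  using C_increment(1)[of 0 "2 * pi"] C_shift[of 0 1] by (simp add: mult_ac)

text \<open>Bounds in terms of \<open>g0\<close> and \<open>G\<close> only; they supply the total
  turn that \<open>orbit_range\<close> requires, with thresholds independent of
  \<open>\<gamma>\<close>.\<close>

lemma rotation_bounds:
  assumes "\<bar>C b - L - C a\<bar> \<le> L / 2"
  shows "pi * g0 ^ 3 / G ^ 3 \<le> b - a" "b - a \<le> 4 * pi"
proof -
  have d: "L / 2 \<le> C b - C a" "C b - C a \<le> 3 * L / 2" using assms by linarith+
  have ab: "a \<le> b"
  proof (rule ccontr)
    assume "\<not> a \<le> b"
    then have ba: "b \<le> a" by simp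
    have "0 \<le> g0 ^ 3 * (a - b)" using ba g0_pos by simp
    then have "C b - C a \<le> 0" using C_increment(1)[OF ba] by linarith
    then show False using d L_pos by linarith
  qed
  have "pi * g0 ^ 3 \<le> L / 2" using L_ge by simp
  also have "\<dots> \<le> G ^ 3 * (b - a)" using d C_increment(2)[OF ab] by linarith
  finally show "pi * g0 ^ 3 / G ^ 3 \<le> b - a" using G_pos by (simp add: pos_divide_le_eq mult.commute)
  show "b - a \<le> 4 * pi"
  proof (rule ccontr)
    assume "\<not> b - a \<le> 4 * pi"
    then have ba: "a + 4 * pi \<le> b" by simp
    have "0 \<le> g0 ^ 3 * (b - (a + 4 * pi))" using ba g0_pos by simp
    then have "0 \<le> C b - C (a + 4 * pi)" using C_increment(1)[OF ba] by linarith
    moreover have "C (a + 4 * pi) = C a + 2 * L" using C_shift[of a 2] by (simp add: mult_ac)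
    ultimately show False using d L_pos by linarith
  qed
qed

text \<open>Near lifts of one point the advance is close to a multiple of \<open>L\<close>. It is
  within \<open>L / 2\<close> of \<open>L\<close>, and the errors add less than another
  \<open>L / 2\<close>, so the multiple is 1.\<close>

lemma rotation_index:
  assumes rot: "\<bar>C b - L - C a\<bar> \<le> L / 2"
    and a: "\<bar>a - (q + 2 * pi * of_int k)\<bar> \<le> \<eta>" and b: "\<bar>b - (q + 2 * pi * of_int k')\<bar> \<le> \<eta>" and \<eta>: "2 * G ^ 3 * \<eta> < pi * g0 ^ 3"
  shows "k' = k + 1"
proof -
  have Ck: "C (q + 2 * pi * of_int k) = C q + of_int k * L" for k :: int by (rule C_shift)
  have "\<bar>C a - (C q + of_int k * L)\<bar> \<le> G ^ 3 * \<eta>"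
    using C_lipschitz[of a "q + 2 * pi * of_int k"] mult_left_mono[OF a less_imp_le[OF zero_less_power[OF G_pos]], of 3] unfolding Ck by linarith
  moreover have "\<bar>C b - (C q + of_int k' * L)\<bar> \<le> G ^ 3 * \<eta>"
    using C_lipschitz[of b "q + 2 * pi * of_int k'"] mult_left_mono[OF b less_imp_le[OF zero_less_power[OF G_pos]], of 3] unfolding Ck by linarith
  ultimately have "\<bar>(of_int k' * L - of_int k * L) - L\<bar> \<le> L / 2 + 2 * G ^ 3 * \<eta>" using rot by linarith
  also have "\<dots> < L" using \<eta> L_ge by linarith
  finally have "\<bar>of_int (k' - k - 1) * L\<bar> < L" by (simp add: algebra_simps)
  then have "\<bar>real_of_int (k' - k - 1)\<bar> * L < 1 * L" using L_pos by (simp add: abs_mult)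
  then have "\<bar>real_of_int (k' - k - 1)\<bar> < 1" using L_pos by (simp only: mult_less_cancel_right_pos)
  then show ?thesis by linarith
qed

lemma rotation_close:
  assumes "\<bar>(b - 2 * pi) - a\<bar> \<le> \<eta>" "2 * G ^ 3 * \<eta> < pi * g0 ^ 3"
  shows "\<bar>C b - L - C a\<bar> \<le> L / 2"
proof -
  have "C b - L = C (b - 2 * pi)" using C_shift[of "b - 2 * pi" 1] by simp
  moreover have "\<bar>C (b - 2 * pi) - C a\<bar> \<le> G ^ 3 * \<eta>"
    using C_lipschitz[of "b - 2 * pi" a] mult_left_mono[OF assms(1) less_imp_le[OF zero_less_power[OF G_pos]], of 3] by linarith
  ultimately show ?thesis using assms(2) L_ge by linarith
qed

end

context twist_curve
begin

abbreviation orbit_path :: "nat \<Rightarrow> complex \<Rightarrow> complex \<Rightarrow> real \<Rightarrow> real \<Rightarrow> complex list" where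
  "orbit_path j x y u \<theta> \<equiv> x # map (\<lambda>i. \<Gamma> (vx u \<theta> (Suc i))) [0..<j] @ [y]"

lemma orbit_path_nth:
  assumes "1 \<le> j"
  shows "orbit_path j x y u \<theta> ! 1 = \<Gamma> (vx u \<theta> 1)" "orbit_path j x y u \<theta> ! j = \<Gamma> (vx u \<theta> j)"
  using assms by (cases j; simp add: nth_append del: upt_Suc)+

text \<open>The four orbits are distinguished by the answers to two questions: whether \<open>x\<close> is close to the
  first reflection point, and whether \<open>y\<close> is close to the last one.\<close>

lemma interior_count:
  "\<exists>c0>0. \<exists>j0. \<forall>j\<ge>j0. \<forall>\<Omega> \<gamma> A C L x y q. billiard_table \<Gamma> g g1 g2 g3 g0 G \<Omega> \<gamma> A C L \<longrightarrow> x \<in> \<Omega> \<longrightarrow> y \<in> \<Omega> \<longrightarrow>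
     norm (x - \<Gamma> q) \<le> c0 / real j ^ 4 \<longrightarrow> norm (y - \<Gamma> q) \<le> c0 / real j ^ 4 \<longrightarrow> card (interior_ccw_orbits \<Omega> L \<gamma> j x y) = 4"
proof -
  define \<delta> where "\<delta> = pi * g0 ^ 3 / G ^ 3"
  have \<delta>0: "0 < \<delta>" using g0_pos G_pos by (simp add: \<delta>_def)
  have "g0 ^ 3 \<le> G ^ 3" using power_mono[of g0 G 3] g0_pos g_ge[of 0] g_le[of 0] by linarith
  then have \<delta>1: "\<delta> \<le> pi" using G_pos by (simp add: \<delta>_def pos_divide_le_eq)
  obtain k1 k2 j1 where k: "0 < k1" "0 < k2" and range: "\<forall>j\<ge>j1. \<forall>a b u \<theta>. 0 < \<theta> \<longrightarrow> \<theta> < pi \<longrightarrow> a \<le> 1 \<longrightarrow> j \<le> b \<longrightarrow> b \<le> Suc j \<longrightarrow>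
    \<delta> \<le> vx u \<theta> b - vx u \<theta> a \<longrightarrow> vx u \<theta> b - vx u \<theta> a \<le> 4 * pi \<longrightarrow>
    (\<forall>i\<le>j. k1 / real j \<le> vx u \<theta> (Suc i) - vx u \<theta> i \<and> vx u \<theta> (Suc i) - vx u \<theta> i \<le> k2 / real j \<and> vx u \<theta> (Suc i) - vx u \<theta> i \<le> 1) \<and>
    (\<forall>i\<le>Suc j. k1 / real j \<le> ax u \<theta> i \<and> ax u \<theta> i \<le> k2 / real j)"
    by (insert orbit_range[OF \<delta>0], elim exE conjE, rule that)
  obtain h1 h2 c1 j2 where c1: "0 < c1" and ex: "\<forall>j\<ge>j2. \<forall>m. j \<le> m + 1 \<longrightarrow> m \<le> j + 1 \<longrightarrow> (\<forall>s t x y q. (s = 1 \<or> s = -1) \<longrightarrow> (t = 1 \<or> t = -1) \<longrightarrow>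
    norm (x - \<Gamma> q) \<le> c1 / real j ^ 4 \<longrightarrow> norm (y - \<Gamma> q) \<le> c1 / real j ^ 4 \<longrightarrow>
    (\<exists>u \<theta>. 0 < \<theta> \<and> \<theta> < pi \<and> (\<forall>i<m. vx u \<theta> (Suc i) - vx u \<theta> i \<le> h2 / real j) \<and> (\<forall>i\<le>m. h1 / real j \<le> ax u \<theta> i \<and> ax u \<theta> i \<le> h2 / real j) \<and>
      \<bar>u - q\<bar> \<le> 1 / real j ^ 3 \<and> \<bar>vx u \<theta> m - (q + 2 * pi)\<bar> \<le> 1 / real j ^ 3 \<and> foc s x u \<theta> = 0 \<and> foc t y (vx u \<theta> m) (ax u \<theta> m) = 0))"
    by (insert orbit_exists, elim exE conjE, rule that)
  obtain c2 j3 where c2: "0 < c2" and ends: "\<forall>j\<ge>j3. \<forall>a b x q. k1 / real j \<le> b - a \<longrightarrow> b - a \<le> k2 / real j \<longrightarrow> b - a \<le> 1 \<longrightarrow>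
     x \<in> open_segment (\<Gamma> a) (\<Gamma> b) \<longrightarrow> norm (x - \<Gamma> q) \<le> c2 / real j ^ 4 \<longrightarrow>
     (\<exists>k::int. \<bar>a - (q + 2 * pi * of_int k)\<bar> \<le> 1 / real j ^ 3) \<or> (\<exists>k::int. \<bar>b - (q + 2 * pi * of_int k)\<bar> \<le> 1 / real j ^ 3)"
    by (insert link_ends[OF k], elim exE conjE, rule that)
  obtain j4 where uniq: "\<forall>j\<ge>j4. \<forall>m. j \<le> 2 * m \<longrightarrow> m \<le> 2 * j \<longrightarrow> (\<forall>s t x y q u \<theta> v \<phi>. (s = 1 \<or> s = -1) \<longrightarrow> (t = 1 \<or> t = -1) \<longrightarrow>
    norm (x - \<Gamma> q) \<le> 1 / real j ^ 4 \<longrightarrow> norm (y - \<Gamma> q) \<le> 1 / real j ^ 4 \<longrightarrow>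
    0 < \<theta> \<longrightarrow> \<theta> < pi \<longrightarrow> 0 < \<phi> \<longrightarrow> \<phi> < pi \<longrightarrow>
    (\<forall>i<m. vx u \<theta> (Suc i) - vx u \<theta> i \<le> k2 / real j) \<longrightarrow> (\<forall>i<m. vx v \<phi> (Suc i) - vx v \<phi> i \<le> k2 / real j) \<longrightarrow>
    (\<forall>i\<le>m. k1 / real j \<le> ax u \<theta> i \<and> ax u \<theta> i \<le> k2 / real j) \<longrightarrow> (\<forall>i\<le>m. k1 / real j \<le> ax v \<phi> i \<and> ax v \<phi> i \<le> k2 / real j) \<longrightarrow>
    \<bar>u - q\<bar> \<le> 1 / real j ^ 3 \<longrightarrow> \<bar>v - q\<bar> \<le> 1 / real j ^ 3 \<longrightarrow>
    \<bar>vx u \<theta> m - (q + 2 * pi)\<bar> \<le> 1 / real j ^ 3 \<longrightarrow> \<bar>vx v \<phi> m - (q + 2 * pi)\<bar> \<le> 1 / real j ^ 3 \<longrightarrow>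
    foc s x u \<theta> = 0 \<longrightarrow> foc s x v \<phi> = 0 \<longrightarrow>
    foc t y (vx u \<theta> m) (ax u \<theta> m) = 0 \<longrightarrow> foc t y (vx v \<phi> m) (ax v \<phi> m) = 0 \<longrightarrow> u = v \<and> \<theta> = \<phi>)"
    by (insert orbit_unique[OF k], elim exE conjE, rule that)
  define c0 where "c0 = min 1 (min c1 c2)"
  have c0: "0 < c0" "c0 \<le> 1" "c0 \<le> c1" "c0 \<le> c2" using c1 c2 by (auto simp: c0_def)
  define h where "h = g0 ^ 3 / 2 * k1"
  have h: "0 < h" using g0_pos k by (simp add: h_def)
  obtain j5 :: nat where j5: "real j5 \<ge> (1 + G ^ 3) + (2 + G ^ 3) / h + 2 * G ^ 3 * (1 + 2 * k2) / (pi * g0 ^ 3) + 5" using real_arch_simple by blast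
  have main: "card (interior_ccw_orbits \<Omega> L \<gamma> j x y) = 4"
    if j: "j \<ge> j1 + j2 + j3 + j4 + j5" and bt: "billiard_table \<Gamma> g g1 g2 g3 g0 G \<Omega> \<gamma> A C L" and xy: "x \<in> \<Omega>" "y \<in> \<Omega>"
     and q: "norm (x - \<Gamma> q) \<le> c0 / real j ^ 4" "norm (y - \<Gamma> q) \<le> c0 / real j ^ 4" for j \<Omega> \<gamma> A C L x y q
  proof -
    interpret bt: billiard_table \<Gamma> g g1 g2 g3 g0 G \<Omega> \<gamma> A C L by (rule bt)
    have jj: "j1 \<le> j" "j2 \<le> j" "j3 \<le> j" "j4 \<le> j" "j5 \<le> j" using j by auto
    define N where "N = real j"
    have nn: "0 \<le> 1 + G ^ 3" "0 \<le> (2 + G ^ 3) / h" "0 \<le> 2 * G ^ 3 * (1 + 2 * k2) / (pi * g0 ^ 3)" using G_pos g0_pos h k by (auto intro!: divide_nonneg_nonneg mult_nonneg_nonneg add_nonneg_nonneg)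
    have N: "1 + G ^ 3 \<le> N" "(2 + G ^ 3) / h < N" "2 * G ^ 3 * (1 + 2 * k2) / (pi * g0 ^ 3) < N" "5 \<le> N"
      using jj(5) j5 nn unfolding N_def by linarith+
    have N0: "0 < N" using N by linarith
    have j5': "5 \<le> j" using N(4) by (simp add: N_def)
    define w where "w = 1 / real j ^ 3"
    define \<eta> where "\<eta> = (1 + 2 * k2) / N"
    have wN: "w \<le> 1 / N" using power_increasing[of 1 3 N] N by (simp add: w_def N_def[symmetric] divide_left_mono)
    have w0: "0 < w" "w \<le> 1" using wN N0 N(4) by (auto simp: w_def N_def field_simps)
    have \<eta>1: "2 * G ^ 3 * \<eta> < pi * g0 ^ 3" using N(3) N0 g0_pos by (simp add: \<eta>_def field_simps)
    have "0 \<le> k2 / N" "\<eta> = 1 / N + 2 * (k2 / N)" using k N0 by (simp_all add: \<eta>_def add_divide_distrib)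
    then have \<eta>2: "w + k2 / N \<le> \<eta>" "2 * w + 2 * (k2 / N) \<le> 2 * \<eta>" "w \<le> \<eta>" using wN by linarith+
    have q1: "norm (x - \<Gamma> q) \<le> 1 / real j ^ 4" "norm (y - \<Gamma> q) \<le> 1 / real j ^ 4"
      "norm (x - \<Gamma> q) \<le> c1 / real j ^ 4" "norm (y - \<Gamma> q) \<le> c1 / real j ^ 4"
      "norm (x - \<Gamma> q) \<le> c2 / real j ^ 4" "norm (y - \<Gamma> q) \<le> c2 / real j ^ 4"
      using q divide_right_mono[OF c0(2), of "real j ^ 4"] divide_right_mono[OF c0(3), of "real j ^ 4"] divide_right_mono[OF c0(4), of "real j ^ 4"] by simp_all
    have in': "inside x" "inside y" using bt.inside_\<Omega> xy by auto
    define S where "S = interior_ccw_orbits \<Omega> L \<gamma> j x y"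
    have j2': "2 \<le> j" using j5' by simp
    note S_iff = bt.interior_ccw_iff[OF j2' xy]
    \<comment> \<open>The end of a link near \<open>\<Gamma> q\<close> is within
      \<open>(1 + G ^ 3) / N ^ 3\<close> of the point, the other end farther than
      \<open>1 / N ^ 2\<close>, so this threshold tells the cases apart. The features are functions
      of the vertex list, since orbits are counted as lists.\<close>
    define f1 where "f1 p = (norm (x - p ! 1) \<le> 1 / N ^ 2)" for p :: "complex list"
    define f2 where "f2 p = (norm (y - p ! j) \<le> 1 / N ^ 2)" for p :: "complex list"
    have sm: "(1 + G ^ 3) / N ^ 3 \<le> 1 / N ^ 2"
      using divide_right_mono[OF N(1), of "N ^ 3"] N0 by (simp add: power2_eq_square power3_eq_cube)
    have near: "norm (z - \<Gamma> a) \<le> (1 + G ^ 3) / N ^ 3" if "norm (z - \<Gamma> q) \<le> 1 / real j ^ 4" "\<bar>a - (q + 2 * pi * of_int k)\<bar> \<le> w" for z a k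
      using near_dist[OF that(1), of a k] that(2) j5' by (simp add: w_def N_def)
    have Hbig: "(1 + G ^ 3) / N ^ 3 + 1 / N ^ 2 < H a b" if "k1 / real j \<le> b - a" "b - a \<le> 1" for a b
    proof -
      have "0 < k1 / real j" using k N0 by (simp add: N_def)
      then have "(g0 ^ 3 / 2) * (b - a) \<le> H a b" using Hf_lower[of "b - a" a] that by (simp add: Hf_def)
      moreover have "h / N \<le> (g0 ^ 3 / 2) * (b - a)" using mult_left_mono[OF that(1), of "g0 ^ 3 / 2"] g0_pos by (simp add: h_def N_def)
      moreover have "(1 + G ^ 3) / N ^ 3 + 1 / N ^ 2 < h / N"
      proof -
        have "(1 + G ^ 3) / N ^ 3 \<le> (1 + G ^ 3) / N ^ 2" using power_increasing[of 2 3 N] N nn(1) by (intro divide_left_mono) auto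
        then have "(1 + G ^ 3) / N ^ 3 + 1 / N ^ 2 \<le> (2 + G ^ 3) / N ^ 2" by (simp add: add_divide_distrib)
        also have "\<dots> < h / N"
        proof -
          have "2 + G ^ 3 < N * h" using N(2) h by (simp add: pos_divide_less_eq)
          then have "(2 + G ^ 3) / N ^ 2 < N * h / N ^ 2" using N0 by (intro divide_strict_right_mono) auto
          also have "\<dots> = h / N" using N0 by (simp add: power2_eq_square)
          finally show ?thesis .
        qed
        finally show ?thesis .
      qed
      ultimately show ?thesis by linarith
    qed
    have far: "1 / N ^ 2 < norm (z - \<Gamma> b)" if "norm (z - \<Gamma> a) \<le> (1 + G ^ 3) / N ^ 3" "(1 + G ^ 3) / N ^ 3 + 1 / N ^ 2 < norm (\<Gamma> b - \<Gamma> a)" for z a b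
      using norm_triangle_ineq[of "\<Gamma> b - z" "z - \<Gamma> a"] that by (simp add: norm_minus_commute)
    have link: "th (vx u \<theta> i) (vx u \<theta> (Suc i)) = ax u \<theta> i" "ph (vx u \<theta> i) (vx u \<theta> (Suc i)) = ax u \<theta> (Suc i)"
       "0 < vx u \<theta> (Suc i) - vx u \<theta> i" "vx u \<theta> (Suc i) - vx u \<theta> i < 2 * pi" if "0 < \<theta>" "\<theta> < pi" for u \<theta> i
      using orbit_link[OF that] by auto
    have "\<exists>!p. p \<in> S \<and> f1 p = b1 \<and> f2 p = b2" for b1 b2
    proof -
      \<comment> \<open>\<open>b1\<close> says that \<open>x\<close> is near the first reflection
        point. The chain then starts at vertex 1, which is reached along the ray through
        \<open>x\<close> (\<open>s = -1\<close>); otherwise it starts at the backward impact, vertex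
        0, and leaves through \<open>x\<close>. At \<open>y\<close>, nearness to the last reflection
        point means that the chain ends at vertex \<open>j\<close> with a ray leaving through
        \<open>y\<close>. The number \<open>m\<close> of links is \<open>j - 1\<close>,
        \<open>j\<close> or \<open>j + 1\<close>.\<close>
      define s :: real where "s = (if b1 then -1 else 1)"
      define t :: real where "t = (if b2 then 1 else -1)"
      define a :: nat where "a = (if b1 then 1 else 0)"
      define b :: nat where "b = (if b2 then j else Suc j)"
      define m where "m = b - a"
      have st: "s = 1 \<or> s = -1" "t = 1 \<or> t = -1" by (auto simp: s_def t_def)
      have ab: "a \<le> 1" "j \<le> b" "b \<le> Suc j" "a + m = b" "j \<le> m + 1" "m \<le> j + 1" "j \<le> 2 * m" "m \<le> 2 * j"
        using j5' by (auto simp: a_def b_def m_def)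
      have R: "(\<forall>i\<le>j. k1 / real j \<le> vx u \<theta> (Suc i) - vx u \<theta> i \<and> vx u \<theta> (Suc i) - vx u \<theta> i \<le> k2 / real j \<and> vx u \<theta> (Suc i) - vx u \<theta> i \<le> 1) \<and>
          (\<forall>i\<le>Suc j. k1 / real j \<le> ax u \<theta> i \<and> ax u \<theta> i \<le> k2 / real j)"
        if "0 < \<theta>" "\<theta> < pi" "a' \<le> 1" "j \<le> b'" "b' \<le> Suc j" "\<delta> \<le> vx u \<theta> b' - vx u \<theta> a'" "vx u \<theta> b' - vx u \<theta> a' \<le> 4 * pi" for u \<theta> a' b'
        using range[rule_format, OF jj(1) that] by blast
      have exist: "\<exists>p. p \<in> S \<and> f1 p = b1 \<and> f2 p = b2"
      proof -
        obtain ua \<theta>a where t0: "0 < \<theta>a" "\<theta>a < pi" and wn: "\<bar>ua - q\<bar> \<le> w" "\<bar>vx ua \<theta>a m - (q + 2 * pi)\<bar> \<le> w"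
          and fo: "foc s x ua \<theta>a = 0" "foc t y (vx ua \<theta>a m) (ax ua \<theta>a m) = 0"
          using ex[rule_format, OF jj(2) ab(5,6) st q1(3,4)] unfolding w_def by blast
        \<comment> \<open>If the chain starts at vertex 1, one link is prepended to recover the
          backward impact.\<close>
        have "\<exists>u \<theta>. 0 < \<theta> \<and> \<theta> < pi \<and> vx u \<theta> a = ua \<and> ax u \<theta> a = \<theta>a"
        proof (cases b1)
          case True
          obtain u where u: "0 < ua - u" "ua - u < 2 * pi" "ph u ua = \<theta>a" using ph_exists[OF t0] by blast
          have "vx u (th u ua) 1 = ua" "ax u (th u ua) 1 = \<theta>a"
            using bm_chord[OF u(1,2)] u(3) vx_Suc[of u "th u ua" 0] by simp_all
          then show ?thesis using chord(3,4)[OF u(1,2)] True by (intro exI[of _ u] exI[of _ "th u ua"]) (simp add: a_def)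
        next
          case False
          then show ?thesis using t0 by (intro exI[of _ ua] exI[of _ \<theta>a]) (simp add: a_def)
        qed
        then obtain u \<theta> where \<theta>: "0 < \<theta>" "\<theta> < pi" and va: "vx u \<theta> a = ua" "ax u \<theta> a = \<theta>a" by blast
        have sh: "vx u \<theta> (a + i) = vx ua \<theta>a i" "ax u \<theta> (a + i) = ax ua \<theta>a i" for i
          using vx_add[of u \<theta> i a] va by (simp_all add: add.commute)
        have vb: "vx u \<theta> b = vx ua \<theta>a m" "ax u \<theta> b = ax ua \<theta>a m" using sh[of m] ab(4) by simp_all
        have tot: "\<delta> \<le> vx u \<theta> b - vx u \<theta> a" "vx u \<theta> b - vx u \<theta> a \<le> 4 * pi"
          using wn w0 \<delta>1 pi_gt3 unfolding vb va by (auto simp: abs_le_iff)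
        note Rr = R[OF \<theta> ab(1-3) tot]
        have R0: "k1 / real j \<le> vx u \<theta> 1 - u" "vx u \<theta> 1 - u \<le> k2 / real j" "vx u \<theta> 1 - u \<le> 1"
          and Rj: "k1 / real j \<le> vx u \<theta> (Suc j) - vx u \<theta> j" "vx u \<theta> (Suc j) - vx u \<theta> j \<le> k2 / real j" "vx u \<theta> (Suc j) - vx u \<theta> j \<le> 1"
          using conjunct1[OF Rr, rule_format, of 0] conjunct1[OF Rr, rule_format, of j] by auto
        note l0 = link[OF \<theta>, of u 0, unfolded vx_0 One_nat_def[symmetric]] and lj = link[OF \<theta>, of u j]
        have H0: "(1 + G ^ 3) / N ^ 3 + 1 / N ^ 2 < H u (vx u \<theta> 1)" by (rule Hbig[OF R0(1,3)])
        have Hj: "(1 + G ^ 3) / N ^ 3 + 1 / N ^ 2 < H (vx u \<theta> j) (vx u \<theta> (Suc j))" by (rule Hbig[OF Rj(1,3)])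
        have pN: "0 < 1 / N ^ 2" using N0 by simp
        have H0': "(1 + G ^ 3) / N ^ 3 < H u (vx u \<theta> 1)" and Hj': "(1 + G ^ 3) / N ^ 3 < H (vx u \<theta> j) (vx u \<theta> (Suc j))" using H0 Hj pN by linarith+
        have xa: "norm (x - \<Gamma> ua) \<le> (1 + G ^ 3) / N ^ 3" using near[OF q1(1), of ua 0] wn(1) by simp
        have yb: "norm (y - \<Gamma> (vx u \<theta> b)) \<le> (1 + G ^ 3) / N ^ 3" using near[OF q1(2), of "vx u \<theta> b" 1] wn(2) vb by simp
        have xs: "x \<in> open_segment (\<Gamma> u) (\<Gamma> (vx u \<theta> 1))"
        proof (rule segment_foc[OF in'(1) l0(3,4)])
          show "foc 1 x u (th u (vx u \<theta> 1)) = 0 \<and> norm (x - \<Gamma> u) < H u (vx u \<theta> 1) \<or> foc (- 1) x (vx u \<theta> 1) (ph u (vx u \<theta> 1)) = 0 \<and> norm (x - \<Gamma> (vx u \<theta> 1)) < H u (vx u \<theta> 1)"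
            using fo(1) va order_le_less_trans[OF xa, of "H u (vx u \<theta> 1)"] H0' l0(1,2) unfolding s_def a_def by (cases b1) auto
        qed
        have ys: "y \<in> open_segment (\<Gamma> (vx u \<theta> j)) (\<Gamma> (vx u \<theta> (Suc j)))"
        proof (rule segment_foc[OF in'(2) lj(3,4)])
          show "foc 1 y (vx u \<theta> j) (th (vx u \<theta> j) (vx u \<theta> (Suc j))) = 0 \<and> norm (y - \<Gamma> (vx u \<theta> j)) < H (vx u \<theta> j) (vx u \<theta> (Suc j)) \<or>
             foc (- 1) y (vx u \<theta> (Suc j)) (ph (vx u \<theta> j) (vx u \<theta> (Suc j))) = 0 \<and> norm (y - \<Gamma> (vx u \<theta> (Suc j))) < H (vx u \<theta> j) (vx u \<theta> (Suc j))"
            using fo(2) vb order_le_less_trans[OF yb Hj'] lj(1,2) unfolding t_def b_def by (cases b2) auto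
        qed
        have v1: "\<bar>vx u \<theta> 1 - ua\<bar> \<le> k2 / N"
          using va R0 l0(3) k N0 by (cases b1) (auto simp: a_def N_def)
        have vj: "\<bar>vx u \<theta> (Suc j) - vx u \<theta> b\<bar> \<le> k2 / N"
          using Rj lj(3) k N0 by (cases b2) (auto simp: b_def N_def)
        have "\<bar>(vx u \<theta> (Suc j) - 2 * pi) - vx u \<theta> 1\<bar> \<le> 2 * w + 2 * (k2 / N)"
          using v1 vj wn vb by (simp add: abs_le_iff)
        also have "\<dots> = (2 * w * N + 2 * k2) / N" using N0 by (simp add: field_simps)
        also have "\<dots> \<le> \<eta>"
        proof -
          have "2 * w * N \<le> 1"
          proof -
            have "2 * w \<le> 1 / N"
              using power_increasing[of 2 3 N] N N0 by (simp add: w_def N_def[symmetric] field_simps power2_eq_square power3_eq_cube)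
                (smt (verit) mult_le_cancel_right1 mult_mono)
            then show ?thesis using N0 by (simp add: field_simps)
          qed
          then show ?thesis unfolding \<eta>_def using N0 by (intro divide_right_mono) auto
        qed
        finally have rot: "\<bar>C (vx u \<theta> (Suc j)) - L - C (vx u \<theta> 1)\<bar> \<le> L / 2" by (rule bt.rotation_close[OF _ \<eta>1])
        define p where "p = orbit_path j x y u \<theta>"
        have "p \<in> S" unfolding S_def S_iff p_def using \<theta> xs ys rot by blast
        have pn: "p ! 1 = \<Gamma> (vx u \<theta> 1)" "p ! j = \<Gamma> (vx u \<theta> j)" unfolding p_def using orbit_path_nth[of j x u \<theta> y] j5' by auto
        have "f1 p = b1"
        proof (cases b1)
          case True
          then have "vx u \<theta> 1 = ua" using va by (simp add: a_def)
          then show ?thesis using True xa sm pn unfolding f1_def by simp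
        next
          case False
          then have "u = ua" using va by (simp add: a_def)
          then show ?thesis using False far[OF xa, of "vx u \<theta> 1"] H0 pn unfolding f1_def H_def by simp
        qed
        moreover have "f2 p = b2"
        proof (cases b2)
          case True
          then show ?thesis using yb sm pn unfolding f2_def b_def by simp
        next
          case False
          then show ?thesis using yb far[of y "vx u \<theta> (Suc j)" "vx u \<theta> j"] Hj pn unfolding f2_def b_def H_def by (simp add: norm_minus_commute)
        qed
        ultimately show ?thesis using \<open>p \<in> S\<close> by blast
      qed
      \<comment> \<open>Every orbit of the given type yields, after a shift by full turns, a chain
        that meets the hypotheses of \<open>orbit_unique\<close>: \<open>link_ends\<close> leaves
        two candidates on each outer link for the end near \<open>\<Gamma> q\<close>, and the type
        excludes one of them.\<close>
      have data: "\<exists>v \<phi> u \<theta>. p = orbit_path j x y u \<theta> \<and> (\<forall>i. vx u \<theta> (a + i) = vx v \<phi> i) \<and> 0 < \<phi> \<and> \<phi> < pi \<and>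
          (\<forall>i<m. vx v \<phi> (Suc i) - vx v \<phi> i \<le> k2 / real j) \<and> (\<forall>i\<le>m. k1 / real j \<le> ax v \<phi> i \<and> ax v \<phi> i \<le> k2 / real j) \<and>
          \<bar>v - q\<bar> \<le> 1 / real j ^ 3 \<and> \<bar>vx v \<phi> m - (q + 2 * pi)\<bar> \<le> 1 / real j ^ 3 \<and> foc s x v \<phi> = 0 \<and> foc t y (vx v \<phi> m) (ax v \<phi> m) = 0"
        if p: "p \<in> S" "f1 p = b1" "f2 p = b2" for p
      proof -
        obtain u \<theta> where \<theta>: "0 < \<theta>" "\<theta> < pi" and xs: "x \<in> open_segment (\<Gamma> u) (\<Gamma> (vx u \<theta> 1))"
          and ys: "y \<in> open_segment (\<Gamma> (vx u \<theta> j)) (\<Gamma> (vx u \<theta> (Suc j)))"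
          and rot: "\<bar>C (vx u \<theta> (Suc j)) - L - C (vx u \<theta> 1)\<bar> \<le> L / 2" and pp: "p = orbit_path j x y u \<theta>"
          using p(1) unfolding S_def S_iff by blast
        have tot: "\<delta> \<le> vx u \<theta> (Suc j) - vx u \<theta> 1" "vx u \<theta> (Suc j) - vx u \<theta> 1 \<le> 4 * pi"
          using bt.rotation_bounds[OF rot] by (auto simp: \<delta>_def)
        note Rr = R[OF \<theta> order_refl le_SucI[OF order_refl] order_refl tot]
        have R0: "k1 / real j \<le> vx u \<theta> 1 - u" "vx u \<theta> 1 - u \<le> k2 / real j" "vx u \<theta> 1 - u \<le> 1"
          and Rj: "k1 / real j \<le> vx u \<theta> (Suc j) - vx u \<theta> j" "vx u \<theta> (Suc j) - vx u \<theta> j \<le> k2 / real j" "vx u \<theta> (Suc j) - vx u \<theta> j \<le> 1"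
          using conjunct1[OF Rr, rule_format, of 0] conjunct1[OF Rr, rule_format, of j] by auto
        note l0 = link[OF \<theta>, of u 0, unfolded vx_0 One_nat_def[symmetric]] and lj = link[OF \<theta>, of u j]
        have H0: "(1 + G ^ 3) / N ^ 3 + 1 / N ^ 2 < H u (vx u \<theta> 1)" by (rule Hbig[OF R0(1,3)])
        have Hj: "(1 + G ^ 3) / N ^ 3 + 1 / N ^ 2 < H (vx u \<theta> j) (vx u \<theta> (Suc j))" by (rule Hbig[OF Rj(1,3)])
        have pn: "p ! 1 = \<Gamma> (vx u \<theta> 1)" "p ! j = \<Gamma> (vx u \<theta> j)" unfolding pp using orbit_path_nth[of j x u \<theta> y] j5' by auto
        have e0: "(\<exists>k::int. \<bar>u - (q + 2 * pi * of_int k)\<bar> \<le> w) \<or> (\<exists>k::int. \<bar>vx u \<theta> 1 - (q + 2 * pi * of_int k)\<bar> \<le> w)"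
          using ends[rule_format, OF jj(3) R0 xs q1(5)] unfolding w_def .
        have ej: "(\<exists>k::int. \<bar>vx u \<theta> j - (q + 2 * pi * of_int k)\<bar> \<le> w) \<or> (\<exists>k::int. \<bar>vx u \<theta> (Suc j) - (q + 2 * pi * of_int k)\<bar> \<le> w)"
          using ends[rule_format, OF jj(3) Rj ys q1(6)] unfolding w_def .
        have "\<exists>k::int. \<bar>vx u \<theta> a - (q + 2 * pi * of_int k)\<bar> \<le> w"
        proof (cases b1)
          case True
          have "\<not> (\<exists>k::int. \<bar>u - (q + 2 * pi * of_int k)\<bar> \<le> w)"
          proof
            assume "\<exists>k::int. \<bar>u - (q + 2 * pi * of_int k)\<bar> \<le> w"
            then obtain k :: int where "\<bar>u - (q + 2 * pi * of_int k)\<bar> \<le> w" by blast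
            from far[OF near[OF q1(1) this], of "vx u \<theta> 1"] H0 have "1 / N ^ 2 < norm (x - \<Gamma> (vx u \<theta> 1))" by (simp add: H_def)
            then show False using p(2) True pn unfolding f1_def by simp
          qed
          then show ?thesis using e0 True by (simp add: a_def)
        next
          case False
          have "\<not> (\<exists>k::int. \<bar>vx u \<theta> 1 - (q + 2 * pi * of_int k)\<bar> \<le> w)"
          proof
            assume "\<exists>k::int. \<bar>vx u \<theta> 1 - (q + 2 * pi * of_int k)\<bar> \<le> w"
            then obtain k :: int where "\<bar>vx u \<theta> 1 - (q + 2 * pi * of_int k)\<bar> \<le> w" by blast
            from near[OF q1(1) this] sm show False using p(2) False pn unfolding f1_def by simp
          qed
          then show ?thesis using e0 False by (simp add: a_def)
        qed
        then obtain ka :: int where ka: "\<bar>vx u \<theta> a - (q + 2 * pi * of_int ka)\<bar> \<le> w" by blast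
        have "\<exists>k::int. \<bar>vx u \<theta> b - (q + 2 * pi * of_int k)\<bar> \<le> w"
        proof (cases b2)
          case False
          have "\<not> (\<exists>k::int. \<bar>vx u \<theta> j - (q + 2 * pi * of_int k)\<bar> \<le> w)"
          proof
            assume "\<exists>k::int. \<bar>vx u \<theta> j - (q + 2 * pi * of_int k)\<bar> \<le> w"
            then obtain k :: int where "\<bar>vx u \<theta> j - (q + 2 * pi * of_int k)\<bar> \<le> w" by blast
            from near[OF q1(2) this] sm show False using p(3) False pn unfolding f2_def by simp
          qed
          then show ?thesis using ej False by (simp add: b_def)
        next
          case True
          have "\<not> (\<exists>k::int. \<bar>vx u \<theta> (Suc j) - (q + 2 * pi * of_int k)\<bar> \<le> w)"
          proof
            assume "\<exists>k::int. \<bar>vx u \<theta> (Suc j) - (q + 2 * pi * of_int k)\<bar> \<le> w"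
            then obtain k :: int where "\<bar>vx u \<theta> (Suc j) - (q + 2 * pi * of_int k)\<bar> \<le> w" by blast
            from far[OF near[OF q1(2) this], of "vx u \<theta> j"] Hj have "1 / N ^ 2 < norm (y - \<Gamma> (vx u \<theta> j))" by (simp add: H_def norm_minus_commute)
            then show False using p(3) True pn unfolding f2_def by simp
          qed
          then show ?thesis using ej True by (simp add: b_def)
        qed
        then obtain kb :: int where kb: "\<bar>vx u \<theta> b - (q + 2 * pi * of_int kb)\<bar> \<le> w" by blast
        have kN0: "0 < k2 / N" using k N0 by simp
        have n1: "\<bar>vx u \<theta> 1 - (q + 2 * pi * of_int ka)\<bar> \<le> \<eta>"
          using ka R0(2) l0(3) \<eta>2(1) kN0 by (cases b1) (auto simp: a_def N_def abs_le_iff)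
        have nj: "\<bar>vx u \<theta> (Suc j) - (q + 2 * pi * of_int kb)\<bar> \<le> \<eta>"
          using kb Rj(2) lj(3) \<eta>2(1) kN0 by (cases b2) (auto simp: b_def N_def abs_le_iff)
        have kab: "kb = ka + 1" by (rule bt.rotation_index[OF rot n1 nj \<eta>1])
        \<comment> \<open>The shift by \<open>ka\<close> turns moves the start next to
          \<open>q\<close> itself and, as \<open>kb = ka + 1\<close>, the end next to
          \<open>q + 2 * pi\<close>.\<close>
        define u' where "u' = u + 2 * pi * of_int (- ka)"
        have sh: "vx u' \<theta> i = vx u \<theta> i - 2 * pi * of_int ka" "ax u' \<theta> i = ax u \<theta> i" for i
          using vx_shift[of u "- ka" \<theta> i] by (auto simp: u'_def)
        have \<Gamma>sh: "\<Gamma> (vx u' \<theta> i) = \<Gamma> (vx u \<theta> i)" for i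
          using vx_shift[of u "- ka" \<theta> i] \<Gamma>_period_int[of "vx u \<theta> i" "- ka"] by (simp add: u'_def)
        define v where "v = vx u' \<theta> a"
        define \<phi> where "\<phi> = ax u' \<theta> a"
        have vv: "vx u' \<theta> (a + i) = vx v \<phi> i" "ax u' \<theta> (a + i) = ax v \<phi> i" for i
          using vx_add[of u' \<theta> i a] by (simp_all add: v_def \<phi>_def add.commute)
        have \<phi>: "0 < \<phi>" "\<phi> < pi" using orbit_link(1,2)[OF \<theta>] by (auto simp: \<phi>_def)
        have l: "vx v \<phi> (Suc i) - vx v \<phi> i \<le> k2 / real j" if "i < m" for i
          using conjunct1[OF Rr, rule_format, of "a + i"] that ab vv(1)[of i] vv(1)[of "Suc i"] sh by auto
        have an: "k1 / real j \<le> ax v \<phi> i \<and> ax v \<phi> i \<le> k2 / real j" if "i \<le> m" for i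
          using conjunct2[OF Rr, rule_format, of "a + i"] that ab vv(2)[of i] sh by auto
        have nv: "\<bar>v - q\<bar> \<le> w" using ka by (simp add: v_def sh)
        have vm: "vx v \<phi> m = vx u' \<theta> b" "ax v \<phi> m = ax u' \<theta> b" using vv[of m] ab(4) by simp_all
        have nb: "\<bar>vx v \<phi> m - (q + 2 * pi)\<bar> \<le> w" unfolding vm sh using kb kab by (simp add: algebra_simps)
        have xs': "x \<in> open_segment (\<Gamma> (vx u' \<theta> 0)) (\<Gamma> (vx u' \<theta> (Suc 0)))" using xs unfolding \<Gamma>sh by simp
        have ys': "y \<in> open_segment (\<Gamma> (vx u' \<theta> j)) (\<Gamma> (vx u' \<theta> (Suc j)))" using ys unfolding \<Gamma>sh by simp
        note l0' = link[OF \<theta>, of u' 0] and lj' = link[OF \<theta>, of u' j]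
        have fx: "foc s x v \<phi> = 0"
          using foc_segment[OF xs' l0'(3,4)] unfolding l0'(1,2) by (cases b1) (auto simp: s_def v_def \<phi>_def a_def)
        have fy: "foc t y (vx v \<phi> m) (ax v \<phi> m) = 0"
          using foc_segment[OF ys' lj'(3,4)] unfolding lj'(1,2) vm by (cases b2) (auto simp: t_def b_def)
        have pp': "p = orbit_path j x y u' \<theta>" unfolding pp \<Gamma>sh ..
        show ?thesis
          using pp' vv(1) \<phi> l an nv nb fx fy unfolding w_def by blast
      qed
      have unique: "p = p'" if p: "p \<in> S \<and> f1 p = b1 \<and> f2 p = b2" "p' \<in> S \<and> f1 p' = b1 \<and> f2 p' = b2" for p p'
      proof -
        obtain v \<phi> u \<theta> where 1: "p = orbit_path j x y u \<theta>" "\<forall>i. vx u \<theta> (a + i) = vx v \<phi> i" "0 < \<phi>" "\<phi> < pi"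
          "\<forall>i<m. vx v \<phi> (Suc i) - vx v \<phi> i \<le> k2 / real j" "\<forall>i\<le>m. k1 / real j \<le> ax v \<phi> i \<and> ax v \<phi> i \<le> k2 / real j"
          "\<bar>v - q\<bar> \<le> 1 / real j ^ 3" "\<bar>vx v \<phi> m - (q + 2 * pi)\<bar> \<le> 1 / real j ^ 3" "foc s x v \<phi> = 0" "foc t y (vx v \<phi> m) (ax v \<phi> m) = 0"
          using data[of p] p(1) by blast
        obtain v' \<phi>' u' \<theta>' where 2: "p' = orbit_path j x y u' \<theta>'" "\<forall>i. vx u' \<theta>' (a + i) = vx v' \<phi>' i" "0 < \<phi>'" "\<phi>' < pi"
          "\<forall>i<m. vx v' \<phi>' (Suc i) - vx v' \<phi>' i \<le> k2 / real j" "\<forall>i\<le>m. k1 / real j \<le> ax v' \<phi>' i \<and> ax v' \<phi>' i \<le> k2 / real j"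
          "\<bar>v' - q\<bar> \<le> 1 / real j ^ 3" "\<bar>vx v' \<phi>' m - (q + 2 * pi)\<bar> \<le> 1 / real j ^ 3" "foc s x v' \<phi>' = 0" "foc t y (vx v' \<phi>' m) (ax v' \<phi>' m) = 0"
          using data[of p'] p(2) by blast
        have "v = v' \<and> \<phi> = \<phi>'"
          by (rule uniq[rule_format, OF jj(4) ab(7,8) st q1(1,2) 1(3,4) 2(3,4) 1(5)[rule_format] 2(5)[rule_format] 1(6)[rule_format] 2(6)[rule_format] 1(7) 2(7) 1(8) 2(8) 1(9) 2(9) 1(10) 2(10)])
        then have "vx u \<theta> (a + i) = vx u' \<theta>' (a + i)" for i using 1(2) 2(2) by simp
        \<comment> \<open>The list contains only vertices of index at least 1, and
          \<open>a \<le> 1\<close>; agreement from index \<open>a\<close> on is therefore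
          enough.\<close>
        then have "vx u \<theta> (Suc i) = vx u' \<theta>' (Suc i)" for i using ab(1) by (metis One_nat_def Suc_eq_plus1_left add_Suc le_Suc_eq le_zero_eq plus_nat.add_0)
        then show ?thesis unfolding 1(1) 2(1) by simp
      qed
      show ?thesis using exist unique by blast
    qed
    then show ?thesis unfolding S_def[symmetric] by (rule card_four)
  qed
  show ?thesis
    by (rule exI[of _ c0], intro conjI c0(1), rule exI[of _ "j1 + j2 + j3 + j4 + j5"], intro allI impI, rule main; assumption)
qed

end

context twist_curve
begin

text \<open>With the initial vertex fixed, the twist makes the final vertex strictly increasing in
  the initial angle, and the sweep shows that the target is attained. Closeness of order
  \<open>1/j\<close> is used here only to identify the representative of the end point.\<close>

lemma boundary_unique:
  "\<exists>j0. \<forall>j\<ge>j0. \<forall>\<Omega> \<gamma> A C L a b. billiard_table \<Gamma> g g1 g2 g3 g0 G \<Omega> \<gamma> A C L \<longrightarrow>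
     norm (\<Gamma> b - \<Gamma> a) \<le> 1 / real j \<longrightarrow> (\<exists>!p. p \<in> boundary_ccw_orbits \<Omega> L \<gamma> j (\<Gamma> a) (\<Gamma> b))"
proof -
  \<comment> \<open>\<open>\<eta> \<le> 1\<close> keeps the target \<open>b + 2 * pi\<close> between
    the extreme turns \<open>pi\<close> and \<open>3 * pi\<close> of the sweep, and the ratio of
    cubes makes \<open>\<eta>\<close> an admissible error in \<open>rotation_index\<close> and
    \<open>rotation_close\<close>.\<close>
  define \<eta> where "\<eta> = g0 ^ 3 / G ^ 3"
  have G3: "0 < G ^ 3" and g3: "0 < g0 ^ 3" using g0_pos G_pos by simp_all
  have "g0 ^ 3 \<le> G ^ 3" using power_mono[of g0 G 3] g0_pos g_ge[of 0] g_le[of 0] by linarith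
  then have \<eta>: "0 < \<eta>" "\<eta> \<le> 1" using G3 g3 by (simp_all add: \<eta>_def pos_divide_le_eq)
  have "G ^ 3 * \<eta> = g0 ^ 3" using G3 by (simp add: \<eta>_def)
  then have "2 * G ^ 3 * \<eta> = 2 * g0 ^ 3" by simp
  also have "\<dots> < pi * g0 ^ 3" using pi_gt3 g3 by (intro mult_strict_right_mono) auto
  finally have \<eta>1: "2 * G ^ 3 * \<eta> < pi * g0 ^ 3" .
  obtain k1 k2 j1 where k: "0 < k1" "0 < k2" and range: "\<forall>j\<ge>j1. \<forall>a b u \<theta>. 0 < \<theta> \<longrightarrow> \<theta> < pi \<longrightarrow> a \<le> 1 \<longrightarrow> j \<le> b \<longrightarrow> b \<le> Suc j \<longrightarrow>
    1 \<le> vx u \<theta> b - vx u \<theta> a \<longrightarrow> vx u \<theta> b - vx u \<theta> a \<le> 4 * pi \<longrightarrow>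
    (\<forall>i\<le>j. k1 / real j \<le> vx u \<theta> (Suc i) - vx u \<theta> i \<and> vx u \<theta> (Suc i) - vx u \<theta> i \<le> k2 / real j \<and> vx u \<theta> (Suc i) - vx u \<theta> i \<le> 1) \<and>
    (\<forall>i\<le>Suc j. k1 / real j \<le> ax u \<theta> i \<and> ax u \<theta> i \<le> k2 / real j)"
    by (insert orbit_range[OF zero_less_one], elim exE conjE, rule that)
  obtain c' j2 where c': "0 < c'" and T: "\<forall>j\<ge>j2. \<forall>m. j \<le> 2 * m \<longrightarrow> m \<le> 2 * j \<longrightarrow> (\<forall>u \<theta> v \<phi>.
     0 < \<theta> \<longrightarrow> \<theta> < pi \<longrightarrow> 0 < \<phi> \<longrightarrow> \<phi> < pi \<longrightarrow>
     (\<forall>i<m. vx u \<theta> (Suc i) - vx u \<theta> i \<le> k2 / real j) \<longrightarrow> (\<forall>i<m. vx v \<phi> (Suc i) - vx v \<phi> i \<le> k2 / real j) \<longrightarrow>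
     g u * \<theta> < g v * \<phi> \<longrightarrow> \<bar>v - u\<bar> \<le> g v * \<phi> - g u * \<theta> \<longrightarrow>
     c' * real j * (g v * \<phi> - g u * \<theta>) \<le> vx v \<phi> m - vx u \<theta> m \<and>
     \<bar>g (vx v \<phi> m) * ax v \<phi> m - g (vx u \<theta> m) * ax u \<theta> m\<bar> \<le> 2 * (g v * \<phi> - g u * \<theta>))"
    by (insert twist_orbits[OF k(2)], elim exE conjE, rule that)
  obtain \<kappa>1 \<kappa>2 j3 where \<kappa>: "0 < \<kappa>1" "\<kappa>1 \<le> \<kappa>2" and S: "\<forall>j\<ge>j3. \<forall>m. j \<le> 2 * m \<longrightarrow> m \<le> 2 * j \<longrightarrow> (\<forall>u \<theta>. \<kappa>1 / real j \<le> \<theta> \<longrightarrow> \<theta> \<le> \<kappa>2 / real j \<longrightarrow>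
     0 < \<theta> \<and> \<theta> < pi \<and> (\<forall>i<m. vx u \<theta> (Suc i) - vx u \<theta> i \<le> d \<and> g (vx u \<theta> i) * ax u \<theta> i \<le> 2 * (g u * \<theta>) \<and> g u * \<theta> \<le> 2 * (g (vx u \<theta> i) * ax u \<theta> i)) \<and>
     (\<theta> = \<kappa>1 / real j \<longrightarrow> vx u \<theta> m - u \<le> pi) \<and> (\<theta> = \<kappa>2 / real j \<longrightarrow> 3 * pi \<le> vx u \<theta> m - u))"
    by (insert orbit_sweep, elim exE conjE, rule that)
  obtain j4 :: nat where j4: "real j4 \<ge> 8 / g0 ^ 3 + 2 / (g0 ^ 3 * \<eta>) + 2" using real_arch_simple by blast
  have main: "\<exists>!p. p \<in> boundary_ccw_orbits \<Omega> L \<gamma> j (\<Gamma> a) (\<Gamma> b0)"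
    if j: "j \<ge> j1 + j2 + j3 + j4" and bt: "billiard_table \<Gamma> g g1 g2 g3 g0 G \<Omega> \<gamma> A C L"
     and ab: "norm (\<Gamma> b0 - \<Gamma> a) \<le> 1 / real j" for j \<Omega> \<gamma> A C L a b0
  proof -
    interpret bt: billiard_table \<Gamma> g g1 g2 g3 g0 G \<Omega> \<gamma> A C L by (rule bt)
    have jj: "j1 \<le> j" "j2 \<le> j" "j3 \<le> j" "j4 \<le> j" using j by auto
    define N where "N = real j"
    have nn: "0 < 8 / g0 ^ 3" "0 < 2 / (g0 ^ 3 * \<eta>)" using g3 \<eta> by simp_all
    have N: "8 / g0 ^ 3 < N" "2 / (g0 ^ 3 * \<eta>) < N" "2 \<le> N" using jj(4) j4 nn unfolding N_def by linarith+
    have N0: "0 < N" using N by linarith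
    have j1': "1 \<le> j" using N(3) by (simp add: N_def)
    have e: "norm (\<Gamma> b0 - \<Gamma> a) \<le> 1 / N" using ab by (simp add: N_def)
    have "8 < N * g0 ^ 3" using N(1) g3 by (simp add: pos_divide_less_eq)
    then have "1 / N < g0 ^ 3 / 8" using N0 by (simp add: field_simps)
    then obtain k :: int where kk: "\<bar>b0 - (a + 2 * pi * of_int k)\<bar> \<le> 2 / g0 ^ 3 * norm (\<Gamma> b0 - \<Gamma> a)"
      using near_parameter[of b0 a] e by (metis order_le_less_trans)
    define b where "b = b0 - 2 * pi * of_int k"
    have "2 / g0 ^ 3 * norm (\<Gamma> b0 - \<Gamma> a) \<le> 2 / g0 ^ 3 * (1 / N)" using e g3 by (intro mult_left_mono) auto
    also have "\<dots> \<le> \<eta>"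
    proof -
      have "2 < N * (g0 ^ 3 * \<eta>)" using N(2) g3 \<eta> by (simp add: pos_divide_less_eq)
      then have "2 \<le> \<eta> * (g0 ^ 3 * N)" by (simp add: mult_ac)
      then have "2 / (g0 ^ 3 * N) \<le> \<eta>" using g3 N0 by (subst pos_divide_le_eq) auto
      then show ?thesis by simp
    qed
    finally have ba: "\<bar>b - a\<bar> \<le> \<eta>" using kk unfolding b_def by linarith
    have \<Gamma>b: "\<Gamma> b0 = \<Gamma> b" using \<Gamma>_period_int[of b k] by (simp add: b_def)
    have fr: "\<Gamma> a \<in> frontier \<Omega>" "\<Gamma> b \<in> frontier \<Omega>" by (simp_all add: bt.frontier_eq)
    note iff = bt.boundary_ccw_iff[OF j1' fr]
    define lo where "lo = \<kappa>1 / N"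
    define hi where "hi = \<kappa>2 / N"
    have lohi: "lo \<le> hi" using \<kappa> N0 by (simp add: lo_def hi_def divide_right_mono)
    have jm: "j \<le> 2 * j" by simp
    have th: "0 < \<theta>" "\<theta> < pi" if "lo \<le> \<theta>" "\<theta> \<le> hi" for \<theta>
      using S[rule_format, OF jj(3) jm jm, of \<theta> a] that unfolding lo_def hi_def N_def by blast+
    have endlo: "vx a lo j - a \<le> pi" and endhi: "3 * pi \<le> vx a hi j - a"
      using S[rule_format, OF jj(3) jm jm, of lo a] S[rule_format, OF jj(3) jm jm, of hi a] lohi unfolding lo_def hi_def N_def by blast+
    have cont: "continuous_on {lo..hi} (\<lambda>\<theta>. vx a \<theta> j)"
      unfolding vx_def
    proof (intro continuous_on_fst continuous_on_compose2[OF bm_iter_continuous])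
      show "continuous_on {lo..hi} (\<lambda>\<theta>. (a, \<theta>))" by (intro continuous_intros)
      show "(\<lambda>\<theta>. (a, \<theta>)) ` {lo..hi} \<subseteq> UNIV \<times> {0..pi}" using th by (auto simp: less_imp_le)
    qed
    have mid: "vx a lo j \<le> b + 2 * pi" "b + 2 * pi \<le> vx a hi j" using endlo endhi ba \<eta> pi_gt3 by linarith+
    obtain \<theta>0 where \<theta>0: "lo \<le> \<theta>0" "\<theta>0 \<le> hi" "vx a \<theta>0 j = b + 2 * pi"
      using IVT'[of "\<lambda>\<theta>. vx a \<theta> j", OF mid lohi cont] by blast
    define P where "P \<theta> = map (\<lambda>i. \<Gamma> (vx a \<theta> i)) [0..<Suc j]" for \<theta>
    have rot0: "\<bar>C (b + 2 * pi) - L - C a\<bar> \<le> L / 2" by (rule bt.rotation_close[OF _ \<eta>1]) (use ba in simp)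
    have mem: "P \<theta>0 \<in> boundary_ccw_orbits \<Omega> L \<gamma> j (\<Gamma> a) (\<Gamma> b)"
      unfolding iff
    proof (rule exI[of _ a], rule exI[of _ \<theta>0], intro conjI)
      show "\<Gamma> b = \<Gamma> (vx a \<theta>0 j)" using \<Gamma>_period by (simp add: \<theta>0(3))
      show "\<bar>C (vx a \<theta>0 j) - L - C a\<bar> \<le> L / 2" unfolding \<theta>0(3) by (rule rot0)
    qed (use th[OF \<theta>0(1,2)] in \<open>auto simp: P_def\<close>)
    have total: "1 \<le> b + 2 * pi - a" "b + 2 * pi - a \<le> 4 * pi" using ba \<eta> pi_gt3 by linarith+
    have step: "\<forall>i<j. vx a \<theta> (Suc i) - vx a \<theta> i \<le> k2 / real j" if "0 < \<theta>" "\<theta> < pi" "vx a \<theta> j = b + 2 * pi" for \<theta>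
      using range[rule_format, OF jj(1) that(1,2), of 0 j a] total that(3) by simp
    have "\<not> \<theta> < \<phi>" if t: "0 < \<theta>" "\<theta> < pi" "vx a \<theta> j = b + 2 * pi" and f: "0 < \<phi>" "\<phi> < pi" "vx a \<phi> j = b + 2 * pi" for \<theta> \<phi>
    proof
      assume "\<theta> < \<phi>"
      then have lt: "g a * \<theta> < g a * \<phi>" using g_pos[of a] by simp
      have "c' * real j * (g a * \<phi> - g a * \<theta>) \<le> vx a \<phi> j - vx a \<theta> j"
        by (rule conjunct1[OF T[rule_format, OF jj(2) jm jm t(1,2) f(1,2)]]) (use step[OF t] step[OF f] lt in auto)
      moreover have "0 < c' * real j * (g a * \<phi> - g a * \<theta>)" using c' j1' lt by simp
      ultimately show False using t(3) f(3) by simp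
    qed
    then have uniq: "\<theta> = \<phi>" if "0 < \<theta>" "\<theta> < pi" "vx a \<theta> j = b + 2 * pi" "0 < \<phi>" "\<phi> < pi" "vx a \<phi> j = b + 2 * pi" for \<theta> \<phi>
      using that by (meson linorder_neqE_linordered_idom)
    have only: "p = P \<theta>0" if p: "p \<in> boundary_ccw_orbits \<Omega> L \<gamma> j (\<Gamma> a) (\<Gamma> b)" for p
    proof -
      obtain u \<theta> where \<theta>: "0 < \<theta>" "\<theta> < pi" and e: "\<Gamma> a = \<Gamma> u" "\<Gamma> b = \<Gamma> (vx u \<theta> j)"
        and rot: "\<bar>C (vx u \<theta> j) - L - C u\<bar> \<le> L / 2" and pp: "p = map (\<lambda>i. \<Gamma> (vx u \<theta> i)) [0..<Suc j]"
        using p unfolding iff by blast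
      obtain l :: int where u: "u = a + 2 * pi * of_int l" using \<Gamma>_eq_iff e(1) by metis
      have vs: "vx u \<theta> i = vx a \<theta> i + 2 * pi * of_int l" for i using vx_shift[of a l \<theta> i] u by simp
      obtain n :: int where n: "vx a \<theta> j = b + 2 * pi * of_int n"
        using \<Gamma>_eq_iff[of b "vx a \<theta> j"] e(2) vs[of j] \<Gamma>_period_int by metis
      have "C (vx u \<theta> j) - L - C u = C (vx a \<theta> j) - L - C a" unfolding vs unfolding u bt.C_shift by simp
      then have "\<bar>C (vx a \<theta> j) - L - C a\<bar> \<le> L / 2" using rot by (simp only:)
      then have "n = 0 + 1" by (rule bt.rotation_index[OF _ _ _ \<eta>1, where q=a]) (use ba \<eta> n in auto)
      then have "vx a \<theta> j = b + 2 * pi" using n by simp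
      then have \<theta>\<theta>: "\<theta> = \<theta>0" using uniq[OF \<theta> _ th[OF \<theta>0(1,2)] \<theta>0(3)] by blast
      have "\<Gamma> (vx u \<theta> i) = \<Gamma> (vx a \<theta> i)" for i unfolding vs by (rule \<Gamma>_period_int)
      then have "p = P \<theta>" unfolding pp P_def by (simp only:)
      then show ?thesis by (simp only: \<theta>\<theta>)
    qed
    show ?thesis unfolding \<Gamma>b using mem only by blast
  qed
  show ?thesis by (rule exI[of _ "j1 + j2 + j3 + j4"], intro allI impI, rule main; assumption)
qed

end

section \<open>Parametrization by the tangent angle\<close>

lemma has_vector_derivative_inner_const:
  assumes "(f has_vector_derivative f') (at s)"
  shows "((\<lambda>s. a \<bullet> f s) has_real_derivative a \<bullet> f') (at s)"
  using bounded_linear.has_vector_derivative[OF bounded_linear_inner_right assms]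
  unfolding has_real_derivative_iff_has_vector_derivative .

lemma has_vector_derivative_shift:
  assumes "(f has_vector_derivative f') (at (s + L))"
  shows "((\<lambda>s. f (s + L)) has_vector_derivative f') (at (s::real))"
proof -
  have "((\<lambda>s. s + L) has_vector_derivative 1) (at s)" by (auto intro!: derivative_eq_intros)
  from vector_diff_chain_at[OF this assms] show ?thesis by (simp add: o_def)
qed

lemma continuous_periodic_bounded:
  fixes f :: "real \<Rightarrow> real"
  assumes "continuous_on UNIV f" "\<And>s. f (s + L) = f s" "0 < L"
  obtains B where "\<And>s. \<bar>f s\<bar> \<le> B"
proof -
  have "compact (f ` {0..L})" by (intro compact_continuous_image continuous_on_subset[OF assms(1)]) auto
  then have "bounded (f ` {0..L})" by (rule compact_imp_bounded)
  then obtain B where "\<forall>x\<in>f ` {0..L}. norm x \<le> B" unfolding bounded_iff by blast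
  then have B: "\<bar>f s\<bar> \<le> B" if "s \<in> {0..L}" for s using that by force
  show ?thesis
  proof (rule that)
    fix s
    obtain k :: int where "s + of_int k * L \<in> {0..<L}" using period_representative[OF assms(3)] .
    then have "\<bar>f (s + of_int k * L)\<bar> \<le> B" by (intro B) auto
    then show "\<bar>f s\<bar> \<le> B" by (simp add: periodic_of_int[of f, OF assms(2)])
  qed
qed

text \<open>The shift relation makes the increasing function \<open>A\<close> unbounded in both
  directions, hence onto; the inverse function theorem on the line does the rest.\<close>

lemma shift_inverse:
  fixes A A' :: "real \<Rightarrow> real"
  assumes A: "\<And>s. (A has_real_derivative A' s) (at s)" and pos: "\<And>s. 0 < A' s"
    and shift: "\<And>s. A (s + L) = A s + P" and "0 < L" "0 < P"
  shows "\<exists>C. (\<forall>\<psi>. A (C \<psi>) = \<psi>) \<and> (\<forall>s. C (A s) = s) \<and> (\<forall>\<psi>. (C has_real_derivative inverse (A' (C \<psi>))) (at \<psi>))"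
proof -
  have mono: "A s < A t" if "s < t" for s t
    using that A pos by (intro DERIV_pos_imp_increasing[of s t A]) auto
  have cont: "isCont A s" for s using A by (rule DERIV_isCont)
  have nat: "A (s + real n * L) = A s + real n * P" for s n
  proof (induction n)
    case (Suc n) then show ?case using shift[of "s + real n * L"] by (simp add: algebra_simps)
  qed simp
  have surj: "\<exists>s. A s = \<psi>" for \<psi>
  proof -
    obtain n :: nat where "\<bar>\<psi> - A 0\<bar> / P < real n" using reals_Archimedean2 by blast
    then have n: "\<bar>\<psi> - A 0\<bar> \<le> real n * P" using assms(5) by (simp add: pos_divide_less_eq)
    have "A (- (real n * L)) \<le> \<psi>" "\<psi> \<le> A (real n * L)" using nat[of "- (real n * L)" n] nat[of 0 n] n by (simp_all add: abs_le_iff)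
    then show ?thesis using IVT[of A "- (real n * L)" \<psi> "real n * L"] cont assms(4) by auto
  qed
  define C where "C \<psi> = (SOME s. A s = \<psi>)" for \<psi>
  have AC: "A (C \<psi>) = \<psi>" for \<psi> unfolding C_def by (rule someI_ex[OF surj])
  have CA: "C (A s) = s" for s using mono AC[of "A s"] by (metis linorder_neqE_linordered_idom less_irrefl)
  show ?thesis
  proof (intro exI[of _ C] conjI allI)
    fix \<psi>
    have "isCont C (A (C \<psi>))" by (rule isCont_inverse_function2[of "C \<psi> - 1" _ "C \<psi> + 1"]) (use CA cont in auto)
    then have "isCont C \<psi>" by (simp only: AC)
    then show "(C has_real_derivative inverse (A' (C \<psi>))) (at \<psi>)"
      using A pos[of "C \<psi>"] AC by (intro DERIV_inverse_function[where f=A and a="\<psi> - 1" and b="\<psi> + 1"]) auto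
  qed (rule AC CA)+
qed

text \<open>Differentiating the unit speed condition shows that the second derivative is normal to
  the curve, and its coefficient is the signed curvature. Periodicity passes to every derivative and
  is used later to bound functions of them.\<close>

lemma arclength_derivatives:
  assumes "arclength_parametrization \<Omega> L \<gamma>"
  shows "\<exists>D :: nat \<Rightarrow> real \<Rightarrow> complex. D 0 = \<gamma> \<and> D 1 = tangent \<gamma> \<and> (\<forall>n s. (D n has_vector_derivative D (Suc n) s) (at s)) \<and>
    (\<forall>n s. D n (s + L) = D n s) \<and> (\<forall>s. D 2 s = curvature \<gamma> s *\<^sub>R (\<i> * tangent \<gamma> s)) \<and> (\<forall>s. curvature \<gamma> s = (\<i> * D 1 s) \<bullet> D 2 s)"
proof -
  obtain D :: "nat \<Rightarrow> real \<Rightarrow> complex" where D0: "D 0 = \<gamma>" and D: "\<And>n s. (D n has_vector_derivative D (Suc n) s) (at s)"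
    and unit: "\<And>s. norm (tangent \<gamma> s) = 1" and per: "\<And>s. \<gamma> (s + L) = \<gamma> s"
    using assms unfolding arclength_parametrization_def smooth_curve_def by blast
  have D1: "D 1 = tangent \<gamma>"
  proof
    show "D 1 s = tangent \<gamma> s" for s using vector_derivative_at[OF D[of 0 s]] by (simp add: tangent_def D0)
  qed
  then have D1': "D (Suc 0) = tangent \<gamma>" by simp
  have D2: "vector_derivative (tangent \<gamma>) (at s) = D 2 s" for s
    using vector_derivative_at[OF D[of 1 s]] by (simp add: D1' numeral_2_eq_2)
  have K: "curvature \<gamma> s = (\<i> * D 1 s) \<bullet> D 2 s" for s by (simp only: curvature_def D2 D1)
  have shift: "D n (s + L) = D n s" for n s
  proof (induction n arbitrary: s)
    case 0 then show ?case by (simp add: D0 per)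
  next
    case (Suc n)
    have "((\<lambda>s. D n (s + L)) has_vector_derivative D (Suc n) (s + L)) (at s)" by (rule has_vector_derivative_shift[OF D])
    then show ?case unfolding Suc using vector_derivative_unique_at[OF _ D[of n s]] by blast
  qed
  have "D 2 s = curvature \<gamma> s *\<^sub>R (\<i> * tangent \<gamma> s)" for s
  proof -
    define c where "c = Re (D 1 s)"
    define e where "e = Im (D 1 s)"
    define c' where "c' = Re (D 2 s)"
    define e' where "e' = Im (D 2 s)"
    have d: "((\<lambda>s. Re (D 1 s)) has_real_derivative c') (at s)" "((\<lambda>s. Im (D 1 s)) has_real_derivative e') (at s)"
      using bounded_linear.has_vector_derivative[OF bounded_linear_Re D[of 1 s]] bounded_linear.has_vector_derivative[OF bounded_linear_Im D[of 1 s]]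
      unfolding has_real_derivative_iff_has_vector_derivative c'_def e'_def by (simp_all add: numeral_2_eq_2)
    have one: "Re (D 1 t) ^ 2 + Im (D 1 t) ^ 2 = 1" for t
      unfolding D1 using unit[of t] cmod_power2[of "tangent \<gamma> t"] by simp
    have "((\<lambda>t. Re (D 1 t) ^ 2 + Im (D 1 t) ^ 2) has_real_derivative 2 * c * c' + 2 * e * e') (at s)"
      using DERIV_add[OF DERIV_power[OF d(1), of 2] DERIV_power[OF d(2), of 2]] by (simp add: c_def e_def mult_ac)
    moreover have "((\<lambda>t. Re (D 1 t) ^ 2 + Im (D 1 t) ^ 2) has_real_derivative 0) (at s)" unfolding one by simp
    ultimately have "2 * c * c' + 2 * e * e' = 0" by (rule DERIV_unique)
    then have z: "c * c' + e * e' = 0" by simp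
    have o: "c * c + e * e = 1" using one[of s] by (simp add: c_def e_def power2_eq_square)
    have k: "curvature \<gamma> s = - e * c' + c * e'" by (simp add: K inner_complex_def c_def e_def c'_def e'_def)
    have "c' = curvature \<gamma> s * - e"
    proof -
      have "c' = (c * c + e * e) * c' - c * (c * c' + e * e')" using o z by simp
      then show ?thesis unfolding k by (simp add: algebra_simps)
    qed
    moreover have "e' = curvature \<gamma> s * c"
    proof -
      have "e' = (c * c + e * e) * e' - e * (c * c' + e * e')" using o z by simp
      then show ?thesis unfolding k by (simp add: algebra_simps)
    qed
    ultimately show ?thesis by (simp add: complex_eq_iff c_def e_def c'_def e'_def D1')
  qed
  then show ?thesis using D0 D1 D shift K by (intro exI[of _ D] conjI allI)
qed

text \<open>An antiderivative \<open>F\<close> of the curvature makes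
  \<open>tangent \<gamma> s * cis (- F s)\<close> constant; this unit number supplies the additive
  constant of the angle. Periodicity of the tangent leaves an integer \<open>k\<close> open, which
  \<open>turning_number\<close> determines.\<close>

lemma tangent_angle:
  assumes "arclength_parametrization \<Omega> L \<gamma>"
  shows "\<exists>A k. (\<forall>s. (A has_real_derivative curvature \<gamma> s) (at s)) \<and> (\<forall>s. tangent \<gamma> s = cis (A s)) \<and> (\<forall>s. A (s + L) = A s + 2 * pi * of_int k)"
proof -
  obtain D :: "nat \<Rightarrow> real \<Rightarrow> complex" where D': "D 0 = \<gamma>" "D 1 = tangent \<gamma>" "\<forall>n s. (D n has_vector_derivative D (Suc n) s) (at s)"
    "\<forall>n s. D n (s + L) = D n s" "\<forall>s. D 2 s = curvature \<gamma> s *\<^sub>R (\<i> * tangent \<gamma> s)" "\<forall>s. curvature \<gamma> s = (\<i> * D 1 s) \<bullet> D 2 s"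
    by (insert arclength_derivatives[OF assms], elim exE conjE, rule that)
  note D = D'[rule_format]
  have unit: "\<And>s. norm (tangent \<gamma> s) = 1" using assms by (simp add: arclength_parametrization_def)
  have kc: "isCont (curvature \<gamma>) s" for s
  proof -
    have "isCont (D n) s" for n using has_vector_derivative_continuous[OF D(3)] .
    note [continuous_intros] = this
    have "isCont (\<lambda>s. (\<i> * D 1 s) \<bullet> D 2 s) s" by (intro continuous_intros)
    then show ?thesis by (simp only: D(6)[symmetric])
  qed
  have "\<exists>F. \<forall>x::real. - \<infinity> < ereal x \<longrightarrow> ereal x < \<infinity> \<longrightarrow> (F has_vector_derivative curvature \<gamma> x) (at x)"
    by (rule einterval_antiderivative) (use kc in auto)
  then obtain F where F: "\<And>s. (F has_real_derivative curvature \<gamma> s) (at s)" by (auto simp: has_real_derivative_iff_has_vector_derivative)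
  have T: "(tangent \<gamma> has_vector_derivative curvature \<gamma> s *\<^sub>R (\<i> * tangent \<gamma> s)) (at s)" for s
    using D(3)[of 1 s] D(5)[of s] D(2) by (simp add: numeral_2_eq_2)
  have "((\<lambda>s. tangent \<gamma> s * cis (- F s)) has_vector_derivative 0) (at s)" for s
  proof -
    have "((\<lambda>s. - F s) has_real_derivative - curvature \<gamma> s) (at s)" by (intro derivative_intros F)
    note has_vector_derivative_mult[OF T has_vector_derivative_cis_comp[OF this]]
    then show ?thesis by (simp add: algebra_simps)
  qed
  then have "\<exists>c. \<forall>s\<in>UNIV. tangent \<gamma> s * cis (- F s) = c"
    by (intro has_derivative_zero_constant) (auto simp: has_vector_derivative_def)
  then obtain c where c: "\<And>s. tangent \<gamma> s * cis (- F s) = c" by auto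
  have Tc: "tangent \<gamma> s = c * cis (F s)" for s unfolding c[of s, symmetric] by (simp add: mult.assoc cis_mult)
  have "norm c = 1" using unit[of 0] by (simp add: Tc norm_mult)
  then obtain a where a: "c = cis a" by (metis complex_norm_eq_1_exp cis_conv_exp)
  define A where "A s = a + F s" for s
  have A: "(A has_real_derivative curvature \<gamma> s) (at s)" for s unfolding A_def[abs_def] by (auto intro!: derivative_eq_intros F)
  have TA: "tangent \<gamma> s = cis (A s)" for s by (simp add: Tc a A_def cis_mult)
  have "((\<lambda>s. A (s + L) - A s) has_vector_derivative curvature \<gamma> (s + L) - curvature \<gamma> s) (at s)" for s
    using A by (intro has_vector_derivative_diff has_vector_derivative_shift) (simp_all add: has_real_derivative_iff_has_vector_derivative)
  then have "((\<lambda>s. A (s + L) - A s) has_vector_derivative 0) (at s)" for s by (simp add: D(4,6))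
  then have "\<exists>p. \<forall>s\<in>UNIV. A (s + L) - A s = p"
    by (intro has_derivative_zero_constant) (auto simp: has_vector_derivative_def)
  then obtain p where p: "\<And>s. A (s + L) - A s = p" by auto
  have "cis (A (0 + L)) = cis (A 0)" using D(4)[of 1 0] by (simp only: D(2) TA)
  then have "cis (A (0 + L)) / cis (A 0) = 1" by simp
  then have "cis p = 1" by (simp only: cis_divide p)
  then have "cos p = 1" by (simp add: complex_eq_iff)
  then obtain k :: int where "p = of_int k * 2 * pi" using cos_one_2pi_int by auto
  then have "A (s + L) = A s + 2 * pi * of_int k" for s using p[of s] by (simp add: mult_ac)
  then show ?thesis using A TA by (intro exI[of _ A] exI[of _ k] conjI allI)
qed

lemma has_vector_derivative_tangent:
  assumes "arclength_parametrization \<Omega> L \<gamma>" shows "(\<gamma> has_vector_derivative tangent \<gamma> s) (at s)"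
proof -
  obtain D :: "nat \<Rightarrow> real \<Rightarrow> complex" where "D 0 = \<gamma>" "D 1 = tangent \<gamma>" "\<forall>n s. (D n has_vector_derivative D (Suc n) s) (at s)"
    by (insert arclength_derivatives[OF assms], elim exE conjE, rule that)
  then show ?thesis by (metis One_nat_def)
qed

text \<open>A separating line between \<open>\<gamma> s\<close> and \<open>\<Omega>\<close> is tangent to the boundary, and the orientation
  clause puts \<open>\<Omega>\<close> on its left.\<close>

lemma tangent_supports:
  assumes \<gamma>: "arclength_parametrization \<Omega> L \<gamma>" and "convex \<Omega>" "open \<Omega>" "z \<in> \<Omega>"
  shows "0 < (\<i> * tangent \<gamma> s) \<bullet> (z - \<gamma> s)"
proof -
  have unit: "norm (tangent \<gamma> s) = 1" and fr: "range \<gamma> = frontier \<Omega>"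
    and left: "\<forall>\<^sub>F r in at_right 0. \<gamma> s + r *\<^sub>R (\<i> * tangent \<gamma> s) \<in> \<Omega>" using \<gamma> by (auto simp: arclength_parametrization_def)
  define n where "n = \<i> * tangent \<gamma> s"
  have "\<gamma> s \<in> frontier \<Omega>" using fr by auto
  then have "\<gamma> s \<notin> \<Omega>" using \<open>open \<Omega>\<close> by (simp add: frontier_def interior_open)
  then obtain a b where a: "a \<noteq> 0" "a \<bullet> \<gamma> s \<le> b" "\<And>z. z \<in> \<Omega> \<Longrightarrow> b \<le> a \<bullet> z"
    using separating_hyperplane_sets[of "{\<gamma> s}" \<Omega>] assms by auto
  have cl: "b \<le> a \<bullet> z" if "z \<in> closure \<Omega>" for z
  proof -
    have "closure \<Omega> \<subseteq> {z. b \<le> a \<bullet> z}" by (rule closure_minimal) (use a in \<open>auto intro: closed_halfspace_ge\<close>)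
    then show ?thesis using that by auto
  qed
  have "a \<bullet> \<gamma> s \<le> a \<bullet> \<gamma> t" for t
  proof -
    have "\<gamma> t \<in> closure \<Omega>" using fr by (auto simp: frontier_def)
    then show ?thesis using cl a(2) by fastforce
  qed
  then have 0: "a \<bullet> tangent \<gamma> s = 0"
    by (intro DERIV_local_min[OF has_vector_derivative_inner_const[OF has_vector_derivative_tangent[OF \<gamma>]] zero_less_one]) auto
  define c where "c = a \<bullet> n"
  have ac: "a = c *\<^sub>R n"
  proof -
    define u where "u = Re (tangent \<gamma> s)"
    define v where "v = Im (tangent \<gamma> s)"
    have 1: "u * u + v * v = 1" using unit cmod_power2[of "tangent \<gamma> s"] by (simp add: u_def v_def power2_eq_square)
    have z0: "Re a * u + Im a * v = 0" using 0 by (simp add: inner_complex_def u_def v_def)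
    have c: "c = - Re a * v + Im a * u" by (simp add: c_def n_def inner_complex_def u_def v_def)
    have "Re a = (u * u + v * v) * Re a - u * (Re a * u + Im a * v)" "Im a = (u * u + v * v) * Im a - v * (Re a * u + Im a * v)"
      unfolding 1 z0 by simp_all
    then have "Re a = c * - v" "Im a = c * u" unfolding c by (simp_all add: algebra_simps)
    then show ?thesis by (simp add: complex_eq_iff n_def u_def v_def)
  qed
  have nn: "n \<bullet> n = 1" using unit by (simp add: n_def dot_square_norm norm_mult)
  obtain r where "0 < r" "\<gamma> s + r *\<^sub>R n \<in> \<Omega>"
  proof -
    have "\<forall>\<^sub>F r in at_right (0::real). 0 < r" by (simp add: eventually_at_right_less)
    then have "\<exists>r. 0 < r \<and> \<gamma> s + r *\<^sub>R (\<i> * tangent \<gamma> s) \<in> \<Omega>"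
      using left eventually_happens'[OF trivial_limit_at_right_real eventually_conj] by blast
    then show ?thesis using that by (auto simp: n_def)
  qed
  then have "a \<bullet> \<gamma> s \<le> a \<bullet> (\<gamma> s + r *\<^sub>R n)" using a by fastforce
  then have "0 \<le> r * c" by (simp add: inner_add_right c_def)
  then have "0 \<le> c" using \<open>0 < r\<close> by (simp add: zero_le_mult_iff)
  moreover have "c \<noteq> 0" using ac a(1) by auto
  ultimately have c: "0 < c" by simp
  obtain e where e: "0 < e" "ball z e \<subseteq> \<Omega>" using assms(3,4) open_contains_ball by blast
  have "norm n = 1" using nn by (simp add: norm_eq_1)
  then have "z - (e / 2) *\<^sub>R n \<in> ball z e" using e by (simp add: dist_norm)
  then have "a \<bullet> \<gamma> s \<le> a \<bullet> (z - (e / 2) *\<^sub>R n)" using e a by fastforce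
  then have "c * (e / 2) \<le> a \<bullet> (z - \<gamma> s)" by (simp add: inner_diff_right c_def mult.commute)
  moreover have "0 < c * (e / 2)" using c e by simp
  ultimately have "0 < c * (n \<bullet> (z - \<gamma> s))" using ac by simp
  then show ?thesis using c by (simp add: n_def zero_less_mult_iff)
qed

lemma tangent_supports_closure:
  assumes "arclength_parametrization \<Omega> L \<gamma>" "convex \<Omega>" "open \<Omega>" "z \<in> closure \<Omega>"
  shows "0 \<le> (\<i> * tangent \<gamma> s) \<bullet> (z - \<gamma> s)"
proof -
  have "closure \<Omega> \<subseteq> {z. (\<i> * tangent \<gamma> s) \<bullet> \<gamma> s \<le> (\<i> * tangent \<gamma> s) \<bullet> z}"
  proof (rule closure_minimal[OF _ closed_halfspace_ge])
    show "\<Omega> \<subseteq> {z. (\<i> * tangent \<gamma> s) \<bullet> \<gamma> s \<le> (\<i> * tangent \<gamma> s) \<bullet> z}"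
    proof
      fix z assume "z \<in> \<Omega>"
      from tangent_supports[OF assms(1-3) this, of s] show "z \<in> {z. (\<i> * tangent \<gamma> s) \<bullet> \<gamma> s \<le> (\<i> * tangent \<gamma> s) \<bullet> z}"
        by (simp add: inner_diff_right)
    qed
  qed
  then show ?thesis using assms(4) by (auto simp: inner_diff_right)
qed

text \<open>At the common point the supporting line of the first curve is touched by the second, so
  the tangents are parallel, and the orientation clauses exclude opposite directions. The tangent is
  thus a function of the boundary point, and \<open>\<Gamma>\<close> does not depend on the
  arclength parametrization it was built from.\<close>

lemma tangent_unique:
  assumes \<gamma>: "arclength_parametrization \<Omega> L \<gamma>" and \<gamma>': "arclength_parametrization \<Omega> L' \<gamma>'" and "convex \<Omega>" "open \<Omega>"
    and eq: "\<gamma> s = \<gamma>' t"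
  shows "tangent \<gamma> s = tangent \<gamma>' t"
proof -
  define n where "n = \<i> * tangent \<gamma> s"
  have unit: "norm (tangent \<gamma> s) = 1" "norm (tangent \<gamma>' t) = 1" and fr: "range \<gamma>' = frontier \<Omega>"
    and left: "\<forall>\<^sub>F r in at_right 0. \<gamma>' t + r *\<^sub>R (\<i> * tangent \<gamma>' t) \<in> \<Omega>" using \<gamma> \<gamma>' by (auto simp: arclength_parametrization_def)
  have "n \<bullet> \<gamma>' t \<le> n \<bullet> \<gamma>' t'" for t'
  proof -
    have "\<gamma>' t' \<in> closure \<Omega>" using fr by (auto simp: frontier_def)
    from tangent_supports_closure[OF \<gamma> assms(3,4) this, of s] show ?thesis by (simp add: eq inner_diff_right n_def)
  qed
  then have 0: "n \<bullet> tangent \<gamma>' t = 0"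
    by (intro DERIV_local_min[OF has_vector_derivative_inner_const[OF has_vector_derivative_tangent[OF \<gamma>']] zero_less_one]) auto
  obtain r where r: "0 < r" "\<gamma>' t + r *\<^sub>R (\<i> * tangent \<gamma>' t) \<in> \<Omega>"
  proof -
    have "\<forall>\<^sub>F r in at_right (0::real). 0 < r" by (simp add: eventually_at_right_less)
    then show ?thesis using that
      left eventually_happens'[OF trivial_limit_at_right_real eventually_conj] by blast
  qed
  have "0 < n \<bullet> (r *\<^sub>R (\<i> * tangent \<gamma>' t))" using tangent_supports[OF \<gamma> assms(3,4) r(2), of s] by (simp add: eq n_def)
  then have "0 < r * (n \<bullet> (\<i> * tangent \<gamma>' t))" by simp
  then have 1: "0 < n \<bullet> (\<i> * tangent \<gamma>' t)" using r(1) by (simp add: zero_less_mult_iff)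
  define w where "w = tangent \<gamma>' t * cnj (tangent \<gamma> s)"
  have w: "norm w = 1" "Im w = 0" "0 < Re w"
    using unit 0 1 by (simp_all add: w_def norm_mult n_def inner_complex_def algebra_simps)
  then have "w = 1" by (simp add: complex_eq_iff cmod_eq_Re)
  then have "tangent \<gamma>' t * (cnj (tangent \<gamma> s) * tangent \<gamma> s) = tangent \<gamma> s" by (simp add: w_def mult.assoc[symmetric])
  moreover have "cnj (tangent \<gamma> s) * tangent \<gamma> s = 1" using unit(1) complex_norm_square[of "tangent \<gamma> s"] by (simp add: mult.commute)
  ultimately show ?thesis by simp
qed

text \<open>If the tangent turned more than once along the boundary, two boundary points would have the same
  supporting line, hence the segment between them would consist of boundary points whose tangent is
  parallel to it; but a strictly monotone tangent angle allows only finitely many such points.\<close>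

lemma turning_number:
  assumes \<gamma>: "arclength_parametrization \<Omega> L \<gamma>" and conv: "convex \<Omega>" "open \<Omega>" and pos: "\<And>s. 0 < curvature \<gamma> s"
    and A: "\<And>s. (A has_real_derivative curvature \<gamma> s) (at s)" and T: "\<And>s. tangent \<gamma> s = cis (A s)"
    and k: "\<And>s. A (s + L) = A s + 2 * pi * of_int k"
  shows "k = 1"
proof -
  have L: "0 < L" and inj: "inj_on \<gamma> {0..<L}" and fr: "range \<gamma> = frontier \<Omega>" and per: "\<And>s. \<gamma> (s + L) = \<gamma> s"
    using \<gamma> by (auto simp: arclength_parametrization_def)
  have mono: "A s < A t" if "s < t" for s t
    using that A pos by (intro DERIV_pos_imp_increasing[of s t A]) auto
  have cont: "isCont A s" for s using A by (rule DERIV_isCont)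
  have "A 0 < A L" using mono L by simp
  then have "0 < real_of_int k" using k[of 0] by (simp add: zero_less_mult_iff)
  then have k1: "1 \<le> k" by simp
  have "\<not> 2 \<le> k"
  proof
    assume "2 \<le> k"
    then have k2: "2 \<le> real_of_int k" by simp
    have AL: "A L = A 0 + 2 * pi * of_int k" using k[of 0] by simp
    have "2 * pi * 2 \<le> 2 * pi * real_of_int k" using k2 by (intro mult_left_mono) auto
    \<comment> \<open>With \<open>k \<ge> 2\<close> the direction of the tangent at 0 recurs at some
      \<open>s'\<close> strictly inside the period.\<close>
    then have "A 0 \<le> A 0 + 2 * pi" "A 0 + 2 * pi \<le> A L" "A 0 + 2 * pi \<noteq> A L" using AL pi_gt_zero by linarith+
    then have "A L \<noteq> A 0 + 2 * pi" "\<exists>x\<ge>0. x \<le> L \<and> A x = A 0 + 2 * pi" using IVT[of A 0 "A 0 + 2 * pi" L] cont L by simp_all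
    then obtain s' where s': "0 \<le> s'" "s' \<le> L" "A s' = A 0 + 2 * pi" "s' \<noteq> L" by blast
    then have s'0: "s' \<noteq> 0" by auto
    define n where "n = \<i> * cis (A 0)"
    have Ts: "tangent \<gamma> s' = cis (A 0)" by (simp add: T s' cis_mult[symmetric])
    have ne: "\<gamma> s' \<noteq> \<gamma> 0" using inj_onD[OF inj, of s' 0] s' s'0 L by auto
    have cl: "\<gamma> t \<in> closure \<Omega>" for t using fr by (auto simp: frontier_def)
    have "0 \<le> n \<bullet> (\<gamma> s' - \<gamma> 0)" "0 \<le> n \<bullet> (\<gamma> 0 - \<gamma> s')"
      using tangent_supports_closure[OF \<gamma> conv cl[of s'], of 0] tangent_supports_closure[OF \<gamma> conv cl[of 0], of s'] by (simp_all add: n_def T[of 0] Ts)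
    then have flat: "n \<bullet> \<gamma> s' = n \<bullet> \<gamma> 0" by (simp add: inner_diff_right)
    have "closed_segment (\<gamma> 0) (\<gamma> s') \<subseteq> \<gamma> ` {t \<in> {0..<L}. sin (A t - A 0) = 0}"
    proof
      fix z assume z: "z \<in> closed_segment (\<gamma> 0) (\<gamma> s')"
      then have zc: "z \<in> closure \<Omega>" using closed_segment_subset[OF cl[of 0] cl[of s'] convex_closure[OF conv(1)]] by blast
      have nz: "n \<bullet> z = n \<bullet> \<gamma> 0"
      proof -
        obtain u where "z = (1 - u) *\<^sub>R \<gamma> 0 + u *\<^sub>R \<gamma> s'" using z by (auto simp: in_segment)
        then have "n \<bullet> z = (1 - u) * (n \<bullet> \<gamma> 0) + u * (n \<bullet> \<gamma> s')" by (simp only: inner_add_right inner_scaleR_right)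
        then show ?thesis unfolding flat by (simp add: algebra_simps)
      qed
      then have "z \<notin> \<Omega>" using tangent_supports[OF \<gamma> conv, of z 0] by (auto simp: n_def T inner_diff_right)
      then have "z \<in> range \<gamma>" using zc conv(2) fr by (simp add: frontier_def interior_open)
      then obtain t0 where "z = \<gamma> t0" by blast
      obtain i :: int where tL: "t0 + of_int i * L \<in> {0..<L}" using period_representative[OF L] .
      define t where "t = t0 + of_int i * L"
      have t: "z = \<gamma> t" using \<open>z = \<gamma> t0\<close> by (simp add: t_def periodic_of_int[of \<gamma>, OF per])
      note tL = tL[folded t_def]
      have "n \<bullet> \<gamma> t \<le> n \<bullet> \<gamma> t'" for t'
        using tangent_supports_closure[OF \<gamma> conv cl[of t'], of 0] nz t by (simp add: n_def T inner_diff_right)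
      then have "n \<bullet> tangent \<gamma> t = 0"
        by (intro DERIV_local_min[OF has_vector_derivative_inner_const[OF has_vector_derivative_tangent[OF \<gamma>]] zero_less_one]) auto
      then have "sin (A t - A 0) = 0" by (simp add: n_def T inner_complex_def sin_diff algebra_simps)
      then show "z \<in> \<gamma> ` {t \<in> {0..<L}. sin (A t - A 0) = 0}" using t tL by blast
    qed
    \<comment> \<open>Over one period the increasing function \<open>A\<close> gains only
      \<open>2 * pi * k\<close>, so \<open>A t - A 0\<close> meets finitely many multiples of
      \<open>pi\<close>, each at most once.\<close>
    moreover have "finite {t \<in> {0..<L}. sin (A t - A 0) = 0}"
    proof (rule finite_imageD)
      show "inj_on A {t \<in> {0..<L}. sin (A t - A 0) = 0}"
        by (rule inj_onI) (metis mono linorder_neqE_linordered_idom less_irrefl)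
      have "A ` {t \<in> {0..<L}. sin (A t - A 0) = 0} \<subseteq> (\<lambda>i::int. A 0 + of_int i * pi) ` {0..2 * k}"
      proof
        fix a assume "a \<in> A ` {t \<in> {0..<L}. sin (A t - A 0) = 0}"
        then obtain t where t: "a = A t" "0 \<le> t" "t < L" "sin (A t - A 0) = 0" by auto
        then obtain i :: int where i: "A t - A 0 = of_int i * pi" by (auto simp: sin_zero_iff_int2)
        have "A 0 \<le> A t" "A t \<le> A L" using mono[of 0 t] mono[of t L] t by (cases "t = 0"; simp)+
        then have "0 \<le> real_of_int i * pi" "real_of_int i * pi \<le> 2 * pi * real_of_int k" using i AL by linarith+
        then have "0 \<le> real_of_int i * pi" "real_of_int i * pi \<le> (2 * real_of_int k) * pi" using i AL by (simp_all add: mult.commute)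
        then have "0 \<le> real_of_int i" "real_of_int i \<le> 2 * real_of_int k" using pi_gt_zero by (simp_all add: zero_le_mult_iff)
        then have "i \<in> {0..2 * k}" by auto
        then show "a \<in> (\<lambda>i::int. A 0 + of_int i * pi) ` {0..2 * k}" using i t by (intro image_eqI[of _ _ i]) auto
      qed
      then show "finite (A ` {t \<in> {0..<L}. sin (A t - A 0) = 0})" by (rule finite_subset) simp
    qed
    ultimately have "finite (closed_segment (\<gamma> 0) (\<gamma> s'))" using finite_subset by blast
    then show False using ne by (simp add: finite_closed_segment)
  qed
  then show ?thesis using k1 by simp
qed

text \<open>\<open>g\<close> is the power -1/3 of the curvature, read at the inverse
  \<open>b\<close> of the tangent angle. Derivatives in the angle are computed in arclength, each
  one bringing a factor \<open>h ^ 3\<close>, which is the derivative of \<open>b\<close>;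
  continuity and periodicity bound them all.\<close>

lemma gauss_parametrization:
  assumes \<gamma>: "arclength_parametrization \<Omega> L \<gamma>" and conv: "convex \<Omega>" "open \<Omega>" and pos: "\<And>s. 0 < curvature \<gamma> s"
  obtains \<Gamma> g g1 g2 g3 g0 G where "gauss_curve \<Gamma> g g1 g2 g3 g0 G" "range \<Gamma> = frontier \<Omega>"
    "\<And>\<psi>. \<exists>s. \<gamma> s = \<Gamma> \<psi> \<and> tangent \<gamma> s = cis \<psi>"
proof -
  obtain D :: "nat \<Rightarrow> real \<Rightarrow> complex" where D': "D 0 = \<gamma>" "D 1 = tangent \<gamma>" "\<forall>n s. (D n has_vector_derivative D (Suc n) s) (at s)"
    "\<forall>n s. D n (s + L) = D n s" "\<forall>s. D 2 s = curvature \<gamma> s *\<^sub>R (\<i> * tangent \<gamma> s)" "\<forall>s. curvature \<gamma> s = (\<i> * D 1 s) \<bullet> D 2 s"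
    by (insert arclength_derivatives[OF \<gamma>], elim exE conjE, rule that)
  note D = D'[rule_format]
  obtain A k where A': "\<forall>s. (A has_real_derivative curvature \<gamma> s) (at s)" "\<forall>s. tangent \<gamma> s = cis (A s)" "\<forall>s. A (s + L) = A s + 2 * pi * of_int k"
    by (insert tangent_angle[OF \<gamma>], elim exE conjE, rule that)
  note A = A'(1)[rule_format] and T = A'(2)[rule_format] and Ak = A'(3)[rule_format]
  have k: "k = 1" by (rule turning_number[OF \<gamma> conv pos A T Ak])
  have L: "0 < L" and fr: "range \<gamma> = frontier \<Omega>" and per: "\<And>s. \<gamma> (s + L) = \<gamma> s"
    using \<gamma> by (auto simp: arclength_parametrization_def)
  have AL: "A (s + L) = A s + 2 * pi" for s using Ak[of s] k by simp
  have pi2: "0 < 2 * pi" by simp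
  obtain b where A'': "\<forall>\<psi>. A (b \<psi>) = \<psi>" "\<forall>s. b (A s) = s" "\<forall>\<psi>. (b has_real_derivative inverse (curvature \<gamma> (b \<psi>))) (at \<psi>)"
    by (insert shift_inverse[OF A pos AL L pi2], elim exE conjE, rule that)
  note Ab = A''(1)[rule_format] and bA = A''(2)[rule_format] and b = A''(3)[rule_format]
  have bL: "b (\<psi> + 2 * pi) = b \<psi> + L" for \<psi> using bA[of "b \<psi> + L"] by (simp add: AL Ab)
  define K0 where "K0 s = (\<i> * D 1 s) \<bullet> D 2 s" for s
  define K1 where "K1 s = (\<i> * D 2 s) \<bullet> D 2 s + (\<i> * D 1 s) \<bullet> D 3 s" for s
  define K2 where "K2 s = (\<i> * D 3 s) \<bullet> D 2 s + 2 * ((\<i> * D 2 s) \<bullet> D 3 s) + (\<i> * D 1 s) \<bullet> D 4 s" for s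
  define K3 where "K3 s = (\<i> * D 4 s) \<bullet> D 2 s + 3 * ((\<i> * D 3 s) \<bullet> D 3 s) + 3 * ((\<i> * D 2 s) \<bullet> D 4 s) + (\<i> * D 1 s) \<bullet> D 5 s" for s
  have DD: "((\<lambda>s. (\<i> * D m s) \<bullet> D n s) has_real_derivative (\<i> * D (Suc m) s) \<bullet> D n s + (\<i> * D m s) \<bullet> D (Suc n) s) (at s)" for m n s
    using bounded_bilinear.has_vector_derivative[OF bounded_bilinear_inner has_vector_derivative_mult_right[OF D(3)[of m s], of \<i>] D(3)[of n s]]
    unfolding has_real_derivative_iff_has_vector_derivative by (simp add: add.commute)
  note num = numeral_2_eq_2 numeral_3_eq_3 eval_nat_numeral
  have K: "(K0 has_real_derivative K1 s) (at s)" "(K1 has_real_derivative K2 s) (at s)" "(K2 has_real_derivative K3 s) (at s)" for s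
  proof -
    show "(K0 has_real_derivative K1 s) (at s)" using DD[of 1 2 s] unfolding K0_def[abs_def] K1_def by (simp add: num)
    show "(K1 has_real_derivative K2 s) (at s)" using DERIV_add[OF DD[of 2 2 s] DD[of 1 3 s]] unfolding K1_def[abs_def] K2_def by (simp add: num algebra_simps)
    show "(K2 has_real_derivative K3 s) (at s)"
      using DERIV_add[OF DERIV_add[OF DD[of 3 2 s] DERIV_cmult[OF DD[of 2 3 s], of 2]] DD[of 1 4 s]] unfolding K2_def[abs_def] K3_def by (simp add: num algebra_simps)
  qed
  have KK: "curvature \<gamma> = K0" by (simp add: fun_eq_iff K0_def D(6))
  have K0: "0 < K0 s" for s using pos by (simp add: KK)
  define h where "h s = K0 s powr (- 1 / 3)" for s
  have h0: "0 < h s" for s using K0[of s] by (simp add: h_def)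
  have h3: "h s ^ 3 = inverse (K0 s)" for s
    using powr_power[of "K0 s" "- 1 / 3" 3] K0[of s] by (simp add: h_def powr_minus)
  have h4: "K0 s powr (- 4 / 3) = h s ^ 4" for s
    using powr_power[of "K0 s" "- 1 / 3" 4] K0[of s] by (simp add: h_def)
  have h': "(h has_real_derivative - 1 / 3 * K1 s * h s ^ 4) (at s)" for s
  proof -
    have "((\<lambda>s. K0 s powr (- 1 / 3)) has_real_derivative (- 1 / 3) * K0 s powr (- 1 / 3 - 1) * K1 s) (at s)"
      by (rule DERIV_chain2[OF has_real_derivative_powr[OF K0] K(1)])
    then show ?thesis unfolding h_def[abs_def, symmetric] using h4[of s] by (simp add: mult_ac)
  qed
  \<comment> \<open>Each of \<open>f1\<close>, \<open>f2\<close>, \<open>f3\<close> is the arclength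
    derivative of its predecessor, beginning with \<open>h\<close>, times
    \<open>h ^ 3\<close>.\<close>
  define f1 where "f1 s = - 1 / 3 * K1 s * h s ^ 7" for s
  define f2 where "f2 s = - 1 / 3 * K2 s * h s ^ 10 + 7 / 9 * K1 s ^ 2 * h s ^ 13" for s
  define f3 where "f3 s = (- 1 / 3 * K3 s * h s ^ 10 + 10 / 9 * K2 s * K1 s * h s ^ 13 + 14 / 9 * K1 s * K2 s * h s ^ 13 - 91 / 27 * K1 s ^ 3 * h s ^ 16) * h s ^ 3" for s
  have f1': "(f1 has_real_derivative - 1 / 3 * K2 s * h s ^ 7 + 7 / 9 * K1 s ^ 2 * h s ^ 10) (at s)" for s
    unfolding f1_def[abs_def] by (rule derivative_eq_intros K h' refl)+ (simp add: algebra_simps power2_eq_square power_add[symmetric] flip: power_Suc)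
  have f2': "(f2 has_real_derivative - 1 / 3 * K3 s * h s ^ 10 + 10 / 9 * K2 s * K1 s * h s ^ 13 + 14 / 9 * K1 s * K2 s * h s ^ 13 - 91 / 27 * K1 s ^ 3 * h s ^ 16) (at s)" for s
    unfolding f2_def[abs_def] by (rule derivative_eq_intros K h' refl)+ (simp add: algebra_simps power2_eq_square power3_eq_cube power_add[symmetric] flip: power_Suc)
  have comp: "((\<lambda>\<psi>. f (b \<psi>)) has_real_derivative f' * h (b \<psi>) ^ 3) (at \<psi>)" if "(f has_real_derivative f') (at (b \<psi>))" for f f' \<psi>
    using DERIV_chain2[OF that b[of \<psi>]] by (simp add: h3 KK)
  have Kcont: "continuous_on UNIV K1" "continuous_on UNIV K2" "continuous_on UNIV K0" "continuous_on UNIV h"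
    using K h' by (auto intro!: DERIV_continuous_on)
  have "continuous_on UNIV K3"
  proof -
    have "continuous_on UNIV (D n)" for n using has_vector_derivative_continuous[OF D(3)] by (simp add: continuous_on_eq_continuous_at)
    note [continuous_intros] = this
    show ?thesis unfolding K3_def[abs_def] by (intro continuous_intros)
  qed
  note cont = Kcont this
  have per': "K0 (s + L) = K0 s" "K1 (s + L) = K1 s" "K2 (s + L) = K2 s" "K3 (s + L) = K3 s" "h (s + L) = h s" for s
    by (simp_all add: K0_def K1_def K2_def K3_def h_def D(4))
  have bd: "\<exists>B. \<forall>s. \<bar>f s\<bar> \<le> B" if "continuous_on UNIV f" "\<And>s. f (s + L) = f s" for f :: "real \<Rightarrow> real"
    using continuous_periodic_bounded[OF that L] by blast
  have "\<exists>B. \<forall>s. \<bar>h s\<bar> \<le> B" "\<exists>B. \<forall>s. \<bar>f1 s\<bar> \<le> B" "\<exists>B. \<forall>s. \<bar>f2 s\<bar> \<le> B" "\<exists>B. \<forall>s. \<bar>f3 s\<bar> \<le> B" "\<exists>B. \<forall>s. \<bar>inverse (h s)\<bar> \<le> B"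
    unfolding f1_def[abs_def] f2_def[abs_def] f3_def[abs_def]
    by (intro bd; insert cont h0; auto intro!: continuous_intros simp: per' less_imp_neq[symmetric] dest: less_imp_neq)+
  then obtain B0 B1 B2 B3 B4 where B: "\<And>s. \<bar>h s\<bar> \<le> B0" "\<And>s. \<bar>f1 s\<bar> \<le> B1" "\<And>s. \<bar>f2 s\<bar> \<le> B2" "\<And>s. \<bar>f3 s\<bar> \<le> B3" "\<And>s. \<bar>inverse (h s)\<bar> \<le> B4"
    by blast
  define G where "G = Max {B0, B1, B2, B3}"
  have G: "B0 \<le> G" "B1 \<le> G" "B2 \<le> G" "B3 \<le> G" by (simp_all add: G_def)
  have B4: "0 < B4" using B(5)[of 0] h0[of 0] by (smt (verit) positive_imp_inverse_positive)
  define \<Gamma> where "\<Gamma> \<psi> = \<gamma> (b \<psi>)" for \<psi>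
  have "gauss_curve \<Gamma> (\<lambda>\<psi>. h (b \<psi>)) (\<lambda>\<psi>. f1 (b \<psi>)) (\<lambda>\<psi>. f2 (b \<psi>)) (\<lambda>\<psi>. f3 (b \<psi>)) (1 / B4) G"
  proof
    fix t
    show "(\<Gamma> has_vector_derivative h (b t) ^ 3 *\<^sub>R cis t) (at t)"
      using vector_diff_chain_at[OF b[of t, unfolded has_real_derivative_iff_has_vector_derivative] has_vector_derivative_tangent[OF \<gamma>]]
      unfolding \<Gamma>_def[abs_def] by (simp add: o_def h3 KK T Ab)
    show "\<Gamma> (t + 2 * pi) = \<Gamma> t" by (simp add: \<Gamma>_def bL per)
    show "0 < 1 / B4" using B4 by simp
    show "1 / B4 \<le> h (b t)"
    proof -
      have "inverse (h (b t)) \<le> B4" using B(5)[of "b t"] by linarith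
      then have "inverse B4 \<le> inverse (inverse (h (b t)))" using h0 by (intro le_imp_inverse_le) auto
      then show ?thesis by (simp add: inverse_eq_divide)
    qed
    show "h (b t) \<le> G" "\<bar>f1 (b t)\<bar> \<le> G" "\<bar>f2 (b t)\<bar> \<le> G" "\<bar>f3 (b t)\<bar> \<le> G"
      using B(1-4)[of "b t"] G by linarith+
    have h7: "h s ^ 4 * h s ^ 3 = h s ^ 7" "h s ^ 7 * h s ^ 3 = h s ^ 10" "h s ^ 10 * h s ^ 3 = h s ^ 13" for s
      by (simp_all flip: power_add)
    show "((\<lambda>\<psi>. h (b \<psi>)) has_real_derivative f1 (b t)) (at t)" using comp[OF h'] by (simp add: f1_def mult.assoc h7)
    show "((\<lambda>\<psi>. f1 (b \<psi>)) has_real_derivative f2 (b t)) (at t)" 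
    proof -
      have "(- 1 / 3 * K2 s * h s ^ 7 + 7 / 9 * K1 s ^ 2 * h s ^ 10) * h s ^ 3 = f2 s" for s
        unfolding f2_def h7(2,3)[symmetric] by (simp only: distrib_right mult.assoc)
      then show ?thesis using comp[OF f1', of t] by simp
    qed
    show "((\<lambda>\<psi>. f2 (b \<psi>)) has_real_derivative f3 (b t)) (at t)" using comp[OF f2'] by (simp add: f3_def)
  qed
  moreover have "range \<Gamma> = frontier \<Omega>"
  proof -
    have "range \<Gamma> = range \<gamma>" unfolding \<Gamma>_def[abs_def] using bA by (metis (no_types, lifting) image_cong range_composition surj_def comp_def)
    then show ?thesis using fr by simp
  qed
  moreover have "\<exists>s. \<gamma> s = \<Gamma> \<psi> \<and> tangent \<gamma> s = cis \<psi>" for \<psi> by (rule exI[of _ "b \<psi>"]) (simp add: \<Gamma>_def T Ab)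
  ultimately show ?thesis using that by blast
qed

text \<open>\<open>tangent_unique\<close> identifies the tangent angle of an arbitrary
  parametrization with the parameter of \<open>\<Gamma>\<close>. The domain provides positive
  curvature for one parametrization; for the present one it follows by expressing its curvature as
  \<open>inverse (g ^ 3)\<close>.\<close>

lemma billiard_table_exists:
  assumes \<gamma>0: "arclength_parametrization \<Omega> L0 \<gamma>0" and conv: "convex \<Omega>" "open \<Omega>"
    and gc: "gauss_curve \<Gamma> g g1 g2 g3 g0 G" and fr\<Gamma>: "range \<Gamma> = frontier \<Omega>"
    and \<Gamma>: "\<And>\<psi>. \<exists>s. \<gamma>0 s = \<Gamma> \<psi> \<and> tangent \<gamma>0 s = cis \<psi>"
    and \<gamma>: "arclength_parametrization \<Omega> L \<gamma>"
  shows "\<exists>A C. billiard_table \<Gamma> g g1 g2 g3 g0 G \<Omega> \<gamma> A C L"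
proof -
  interpret gauss_curve \<Gamma> g g1 g2 g3 g0 G by (rule gc)
  obtain A k where A': "\<forall>s. (A has_real_derivative curvature \<gamma> s) (at s)" "\<forall>s. tangent \<gamma> s = cis (A s)" "\<forall>s. A (s + L) = A s + 2 * pi * of_int k"
    by (insert tangent_angle[OF \<gamma>], elim exE conjE, rule that)
  note A = A'(1)[rule_format] and T = A'(2)[rule_format] and Ak = A'(3)[rule_format]
  have L: "0 < L" and inj: "inj_on \<gamma> {0..<L}" and fr: "range \<gamma> = frontier \<Omega>"
    using \<gamma> by (auto simp: arclength_parametrization_def)
  have eq: "\<gamma> s = \<Gamma> (A s)" for s
  proof -
    have "\<gamma> s \<in> range \<Gamma>" using fr fr\<Gamma> by blast
    then obtain \<psi> where \<psi>: "\<gamma> s = \<Gamma> \<psi>" by blast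
    obtain t where t: "\<gamma>0 t = \<Gamma> \<psi>" "tangent \<gamma>0 t = cis \<psi>" using \<Gamma> by blast
    have "cis (A s) = cis \<psi>" using tangent_unique[OF \<gamma> \<gamma>0 conv, of s t] \<psi> t T by simp
    then have "cis (A s) / cis \<psi> = 1" by simp
    then have "cis (A s - \<psi>) = 1" by (simp only: cis_divide)
    then have "cos (A s - \<psi>) = 1" by (simp add: complex_eq_iff)
    then obtain m :: int where "A s - \<psi> = of_int m * 2 * pi" using cos_one_2pi_int by auto
    then have "A s = \<psi> + 2 * pi * of_int m" by (simp add: mult_ac)
    then show ?thesis using \<Gamma>_period_int \<psi> by simp
  qed
  have \<kappa>: "curvature \<gamma> s = inverse (g (A s) ^ 3)" for s
  proof -
    have "(\<gamma> has_vector_derivative curvature \<gamma> s *\<^sub>R (g (A s) ^ 3 *\<^sub>R cis (A s))) (at s)"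
    proof -
      have "\<Gamma> \<circ> A = \<gamma>" by (simp add: fun_eq_iff eq)
      then show ?thesis using vector_diff_chain_at[OF A[of s, unfolded has_real_derivative_iff_has_vector_derivative] \<Gamma>_deriv] by simp
    qed
    then have "tangent \<gamma> s = curvature \<gamma> s *\<^sub>R (g (A s) ^ 3 *\<^sub>R cis (A s))" by (simp add: tangent_def vector_derivative_at)
    then have "(1 - curvature \<gamma> s * g (A s) ^ 3) *\<^sub>R cis (A s) = 0" by (simp add: T algebra_simps)
    then have "curvature \<gamma> s * g (A s) ^ 3 = 1" by simp
    then show ?thesis by (metis inverse_unique mult.commute)
  qed
  have pos: "0 < curvature \<gamma> s" for s using g_pos[of "A s"] by (simp add: \<kappa>)
  have k: "k = 1" by (rule turning_number[OF \<gamma> conv pos A T Ak])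
  have AL: "A (s + L) = A s + 2 * pi" for s using Ak[of s] k by simp
  have pi2: "0 < 2 * pi" by simp
  obtain C where A'': "\<forall>\<psi>. A (C \<psi>) = \<psi>" "\<forall>s. C (A s) = s" "\<forall>\<psi>. (C has_real_derivative inverse (curvature \<gamma> (C \<psi>))) (at \<psi>)"
    by (insert shift_inverse[OF A pos AL L pi2], elim exE conjE, rule that)
  note AC = A''(1)[rule_format] and CA = A''(2)[rule_format] and C = A''(3)[rule_format]
  have "billiard_table \<Gamma> g g1 g2 g3 g0 G \<Omega> \<gamma> A C L"
  proof
    show "continuous_on UNIV A" using A by (intro DERIV_continuous_on) auto
    show "(C has_real_derivative g \<psi> ^ 3) (at \<psi>)" for \<psi> using C[of \<psi>] by (simp add: \<kappa> AC)
    show "0 < Im (cis (- \<psi>) * (x - \<Gamma> \<psi>))" if "x \<in> \<Omega>" for x \<psi>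
    proof -
      obtain t where t: "\<gamma>0 t = \<Gamma> \<psi>" "tangent \<gamma>0 t = cis \<psi>" using \<Gamma> by blast
      from tangent_supports[OF \<gamma>0 conv that, of t] show ?thesis by (simp add: t inner_complex_def algebra_simps)
    qed
  qed (use L eq T AL AC CA fr\<Gamma> conv in auto)
  then show ?thesis by blast
qed

section \<open>Reversing the orientation\<close>

text \<open>Conjugation reverses the orientation and the sign of the parameter restores it, so the
  result is again positively oriented.\<close>

definition conj_curve :: "(real \<Rightarrow> complex) \<Rightarrow> real \<Rightarrow> complex" where
  "conj_curve \<gamma> s = cnj (\<gamma> (- s))"

lemma conj_curve_conj_curve [simp]: "conj_curve (conj_curve \<gamma>) = \<gamma>"
  by (simp add: conj_curve_def fun_eq_iff)

lemma linear_cnj: "linear cnj" using bounded_linear_cnj by (rule bounded_linear.linear)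

lemma inj_cnj: "inj cnj" by (simp add: inj_on_def)

lemma cnj_image_cnj [simp]: "cnj ` cnj ` S = S" by (simp add: image_image)

lemma mem_cnj_image [simp]: "cnj x \<in> cnj ` S \<longleftrightarrow> x \<in> S" by (simp add: inj_image_mem_iff inj_cnj)

lemma frontier_cnj_image: "frontier (cnj ` S) = cnj ` frontier S"
  by (simp add: frontier_def closure_injective_linear_image[OF linear_cnj inj_cnj, symmetric]
      interior_injective_linear_image[OF linear_cnj inj_cnj] image_set_diff[OF inj_cnj])

lemma inner_cnj: "cnj a \<bullet> cnj b = a \<bullet> b" by (simp add: inner_complex_def)

lemma has_vector_derivative_conj_curve:
  assumes "(f has_vector_derivative f') (at (- s))"
  shows "(conj_curve f has_vector_derivative - cnj f') (at s)"
proof -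
  have "((\<lambda>s. - s) has_vector_derivative - 1) (at s)" by (auto intro!: derivative_eq_intros)
  from vector_diff_chain_at[OF this assms]
  have "((\<lambda>s. f (- s)) has_vector_derivative - f') (at s)" by (simp add: o_def)
  from bounded_linear.has_vector_derivative[OF bounded_linear_cnj this] show ?thesis by (simp add: conj_curve_def[abs_def])
qed

lemma tangent_conj_curve:
  assumes "smooth_curve \<gamma>" shows "tangent (conj_curve \<gamma>) s = - cnj (tangent \<gamma> (- s))"
proof -
  obtain D where D: "D 0 = \<gamma>" "\<forall>n s. (D n has_vector_derivative D (Suc n) s) (at s)" using assms unfolding smooth_curve_def by blast
  then have d: "(\<gamma> has_vector_derivative D 1 s) (at s)" for s by (metis One_nat_def)
  show ?thesis unfolding tangent_def
    using vector_derivative_at[OF d] vector_derivative_at[OF has_vector_derivative_conj_curve[OF d]] by simp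
qed

lemma smooth_conj_curve:
  assumes "smooth_curve \<gamma>" shows "smooth_curve (conj_curve \<gamma>)"
proof -
  obtain D where D: "D 0 = \<gamma>" "\<forall>n s. (D n has_vector_derivative D (Suc n) s) (at s)" using assms unfolding smooth_curve_def by blast
  define E where "E n s = (- 1) ^ n * conj_curve (D n) s" for n s
  have "(E n has_vector_derivative E (Suc n) s) (at s)" for n s
  proof -
    have "((\<lambda>s. (- 1) ^ n * conj_curve (D n) s) has_vector_derivative (- 1) ^ n * - cnj (D (Suc n) (- s))) (at s)"
      using D(2) by (intro has_vector_derivative_mult_right has_vector_derivative_conj_curve) blast
    then show ?thesis by (simp add: E_def[abs_def] conj_curve_def)
  qed
  moreover have "E 0 = conj_curve \<gamma>" by (simp add: E_def[abs_def] D(1))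
  ultimately show ?thesis unfolding smooth_curve_def by blast
qed

lemma arclength_conj_curve:
  assumes "arclength_parametrization \<Omega> L \<gamma>" shows "arclength_parametrization (cnj ` \<Omega>) L (conj_curve \<gamma>)"
proof -
  have L: "0 < L" and sm: "smooth_curve \<gamma>" and unit: "\<And>s. norm (tangent \<gamma> s) = 1" and per: "\<And>s. \<gamma> (s + L) = \<gamma> s"
    and inj: "inj_on \<gamma> {0..<L}" and fr: "range \<gamma> = frontier \<Omega>"
    and left: "\<And>s. \<forall>\<^sub>F r in at_right 0. \<gamma> s + r *\<^sub>R (\<i> * tangent \<gamma> s) \<in> \<Omega>"
    using assms by (auto simp: arclength_parametrization_def)
  note T = tangent_conj_curve[OF sm]
  show ?thesis unfolding arclength_parametrization_def
  proof (intro conjI allI L smooth_conj_curve[OF sm])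
    show "norm (tangent (conj_curve \<gamma>) s) = 1" for s using unit by (simp add: T)
    show "conj_curve \<gamma> (s + L) = conj_curve \<gamma> s" for s using per[of "- s - L"] by (simp add: conj_curve_def)
    show "inj_on (conj_curve \<gamma>) {0..<L}"
    proof (rule inj_onI)
      fix s t assume s: "s \<in> {0..<L}" and t: "t \<in> {0..<L}" and "conj_curve \<gamma> s = conj_curve \<gamma> t"
      then have e: "\<gamma> (- s) = \<gamma> (- t)" by (simp add: conj_curve_def)
      have m: "\<gamma> (if r = 0 then 0 else L - r) = \<gamma> (- r)" for r using per[of "- r"] by simp
      have "(if s = 0 then 0 else L - s) = (if t = 0 then 0 else L - t)"
        by (rule inj_onD[OF inj]) (use e m s t in auto)
      then show "s = t" using s t by (auto split: if_splits)
    qed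
    have "range (conj_curve \<gamma>) = cnj ` range \<gamma>"
    proof
      show "cnj ` range \<gamma> \<subseteq> range (conj_curve \<gamma>)"
        unfolding conj_curve_def[abs_def] by (auto intro!: image_eqI[where x="- _"])
    qed (auto simp: conj_curve_def)
    then show "range (conj_curve \<gamma>) = frontier (cnj ` \<Omega>)" by (simp add: fr frontier_cnj_image)
    show "\<forall>\<^sub>F r in at_right 0. conj_curve \<gamma> s + r *\<^sub>R (\<i> * tangent (conj_curve \<gamma>) s) \<in> cnj ` \<Omega>" for s
    proof (rule eventually_mono[OF left[of "- s"]])
      fix r assume "\<gamma> (- s) + r *\<^sub>R (\<i> * tangent \<gamma> (- s)) \<in> \<Omega>"
      moreover have "conj_curve \<gamma> s + r *\<^sub>R (\<i> * tangent (conj_curve \<gamma>) s) = cnj (\<gamma> (- s) + r *\<^sub>R (\<i> * tangent \<gamma> (- s)))"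
        by (simp add: conj_curve_def T)
      ultimately show "conj_curve \<gamma> s + r *\<^sub>R (\<i> * tangent (conj_curve \<gamma>) s) \<in> cnj ` \<Omega>" by (simp only: mem_cnj_image)
    qed
  qed
qed

lemma curvature_conj_curve:
  assumes "smooth_curve \<gamma>" shows "curvature (conj_curve \<gamma>) s = curvature \<gamma> (- s)"
proof -
  obtain D where D: "D 0 = \<gamma>" "\<forall>n s. (D n has_vector_derivative D (Suc n) s) (at s)" using assms unfolding smooth_curve_def by blast
  have T: "tangent \<gamma> = D 1" using vector_derivative_at[OF D(2)[rule_format, of 0]] D(1) by (simp add: tangent_def fun_eq_iff)
  have d: "(tangent \<gamma> has_vector_derivative D 2 s) (at s)" for s using D(2)[rule_format, of 1 s] T by (simp add: numeral_2_eq_2)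
  have "tangent (conj_curve \<gamma>) = (\<lambda>s. - conj_curve (tangent \<gamma>) s)"
    by (simp add: tangent_conj_curve[OF assms] conj_curve_def fun_eq_iff)
  then have "(tangent (conj_curve \<gamma>) has_vector_derivative cnj (D 2 (- s))) (at s)"
    using has_vector_derivative_minus[OF has_vector_derivative_conj_curve[OF d]] by simp
  then have "curvature (conj_curve \<gamma>) s = (\<i> * - cnj (tangent \<gamma> (- s))) \<bullet> cnj (D 2 (- s))"
    by (simp add: curvature_def vector_derivative_at tangent_conj_curve[OF assms])
  also have "\<dots> = (\<i> * tangent \<gamma> (- s)) \<bullet> D 2 (- s)" using inner_cnj[of "\<i> * tangent \<gamma> (- s)" "D 2 (- s)"] by simp
  finally show ?thesis by (simp add: curvature_def vector_derivative_at[OF d])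
qed

lemma smooth_strictly_convex_cnj:
  assumes "smooth_strictly_convex_domain \<Omega>" shows "smooth_strictly_convex_domain (cnj ` \<Omega>)"
proof -
  obtain L \<gamma> where o: "open \<Omega>" "\<Omega> \<noteq> {}" "convex \<Omega>" and \<gamma>: "arclength_parametrization \<Omega> L \<gamma>" and \<kappa>: "\<forall>s. curvature \<gamma> s > 0"
    using assms unfolding smooth_strictly_convex_domain_def by blast
  have "smooth_curve \<gamma>" using \<gamma> by (simp add: arclength_parametrization_def)
  then have "\<forall>s. curvature (conj_curve \<gamma>) s > 0" using \<kappa> by (simp add: curvature_conj_curve)
  moreover have "open (cnj ` \<Omega>)" using interior_injective_linear_image[OF linear_cnj inj_cnj, of \<Omega>] o(1) by (metis interior_open open_interior)
  ultimately show ?thesis unfolding smooth_strictly_convex_domain_def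
    using o arclength_conj_curve[OF \<gamma>] convex_linear_image[OF linear_cnj] by blast
qed

lemma angle_between_cnj: "angle_between (cnj u) (cnj v) = angle_between u v"
  by (simp add: angle_between_def inner_cnj)

lemma angle_between_cos: "\<bar>u \<bullet> v / (norm u * norm (v :: complex))\<bar> \<le> 1"
  using Cauchy_Schwarz_ineq2[of u v] by (cases "norm u * norm v = 0") (auto simp: abs_mult divide_le_eq)

lemma angle_between_bounds: "0 \<le> angle_between u v" "angle_between u v \<le> pi"
proof -
  have c: "- 1 \<le> u \<bullet> v / (norm u * norm v)" "u \<bullet> v / (norm u * norm v) \<le> 1" using angle_between_cos[of u v] by linarith+
  show "0 \<le> angle_between u v" "angle_between u v \<le> pi"
    unfolding angle_between_def using arccos_lbound[OF c] arccos_ubound[OF c] by blast+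
qed

lemma angle_between_minus_right: "angle_between u (- v) = pi - angle_between u v"
proof -
  have c: "- 1 \<le> u \<bullet> v / (norm u * norm v)" "u \<bullet> v / (norm u * norm v) \<le> 1" using angle_between_cos[of u v] by linarith+
  have "u \<bullet> (- v) / (norm u * norm (- v)) = - (u \<bullet> v / (norm u * norm v))" by simp
  then show ?thesis unfolding angle_between_def using arccos_minus[OF c] by simp
qed

lemma angle_between_conj_curve:
  assumes "smooth_curve \<gamma>"
  shows "angle_between (cnj u) (tangent (conj_curve \<gamma>) s) = pi - angle_between u (tangent \<gamma> (- s))"
  by (simp add: tangent_conj_curve[OF assms] angle_between_minus_right angle_between_cnj)

lemma broken_geodesic_cnj:
  assumes "smooth_curve \<gamma>" "broken_geodesic \<Omega> \<gamma> p"
  shows "broken_geodesic (cnj ` \<Omega>) (conj_curve \<gamma>) (map cnj p)"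
  unfolding broken_geodesic_def
proof (intro conjI allI impI)
  show "set (map cnj p) \<subseteq> closure (cnj ` \<Omega>)"
    using assms(2) unfolding broken_geodesic_def by (auto simp: closure_injective_linear_image[OF linear_cnj inj_cnj, symmetric])
  fix i
  { assume "Suc i < length (map cnj p)" then show "map cnj p ! i \<noteq> map cnj p ! Suc i"
      using assms(2) unfolding broken_geodesic_def by simp }
  assume i: "Suc (Suc i) < length (map cnj p)"
  then have p: "p ! Suc i \<in> frontier \<Omega>" and r: "\<And>s. \<gamma> s = p ! Suc i \<Longrightarrow>
      angle_between (p ! i - p ! Suc i) (- tangent \<gamma> s) = angle_between (p ! Suc (Suc i) - p ! Suc i) (tangent \<gamma> s)"
    using assms(2) unfolding broken_geodesic_def by auto
  show "map cnj p ! Suc i \<in> frontier (cnj ` \<Omega>)" using i p by (simp add: frontier_cnj_image)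
  fix s assume "conj_curve \<gamma> s = map cnj p ! Suc i"
  then have "\<gamma> (- s) = p ! Suc i" using i by (simp add: conj_curve_def)
  from r[OF this] have "angle_between (cnj (p ! i - p ! Suc i)) (tangent (conj_curve \<gamma>) s) = pi - angle_between (cnj (p ! Suc (Suc i) - p ! Suc i)) (tangent (conj_curve \<gamma>) s)"
    unfolding angle_between_conj_curve[OF assms(1)] by (simp add: angle_between_minus_right)
  then show "angle_between (map cnj p ! i - map cnj p ! Suc i) (- tangent (conj_curve \<gamma>) s) =
      angle_between (map cnj p ! Suc (Suc i) - map cnj p ! Suc i) (tangent (conj_curve \<gamma>) s)"
    using i by (simp add: angle_between_minus_right)
qed

lemma broken_geodesic_cnj_iff:
  assumes "smooth_curve \<gamma>"
  shows "broken_geodesic (cnj ` \<Omega>) (conj_curve \<gamma>) (map cnj p) \<longleftrightarrow> broken_geodesic \<Omega> \<gamma> p"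
  using broken_geodesic_cnj[OF assms] broken_geodesic_cnj[OF smooth_conj_curve[OF assms], of "cnj ` \<Omega>" "map cnj p"] by (auto simp: o_def)

text \<open>The length condition keeps \<open>last\<close> away from empty lists, where it does not
  commute with \<open>map\<close>.\<close>

lemma next_impact_cnj_iff:
  assumes "2 \<le> length p"
  shows "next_impact (cnj ` \<Omega>) (map cnj p) (cnj y) \<longleftrightarrow> next_impact \<Omega> p y"
proof -
  have "p \<noteq> []" "butlast p \<noteq> []" using assms by (auto simp: butlast_conv_take)
  then have "last (map cnj p) = cnj (last p)" "last (butlast (map cnj p)) = cnj (last (butlast p))"
    by (simp_all add: last_map map_butlast[symmetric])
  then show ?thesis unfolding next_impact_def frontier_cnj_image by (simp add: open_segment_linear_image[OF linear_cnj inj_cnj])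
qed

text \<open>The effect of conjugation on phase points: the parameter changes sign, and since the
  tangent is conjugated and reversed, the angle becomes its supplement. This exchanges the
  normalizations at 0 and at \<open>pi\<close>.\<close>

definition flip_angle :: "real \<times> real \<Rightarrow> real \<times> real" where "flip_angle = (\<lambda>(s, \<theta>). (- s, pi - \<theta>))"

lemma flip_angle_simps [simp]: "flip_angle (s, \<theta>) = (- s, pi - \<theta>)" "flip_angle (flip_angle z) = z"
  by (simp_all add: flip_angle_def split: prod.splits)

lemma billiard_map_graph_flip:
  assumes "smooth_curve \<gamma>" "billiard_map_graph \<gamma> (s, \<theta>) z"
  shows "billiard_map_graph (conj_curve \<gamma>) (- s, pi - \<theta>) (flip_angle z)"
proof -
  obtain t \<phi> where z: "z = (t, \<phi>)" by (cases z)
  show ?thesis using assms(2) angle_between_conj_curve[OF assms(1), of "\<gamma> t - \<gamma> s" "- s"] angle_between_conj_curve[OF assms(1), of "\<gamma> t - \<gamma> s" "- t"]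
    by (auto simp: z billiard_map_graph_def conj_curve_def split: if_splits)
qed

lemma is_billiard_lift_flip:
  assumes "smooth_curve \<gamma>" "is_billiard_lift \<gamma> e B"
  shows "is_billiard_lift (conj_curve \<gamma>) (pi - e) (flip_angle \<circ> B \<circ> flip_angle)"
  unfolding is_billiard_lift_def
proof (intro conjI allI ballI)
  have fc: "continuous_on A flip_angle" for A unfolding flip_angle_def case_prod_unfold by (intro continuous_intros)
  have "continuous_on (UNIV \<times> {0..pi}) (\<lambda>z. B (flip_angle z))"
    by (rule continuous_on_compose2[OF _ fc]) (use assms(2) in \<open>auto simp: is_billiard_lift_def\<close>)
  then show "continuous_on (UNIV \<times> {0..pi}) (flip_angle \<circ> B \<circ> flip_angle)"
    unfolding o_def by (rule continuous_on_compose2[OF fc[of UNIV]]) auto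
  show "(flip_angle \<circ> B \<circ> flip_angle) (s, pi - e) = (s, pi - e)" for s
    using assms(2) by (simp add: is_billiard_lift_def)
  fix s \<theta> assume "\<theta> \<in> {0..pi}"
  then have "billiard_map_graph \<gamma> (- s, pi - \<theta>) (B (- s, pi - \<theta>))" using assms(2) unfolding is_billiard_lift_def by simp
  from billiard_map_graph_flip[OF assms(1) this]
  show "billiard_map_graph (conj_curve \<gamma>) (s, \<theta>) ((flip_angle \<circ> B \<circ> flip_angle) (s, \<theta>))" by simp
qed

lemma lift_strip:
  assumes "is_billiard_lift \<gamma> e B" "\<theta> \<in> {0..pi}" shows "snd (B (s, \<theta>)) \<in> {0..pi}"
proof -
  have "billiard_map_graph \<gamma> (s, \<theta>) (B (s, \<theta>))" using assms unfolding is_billiard_lift_def by blast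
  then show ?thesis using assms(2) angle_between_bounds
    unfolding billiard_map_graph_def by (auto split: if_splits prod.splits)
qed

context billiard_table
begin

text \<open>Both lifts are arbitrary choices that are determined on the closed strip only; the
  second conjunct keeps the iterates there. The clockwise lift is flipped first, so that
  \<open>lift_unique\<close>, stated for the normalization at 0, applies to it.\<close>

lemma cw_lift_iter:
  assumes sm: "smooth_curve \<gamma>" and \<theta>: "\<theta> \<in> {0..pi}"
  shows "(billiard_lift (conj_curve \<gamma>) pi ^^ n) (s, \<theta>) = flip_angle ((billiard_lift \<gamma> 0 ^^ n) (- s, pi - \<theta>)) \<and>
     snd ((billiard_lift \<gamma> 0 ^^ n) (- s, pi - \<theta>)) \<in> {0..pi}"
proof (induction n)
  case 0 then show ?case using \<theta> by simp
next
  case (Suc n)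
  define B where "B = billiard_lift \<gamma> 0"
  define B' where "B' = billiard_lift (conj_curve \<gamma>) pi"
  have B: "is_billiard_lift \<gamma> 0 B" unfolding B_def by (rule is_lift_billiard_lift)
  have "is_billiard_lift (conj_curve \<gamma>) pi (flip_angle \<circ> B \<circ> flip_angle)" using is_billiard_lift_flip[OF sm B] by simp
  then have B': "is_billiard_lift (conj_curve \<gamma>) pi B'" unfolding B'_def billiard_lift_def 
    by (rule someI[where P="is_billiard_lift (conj_curve \<gamma>) pi"])
  have FB: "is_billiard_lift \<gamma> 0 (flip_angle \<circ> B' \<circ> flip_angle)" using is_billiard_lift_flip[OF smooth_conj_curve[OF sm] B'] by simp
  obtain t \<phi> where t: "(B ^^ n) (- s, pi - \<theta>) = (t, \<phi>)" by (cases "(B ^^ n) (- s, pi - \<theta>)")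
  have \<phi>: "\<phi> \<in> {0..pi}" and IH: "(B' ^^ n) (s, \<theta>) = (- t, pi - \<phi>)" using Suc.IH t by (auto simp: B_def B'_def)
  have "(flip_angle \<circ> B' \<circ> flip_angle) (t, \<phi>) = B (t, \<phi>)" using lift_unique[OF FB \<phi>] lift_unique[OF B \<phi>] by simp
  then have "flip_angle (B' (- t, pi - \<phi>)) = B (t, \<phi>)" by simp
  then have "B' (- t, pi - \<phi>) = flip_angle (B (t, \<phi>))" by (metis flip_angle_simps(2))
  moreover have "snd (B (t, \<phi>)) \<in> {0..pi}" by (rule lift_strip[OF B \<phi>])
  ultimately show ?case using t IH unfolding B_def[symmetric] B'_def[symmetric] by simp
qed

text \<open>Negating both representatives preserves their being nearest and turns an advance by
  \<open>L\<close> into a retreat by \<open>L\<close>.\<close>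

lemma one_cw_rotation_iff:
  assumes sm: "smooth_curve \<gamma>"
  shows "one_cw_rotation L (conj_curve \<gamma>) j (cnj x') (cnj v) (cnj y') \<longleftrightarrow> one_ccw_rotation L \<gamma> j x' v y'"
proof -
  have key: "fst ((billiard_lift (conj_curve \<gamma>) pi ^^ j) (- s, angle_between (cnj v) (tangent (conj_curve \<gamma>) (- s)))) =
      - fst ((billiard_lift \<gamma> 0 ^^ j) (s, angle_between v (tangent \<gamma> s)))" for s
  proof -
    have "angle_between (cnj v) (tangent (conj_curve \<gamma>) (- s)) \<in> {0..pi}" using angle_between_bounds by simp
    from conjunct1[OF cw_lift_iter[OF sm this, of j "- s"]] show ?thesis
      by (simp add: angle_between_conj_curve[OF sm] flip_angle_def case_prod_unfold)
  qed
  have nr: "nearest_representatives L (- s) (- t) \<longleftrightarrow> nearest_representatives L s t" for s t by (simp add: nearest_iff abs_minus_commute)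
  show ?thesis
  proof
    assume "one_ccw_rotation L \<gamma> j x' v y'"
    then obtain s t where st: "\<gamma> s = x'" "\<gamma> t = y'" "nearest_representatives L s t"
      "\<bar>fst ((billiard_lift \<gamma> 0 ^^ j) (s, angle_between v (tangent \<gamma> s))) - t - L\<bar> \<le> L / 100"
      unfolding one_ccw_rotation_def by blast
    show "one_cw_rotation L (conj_curve \<gamma>) j (cnj x') (cnj v) (cnj y')" unfolding one_cw_rotation_def
    proof (rule exI[of _ "- s"], rule exI[of _ "- t"], intro conjI)
      show "\<bar>fst ((billiard_lift (conj_curve \<gamma>) pi ^^ j) (- s, angle_between (cnj v) (tangent (conj_curve \<gamma>) (- s)))) - - t + L\<bar> \<le> L / 100"
        unfolding key using st(4) by linarith
    qed (simp_all add: st nr conj_curve_def)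
  next
    assume "one_cw_rotation L (conj_curve \<gamma>) j (cnj x') (cnj v) (cnj y')"
    then obtain s t where st: "conj_curve \<gamma> s = cnj x'" "conj_curve \<gamma> t = cnj y'" "nearest_representatives L s t"
      "\<bar>fst ((billiard_lift (conj_curve \<gamma>) pi ^^ j) (s, angle_between (cnj v) (tangent (conj_curve \<gamma>) s))) - t + L\<bar> \<le> L / 100"
      unfolding one_cw_rotation_def by blast
    show "one_ccw_rotation L \<gamma> j x' v y'" unfolding one_ccw_rotation_def
    proof (rule exI[of _ "- s"], rule exI[of _ "- t"], intro conjI)
      show "\<bar>fst ((billiard_lift \<gamma> 0 ^^ j) (- s, angle_between v (tangent \<gamma> (- s)))) - - t - L\<bar> \<le> L / 100"
        using st(4) key[of "- s"] unfolding minus_minus by linarith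
    qed (use st nr[of s t] in \<open>simp_all add: conj_curve_def\<close>)
  qed
qed

lemma interior_cw_iff:
  assumes sm: "smooth_curve \<gamma>" and j: "1 \<le> j"
  shows "map cnj p \<in> interior_cw_orbits (cnj ` \<Omega>) L (conj_curve \<gamma>) j (cnj x) (cnj y) \<longleftrightarrow> p \<in> interior_ccw_orbits \<Omega> L \<gamma> j x y"
proof -
  have o: "interior_orbit (cnj ` \<Omega>) (conj_curve \<gamma>) j (cnj x) (cnj y) (map cnj p) \<longleftrightarrow> interior_orbit \<Omega> \<gamma> j x y p"
    unfolding interior_orbit_def broken_geodesic_cnj_iff[OF sm] by (cases "p = []") (auto simp: hd_map last_map)
  have "(\<exists>y'. next_impact (cnj ` \<Omega>) (map cnj p) y' \<and> one_cw_rotation L (conj_curve \<gamma>) j (map cnj p ! 1) (map cnj p ! 2 - map cnj p ! 1) y') \<longleftrightarrow>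
      (\<exists>y'. next_impact \<Omega> p y' \<and> one_ccw_rotation L \<gamma> j (p ! 1) (p ! 2 - p ! 1) y')" if len: "length p = j + 2"
  proof -
    have m: "map cnj p ! 1 = cnj (p ! 1)" "map cnj p ! 2 = cnj (p ! 2)" using len j by simp_all
    have "(\<exists>y'. next_impact (cnj ` \<Omega>) (map cnj p) y' \<and> one_cw_rotation L (conj_curve \<gamma>) j (map cnj p ! 1) (map cnj p ! 2 - map cnj p ! 1) y') \<longleftrightarrow>
        (\<exists>y'. next_impact (cnj ` \<Omega>) (map cnj p) (cnj y') \<and> one_cw_rotation L (conj_curve \<gamma>) j (map cnj p ! 1) (map cnj p ! 2 - map cnj p ! 1) (cnj y'))"
      by (metis complex_cnj_cnj)
    then show ?thesis unfolding m complex_cnj_diff[symmetric] one_cw_rotation_iff[OF sm] using next_impact_cnj_iff[of p \<Omega>] len by simp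
  qed
  then show ?thesis unfolding interior_cw_orbits_def interior_ccw_orbits_def mem_Collect_eq o
    by (auto simp: interior_orbit_def)
qed

lemma boundary_cw_iff:
  assumes sm: "smooth_curve \<gamma>" and j: "1 \<le> j"
  shows "map cnj p \<in> boundary_cw_orbits (cnj ` \<Omega>) L (conj_curve \<gamma>) j (cnj x) (cnj y) \<longleftrightarrow> p \<in> boundary_ccw_orbits \<Omega> L \<gamma> j x y"
proof -
  have o: "boundary_orbit (cnj ` \<Omega>) (conj_curve \<gamma>) j (cnj x) (cnj y) (map cnj p) \<longleftrightarrow> boundary_orbit \<Omega> \<gamma> j x y p"
    unfolding boundary_orbit_def broken_geodesic_cnj_iff[OF sm] by (cases "p = []") (auto simp: hd_map last_map)
  have "one_cw_rotation L (conj_curve \<gamma>) j (cnj x) (map cnj p ! 1 - map cnj p ! 0) (cnj y) \<longleftrightarrow> one_ccw_rotation L \<gamma> j x (p ! 1 - p ! 0) y"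
    if len: "length p = j + 1"
  proof -
    have m: "map cnj p ! 1 - map cnj p ! 0 = cnj (p ! 1 - p ! 0)" using len j by simp
    show ?thesis unfolding m one_cw_rotation_iff[OF sm] ..
  qed
  then show ?thesis unfolding boundary_cw_orbits_def boundary_ccw_orbits_def mem_Collect_eq o
    by (auto simp: boundary_orbit_def)
qed

lemma interior_cw_card:
  assumes "smooth_curve \<gamma>" "1 \<le> j"
  shows "card (interior_cw_orbits (cnj ` \<Omega>) L (conj_curve \<gamma>) j (cnj x) (cnj y)) = card (interior_ccw_orbits \<Omega> L \<gamma> j x y)"
proof -
  have "interior_cw_orbits (cnj ` \<Omega>) L (conj_curve \<gamma>) j (cnj x) (cnj y) = map cnj ` interior_ccw_orbits \<Omega> L \<gamma> j x y"
  proof (intro equalityI subsetI)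
    fix q assume "q \<in> interior_cw_orbits (cnj ` \<Omega>) L (conj_curve \<gamma>) j (cnj x) (cnj y)"
    then have "map cnj (map cnj q) \<in> interior_cw_orbits (cnj ` \<Omega>) L (conj_curve \<gamma>) j (cnj x) (cnj y)" by (simp add: o_def)
    then have "map cnj q \<in> interior_ccw_orbits \<Omega> L \<gamma> j x y" unfolding interior_cw_iff[OF assms] .
    then show "q \<in> map cnj ` interior_ccw_orbits \<Omega> L \<gamma> j x y" by (intro image_eqI[of _ _ "map cnj q"]) (simp_all add: o_def)
  qed (use interior_cw_iff[OF assms] in blast)
  moreover have "inj (map cnj)" using inj_cnj by simp
  ultimately show ?thesis by (simp add: card_image inj_on_subset[OF _ subset_UNIV])
qed

lemma boundary_cw_unique:
  assumes "smooth_curve \<gamma>" "1 \<le> j" "\<exists>!p. p \<in> boundary_ccw_orbits \<Omega> L \<gamma> j x y"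
  shows "\<exists>!p. p \<in> boundary_cw_orbits (cnj ` \<Omega>) L (conj_curve \<gamma>) j (cnj x) (cnj y)"
proof -
  obtain p where p: "p \<in> boundary_ccw_orbits \<Omega> L \<gamma> j x y" "\<And>q. q \<in> boundary_ccw_orbits \<Omega> L \<gamma> j x y \<Longrightarrow> q = p" using assms(3) by blast
  note iff = boundary_cw_iff[OF assms(1,2)]
  have "q = map cnj p" if "q \<in> boundary_cw_orbits (cnj ` \<Omega>) L (conj_curve \<gamma>) j (cnj x) (cnj y)" for q
  proof -
    have "map cnj (map cnj q) = q" by (simp add: o_def)
    then have "map cnj q = p" using that iff[of "map cnj q"] p(2) by simp
    then show ?thesis using \<open>map cnj (map cnj q) = q\<close> by simp
  qed
  then show ?thesis using iff[of p] p(1) by blast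
qed

end

text \<open>The constants are chosen before \<open>L\<close> and \<open>\<gamma>\<close>: they come
  from one tangent angle parametrization, and each \<open>\<gamma>\<close> enters through
  \<open>billiard_table_exists\<close>. The table is exported as well, because the passage to
  clockwise orbits takes place in that locale.\<close>

lemma ccw_orbits:
  assumes "smooth_strictly_convex_domain \<Omega>"
  shows "\<exists>c0>0. \<exists>j0\<ge>1. \<forall>L \<gamma>. arclength_parametrization \<Omega> L \<gamma> \<longrightarrow> (\<exists>\<Gamma> g g1 g2 g3 g0 G A C. billiard_table \<Gamma> g g1 g2 g3 g0 G \<Omega> \<gamma> A C L) \<and> (\<forall>j\<ge>j0.
     (\<forall>x\<in>\<Omega>. \<forall>y\<in>\<Omega>. (\<exists>q\<in>frontier \<Omega>. norm (x - q) \<le> c0 / real j ^ 4 \<and> norm (y - q) \<le> c0 / real j ^ 4) \<longrightarrow>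
        card (interior_ccw_orbits \<Omega> L \<gamma> j x y) = 4) \<and>
     (\<forall>x\<in>frontier \<Omega>. \<forall>y\<in>frontier \<Omega>. norm (y - x) \<le> 1 / real j \<longrightarrow> (\<exists>!p. p \<in> boundary_ccw_orbits \<Omega> L \<gamma> j x y)) \<and>
     (\<forall>x\<in>frontier \<Omega>. \<exists>!p. ccw_loop \<Omega> L \<gamma> j x p))"
proof -
  obtain L0 \<gamma>0 where o: "open \<Omega>" "convex \<Omega>" and \<gamma>0: "arclength_parametrization \<Omega> L0 \<gamma>0" and \<kappa>: "\<And>s. curvature \<gamma>0 s > 0"
    using assms unfolding smooth_strictly_convex_domain_def by blast
  obtain \<Gamma> g g1 g2 g3 g0 G where gc: "gauss_curve \<Gamma> g g1 g2 g3 g0 G" and fr: "range \<Gamma> = frontier \<Omega>"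
    and nu: "\<And>\<psi>. \<exists>s. \<gamma>0 s = \<Gamma> \<psi> \<and> tangent \<gamma>0 s = cis \<psi>"
    using gauss_parametrization[OF \<gamma>0 o(2,1) \<kappa>] by blast
  note table = billiard_table_exists[OF \<gamma>0 o(2,1) gc fr nu]
  interpret gauss_curve \<Gamma> g g1 g2 g3 g0 G by (rule gc)
  obtain d c K y0 where "d \<le> 1" "twist_links Y Y' d c K y0" using twist_links_exists by blast
  then interpret twist_curve \<Gamma> g g1 g2 g3 g0 G d c K y0 using gc by (simp add: twist_curve_def twist_curve_axioms_def)
  obtain c0 j1 where c0: "0 < c0" and I: "\<forall>j\<ge>j1. \<forall>\<Omega> \<gamma> A C L x y q. billiard_table \<Gamma> g g1 g2 g3 g0 G \<Omega> \<gamma> A C L \<longrightarrow> x \<in> \<Omega> \<longrightarrow> y \<in> \<Omega> \<longrightarrow>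
     norm (x - \<Gamma> q) \<le> c0 / real j ^ 4 \<longrightarrow> norm (y - \<Gamma> q) \<le> c0 / real j ^ 4 \<longrightarrow> card (interior_ccw_orbits \<Omega> L \<gamma> j x y) = 4"
    by (insert interior_count, elim exE conjE, rule that)
  obtain j2 where B: "\<forall>j\<ge>j2. \<forall>\<Omega> \<gamma> A C L a b. billiard_table \<Gamma> g g1 g2 g3 g0 G \<Omega> \<gamma> A C L \<longrightarrow>
     norm (\<Gamma> b - \<Gamma> a) \<le> 1 / real j \<longrightarrow> (\<exists>!p. p \<in> boundary_ccw_orbits \<Omega> L \<gamma> j (\<Gamma> a) (\<Gamma> b))"
    by (insert boundary_unique, elim exE conjE, rule that)
  show ?thesis
  proof (rule exI[of _ c0], intro conjI c0, rule exI[of _ "j1 + j2 + 1"], intro conjI allI impI)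
    fix L \<gamma> assume "arclength_parametrization \<Omega> L \<gamma>"
    from table[OF this] show "\<exists>\<Gamma> g g1 g2 g3 g0 G A C. billiard_table \<Gamma> g g1 g2 g3 g0 G \<Omega> \<gamma> A C L" by blast
  next
    fix L \<gamma> j assume "arclength_parametrization \<Omega> L \<gamma>" and j: "j1 + j2 + 1 \<le> j"
    from table[OF this(1)] obtain A C where bt: "billiard_table \<Gamma> g g1 g2 g3 g0 G \<Omega> \<gamma> A C L" by blast
    interpret bt: billiard_table \<Gamma> g g1 g2 g3 g0 G \<Omega> \<gamma> A C L by (rule bt)
    have jj: "j1 \<le> j" "j2 \<le> j" "1 \<le> j" using j by auto
    have bd: "\<exists>!p. p \<in> boundary_ccw_orbits \<Omega> L \<gamma> j x y" if xy: "x \<in> frontier \<Omega>" "y \<in> frontier \<Omega>" "norm (y - x) \<le> 1 / real j" for x y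
    proof -
      obtain a b where ab: "x = \<Gamma> a" "y = \<Gamma> b" using xy(1,2) unfolding fr[symmetric] by blast
      show ?thesis unfolding ab by (rule B[rule_format, OF jj(2) bt]) (use xy(3) ab in simp)
    qed
    show "\<forall>x\<in>\<Omega>. \<forall>y\<in>\<Omega>. (\<exists>q\<in>frontier \<Omega>. norm (x - q) \<le> c0 / real j ^ 4 \<and> norm (y - q) \<le> c0 / real j ^ 4) \<longrightarrow>
        card (interior_ccw_orbits \<Omega> L \<gamma> j x y) = 4"
    proof (intro ballI impI)
      fix x y assume xy: "x \<in> \<Omega>" "y \<in> \<Omega>" and "\<exists>q\<in>frontier \<Omega>. norm (x - q) \<le> c0 / real j ^ 4 \<and> norm (y - q) \<le> c0 / real j ^ 4"
      then obtain q where "norm (x - \<Gamma> q) \<le> c0 / real j ^ 4" "norm (y - \<Gamma> q) \<le> c0 / real j ^ 4" unfolding fr[symmetric] by blast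
      from I[rule_format, OF jj(1) bt xy this] show "card (interior_ccw_orbits \<Omega> L \<gamma> j x y) = 4" .
    qed
    show "\<forall>x\<in>frontier \<Omega>. \<forall>y\<in>frontier \<Omega>. norm (y - x) \<le> 1 / real j \<longrightarrow> (\<exists>!p. p \<in> boundary_ccw_orbits \<Omega> L \<gamma> j x y)" using bd by blast
    show "\<forall>x\<in>frontier \<Omega>. \<exists>!p. ccw_loop \<Omega> L \<gamma> j x p"
    proof
      fix x assume x: "x \<in> frontier \<Omega>"
      show "\<exists>!p. ccw_loop \<Omega> L \<gamma> j x p" unfolding bt.ccw_loop_iff[OF jj(3) x] by (rule bd[OF x x]) simp
    qed
  qed simp
qed

text \<open>The infimum in \<open>infdist\<close> provides a near point of the diagonal only up to
  some slack, hence the two radii; the distance in the product dominates that of each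
  component.\<close>

lemma close_to_boundary_diagonalD:
  assumes "close_to_boundary_diagonal \<Omega> \<epsilon> x y" "\<epsilon> < \<epsilon>'" "frontier \<Omega> \<noteq> {}"
  obtains q where "q \<in> frontier \<Omega>" "norm (x - q) \<le> \<epsilon>'" "norm (y - q) \<le> \<epsilon>'"
proof -
  define \<Delta> where "\<Delta> = {(q, q) |q. q \<in> frontier \<Omega>}"
  have ne: "\<Delta> \<noteq> {}" using assms(3) by (auto simp: \<Delta>_def)
  have "infdist (x, y) \<Delta> < \<epsilon>'" using assms(1,2) unfolding close_to_boundary_diagonal_def \<Delta>_def by linarith
  then have "(INF a\<in>\<Delta>. dist (x, y) a) < \<epsilon>'" by (simp add: infdist_notempty[OF ne])
  then obtain z where z: "z \<in> \<Delta>" "dist (x, y) z < \<epsilon>'"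
    using cINF_less_iff[OF ne, of "dist (x, y)" \<epsilon>'] by (auto intro: bdd_belowI2[of _ 0])
  then obtain q where q: "q \<in> frontier \<Omega>" "dist (x, y) (q, q) < \<epsilon>'" by (auto simp: \<Delta>_def)
  show ?thesis
    by (rule that[OF q(1)]) (use q(2) dist_fst_le[of "(x, y)" "(q, q)"] dist_snd_le[of "(x, y)" "(q, q)"] in \<open>simp_all add: dist_norm\<close>)
qed

theorem theorem3p1:
  fixes \<Omega> :: "complex set"
  assumes "bounded \<Omega>" and "smooth_strictly_convex_domain \<Omega>"
  shows "\<exists>C\<^sub>0 > (0::real). \<exists>j\<^sub>0 :: nat. \<forall>L \<gamma>. arclength_parametrization \<Omega> L \<gamma> \<longrightarrow>
    (\<forall>j \<ge> j\<^sub>0.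
      (\<forall>x \<in> interior \<Omega>. \<forall>y \<in> interior \<Omega>.
         close_to_boundary_diagonal \<Omega> (C\<^sub>0 / real j ^ 4) x y \<longrightarrow>
         card (interior_ccw_orbits \<Omega> L \<gamma> j x y) = 4 \<and>
         card (interior_cw_orbits \<Omega> L \<gamma> j x y) = 4) \<and>
      (\<forall>x \<in> frontier \<Omega>. \<forall>y \<in> frontier \<Omega>.
         close_to_boundary_diagonal \<Omega> (C\<^sub>0 / real j ^ 4) x y \<longrightarrow>
         (\<exists>!p. p \<in> boundary_ccw_orbits \<Omega> L \<gamma> j x y) \<and>
         (\<exists>!p. p \<in> boundary_cw_orbits \<Omega> L \<gamma> j x y)) \<and>
      (\<forall>x \<in> frontier \<Omega>. \<exists>p \<in> geodesic_loops \<Omega> L \<gamma> j x.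
         \<forall>p' \<in> geodesic_loops \<Omega> L \<gamma> j x. p' = p \<or> p' = rev p))"
proof -
  obtain c1 j1 where c1: "0 < c1" "1 \<le> j1" and O1: "\<forall>L \<gamma>. arclength_parametrization \<Omega> L \<gamma> \<longrightarrow> (\<exists>\<Gamma> g g1 g2 g3 g0 G A C. billiard_table \<Gamma> g g1 g2 g3 g0 G \<Omega> \<gamma> A C L) \<and> (\<forall>j\<ge>j1.
     (\<forall>x\<in>\<Omega>. \<forall>y\<in>\<Omega>. (\<exists>q\<in>frontier \<Omega>. norm (x - q) \<le> c1 / real j ^ 4 \<and> norm (y - q) \<le> c1 / real j ^ 4) \<longrightarrow>
        card (interior_ccw_orbits \<Omega> L \<gamma> j x y) = 4) \<and>
     (\<forall>x\<in>frontier \<Omega>. \<forall>y\<in>frontier \<Omega>. norm (y - x) \<le> 1 / real j \<longrightarrow> (\<exists>!p. p \<in> boundary_ccw_orbits \<Omega> L \<gamma> j x y)) \<and>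
     (\<forall>x\<in>frontier \<Omega>. \<exists>!p. ccw_loop \<Omega> L \<gamma> j x p))"
    by (insert ccw_orbits[OF assms(2)], elim exE conjE, rule that)
  \<comment> \<open>The mirror image has its own tangent angle parametrization, so its constants are
    obtained separately.\<close>
  define \<Omega>' where "\<Omega>' = cnj ` \<Omega>"
  obtain c2 j2 where c2: "0 < c2" "1 \<le> j2" and O2: "\<forall>L \<gamma>. arclength_parametrization \<Omega>' L \<gamma> \<longrightarrow> (\<exists>\<Gamma> g g1 g2 g3 g0 G A C. billiard_table \<Gamma> g g1 g2 g3 g0 G \<Omega>' \<gamma> A C L) \<and> (\<forall>j\<ge>j2.
     (\<forall>x\<in>\<Omega>'. \<forall>y\<in>\<Omega>'. (\<exists>q\<in>frontier \<Omega>'. norm (x - q) \<le> c2 / real j ^ 4 \<and> norm (y - q) \<le> c2 / real j ^ 4) \<longrightarrow>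
        card (interior_ccw_orbits \<Omega>' L \<gamma> j x y) = 4) \<and>
     (\<forall>x\<in>frontier \<Omega>'. \<forall>y\<in>frontier \<Omega>'. norm (y - x) \<le> 1 / real j \<longrightarrow> (\<exists>!p. p \<in> boundary_ccw_orbits \<Omega>' L \<gamma> j x y)) \<and>
     (\<forall>x\<in>frontier \<Omega>'. \<exists>!p. ccw_loop \<Omega>' L \<gamma> j x p))"
    by (insert ccw_orbits[OF smooth_strictly_convex_cnj[OF assms(2)], folded \<Omega>'_def], elim exE conjE, rule that)
  \<comment> \<open>The bound \<open>1 / 2\<close> turns closeness of two boundary points to a
    common point into \<open>norm (y - x) \<le> 1 / real j\<close>, as required for boundary
    orbits.\<close>
  define c where "c = min (1 / 2) (min c1 c2)"
  have c: "0 < c" "c \<le> 1 / 2" "c \<le> c1" "c \<le> c2" using c1(1) c2(1) by (auto simp: c_def)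
  \<comment> \<open>The final constant is half of \<open>c\<close>, which leaves the slack that
    \<open>close_to_boundary_diagonalD\<close> needs.\<close>
  have main: "(\<forall>x \<in> interior \<Omega>. \<forall>y \<in> interior \<Omega>.
         close_to_boundary_diagonal \<Omega> (c / 2 / real j ^ 4) x y \<longrightarrow>
         card (interior_ccw_orbits \<Omega> L \<gamma> j x y) = 4 \<and>
         card (interior_cw_orbits \<Omega> L \<gamma> j x y) = 4) \<and>
      (\<forall>x \<in> frontier \<Omega>. \<forall>y \<in> frontier \<Omega>.
         close_to_boundary_diagonal \<Omega> (c / 2 / real j ^ 4) x y \<longrightarrow>
         (\<exists>!p. p \<in> boundary_ccw_orbits \<Omega> L \<gamma> j x y) \<and>
         (\<exists>!p. p \<in> boundary_cw_orbits \<Omega> L \<gamma> j x y)) \<and>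
      (\<forall>x \<in> frontier \<Omega>. \<exists>p \<in> geodesic_loops \<Omega> L \<gamma> j x.
         \<forall>p' \<in> geodesic_loops \<Omega> L \<gamma> j x. p' = p \<or> p' = rev p)"
    if \<gamma>: "arclength_parametrization \<Omega> L \<gamma>" and j: "j1 + j2 \<le> j" for L \<gamma> j
  proof -
    have \<gamma>': "arclength_parametrization \<Omega>' L (conj_curve \<gamma>)" unfolding \<Omega>'_def by (rule arclength_conj_curve[OF \<gamma>])
    then have sm: "smooth_curve (conj_curve \<gamma>)" by (simp add: arclength_parametrization_def)
    have jj: "j1 \<le> j" "j2 \<le> j" "1 \<le> j" using j c1(2) by auto
    note S1 = conjunct2[OF O1[rule_format, OF \<gamma>], rule_format, OF jj(1)]
    note S2 = conjunct2[OF O2[rule_format, OF \<gamma>'], rule_format, OF jj(2)]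
    obtain \<Gamma> g g1 g2 g3 g0 G A C where bt: "billiard_table \<Gamma> g g1 g2 g3 g0 G \<Omega>' (conj_curve \<gamma>) A C L"
      using conjunct1[OF O2[rule_format, OF \<gamma>']] by blast
    interpret bt: billiard_table \<Gamma> g g1 g2 g3 g0 G \<Omega>' "conj_curve \<gamma>" A C L by (rule bt)
    have \<Omega>2: "cnj ` \<Omega>' = \<Omega>" by (simp add: \<Omega>'_def)
    note cwi = bt.interior_cw_card[OF sm jj(3), unfolded \<Omega>2 conj_curve_conj_curve]
    note cwb = bt.boundary_cw_unique[OF sm jj(3), unfolded \<Omega>2 conj_curve_conj_curve]
    have frne: "frontier \<Omega> \<noteq> {}" using \<gamma> by (auto simp: arclength_parametrization_def)
    have fr': "frontier \<Omega>' = cnj ` frontier \<Omega>" by (simp add: \<Omega>'_def frontier_cnj_image)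
    have half: "c / 2 / real j ^ 4 < c / real j ^ 4" using c jj(3) by (intro divide_strict_right_mono) auto
    have close: "\<exists>q\<in>frontier \<Omega>. norm (x - q) \<le> c / real j ^ 4 \<and> norm (y - q) \<le> c / real j ^ 4"
      if "close_to_boundary_diagonal \<Omega> (c / 2 / real j ^ 4) x y" for x y
      using close_to_boundary_diagonalD[OF that half frne] by blast
    have cc: "c / real j ^ 4 \<le> c1 / real j ^ 4" "c / real j ^ 4 \<le> c2 / real j ^ 4" using c by (simp_all add: divide_right_mono)
    have "1 / real j ^ 4 \<le> 1 / real j" using power_increasing[of 1 4 "real j"] jj(3) by (intro divide_left_mono) auto
    moreover have "2 * (c / real j ^ 4) \<le> 1 / real j ^ 4" using c divide_right_mono[of "2 * c" 1 "real j ^ 4"] by simp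
    ultimately have c2j: "2 * (c / real j ^ 4) \<le> 1 / real j" by linarith
    have nc: "norm (cnj a - cnj b) = norm (a - b)" for a b unfolding complex_cnj_diff[symmetric] by (rule complex_mod_cnj)
    show ?thesis
    proof (intro conjI ballI impI)
      fix x y assume "x \<in> interior \<Omega>" "y \<in> interior \<Omega>" and "close_to_boundary_diagonal \<Omega> (c / 2 / real j ^ 4) x y"
      then have xy: "x \<in> \<Omega>" "y \<in> \<Omega>" and q: "\<exists>q\<in>frontier \<Omega>. norm (x - q) \<le> c / real j ^ 4 \<and> norm (y - q) \<le> c / real j ^ 4"
        using interior_subset close by blast+
      then obtain q where q: "q \<in> frontier \<Omega>" "norm (x - q) \<le> c / real j ^ 4" "norm (y - q) \<le> c / real j ^ 4" by blast
      show "card (interior_ccw_orbits \<Omega> L \<gamma> j x y) = 4"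
        using conjunct1[OF S1, rule_format, OF xy] q cc by (meson order_trans)
      have "\<exists>q\<in>frontier \<Omega>'. norm (cnj x - q) \<le> c2 / real j ^ 4 \<and> norm (cnj y - q) \<le> c2 / real j ^ 4"
        by (rule bexI[of _ "cnj q"]) (use q cc in \<open>auto simp: nc fr' intro: order_trans\<close>)
      then have "card (interior_ccw_orbits \<Omega>' L (conj_curve \<gamma>) j (cnj x) (cnj y)) = 4"
        using conjunct1[OF S2, rule_format, of "cnj x" "cnj y"] xy by (simp add: \<Omega>'_def)
      then show "card (interior_cw_orbits \<Omega> L \<gamma> j x y) = 4" using cwi[of "cnj x" "cnj y"] by simp
    next
      fix x y assume xy: "x \<in> frontier \<Omega>" "y \<in> frontier \<Omega>" and "close_to_boundary_diagonal \<Omega> (c / 2 / real j ^ 4) x y"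
      then obtain q where q: "norm (x - q) \<le> c / real j ^ 4" "norm (y - q) \<le> c / real j ^ 4" using close by blast
      have "norm (y - x) \<le> norm (y - q) + norm (x - q)" using norm_triangle_ineq4[of "y - q" "x - q"] by simp
      then have n: "norm (y - x) \<le> 1 / real j" using q c2j by linarith
      show "\<exists>!p. p \<in> boundary_ccw_orbits \<Omega> L \<gamma> j x y"
        using conjunct1[OF conjunct2[OF S1], rule_format, OF xy n] .
      have "\<exists>!p. p \<in> boundary_ccw_orbits \<Omega>' L (conj_curve \<gamma>) j (cnj x) (cnj y)"
        by (rule conjunct1[OF conjunct2[OF S2], rule_format]) (use xy n in \<open>simp_all add: fr' nc\<close>)
      from cwb[OF this] show "\<exists>!p. p \<in> boundary_cw_orbits \<Omega> L \<gamma> j x y" by simp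
    next
      fix x assume "x \<in> frontier \<Omega>"
      then obtain p where p: "ccw_loop \<Omega> L \<gamma> j x p" "\<And>q. ccw_loop \<Omega> L \<gamma> j x q \<Longrightarrow> q = p"
        using conjunct2[OF conjunct2[OF S1], rule_format] by blast
      show "\<exists>p \<in> geodesic_loops \<Omega> L \<gamma> j x. \<forall>p' \<in> geodesic_loops \<Omega> L \<gamma> j x. p' = p \<or> p' = rev p"
      proof (rule bexI[of _ p], intro ballI)
        fix p' assume "p' \<in> geodesic_loops \<Omega> L \<gamma> j x"
        then have "p' = p \<or> rev p' = p" using p(2) unfolding geodesic_loops_def by blast
        then show "p' = p \<or> p' = rev p" by (metis rev_rev_ident)
      qed (use p(1) in \<open>simp add: geodesic_loops_def\<close>)
    qed
  qed
  show ?thesis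
    by (rule exI[of _ "c / 2"], intro conjI, use c in simp, rule exI[of _ "j1 + j2"], intro allI impI, rule main; assumption)
qed

end
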